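(* Let $N\ge 2$, $R>0$, and let $B_R(0)\subset\mathbb{R}^N$ be the ball of radius $R$ centred at the origin. (1) Let $\beta\in\mathbb{R}$ and let $v_1$ and $v_2$ be any two eigenfunctions of the Robin problem with parameter $\beta$ $$-\Delta v=\sigma v\ \text{ in }B_R(0),\qquad \frac{\partial v}{\partial\nu}+\beta v=0\ \text{ on }\partial B_R(0),$$ associated with eigenvalues $\sigma_1\neq\sigma_2$, respectively, and having the same spherical part, namely $v_j(x)=v_j^R(r)S(\theta)$, $j=1,2$. Then the function $$u=v_1^R(R)\,v_2-v_2^R(R)\,v_1$$ is an eigenfunction of the clamped plate problem $$\Delta^2u+\alpha\Delta u=\lambda u\ \text{ in }B_R(0),\qquad u=\frac{\partial u}{\partial\nu}=0\ \text{ on }\partial B_R(0),$$ associated with the eigenvalue $\lambda=-\sigma_1\sigma_2$ and with the parameter $\alpha=\sigma_1+\sigma_2$. (2) This representation completely characterizes the analytic branch (for $\alpha\in\mathbb{R}$) of the eigenvalue $\lambda=-\sigma_1\sigma_2$ as the parameter $\beta$ varies (with continuation through $\beta=\pm\infty$). In the limits $\beta\to\pm\infty$ at which $\alpha$ stays finite, the eigenvalue $\lambda$ can be written, up to sign, as a product of two eigenvalues of the Dirichlet Laplacian $$-\Delta w=\gamma w\ \text{ in }B_R(0),\qquad w=0\ \text{ on }\partial B_R(0),$$ and the corresponding eigenfunction can be written as a linear combination of eigenfunctions of this Dirichlet problem. (3) All analytic branches of eigenvalues of the clamped plate problem on $B_R(0)$ can be represented in this fashion.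
   Context: Here $\nu$ is the outward unit normal, $(r,\theta)$ are polar coordinates in $\mathbb{R}^N$ ($r=|x|$, $\theta=x/|x|$), and $S$ is a spherical harmonic of some degree $k\in\{0,1,2,\dots\}$. An analytic branch of eigenvalues of the clamped plate problem is a real-analytic function $\alpha\mapsto\lambda(\alpha)$, $\alpha\in\mathbb{R}$, such that $\lambda(\alpha)$ is an eigenvalue of the clamped plate problem with parameter $\alpha$ for every $\alpha$. Let $\sigma_{k,j}(\beta)$, $j\ge1$, be the $j$-th eigenvalue of the Robin problem with parameter $\beta$ among those whose eigenfunctions have spherical part of degree $k$ (radial part $r^{1-N/2}J_{k+N/2-1}(r\sqrt{\sigma})$ if $\sigma>0$, $r^{1-N/2}I_{k+N/2-1}(r\sqrt{-\sigma})$ if $\sigma<0$, $r^k$ if $\sigma=0$, with $J_\mu$, $I_\mu$ the Bessel and modified Bessel functions of the first kind). Let $\gamma_{k,j}$ be the $j$-th eigenvalue of the Dirichlet Laplacian with spherical part of degree $k$. Then $\gamma_{k,j}=\sigma_{k,j}(+\infty)=\sigma_{k,j+1}(-\infty)$, so the curves $\sigma_{k,j}$ are continued through $\beta=\infty$ by replacing $j$ by $j+1$ each time $\beta$ reaches $+\infty$ (and restarting from $-\infty$). The representation of analytic branches referred to in the claim is that, for fixed degree $k\ge0$ and fixed integer $t\ge1$, a branch consists of the points $$\alpha=\sigma_{k,j}(\beta)+\sigma_{k,j+t}(\beta),\qquad \lambda=-\sigma_{k,j}(\beta)\,\sigma_{k,j+t}(\beta),\qquad \beta\in\mathbb{R},\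 j\ge1,$$ together with the limit points $\alpha=\gamma_{k,j}+\gamma_{k,j+t}$, $\lambda=-\gamma_{k,j}\gamma_{k,j+t}$ reached at $\beta=\infty$. *)

theory Defs
  imports "HOL-Analysis.Analysis"
begin

definition partial :: "'a::euclidean_space \<Rightarrow> ('a \<Rightarrow> real) \<Rightarrow> 'a \<Rightarrow> real" where
  "partial b u x = frechet_derivative u (at x) b"

definition laplacian :: "('a::euclidean_space \<Rightarrow> real) \<Rightarrow> 'a \<Rightarrow> real" where
  "laplacian u x = (\<Sum>b\<in>Basis. partial b (partial b u) x)"

(* Only meant for open U. *)
primrec C_on :: "nat \<Rightarrow> ('a::euclidean_space \<Rightarrow> real) \<Rightarrow> 'a set \<Rightarrow> bool" where
  "C_on 0 u U \<longleftrightarrow> continuous_on U u"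
| "C_on (Suc n) u U \<longleftrightarrow> u differentiable_on U \<and> (\<forall>b\<in>Basis. C_on n (partial b u) U)"

(* Once continuously differentiable up to the boundary of the ball. *)
definition C1_cball :: "real \<Rightarrow> ('a::euclidean_space \<Rightarrow> real) \<Rightarrow> bool" where
  "C1_cball R u \<longleftrightarrow> (\<exists>G. continuous_on (cball 0 R) G \<and>
     (\<forall>x\<in>cball 0 R. (u has_derivative (\<lambda>h. G x \<bullet> h)) (at x within cball 0 R)))"

(* The outward unit normal at x is x / R; the derivative is one-sided, since u is only
   considered on the closed ball. *)
definition has_normal_derivative ::
    "real \<Rightarrow> ('a::euclidean_space \<Rightarrow> real) \<Rightarrow> 'a \<Rightarrow> real \<Rightarrow> bool" where
  "has_normal_derivative R u x d \<longleftrightarrow>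
     ((\<lambda>t. u (x + t *\<^sub>R (x /\<^sub>R R))) has_real_derivative d) (at_left 0)"

(* Eigenfunctions are nontrivial classical solutions. They are functions on the closed ball:
   their values outside it are irrelevant. *)

definition robin_eigenfunction ::
    "real \<Rightarrow> real \<Rightarrow> real \<Rightarrow> ('a::euclidean_space \<Rightarrow> real) \<Rightarrow> bool" where
  "robin_eigenfunction R \<beta> \<sigma> v \<longleftrightarrow>
     C_on 2 v (ball 0 R) \<and> C1_cball R v \<and> (\<exists>x\<in>ball 0 R. v x \<noteq> 0) \<and>
     (\<forall>x\<in>ball 0 R. - laplacian v x = \<sigma> * v x) \<and>
     (\<forall>x\<in>sphere 0 R. \<exists>d. has_normal_derivative R v x d \<and> d + \<beta> * v x = 0)"

definition dirichlet_eigenfunction ::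
    "real \<Rightarrow> real \<Rightarrow> ('a::euclidean_space \<Rightarrow> real) \<Rightarrow> bool" where
  "dirichlet_eigenfunction R \<gamma> w \<longleftrightarrow>
     C_on 2 w (ball 0 R) \<and> continuous_on (cball 0 R) w \<and> (\<exists>x\<in>ball 0 R. w x \<noteq> 0) \<and>
     (\<forall>x\<in>ball 0 R. - laplacian w x = \<gamma> * w x) \<and>
     (\<forall>x\<in>sphere 0 R. w x = 0)"

definition plate_eigenfunction ::
    "real \<Rightarrow> real \<Rightarrow> real \<Rightarrow> ('a::euclidean_space \<Rightarrow> real) \<Rightarrow> bool" where
  "plate_eigenfunction R \<alpha> \<mu> u \<longleftrightarrow>
     C_on 4 u (ball 0 R) \<and> C1_cball R u \<and> (\<exists>x\<in>ball 0 R. u x \<noteq> 0) \<and>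
     (\<forall>x\<in>ball 0 R. laplacian (laplacian u) x + \<alpha> * laplacian u x = \<mu> * u x) \<and>
     (\<forall>x\<in>sphere 0 R. u x = 0 \<and> has_normal_derivative R u x 0)"

(* Restriction to the unit sphere of a homogeneous harmonic polynomial of degree k
   (the zero function is included). *)
definition spherical_harmonic :: "nat \<Rightarrow> ('a::euclidean_space \<Rightarrow> real) \<Rightarrow> bool" where
  "spherical_harmonic k S \<longleftrightarrow> (\<exists>P. real_polynomial_function P \<and>
     (\<forall>c x. P (c *\<^sub>R x) = c ^ k * P x) \<and> (\<forall>x. laplacian P x = 0) \<and>
     (\<forall>\<theta>\<in>sphere 0 1. S \<theta> = P \<theta>))"

(* v(x) = f(r) S(theta); the origin is left out, since theta is not defined there. *)
definition separated ::
    "real \<Rightarrow> (real \<Rightarrow> real) \<Rightarrow> ('a::euclidean_space \<Rightarrow> real) \<Rightarrow> ('a \<Rightarrow> real) \<Rightarrow> bool" where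
  "separated R f S v \<longleftrightarrow> (\<forall>x\<in>cball 0 R - {0}. v x = f (norm x) * S (x /\<^sub>R norm x))"

(* The argument of type 'a itself selects the space R^N. *)

definition robin_spectrum ::
    "'a::euclidean_space itself \<Rightarrow> real \<Rightarrow> nat \<Rightarrow> real \<Rightarrow> real set" where
  "robin_spectrum _ R k \<beta> = {\<sigma>. \<exists>(v :: 'a \<Rightarrow> real) f S.
     robin_eigenfunction R \<beta> \<sigma> v \<and> spherical_harmonic k S \<and> separated R f S v}"

definition dirichlet_spectrum ::
    "'a::euclidean_space itself \<Rightarrow> real \<Rightarrow> nat \<Rightarrow> real set" where
  "dirichlet_spectrum _ R k = {\<gamma>. \<exists>(w :: 'a \<Rightarrow> real) f S.
     dirichlet_eigenfunction R \<gamma> w \<and> spherical_harmonic k S \<and> separated R f S w}"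

(* The j-th smallest element of A, counted from j = 1. *)
definition nth_least :: "real set \<Rightarrow> nat \<Rightarrow> real" where
  "nth_least A j = (THE x. x \<in> A \<and> finite {y \<in> A. y < x} \<and> Suc (card {y \<in> A. y < x}) = j)"

definition robin_eigenvalue ::
    "'a::euclidean_space itself \<Rightarrow> real \<Rightarrow> nat \<Rightarrow> nat \<Rightarrow> real \<Rightarrow> real" where
  "robin_eigenvalue T R k j \<beta> = nth_least (robin_spectrum T R k \<beta>) j"

definition dirichlet_eigenvalue ::
    "'a::euclidean_space itself \<Rightarrow> real \<Rightarrow> nat \<Rightarrow> nat \<Rightarrow> real" where
  "dirichlet_eigenvalue T R k j = nth_least (dirichlet_spectrum T R k) j"

(* The points (alpha, lambda) given by the Robin eigenvalues, together with the limit points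
   reached at beta = infinity. *)
definition branch_points ::
    "'a::euclidean_space itself \<Rightarrow> real \<Rightarrow> nat \<Rightarrow> nat \<Rightarrow> (real \<times> real) set" where
  "branch_points T R k t =
     {(robin_eigenvalue T R k j \<beta> + robin_eigenvalue T R k (j + t) \<beta>,
       - (robin_eigenvalue T R k j \<beta> * robin_eigenvalue T R k (j + t) \<beta>)) | j \<beta>. 1 \<le> j} \<union>
     {(dirichlet_eigenvalue T R k j + dirichlet_eigenvalue T R k (j + t),
       - (dirichlet_eigenvalue T R k j * dirichlet_eigenvalue T R k (j + t))) | j. 1 \<le> j}"

definition real_analytic :: "(real \<Rightarrow> real) \<Rightarrow> bool" where
  "real_analytic f \<longleftrightarrow> (\<forall>x. \<exists>r>0. \<exists>a. \<forall>y. \<bar>y - x\<bar> < r \<longrightarrow> (\<lambda>n. a n * (y - x) ^ n) sums f y)"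

definition analytic_branch :: "'a::euclidean_space itself \<Rightarrow> real \<Rightarrow> (real \<Rightarrow> real) \<Rightarrow> bool" where
  "analytic_branch _ R \<Lambda> \<longleftrightarrow> real_analytic \<Lambda> \<and>
     (\<forall>\<alpha>. \<exists>u :: 'a \<Rightarrow> real. plate_eigenfunction R \<alpha> (\<Lambda> \<alpha>) u)"

end

theory Submission
  imports Defs "HOL-Complex_Analysis.Complex_Analysis"
begin

text \<open>
  The proof reduces everything to one monotone function of one variable. Let P be a harmonic
  polynomial, homogeneous of degree k, and put \<nu> = k + N/2. Then the Laplacian of P(x) q(|x|^2)
  is P(x) (M q)(|x|^2) with M q = 4 \<rho> q'' + 4 \<nu> q', where \<rho> = |x|^2. The solution of
  M q = -\<sigma> q that is regular at 0 is q(\<rho>) = \<Phi>(\<sigma> \<rho>) for one entire function \<Phi>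
  (\<open>bes\<close>), a normalised Bessel function that serves positive, negative and vanishing \<sigma>
  alike. That a separated eigenfunction, whose radial part is an arbitrary function, has to be a
  multiple of P(x) \<Phi>(\<sigma> |x|^2) follows from a Wronskian argument at the origin
  (\<open>helmholtz_separated\<close>).

  Write (\<Phi>(z), z \<Phi>'(z)) = E (sin \<psi>(z), cos \<psi>(z)) with a continuous phase \<psi> and
  \<psi>(0) = \<pi>/2. The phase is an increasing bijection from the reals onto the positive reals; call
  its inverse \<tau>. The Robin condition fixes \<psi>(\<sigma> R^2) up to multiples of \<pi>, so the j-th
  Robin eigenvalue is \<tau>(p + (j - 1) \<pi>) / R^2, where p increases from 0 to \<pi> as \<beta> runs
  through the reals, and the j-th Dirichlet eigenvalue is \<tau>(j \<pi>) / R^2. Letting \<beta> vary,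
  increasing j at \<beta> = \<infinity> and adding the Dirichlet points therefore amounts to letting one
  parameter p run through all positive reals: the branch with index t is the curve
  \<alpha> = \<sigma>1 + \<sigma>2, \<lambda> = -\<sigma>1 \<sigma>2 with \<sigma>1 = \<tau>(p) / R^2 and
  \<sigma>2 = \<tau>(p + t \<pi>) / R^2 (\<open>branch_points_eq\<close>). All limits in the theorem can be read off
  from this form. As \<tau> is real analytic with positive derivative and \<alpha> increases from
  -\<infinity> to \<infinity> along the curve, \<lambda> is an analytic function of \<alpha> on the whole
  real line (\<open>branch_function\<close>).

  For different \<sigma>1 and \<sigma>2 the plate equation factors into the two Helmholtz equations. A
  combination of the two radial solutions satisfies both clamped conditions, without being zero,
  exactly when the two phases at \<rho> = R^2 differ by a multiple of \<pi>. Hence every point of a branch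
  curve is realised by a plate eigenfunction (\<open>plate_eigenfunction_on_branch\<close>), and the radial
  clamped problem has no solution off the curves, where complex or coincident \<sigma>1, \<sigma>2 are
  excluded by a monotone Wronskian (\<open>clamped_series_on_branch\<close>).

  The converse has to deal with an arbitrary plate eigenfunction u, not only a separated one
  (\<open>plate_eigenvalue_on_branch\<close>). If (\<alpha>, \<lambda>) lies on none of the curves, then for every k the
  inhomogeneous radial problem with clamped conditions is solvable for polynomial right-hand sides g.
  Testing the equation of u with these solutions shows that u is orthogonal to all P(x) g(|x|^2).
  These functions span the polynomials, so u = 0 by the Weierstrass theorem. Consequently the graph of
  any analytic branch is covered by the countably many branch curves; it agrees with one of them on
  an uncountable set, and hence everywhere.
\<close>

section \<open>Derivatives, polynomials and the Laplacian of separated functions\<close>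

lemma partial_eqI: "(u has_derivative D) (at x) \<Longrightarrow> partial b u x = D b"
  unfolding partial_def by (metis frechet_derivative_at)

lemma partial_cong_open:
  assumes "open U" "x \<in> U" "\<And>y. y \<in> U \<Longrightarrow> u y = v y"
  shows "partial b u x = partial b v x"
proof -
  have "(u has_derivative D) (at x) \<longleftrightarrow> (v has_derivative D) (at x)" for D
    using assms has_derivative_transform_within_open[of u D x UNIV U v]
      has_derivative_transform_within_open[of v D x UNIV U u] by metis
  then show ?thesis unfolding partial_def frechet_derivative_def by simp
qed

lemma C_on_cong:
  assumes "open U" "\<And>y. y \<in> U \<Longrightarrow> u y = v y"
  shows "C_on n u U \<longleftrightarrow> C_on n v U"
  using assms(2)
proof (induction n arbitrary: u v)
  case 0
  then show ?case using continuous_on_cong[of U U u v] by simp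
next
  case (Suc n)
  have "C_on n (partial b u) U \<longleftrightarrow> C_on n (partial b v) U" for b
    by (rule Suc.IH) (rule partial_cong_open[OF assms(1)], use Suc.prems in auto)
  moreover have "u differentiable_on U \<longleftrightarrow> v differentiable_on U"
    unfolding differentiable_on_def differentiable_def
    using has_derivative_transform[of _ U u v] has_derivative_transform[of _ U v u] Suc.prems
    by metis
  ultimately show ?case by simp
qed

lemma laplacian_cong_open:
  assumes "open U" "x \<in> U" "\<And>y. y \<in> U \<Longrightarrow> u y = v y"
  shows "laplacian u x = laplacian v x"
  unfolding laplacian_def
  by (intro sum.cong refl partial_cong_open[OF assms(1,2)]) (use partial_cong_open[OF assms(1)] assms(3) in blast)

lemma C_on_differentiable_at:
  "C_on (Suc n) u U \<Longrightarrow> open U \<Longrightarrow> x \<in> U \<Longrightarrow> u differentiable (at x)"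
  by (simp add: differentiable_on_eq_differentiable_at)

lemma C_on_SucD: "C_on (Suc n) u U \<Longrightarrow> C_on n u U"
proof (induction n arbitrary: u)
  case 0
  then show ?case by (simp add: differentiable_imp_continuous_on)
next
  case (Suc n)
  then show ?case using C_on.simps(2)[of "Suc n"] by (metis C_on.simps(2))
qed

lemma C_on_mono: "C_on n u U \<Longrightarrow> m \<le> n \<Longrightarrow> C_on m u U"
  by (induction n) (use C_on_SucD le_Suc_eq in blast)+

lemma C_on_continuous: "C_on n u U \<Longrightarrow> continuous_on U u"
  using C_on_mono[of n u U 0] by simp

lemma C_on_subset: "C_on n u U \<Longrightarrow> V \<subseteq> U \<Longrightarrow> C_on n u V"
proof (induction n arbitrary: u)
  case 0
  then show ?case using continuous_on_subset by auto
next
  case (Suc n)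
  then show ?case using differentiable_on_subset by auto
qed

lemma has_derivative_partials:
  fixes u :: "'a::euclidean_space \<Rightarrow> real"
  assumes "u differentiable (at x)"
  shows "(u has_derivative (\<lambda>h. \<Sum>b\<in>Basis. (h \<bullet> b) * partial b u x)) (at x)"
proof -
  have D: "(u has_derivative frechet_derivative u (at x)) (at x)"
    using assms frechet_derivative_works by blast
  interpret linear "frechet_derivative u (at x)"
    using D has_derivative_linear by blast
  have "frechet_derivative u (at x) h = (\<Sum>b\<in>Basis. (h \<bullet> b) * partial b u x)" for h
  proof -
    have "frechet_derivative u (at x) h = frechet_derivative u (at x) (\<Sum>b\<in>Basis. (h \<bullet> b) *\<^sub>R b)"
      by (simp add: euclidean_representation)
    then show ?thesis by (simp add: sum scaleR partial_def)
  qed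
  then have "frechet_derivative u (at x) = (\<lambda>h. \<Sum>b\<in>Basis. (h \<bullet> b) * partial b u x)" by (rule ext)
  with D show ?thesis by simp
qed

lemma C_on_const [simp]: "C_on n (\<lambda>x. c) U"
proof (induction n arbitrary: c)
  case (Suc n)
  have "partial b (\<lambda>x. c) = (\<lambda>x. 0)" for b :: 'a
    by (rule ext, rule partial_eqI) (auto intro!: derivative_eq_intros)
  then show ?case using Suc by simp
qed simp

lemma partial_add:
  "u differentiable (at x) \<Longrightarrow> v differentiable (at x) \<Longrightarrow>
   partial b (\<lambda>x. u x + v x) x = partial b u x + partial b v x"
  by (rule partial_eqI, unfold partial_def)
    (auto intro!: derivative_eq_intros simp: frechet_derivative_works[symmetric])

lemma partial_mult:
  fixes u :: "'a::euclidean_space \<Rightarrow> real"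
  shows "u differentiable (at x) \<Longrightarrow> v differentiable (at x) \<Longrightarrow>
   partial b (\<lambda>x. u x * v x) x = u x * partial b v x + partial b u x * v x"
  by (rule partial_eqI, unfold partial_def)
    (auto intro!: derivative_eq_intros simp: frechet_derivative_works[symmetric])

lemma C_on_add:
  assumes "open U"
  shows "C_on n u U \<Longrightarrow> C_on n v U \<Longrightarrow> C_on n (\<lambda>x. u x + v x) U"
proof (induction n arbitrary: u v)
  case (Suc n)
  have "C_on n (partial b (\<lambda>x. u x + v x)) U" if "b \<in> Basis" for b
  proof -
    have "C_on n (\<lambda>x. partial b u x + partial b v x) U" using Suc that by auto
    then show ?thesis
      using C_on_cong[OF assms, of "partial b (\<lambda>x. u x + v x)" "\<lambda>x. partial b u x + partial b v x" n]
        partial_add C_on_differentiable_at[OF _ assms] Suc.prems by blast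
  qed
  then show ?case using Suc.prems by (auto intro: differentiable_on_add)
qed (auto intro: continuous_on_add)

lemma C_on_mult:
  fixes u v :: "'a::euclidean_space \<Rightarrow> real"
  assumes "open U"
  shows "C_on n u U \<Longrightarrow> C_on n v U \<Longrightarrow> C_on n (\<lambda>x. u x * v x) U"
proof (induction n arbitrary: u v)
  case (Suc n)
  have "C_on n (partial b (\<lambda>x. u x * v x)) U" if "b \<in> Basis" for b
  proof -
    have "C_on n (\<lambda>x. u x * partial b v x + partial b u x * v x) U"
      using Suc.prems[THEN C_on_SucD] Suc.prems that by (intro C_on_add[OF assms] Suc.IH) auto
    then show ?thesis
      using C_on_cong[OF assms, of "partial b (\<lambda>x. u x * v x)" "\<lambda>x. u x * partial b v x + partial b u x * v x" n]
        partial_mult C_on_differentiable_at[OF _ assms] Suc.prems by blast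
  qed
  then show ?case using Suc.prems by (auto intro: differentiable_on_mult)
qed (auto intro: continuous_on_mult)

lemma C_on_sum:
  assumes "open U"
  shows "(\<And>i. i \<in> I \<Longrightarrow> C_on n (f i) U) \<Longrightarrow> C_on n (\<lambda>x. \<Sum>i\<in>I. f i x) U"
  by (induction I rule: infinite_finite_induct) (auto intro!: C_on_add[OF assms])

lemma C_on_diff:
  fixes u v :: "'a::euclidean_space \<Rightarrow> real"
  assumes "open U" "C_on n u U" "C_on n v U"
  shows "C_on n (\<lambda>x. u x - v x) U"
  using C_on_add[OF assms(1,2) C_on_mult[OF assms(1) C_on_const[of n "-1"] assms(3)]] by simp

lemma C_on_partial: "C_on (Suc n) u U \<Longrightarrow> b \<in> Basis \<Longrightarrow> C_on n (partial b u) U"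
  by simp

lemma C_on_laplacian:
  assumes "open U" "C_on (Suc (Suc n)) u U"
  shows "C_on n (laplacian u) U"
proof -
  have "C_on n (\<lambda>x. \<Sum>b\<in>Basis. partial b (partial b u) x) U"
    by (rule C_on_sum[OF assms(1)]) (use assms(2) in auto)
  then show ?thesis by (simp add: laplacian_def[abs_def])
qed

lemma partial_compose_real:
  fixes g :: "'a::euclidean_space \<Rightarrow> real"
  assumes "(\<psi> has_real_derivative d) (at (g x))" "g differentiable (at x)"
  shows "partial b (\<lambda>x. \<psi> (g x)) x = d * partial b g x"
proof (rule partial_eqI[THEN trans])
  have "(g has_derivative frechet_derivative g (at x)) (at x)"
    using assms(2) frechet_derivative_works by blast
  from has_derivative_compose[OF this assms(1)[unfolded has_field_derivative_def]]
  show "((\<lambda>x. \<psi> (g x)) has_derivative (\<lambda>h. d * frechet_derivative g (at x) h)) (at x)" .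
  show "d * frechet_derivative g (at x) b = d * partial b g x" by (simp add: partial_def)
qed

lemma partial_real: "partial (1::real) \<psi> x = deriv \<psi> x" if "\<psi> differentiable (at x)"
proof (rule partial_eqI[THEN trans])
  show "(\<psi> has_derivative (\<lambda>h. deriv \<psi> x * h)) (at x)"
    using that DERIV_deriv_iff_real_differentiable has_field_derivative_def by blast
qed simp

lemma C_on_compose:
  fixes g :: "'a::euclidean_space \<Rightarrow> real" and \<psi> :: "real \<Rightarrow> real"
  assumes "open U" "open V" "g ` U \<subseteq> V"
  shows "C_on n \<psi> V \<Longrightarrow> C_on n g U \<Longrightarrow> C_on n (\<lambda>x. \<psi> (g x)) U"
proof (induction n arbitrary: \<psi>)
  case 0
  then show ?case using assms(3) continuous_on_compose2 by auto
next
  case (Suc n)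
  have dp: "\<psi> differentiable (at (g x))" if "x \<in> U" for x
    using Suc.prems(1) assms(2,3) that C_on_differentiable_at by blast
  have dg: "g differentiable (at x)" if "x \<in> U" for x
    using Suc.prems(2) assms(1) that C_on_differentiable_at by blast
  have eq: "partial b (\<lambda>x. \<psi> (g x)) x = partial 1 \<psi> (g x) * partial b g x" if "x \<in> U" for x b
  proof -
    have "(\<psi> has_real_derivative deriv \<psi> (g x)) (at (g x))"
      using DERIV_deriv_iff_real_differentiable dp[OF that] by blast
    from partial_compose_real[where g = g and x = x, OF this dg[OF that]]
    show ?thesis using partial_real[OF dp[OF that]] by simp
  qed
  have "C_on n (partial b (\<lambda>x. \<psi> (g x))) U" if "b \<in> Basis" for b
  proof -
    have "C_on n (\<lambda>x. partial 1 \<psi> (g x) * partial b g x) U"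
    proof (rule C_on_mult[OF assms(1)])
      show "C_on n (\<lambda>x. partial 1 \<psi> (g x)) U"
        by (rule Suc.IH[of "partial 1 \<psi>", OF _ C_on_SucD[OF Suc.prems(2)]]) (use Suc.prems(1) in auto)
      show "C_on n (partial b g) U" using Suc.prems(2) that by auto
    qed
    then show ?thesis
      using C_on_cong[OF assms(1), of "partial b (\<lambda>x. \<psi> (g x))" "\<lambda>x. partial 1 \<psi> (g x) * partial b g x"] eq by blast
  qed
  moreover have "(\<lambda>x. \<psi> (g x)) differentiable_on U"
    unfolding differentiable_on_eq_differentiable_at[OF assms(1)]
    using differentiable_compose[OF dp dg] by blast
  ultimately show ?case by simp
qed

lemma C_on_realI:
  assumes "open V" "\<And>i x. i < n \<Longrightarrow> x \<in> V \<Longrightarrow> (F i has_real_derivative F (Suc i) x) (at x)"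
    "continuous_on V (F n)"
  shows "C_on n (F 0) V"
  using assms(2,3)
proof (induction n arbitrary: F)
  case (Suc n)
  have "C_on n (F (Suc 0)) V"
    by (rule Suc.IH[of "\<lambda>i. F (Suc i)"]) (use Suc.prems in auto)
  moreover have "partial 1 (F 0) x = F (Suc 0) x" if "x \<in> V" for x
    using Suc.prems(1)[of 0 x] that
    by (metis zero_less_Suc partial_eqI has_field_derivative_def mult.right_neutral)
  moreover have "F 0 differentiable_on V"
    unfolding differentiable_on_eq_differentiable_at[OF assms(1)]
    using Suc.prems(1)[of 0] real_differentiable_def by blast
  ultimately show ?case using C_on_cong[OF assms(1), of "partial 1 (F 0)" "F (Suc 0)" n] by simp
qed simp

lemma real_polynomial_function_partial:
  "real_polynomial_function P \<Longrightarrow> real_polynomial_function (partial b P)"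
proof (induction P rule: real_polynomial_function.induct)
  case (linear f)
  then have "partial b f = (\<lambda>x. f b)"
    by (intro ext partial_eqI bounded_linear_imp_has_derivative)
  then show ?case by auto
next
  case (const c)
  have "partial b (\<lambda>x. c) = (\<lambda>x. 0)"
    by (rule ext, rule partial_eqI) (auto intro!: derivative_eq_intros)
  then show ?case by auto
next
  case (add f g)
  then have "partial b (\<lambda>x. f x + g x) = (\<lambda>x. partial b f x + partial b g x)"
    by (intro ext partial_add differentiable_at_real_polynomial_function)
  then show ?case using add by auto
next
  case (mult f g)
  then have "partial b (\<lambda>x. f x * g x) = (\<lambda>x. f x * partial b g x + partial b f x * g x)"
    by (intro ext partial_mult differentiable_at_real_polynomial_function)
  then show ?case using mult by auto
qed

lemma C_on_polynomial: "real_polynomial_function P \<Longrightarrow> C_on n P U"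
proof (induction n arbitrary: P)
  case 0
  then show ?case
    using continuous_on_polymonial_function real_polynomial_function_eq by auto
next
  case (Suc n)
  then show ?case
    using differentiable_on_real_polynomial_function Suc.IH[OF real_polynomial_function_partial] by simp
qed

lemma real_polynomial_function_inner_self: "real_polynomial_function (\<lambda>x::'a::euclidean_space. x \<bullet> x)"
proof -
  have "real_polynomial_function (\<lambda>x::'a. \<Sum>b\<in>Basis. (x \<bullet> b) * (x \<bullet> b))"
    by (intro real_polynomial_function_sum real_polynomial_function.intros(4) real_polynomial_function.intros(1)
        bounded_linear_inner_left) auto
  then show ?thesis by (simp add: euclidean_inner[symmetric])
qed

lemma partial_inner_self: "partial b (\<lambda>x::'a::euclidean_space. x \<bullet> x) x = 2 * (x \<bullet> b)"
  by (rule partial_eqI[of _ "\<lambda>h. x \<bullet> h + h \<bullet> x", THEN trans])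
    (auto intro!: derivative_eq_intros simp: inner_commute)

lemma laplacian_lincomb:
  fixes u v :: "'a::euclidean_space \<Rightarrow> real"
  assumes "open U" "C_on 2 u U" "C_on 2 v U" "x \<in> U"
  shows "laplacian (\<lambda>x. a * u x + b * v x) x = a * laplacian u x + b * laplacian v x"
proof -
  have pl: "partial e (\<lambda>x. a * u x + b * v x) y = a * partial e u y + b * partial e v y"
    if "u differentiable at y" "v differentiable at y" for u v :: "'a \<Rightarrow> real" and e y
  proof (rule partial_eqI[THEN trans])
    show "((\<lambda>x. a * u x + b * v x) has_derivative
       (\<lambda>h. a * frechet_derivative u (at y) h + b * frechet_derivative v (at y) h)) (at y)"
      using that by (auto intro!: derivative_eq_intros simp: frechet_derivative_works[symmetric])
  qed (simp add: partial_def)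
  have "partial e (partial e (\<lambda>x. a * u x + b * v x)) x = a * partial e (partial e u) x + b * partial e (partial e v) x"
    if e: "e \<in> Basis" for e
  proof -
    have 1: "C_on (Suc (Suc 0)) u U" "C_on (Suc (Suc 0)) v U" using assms by (simp_all add: numeral_2_eq_2)
    have "partial e (partial e (\<lambda>x. a * u x + b * v x)) x = partial e (\<lambda>x. a * partial e u x + b * partial e v x) x"
      by (rule partial_cong_open[OF assms(1,4)], rule pl)
        (use C_on_differentiable_at[OF _ assms(1)] 1 in blast)+
    also have "\<dots> = a * partial e (partial e u) x + b * partial e (partial e v) x"
      by (rule pl) (use C_on_differentiable_at[OF C_on_partial[OF _ e] assms(1,4)] 1 in blast)+
    finally show ?thesis .
  qed
  then show ?thesis
    by (simp add: laplacian_def sum.distrib sum_distrib_left)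
qed

text \<open>Spherical harmonics are used through the harmonic polynomials that they come from: the polynomial absorbs the factor r^k of a separated solution, so that the remaining radial factor is an entire function of the squared radius.\<close>

definition solid_harmonic :: "nat \<Rightarrow> ('a::euclidean_space \<Rightarrow> real) \<Rightarrow> bool" where
  "solid_harmonic k P \<longleftrightarrow> real_polynomial_function P \<and>
     (\<forall>c x. P (c *\<^sub>R x) = c ^ k * P x) \<and> (\<forall>x. laplacian P x = 0)"

text \<open>Differentiate P(t x) = t^k P(x) with respect to t at t = 1.\<close>

lemma euler_homogeneous:
  fixes P :: "'a::euclidean_space \<Rightarrow> real"
  assumes "real_polynomial_function P" "\<And>c x. P (c *\<^sub>R x) = c ^ k * P x"
  shows "(\<Sum>b\<in>Basis. (x \<bullet> b) * partial b P x) = real k * P x"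
proof -
  have "(P has_derivative (\<lambda>h. \<Sum>b\<in>Basis. (h \<bullet> b) * partial b P x)) (at (1 *\<^sub>R x))"
    using has_derivative_partials[OF differentiable_at_real_polynomial_function[OF assms(1)]] by simp
  then have "((\<lambda>t. P (t *\<^sub>R x)) has_derivative (\<lambda>t. \<Sum>b\<in>Basis. ((t *\<^sub>R x) \<bullet> b) * partial b P x)) (at 1)"
    by (rule has_derivative_compose[rotated]) (auto intro!: derivative_eq_intros)
  moreover have "((\<lambda>t. P (t *\<^sub>R x)) has_derivative (\<lambda>t. real k * t * P x)) (at 1)"
    unfolding assms(2) by (auto intro!: derivative_eq_intros)
  ultimately have "(\<lambda>t. \<Sum>b\<in>Basis. ((t *\<^sub>R x) \<bullet> b) * partial b P x) = (\<lambda>t. real k * t * P x)"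
    using has_derivative_unique by blast
  from fun_cong[OF this, of 1] show ?thesis by simp
qed

text \<open>The reduction to one dimension. The mixed term is 4 q' times x . grad P, which is k P by Euler's identity, and the term with the Laplacian of P vanishes. Degree and dimension enter only through k + N/2.\<close>

lemma laplacian_harmonic_radial:
  fixes P :: "'a::euclidean_space \<Rightarrow> real"
  assumes P: "solid_harmonic k P" and V: "open V"
    and q: "\<And>\<rho>. \<rho> \<in> V \<Longrightarrow> (q has_real_derivative q1 \<rho>) (at \<rho>)"
    and q1: "\<And>\<rho>. \<rho> \<in> V \<Longrightarrow> (q1 has_real_derivative q2 \<rho>) (at \<rho>)"
    and x: "x \<bullet> x \<in> V"
  shows "laplacian (\<lambda>x. P x * q (x \<bullet> x)) x =
    P x * (4 * (x \<bullet> x) * q2 (x \<bullet> x) + 4 * (real k + real DIM('a) / 2) * q1 (x \<bullet> x))"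
proof -
  define U where "U = (\<lambda>x::'a. x \<bullet> x) -` V"
  have U: "open U" unfolding U_def by (intro open_vimage V continuous_intros)
  have xU: "x \<in> U" using x by (simp add: U_def)
  note [simp] = differentiable_at_real_polynomial_function
  have Pp: "real_polynomial_function P" using P by (simp add: solid_harmonic_def)
  have di: "(\<lambda>x::'a. x \<bullet> x) differentiable (at y)" for y
    by (simp add: real_polynomial_function_inner_self)
  have dq: "(\<lambda>x. q (x \<bullet> x)) differentiable (at y)" "(\<lambda>x. q1 (x \<bullet> x)) differentiable (at y)" if "y \<in> U" for y
    using differentiable_compose[of q, OF _ di] differentiable_compose[of q1, OF _ di] q q1 that unfolding U_def
    by (metis real_differentiable_def vimageE)+
  have pq: "partial b (\<lambda>x. q (x \<bullet> x)) y = q1 (y \<bullet> y) * (2 * (y \<bullet> b))"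
           "partial b (\<lambda>x. q1 (x \<bullet> x)) y = q2 (y \<bullet> y) * (2 * (y \<bullet> b))" if "y \<in> U" for y b
    using partial_compose_real[OF q di] partial_compose_real[OF q1 di] that
    by (auto simp: U_def partial_inner_self)
  have p1: "partial b (\<lambda>x. P x * q (x \<bullet> x)) y = P y * (q1 (y \<bullet> y) * (2 * (y \<bullet> b))) + partial b P y * q (y \<bullet> y)"
    if "y \<in> U" for y b
    using that by (simp add: partial_mult Pp dq pq)
  have pl: "partial b (\<lambda>y::'a. 2 * (y \<bullet> b)) x = 2" if "b \<in> Basis" for b
    by (rule partial_eqI[of _ "\<lambda>h. 2 * (h \<bullet> b)", THEN trans])
      (use that in \<open>auto intro!: derivative_eq_intros\<close>)
  have dl: "(\<lambda>y::'a. 2 * (y \<bullet> b)) differentiable (at y)" for b y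
    by (auto intro!: derivative_intros)
  have dd: "(\<lambda>y. q1 (y \<bullet> y) * (2 * (y \<bullet> b))) differentiable (at x)" for b
    by (intro differentiable_mult dq xU dl)
  have pP: "real_polynomial_function (partial b P)" for b by (rule real_polynomial_function_partial[OF Pp])
  have p2: "partial b (partial b (\<lambda>x. P x * q (x \<bullet> x))) x =
      P x * (q2 (x \<bullet> x) * 4 * (x \<bullet> b)^2 + 2 * q1 (x \<bullet> x)) + 4 * q1 (x \<bullet> x) * ((x \<bullet> b) * partial b P x)
      + partial b (partial b P) x * q (x \<bullet> x)" if b: "b \<in> Basis" for b
  proof -
    have "partial b (partial b (\<lambda>x. P x * q (x \<bullet> x))) x =
       partial b (\<lambda>y. P y * (q1 (y \<bullet> y) * (2 * (y \<bullet> b))) + partial b P y * q (y \<bullet> y)) x"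
      by (rule partial_cong_open[OF U xU p1])
    also have "\<dots> = partial b (\<lambda>y. P y * (q1 (y \<bullet> y) * (2 * (y \<bullet> b)))) x + partial b (\<lambda>y. partial b P y * q (y \<bullet> y)) x"
      by (rule partial_add) (intro differentiable_mult dd dq xU differentiable_at_real_polynomial_function Pp pP)+
    also have "partial b (\<lambda>y. P y * (q1 (y \<bullet> y) * (2 * (y \<bullet> b)))) x =
        P x * partial b (\<lambda>y. q1 (y \<bullet> y) * (2 * (y \<bullet> b))) x + partial b P x * (q1 (x \<bullet> x) * (2 * (x \<bullet> b)))"
      by (rule partial_mult) (auto simp: Pp dd)
    also have "partial b (\<lambda>y. q1 (y \<bullet> y) * (2 * (y \<bullet> b))) x = q1 (x \<bullet> x) * 2 + q2 (x \<bullet> x) * (2 * (x \<bullet> b)) * (2 * (x \<bullet> b))"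
      by (subst partial_mult) (auto simp: dq xU dl pl b pq)
    also have "partial b (\<lambda>y. partial b P y * q (y \<bullet> y)) x =
       partial b P x * (q1 (x \<bullet> x) * (2 * (x \<bullet> b))) + partial b (partial b P) x * q (x \<bullet> x)"
      by (subst partial_mult) (auto simp: dq xU pP pq)
    finally show ?thesis by (simp add: algebra_simps power2_eq_square)
  qed
  have e: "(\<Sum>b\<in>Basis. (x \<bullet> b) * partial b P x) = real k * P x"
    using euler_homogeneous[of P k x] P by (simp add: solid_harmonic_def)
  have h: "(\<Sum>b\<in>Basis. partial b (partial b P) x) = 0"
    using P by (simp add: solid_harmonic_def laplacian_def)
  have n: "(\<Sum>b\<in>Basis. (x \<bullet> b)^2) = x \<bullet> x"
    using euclidean_inner[of x x] by (simp add: power2_eq_square)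
  have "laplacian (\<lambda>x. P x * q (x \<bullet> x)) x =
      P x * (q2 (x \<bullet> x) * 4 * (\<Sum>b\<in>Basis. (x \<bullet> b)^2) + 2 * real DIM('a) * q1 (x \<bullet> x)) +
      4 * q1 (x \<bullet> x) * (\<Sum>b\<in>Basis. (x \<bullet> b) * partial b P x) + (\<Sum>b\<in>Basis. partial b (partial b P) x) * q (x \<bullet> x)"
    unfolding laplacian_def sum_distrib_left sum_distrib_right
    by (simp add: p2 sum.distrib sum_distrib_left sum_distrib_right algebra_simps)
  then show ?thesis unfolding e h n by (simp add: algebra_simps)
qed

text \<open>The real part of (x_1 + i x_2)^k is a homogeneous harmonic polynomial, and it equals 1 at the first basis vector.\<close>

lemma solid_harmonic_exists:
  assumes "2 \<le> DIM('a::euclidean_space)"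
  shows "\<exists>P :: 'a \<Rightarrow> real. solid_harmonic k P \<and> (\<exists>\<theta>\<in>sphere 0 1. P \<theta> \<noteq> 0)"
proof -
  obtain B :: "'a set" where "B \<subseteq> Basis" "card B = 2"
    using obtain_subset_with_card_n[OF assms] by blast
  then obtain b1 b2 :: 'a where b: "b1 \<in> Basis" "b2 \<in> Basis" "b1 \<noteq> b2"
    by (auto simp: card_2_iff)
  define z where "z = (\<lambda>x::'a. Complex (x \<bullet> b1) (x \<bullet> b2))"
  define Q T where "Q = (\<lambda>k x. Re (z x ^ k))" and "T = (\<lambda>k x. Im (z x ^ k))"
  have poly: "real_polynomial_function (Q k) \<and> real_polynomial_function (T k)" for k
  proof (induction k)
    case 0
    then show ?case by (auto simp: Q_def T_def)
  next
    case (Suc k)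
    have "Q (Suc k) = (\<lambda>x. (x \<bullet> b1) * Q k x - (x \<bullet> b2) * T k x)"
         "T (Suc k) = (\<lambda>x. (x \<bullet> b1) * T k x + (x \<bullet> b2) * Q k x)"
      by (auto simp: Q_def T_def z_def fun_eq_iff)
    moreover have "real_polynomial_function (\<lambda>x::'a. x \<bullet> b)" for b
      by (intro real_polynomial_function.intros(1) bounded_linear_inner_left)
    ultimately show ?case using Suc
      by (auto intro!: real_polynomial_function_diff real_polynomial_function.intros(3,4))
  qed
  have dz: "(z has_derivative (\<lambda>h. Complex (h \<bullet> b1) (h \<bullet> b2))) (at x)" for x
    unfolding z_def Complex_eq
    by (rule derivative_eq_intros refl | simp)+
  have dzk: "((\<lambda>x. z x ^ k) has_derivative (\<lambda>h. of_nat k * Complex (h \<bullet> b1) (h \<bullet> b2) * z x ^ (k - 1))) (at x)" for k x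
    by (rule has_derivative_power[OF dz])
  have dQ: "partial e (Q k) x = Re (of_nat k * Complex (e \<bullet> b1) (e \<bullet> b2) * z x ^ (k - 1))"
    and dT: "partial e (T k) x = Im (of_nat k * Complex (e \<bullet> b1) (e \<bullet> b2) * z x ^ (k - 1))" for e k x
    unfolding Q_def T_def
    by (rule partial_eqI, rule bounded_linear.has_derivative[OF _ dzk], simp add: bounded_linear_Re bounded_linear_Im)+
  have "laplacian (Q k) x = 0" for k x
  proof -
    have 1: "partial b1 (partial b1 (Q k)) x = real (k * (k - 1)) * Q (k - 2) x"
    proof -
      have "partial b1 (Q k) = (\<lambda>x. real k * Q (k - 1) x)"
        unfolding fun_eq_iff dQ unfolding Q_def using b by (auto simp: inner_Basis Complex_eq)
      then have "partial b1 (partial b1 (Q k)) x = real k * partial b1 (Q (k - 1)) x"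
        using partial_mult[of "\<lambda>x. real k" x "Q (k - 1)" b1] poly
        by (simp add: differentiable_at_real_polynomial_function partial_def)
      then show ?thesis
        unfolding dQ unfolding Q_def using b by (simp add: inner_Basis numeral_2_eq_2 Complex_eq mult.assoc)
    qed
    have 2: "partial b2 (partial b2 (Q k)) x = - (real (k * (k - 1)) * Q (k - 2) x)"
    proof -
      have "partial b2 (Q k) = (\<lambda>x. - real k * T (k - 1) x)"
        unfolding fun_eq_iff dQ unfolding T_def using b by (auto simp: inner_Basis Complex_eq)
      then have "partial b2 (partial b2 (Q k)) x = - real k * partial b2 (T (k - 1)) x"
        using partial_mult[of "\<lambda>x. - real k" x "T (k - 1)" b2] poly
        by (simp add: differentiable_at_real_polynomial_function partial_def)
      then show ?thesis
        unfolding dT unfolding Q_def using b by (simp add: inner_Basis numeral_2_eq_2 Complex_eq mult.assoc)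
    qed
    have 3: "partial e (partial e (Q k)) x = 0" if "e \<in> Basis - {b1, b2}" for e
    proof -
      have "partial e (Q k) = (\<lambda>x. 0)"
        unfolding fun_eq_iff dQ using b that by (auto simp: inner_Basis Complex_eq)
      then show ?thesis by (simp add: partial_def)
    qed
    have "laplacian (Q k) x = (\<Sum>e\<in>{b1, b2}. partial e (partial e (Q k)) x)"
      unfolding laplacian_def by (rule sum.mono_neutral_right) (use b 3 in auto)
    then show ?thesis using b 1 2 by simp
  qed
  moreover have "Q k (c *\<^sub>R x) = c ^ k * Q k x" for c x
  proof -
    have "z (c *\<^sub>R x) = of_real c * z x" by (simp add: z_def complex_eq_iff)
    then show ?thesis by (simp add: Q_def power_mult_distrib flip: of_real_power)
  qed
  moreover have "Q k b1 = 1"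
  proof -
    have "z b1 = 1" using b by (simp add: z_def inner_Basis complex_eq_iff)
    then show ?thesis by (simp add: Q_def)
  qed
  ultimately show ?thesis
    using poly b by (intro exI[of _ "Q k"]) (auto simp: solid_harmonic_def intro!: bexI[of _ b1])
qed

section \<open>Radial power series and the Bessel phase\<close>

definition entire_coeffs :: "(nat \<Rightarrow> real) \<Rightarrow> bool" where
  "entire_coeffs c \<longleftrightarrow> (\<forall>x. summable (\<lambda>n. c n * x ^ n))"

definition psum :: "(nat \<Rightarrow> real) \<Rightarrow> real \<Rightarrow> real" where
  "psum c x = (\<Sum>n. c n * x ^ n)"

lemma entire_coeffsD: "entire_coeffs c \<Longrightarrow> summable (\<lambda>n. c n * x ^ n)"
  by (simp add: entire_coeffs_def)

lemma psum_sums: "entire_coeffs c \<Longrightarrow> (\<lambda>n. c n * x ^ n) sums psum c x"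
  by (simp add: entire_coeffs_def psum_def summable_sums)

lemma entire_coeffs_diffs: "entire_coeffs c \<Longrightarrow> entire_coeffs (diffs c)"
  unfolding entire_coeffs_def using termdiff_converges_all by blast

lemma psum_has_derivative: "entire_coeffs c \<Longrightarrow> (psum c has_real_derivative psum (diffs c) x) (at x)"
  unfolding entire_coeffs_def psum_def using termdiffs_strong_converges_everywhere by blast

lemma psum_0 [simp]: "psum c 0 = c 0"
  by (simp add: psum_def)

lemma continuous_on_psum: "entire_coeffs c \<Longrightarrow> continuous_on A (psum c)"
  using psum_has_derivative DERIV_isCont continuous_at_imp_continuous_on by blast

lemma entire_coeffs_lincomb:
  "entire_coeffs c \<Longrightarrow> entire_coeffs d \<Longrightarrow> entire_coeffs (\<lambda>n. a * c n + b * d n)"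
  unfolding entire_coeffs_def
  by (simp add: distrib_right mult.assoc summable_add summable_mult)

lemma psum_lincomb:
  assumes "entire_coeffs c" "entire_coeffs d"
  shows "psum (\<lambda>n. a * c n + b * d n) x = a * psum c x + b * psum d x"
proof -
  have "(\<lambda>n. a * (c n * x ^ n) + b * (d n * x ^ n)) sums (a * psum c x + b * psum d x)"
    by (intro sums_add sums_mult psum_sums assms)
  then show ?thesis unfolding psum_def by (simp add: sums_iff algebra_simps)
qed

lemma diffs_lincomb: "diffs (\<lambda>n. a * c n + b * d n) = (\<lambda>n. a * diffs c n + b * diffs (d :: nat \<Rightarrow> real) n)"
  by (auto simp: diffs_def algebra_simps)

lemma C_on_psum: "entire_coeffs c \<Longrightarrow> C_on n (psum c) UNIV"
proof -
  assume c: "entire_coeffs c"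
  have e: "entire_coeffs ((diffs ^^ i) c)" for i
    by (induction i) (use c entire_coeffs_diffs in auto)
  show ?thesis
    using C_on_realI[of UNIV n "\<lambda>i. psum ((diffs ^^ i) c)"] e psum_has_derivative continuous_on_psum
    by force
qed

text \<open>The operator 4 \<rho> q'' + 4 \<nu> q' on the level of the coefficients of q, see \<open>psum_radial_op\<close>.\<close>

definition radial_op :: "real \<Rightarrow> (nat \<Rightarrow> real) \<Rightarrow> nat \<Rightarrow> real" where
  "radial_op \<nu> c n = 4 * (real n + \<nu>) * diffs c n"

lemma radial_op_lincomb:
  "radial_op \<nu> (\<lambda>n. a * c n + b * d n) = (\<lambda>n. a * radial_op \<nu> c n + b * radial_op \<nu> d n)"
  by (auto simp: radial_op_def diffs_lincomb algebra_simps)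

lemma times_psum_diffs:
  assumes "entire_coeffs d"
  shows "(\<lambda>n. real n * d n * x ^ n) sums (x * psum (diffs d) x)"
proof -
  have "(\<lambda>n. x * (diffs d n * x ^ n)) sums (x * psum (diffs d) x)"
    by (intro sums_mult psum_sums entire_coeffs_diffs assms)
  then have "(\<lambda>n. real (Suc n) * d (Suc n) * x ^ Suc n) sums (x * psum (diffs d) x)"
    by (simp add: diffs_def algebra_simps)
  then show ?thesis using sums_Suc_iff[of "\<lambda>n. real n * d n * x ^ n"] by simp
qed

lemma radial_op_sums:
  assumes "entire_coeffs c"
  shows "(\<lambda>n. radial_op \<nu> c n * x ^ n) sums
     (4 * x * psum (diffs (diffs c)) x + 4 * \<nu> * psum (diffs c) x)"
proof -
  have d: "entire_coeffs (diffs c)" using assms by (rule entire_coeffs_diffs)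
  have "(\<lambda>n. 4 * (real n * diffs c n * x ^ n) + 4 * \<nu> * (diffs c n * x ^ n)) sums
     (4 * (x * psum (diffs (diffs c)) x) + 4 * \<nu> * psum (diffs c) x)"
    by (intro sums_add sums_mult times_psum_diffs psum_sums d)
  then show ?thesis by (simp add: radial_op_def algebra_simps)
qed

lemma entire_coeffs_radial_op: "entire_coeffs c \<Longrightarrow> entire_coeffs (radial_op \<nu> c)"
  using radial_op_sums sums_summable unfolding entire_coeffs_def by metis

lemma psum_radial_op:
  "entire_coeffs c \<Longrightarrow>
   psum (radial_op \<nu> c) x = 4 * x * psum (diffs (diffs c)) x + 4 * \<nu> * psum (diffs c) x"
  using radial_op_sums[of c \<nu> x] by (simp add: psum_def sums_iff)

text \<open>The coefficients of the hypergeometric function 0F1(\<nu>; -z/4). For z > 0 it equals \<Gamma>(\<nu>) (sqrt z / 2)^(1 - \<nu>) J_(\<nu>-1)(sqrt z), and for z < 0 the same expression with |z| and the modified Bessel function I. Passing to this entire function removes the case distinction on the sign of the eigenvalue.\<close>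

definition bessel_coeff :: "real \<Rightarrow> nat \<Rightarrow> real" where
  "bessel_coeff \<nu> n = (- 1 / 4) ^ n / (fact n * pochhammer \<nu> n)"

text \<open>The coefficients of \<rho> \<mapsto> \<Phi>(\<sigma> \<rho>), the regular solution of M q = -\<sigma> q.\<close>

abbreviation bessel_coeffs :: "real \<Rightarrow> real \<Rightarrow> nat \<Rightarrow> real" where
  "bessel_coeffs \<nu> \<sigma> \<equiv> (\<lambda>n. bessel_coeff \<nu> n * \<sigma> ^ n)"

lemma fact_le_pochhammer: "1 \<le> \<nu> \<Longrightarrow> fact n \<le> pochhammer (\<nu>::real) n"
  unfolding pochhammer_fact pochhammer_prod by (rule prod_mono) auto

lemma bessel_coeff_bound:
  assumes "1 \<le> \<nu>" shows "\<bar>bessel_coeff \<nu> n\<bar> \<le> 1 / fact n"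
proof -
  have p: "1 \<le> pochhammer \<nu> n"
    using fact_le_pochhammer[OF assms, of n] fact_ge_1[of n, where 'a = real] by linarith
  have "\<bar>bessel_coeff \<nu> n\<bar> = (1/4) ^ n / (fact n * pochhammer \<nu> n)"
    using p by (simp add: bessel_coeff_def power_abs abs_mult)
  also have "\<dots> \<le> 1 / fact n"
    using p power_le_one[of "1/4::real" n] by (intro frac_le) (auto simp: mult_ge1_I)
  finally show ?thesis .
qed

lemma entire_bessel_coeff: "1 \<le> \<nu> \<Longrightarrow> entire_coeffs (bessel_coeffs \<nu> \<sigma>)"
  unfolding entire_coeffs_def
proof
  fix x :: real assume \<nu>: "1 \<le> \<nu>"
  show "summable (\<lambda>n. bessel_coeff \<nu> n * \<sigma> ^ n * x ^ n)"
  proof (rule summable_comparison_test')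
    show "summable (\<lambda>n. inverse (fact n) * \<bar>\<sigma> * x\<bar> ^ n)" by (rule summable_exp)
    show "norm (bessel_coeff \<nu> n * \<sigma> ^ n * x ^ n) \<le> inverse (fact n) * \<bar>\<sigma> * x\<bar> ^ n" for n
      using mult_right_mono[OF bessel_coeff_bound[OF \<nu>, of n], of "\<bar>\<sigma> * x\<bar> ^ n"]
      by (simp add: abs_mult power_abs power_mult_distrib inverse_eq_divide mult.assoc)
  qed
qed

lemma radial_op_bessel:
  assumes "1 \<le> \<nu>"
  shows "radial_op \<nu> (bessel_coeffs \<nu> \<sigma>) n = - \<sigma> * (bessel_coeff \<nu> n * \<sigma> ^ n)"
proof -
  have "bessel_coeff \<nu> (Suc n) = bessel_coeff \<nu> n * ((- 1 / 4) / (real (Suc n) * (\<nu> + real n)))"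
    unfolding bessel_coeff_def pochhammer_Suc fact_Suc power_Suc times_divide_times_eq
    by (simp only: mult_ac of_nat_mult of_nat_fact)
  moreover have "real (Suc n) * (\<nu> + real n) \<noteq> 0" using assms by simp
  moreover have "M * (a * ((- 1 / 4) / M)) = - a / 4" if "M \<noteq> 0" for a M :: real using that by simp
  ultimately have "real (Suc n) * (\<nu> + real n) * bessel_coeff \<nu> (Suc n) = - bessel_coeff \<nu> n / 4"
    by metis
  then have "4 * \<sigma> ^ Suc n * (real (Suc n) * (\<nu> + real n) * bessel_coeff \<nu> (Suc n)) =
      4 * \<sigma> ^ Suc n * (- bessel_coeff \<nu> n / 4)" by (simp only:)
  then show ?thesis by (simp add: radial_op_def diffs_def algebra_simps)
qed

definition bes :: "real \<Rightarrow> real \<Rightarrow> real" where "bes \<nu> = psum (bessel_coeff \<nu>)"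
definition bes' :: "real \<Rightarrow> real \<Rightarrow> real" where "bes' \<nu> = psum (diffs (bessel_coeff \<nu>))"

lemma entire_bessel_coeff1: "1 \<le> \<nu> \<Longrightarrow> entire_coeffs (bessel_coeff \<nu>)"
  using entire_bessel_coeff[of \<nu> 1] by simp

lemma bes_deriv: "1 \<le> \<nu> \<Longrightarrow> (bes \<nu> has_real_derivative bes' \<nu> x) (at x)"
  unfolding bes_def bes'_def by (intro psum_has_derivative entire_bessel_coeff1)

lemma bes_ode:
  assumes "1 \<le> \<nu>"
  obtains d where "(bes' \<nu> has_real_derivative d) (at x)" "x * d = - \<nu> * bes' \<nu> x - bes \<nu> x / 4"
proof
  note e = entire_bessel_coeff1[OF assms]
  show "(bes' \<nu> has_real_derivative psum (diffs (diffs (bessel_coeff \<nu>))) x) (at x)"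
    unfolding bes'_def by (intro psum_has_derivative entire_coeffs_diffs e)
  have "radial_op \<nu> (bessel_coeff \<nu>) = (\<lambda>n. (-1) * bessel_coeff \<nu> n + 0 * bessel_coeff \<nu> n)"
    using radial_op_bessel[OF assms, of 1] by auto
  then have "psum (radial_op \<nu> (bessel_coeff \<nu>)) x = - bes \<nu> x"
    using psum_lincomb[OF e e, of "-1" 0] by (simp add: bes_def)
  then show "x * psum (diffs (diffs (bessel_coeff \<nu>))) x = - \<nu> * bes' \<nu> x - bes \<nu> x / 4"
    using psum_radial_op[OF e, of \<nu> x] by (simp add: bes'_def)
qed

lemma bes_0: "bes \<nu> 0 = 1" and bes'_0: "bes' \<nu> 0 = - 1 / (4 * \<nu>)"
  by (auto simp: bes_def bes'_def bessel_coeff_def diffs_def)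

lemma bes_pos:
  assumes "1 \<le> \<nu>" "x \<le> 0" shows "0 < bes \<nu> x"
proof -
  have s: "(\<lambda>n. bessel_coeff \<nu> n * x ^ n) sums bes \<nu> x"
    unfolding bes_def by (rule psum_sums[OF entire_bessel_coeff1[OF assms(1)]])
  have nn: "0 \<le> bessel_coeff \<nu> n * x ^ n" for n
  proof -
    have "bessel_coeff \<nu> n * x ^ n = (- x / 4) ^ n / (fact n * pochhammer \<nu> n)"
      by (simp add: bessel_coeff_def flip: power_mult_distrib)
    moreover have "0 < pochhammer \<nu> n" using assms by (intro pochhammer_pos) auto
    ultimately show ?thesis using assms by simp
  qed
  have "sum (\<lambda>n. bessel_coeff \<nu> n * x ^ n) {0} \<le> bes \<nu> x"
    using sum_le_suminf[OF sums_summable[OF s], of "{0}"] nn sums_unique[OF s] by simp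
  then show ?thesis by (simp add: bessel_coeff_def)
qed

text \<open>With A(z) = z \<Phi>'(z) and \<Phi> = \<open>bes\<close>, this is A \<Phi>' - A' \<Phi>, with A' rewritten by the differential equation. It is the numerator of the derivative of the angle of the vector (A, \<Phi>).\<close>

definition bes_wronskian :: "real \<Rightarrow> real \<Rightarrow> real" where
  "bes_wronskian \<nu> x = x * (bes' \<nu> x)\<^sup>2 + (\<nu> - 1) * bes \<nu> x * bes' \<nu> x + (bes \<nu> x)\<^sup>2 / 4"

lemma bes_wronskian_deriv:
  assumes "1 \<le> \<nu>"
  obtains d where "(bes_wronskian \<nu> has_real_derivative d) (at x)"
    "x * d = (bes \<nu> x)\<^sup>2 / 4 - \<nu> * bes_wronskian \<nu> x"
proof -
  obtain f where f: "(bes' \<nu> has_real_derivative f) (at x)" "x * f = - \<nu> * bes' \<nu> x - bes \<nu> x / 4"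
    using bes_ode[OF assms] by blast
  let ?d = "(bes' \<nu> x)\<^sup>2 + 2 * bes' \<nu> x * (x * f) + (\<nu> - 1) * ((bes' \<nu> x)\<^sup>2 + bes \<nu> x * f) + bes \<nu> x * bes' \<nu> x / 2"
  have "(bes_wronskian \<nu> has_real_derivative ?d) (at x)"
    unfolding bes_wronskian_def
    by (auto intro!: derivative_eq_intros bes_deriv[OF assms] f(1) simp: algebra_simps power2_eq_square)
  moreover have "x * ?d = (bes \<nu> x)\<^sup>2 / 4 - \<nu> * bes_wronskian \<nu> x"
  proof -
    have "x * ?d = x * (bes' \<nu> x)\<^sup>2 + 2 * x * bes' \<nu> x * (x * f) + (\<nu> - 1) * (x * (bes' \<nu> x)\<^sup>2 + bes \<nu> x * (x * f)) + x * bes \<nu> x * bes' \<nu> x / 2"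
      by (simp add: algebra_simps)
    then show ?thesis unfolding f(2) bes_wronskian_def by (simp add: field_simps power2_eq_square)
  qed
  ultimately show ?thesis using that by blast
qed

text \<open>By the differential equation, |x|^\<nu> times this quantity has a derivative with the sign of x, namely |x|^(\<nu>-1) \<Phi>^2 / 4 for x > 0. Hence it keeps growing when moving away from the origin, near which it is positive.\<close>

lemma bes_wronskian_pos:
  assumes \<nu>: "1 \<le> \<nu>"
  shows "0 < bes_wronskian \<nu> x"
proof -
  let ?w = "bes_wronskian \<nu>"
  have cont: "isCont ?w y" for y
    using bes_wronskian_deriv[OF \<nu>, of y] DERIV_isCont by metis
  have w0: "0 < ?w 0"
    using \<nu> by (simp add: bes_wronskian_def bes_0 bes'_0 field_simps)
  then obtain d where d: "0 < d" "\<And>y. \<bar>y\<bar> < d \<Longrightarrow> 0 < ?w y"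
    using cont[of 0] unfolding continuous_at_eps_delta
    by (metis abs_diff_less_iff diff_0_right dist_real_def add.right_inverse diff_self uminus_add_conv_diff abs_minus_cancel less_diff_eq add_0)
  show ?thesis
  proof (cases "\<bar>x\<bar> < d")
    case True
    then show ?thesis using d by blast
  next
    case False
    \<comment> \<open>The weight vanishes at the origin, so the monotonicity argument starts at a point near the origin.\<close>
    define e where "e = d / 2"
    have e: "0 < e" "e < d" using d by (auto simp: e_def)
    consider "0 < x" "e < x" | "x < 0" "x < - e" using False e by linarith
    then show ?thesis
    proof cases
      case 1
      have "(\<lambda>y. y powr \<nu> * ?w y) e \<le> (\<lambda>y. y powr \<nu> * ?w y) x"
      proof (rule DERIV_nonneg_imp_nondecreasing[of e x])
        show "e \<le> x" using 1 by simp
        fix y assume y: "e \<le> y" "y \<le> x"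
        then have yp: "0 < y" using e by simp
        obtain g where g: "(?w has_real_derivative g) (at y)" "y * g = (bes \<nu> y)\<^sup>2 / 4 - \<nu> * ?w y"
          using bes_wronskian_deriv[OF \<nu>] by blast
        have "((\<lambda>y. y powr \<nu> * ?w y) has_real_derivative y powr (\<nu> - 1) * (\<nu> * ?w y + y * g)) (at y)"
          using yp by (auto intro!: derivative_eq_intros g(1) simp: algebra_simps powr_diff)
        then show "\<exists>z. ((\<lambda>y. y powr \<nu> * ?w y) has_real_derivative z) (at y) \<and> 0 \<le> z"
          unfolding g(2) by (intro exI conjI) auto
      qed
      moreover have "0 < e powr \<nu> * ?w e" using e d by simp
      ultimately have "0 < x powr \<nu> * ?w x" by simp
      then show ?thesis by (simp add: zero_less_mult_iff)
    next
      case 2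
      have "(\<lambda>y. (-y) powr \<nu> * ?w y) x \<ge> (\<lambda>y. (-y) powr \<nu> * ?w y) (-e)"
      proof (rule DERIV_nonpos_imp_nonincreasing[of x "-e"])
        show "x \<le> -e" using 2 by simp
        fix y assume y: "x \<le> y" "y \<le> -e"
        then have yp: "0 < -y" using e by simp
        obtain g where g: "(?w has_real_derivative g) (at y)" "y * g = (bes \<nu> y)\<^sup>2 / 4 - \<nu> * ?w y"
          using bes_wronskian_deriv[OF \<nu>] by blast
        have "((\<lambda>y. (-y) powr \<nu> * ?w y) has_real_derivative - ((-y) powr (\<nu> - 1) * (\<nu> * ?w y + y * g))) (at y)"
          using yp by (auto intro!: derivative_eq_intros g(1) simp: algebra_simps powr_diff)
        then show "\<exists>z. ((\<lambda>y. (-y) powr \<nu> * ?w y) has_real_derivative z) (at y) \<and> z \<le> 0"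
          unfolding g(2) by (intro exI conjI) auto
      qed
      moreover have "0 < e powr \<nu> * ?w (-e)" using e d by simp
      ultimately have "0 < (-x) powr \<nu> * ?w x" by simp
      then show ?thesis by (simp add: zero_less_mult_iff)
    qed
  qed
qed

definition bes_amp2 :: "real \<Rightarrow> real \<Rightarrow> real" where
  "bes_amp2 \<nu> x = (bes \<nu> x)\<^sup>2 + (x * bes' \<nu> x)\<^sup>2"

lemma bes_amp2_pos:
  assumes "1 \<le> \<nu>" shows "0 < bes_amp2 \<nu> x"
proof (rule ccontr)
  assume "\<not> 0 < bes_amp2 \<nu> x"
  then have "bes \<nu> x = 0" "x * bes' \<nu> x = 0"
    unfolding bes_amp2_def by (auto simp: sum_power2_gt_zero_iff)
  then have "bes_wronskian \<nu> x = 0" by (auto simp: bes_wronskian_def)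
  then show False using bes_wronskian_pos[OF assms, of x] by simp
qed

lemma isCont_bes:
  assumes "1 \<le> \<nu>"
  shows "isCont (bes \<nu>) x" "isCont (bes' \<nu>) x" "isCont (bes_wronskian \<nu>) x" "isCont (bes_amp2 \<nu>) x"
proof -
  show 1: "isCont (bes \<nu>) x" using bes_deriv[OF assms] DERIV_isCont by blast
  show 2: "isCont (bes' \<nu>) x" using bes_ode[OF assms] DERIV_isCont by metis
  show "isCont (bes_wronskian \<nu>) x"
    using bes_wronskian_deriv[OF assms, of x] DERIV_isCont by metis
  show "isCont (bes_amp2 \<nu>) x" unfolding bes_amp2_def by (intro continuous_intros 1 2)
qed

text \<open>The phase is introduced through its derivative and its value at the origin, where (\<Phi>, z \<Phi>') = (1, 0). No branch of the arcus tangent has to be chosen, and analyticity is inherited from the derivative. That it is the angle in question is \<open>bes_polar\<close>.\<close>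

definition phase :: "real \<Rightarrow> real \<Rightarrow> real" where
  "phase \<nu> = (SOME \<psi>. (\<forall>x. (\<psi> has_real_derivative bes_wronskian \<nu> x / bes_amp2 \<nu> x) (at x)) \<and> \<psi> 0 = pi / 2)"

lemma phase_spec:
  assumes "1 \<le> \<nu>"
  shows phase_deriv: "(phase \<nu> has_real_derivative bes_wronskian \<nu> x / bes_amp2 \<nu> x) (at x)"
    and phase_0: "phase \<nu> 0 = pi / 2"
proof -
  have "isCont (\<lambda>x. bes_wronskian \<nu> x / bes_amp2 \<nu> x) x" for x
    using isCont_bes[OF assms] bes_amp2_pos[OF assms, of x] by (intro continuous_intros) auto
  then obtain F where F: "\<And>x. (F has_vector_derivative bes_wronskian \<nu> x / bes_amp2 \<nu> x) (at x)"
    using einterval_antiderivative[of "-\<infinity>" "\<infinity>" "\<lambda>x. bes_wronskian \<nu> x / bes_amp2 \<nu> x"] by auto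
  have "(\<forall>x. ((\<lambda>x. F x - F 0 + pi / 2) has_real_derivative bes_wronskian \<nu> x / bes_amp2 \<nu> x) (at x))"
    using F by (auto intro!: derivative_eq_intros simp: has_real_derivative_iff_has_vector_derivative)
  then have "\<exists>\<psi>. (\<forall>x. (\<psi> has_real_derivative bes_wronskian \<nu> x / bes_amp2 \<nu> x) (at x)) \<and> \<psi> 0 = pi / 2"
    by (intro exI[of _ "\<lambda>x. F x - F 0 + pi / 2"]) auto
  from someI_ex[OF this]
  show "(phase \<nu> has_real_derivative bes_wronskian \<nu> x / bes_amp2 \<nu> x) (at x)" "phase \<nu> 0 = pi / 2"
    unfolding phase_def by blast+
qed

lemma phase_strict_mono: "1 \<le> \<nu> \<Longrightarrow> x < y \<Longrightarrow> phase \<nu> x < phase \<nu> y"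
  using DERIV_pos_imp_increasing[of x y "phase \<nu>"] phase_deriv bes_wronskian_pos bes_amp2_pos
  by (meson divide_pos_pos)

text \<open>D is the component of (z \<Phi>', \<Phi>) orthogonal to the direction given by the phase. The square of D divided by the squared length of the vector is constant, and it vanishes at the origin.\<close>

lemma bes_polar:
  assumes \<nu>: "1 \<le> \<nu>"
  obtains E where "E \<noteq> 0" "bes \<nu> x = E * sin (phase \<nu> x)" "x * bes' \<nu> x = E * cos (phase \<nu> x)"
proof -
  define D where "D = (\<lambda>x. bes \<nu> x * cos (phase \<nu> x) - x * bes' \<nu> x * sin (phase \<nu> x))"
  have "((\<lambda>x. (D x)\<^sup>2 / bes_amp2 \<nu> x) has_real_derivative 0) (at x)" for x
  proof -
    obtain f where f: "(bes' \<nu> has_real_derivative f) (at x)" "x * f = - \<nu> * bes' \<nu> x - bes \<nu> x / 4"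
      using bes_ode[OF \<nu>] by blast
    define c s F A a p S where "c = cos (phase \<nu> x)" and "s = sin (phase \<nu> x)" and "F = bes \<nu> x"
      and "A = x * bes' \<nu> x" and "a = bes' \<nu> x + x * f" and "p = bes_wronskian \<nu> x / bes_amp2 \<nu> x"
      and "S = bes_amp2 \<nu> x"
    let ?f1 = "bes' \<nu> x"
    have Sp: "S > 0" using bes_amp2_pos[OF \<nu>] by (simp add: S_def)
    have Sd: "S = F * F + A * A" by (simp add: S_def bes_amp2_def F_def A_def power2_eq_square)
    have W: "bes_wronskian \<nu> x = A * ?f1 - a * F"
      unfolding bes_wronskian_def a_def f(2) A_def F_def by (simp add: field_simps power2_eq_square)
    have pS: "p * S = A * ?f1 - a * F" using Sp W by (simp add: p_def S_def)
    define D' where "D' = ?f1 * c - F * s * p - a * s - A * c * p"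
    define S' where "S' = 2 * F * ?f1 + 2 * A * a"
    have d1: "(D has_real_derivative D') (at x)"
      unfolding D_def D'_def
      by (auto intro!: derivative_eq_intros bes_deriv[OF \<nu>] phase_deriv[OF \<nu>] f(1)
          simp: c_def s_def F_def A_def a_def p_def algebra_simps)
    have d2: "(bes_amp2 \<nu> has_real_derivative S') (at x)"
      unfolding bes_amp2_def S'_def
      by (auto intro!: derivative_eq_intros bes_deriv[OF \<nu>] f(1)
          simp: F_def A_def a_def algebra_simps power2_eq_square)
    have Dx: "D x = F * c - A * s" by (simp add: D_def F_def A_def c_def s_def)
    have "2 * D' * S = 2 * (S * (?f1 * c - a * s) - (p * S) * (F * s + A * c))"
      unfolding D'_def by (simp add: algebra_simps)
    also have "\<dots> = D x * S'"
      unfolding pS unfolding Sd Dx S'_def by (simp add: algebra_simps)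
    finally have *: "2 * D' * S = D x * S'" .
    have "((\<lambda>x. (D x)\<^sup>2 / bes_amp2 \<nu> x) has_real_derivative
        ((2 * D x * D') * S - (D x)\<^sup>2 * S') / (S * S)) (at x)"
      using Sp by (auto intro!: derivative_eq_intros d1 d2 simp: S_def power2_eq_square)
    moreover have "(2 * D x * D') * S - (D x)\<^sup>2 * S' = D x * (2 * D' * S - D x * S')"
      by (simp add: algebra_simps power2_eq_square)
    ultimately show ?thesis using * by simp
  qed
  from DERIV_isconst_all[rule_format, OF this, of x 0]
  have "(D x)\<^sup>2 / bes_amp2 \<nu> x = 0" by (simp add: D_def phase_0[OF \<nu>])
  then have D0: "bes \<nu> x * cos (phase \<nu> x) = x * bes' \<nu> x * sin (phase \<nu> x)"
    using bes_amp2_pos[OF \<nu>, of x] by (simp add: D_def)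
  define E where "E = bes \<nu> x * sin (phase \<nu> x) + x * bes' \<nu> x * cos (phase \<nu> x)"
  have t: "sin (phase \<nu> x) * sin (phase \<nu> x) = 1 - cos (phase \<nu> x) * cos (phase \<nu> x)"
    using sin_squared_eq[of "phase \<nu> x"] by (simp add: power2_eq_square)
  have a: "bes \<nu> x = E * sin (phase \<nu> x)"
  proof -
    have "E * sin (phase \<nu> x) = bes \<nu> x * (sin (phase \<nu> x) * sin (phase \<nu> x)) +
       (x * bes' \<nu> x * sin (phase \<nu> x)) * cos (phase \<nu> x)" by (simp add: E_def algebra_simps)
    then show ?thesis unfolding t D0[symmetric] by (simp add: algebra_simps)
  qed
  have b: "x * bes' \<nu> x = E * cos (phase \<nu> x)"
  proof -
    have "E * cos (phase \<nu> x) = (bes \<nu> x * cos (phase \<nu> x)) * sin (phase \<nu> x) +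
       x * bes' \<nu> x * (cos (phase \<nu> x) * cos (phase \<nu> x))" by (simp add: E_def algebra_simps)
    also have "\<dots> = x * bes' \<nu> x * (sin (phase \<nu> x) * sin (phase \<nu> x)) + x * bes' \<nu> x * (cos (phase \<nu> x) * cos (phase \<nu> x))"
      unfolding D0 by (simp add: algebra_simps)
    finally show ?thesis unfolding t by (simp add: algebra_simps)
  qed
  have "E \<noteq> 0" using a b bes_amp2_pos[OF \<nu>, of x] by (auto simp: bes_amp2_def)
  then show ?thesis using a b that by blast
qed

text \<open>The derivative of the phase in terms of the phase alone; this is the Pruefer equation on which the estimates at both ends of the real line rest.\<close>

lemma phase_deriv_form:
  assumes "1 \<le> \<nu>" "x \<noteq> 0"
  shows "bes_wronskian \<nu> x / bes_amp2 \<nu> x =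
    ((cos (phase \<nu> x))\<^sup>2 + (\<nu> - 1) * cos (phase \<nu> x) * sin (phase \<nu> x) + x / 4 * (sin (phase \<nu> x))\<^sup>2) / x"
proof -
  obtain E where E: "E \<noteq> 0" "bes \<nu> x = E * sin (phase \<nu> x)" "x * bes' \<nu> x = E * cos (phase \<nu> x)"
    using bes_polar[OF assms(1)] by blast
  have "bes_amp2 \<nu> x = E\<^sup>2 * ((sin (phase \<nu> x))\<^sup>2 + (cos (phase \<nu> x))\<^sup>2)"
    unfolding bes_amp2_def E by (simp only: power_mult_distrib distrib_left)
  then have a: "bes_amp2 \<nu> x = E\<^sup>2" by simp
  have "x * bes_wronskian \<nu> x = (x * bes' \<nu> x)\<^sup>2 + (\<nu> - 1) * bes \<nu> x * (x * bes' \<nu> x) + x * (bes \<nu> x)\<^sup>2 / 4"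
    by (simp add: bes_wronskian_def power2_eq_square algebra_simps)
  also have "\<dots> = E\<^sup>2 * ((cos (phase \<nu> x))\<^sup>2 + (\<nu> - 1) * cos (phase \<nu> x) * sin (phase \<nu> x) + x / 4 * (sin (phase \<nu> x))\<^sup>2)"
    unfolding E by (simp add: power2_eq_square algebra_simps)
  finally have "bes_wronskian \<nu> x = E\<^sup>2 * ((cos (phase \<nu> x))\<^sup>2 + (\<nu> - 1) * cos (phase \<nu> x) * sin (phase \<nu> x) + x / 4 * (sin (phase \<nu> x))\<^sup>2) / x"
    using assms(2) by (simp add: field_simps)
  then show ?thesis unfolding a using E(1) by simp
qed

lemma isCont_phase: "1 \<le> \<nu> \<Longrightarrow> isCont (phase \<nu>) x"
  using phase_deriv DERIV_isCont by blast

text \<open>Otherwise the phase would vanish somewhere on the negative half-line, and with it the function \<Phi>, which is positive there.\<close>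

lemma phase_pos:
  assumes \<nu>: "1 \<le> \<nu>" shows "0 < phase \<nu> x"
proof (rule ccontr)
  assume n: "\<not> 0 < phase \<nu> x"
  have "x < 0"
    using n phase_strict_mono[OF \<nu>, of 0 x] phase_0[OF \<nu>] pi_gt_zero by (cases x "0::real" rule: linorder_cases) auto
  then obtain y where y: "x \<le> y" "y \<le> 0" "phase \<nu> y = 0"
    using IVT[of "phase \<nu>" x 0 0] n phase_0[OF \<nu>] isCont_phase[OF \<nu>] by (auto simp: not_less)
  obtain E where "bes \<nu> y = E * sin (phase \<nu> y)" using bes_polar[OF \<nu>, of y] by blast
  then show False using y bes_pos[OF \<nu>, of y] by simp
qed

text \<open>In the Pruefer equation the numerator is a quadratic form in (cos, sin). As soon as x/4 dominates the mixed term, it is at least 1/2, so that the phase grows at least like ln x / 2.\<close>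

lemma phase_unbounded:
  assumes \<nu>: "1 \<le> \<nu>" shows "\<exists>x. p < phase \<nu> x"
proof -
  \<comment> \<open>From X on, x/4 is at least (\<nu> - 1)^2 / 2 + 1/2.\<close>
  define X where "X = 2 * (\<nu> - 1)\<^sup>2 + 2"
  have X: "X \<ge> 2" by (simp add: X_def)
  have low: "phase \<nu> X - ln X / 2 \<le> phase \<nu> x - ln x / 2" if "X \<le> x" for x
  proof (rule DERIV_nonneg_imp_nondecreasing[OF that])
    fix y assume y: "X \<le> y"
    then have y0: "0 < y" using X by linarith
    let ?c = "cos (phase \<nu> y)" and ?s = "sin (phase \<nu> y)"
    have "1 / 2 * ?s\<^sup>2 + (\<nu> - 1)\<^sup>2 / 2 * ?s\<^sup>2 = ((\<nu> - 1)\<^sup>2 / 2 + 1 / 2) * ?s\<^sup>2" by (simp add: algebra_simps)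
    also have "\<dots> \<le> y / 4 * ?s\<^sup>2" using y by (intro mult_right_mono) (auto simp: X_def)
    finally have "?c\<^sup>2 + (\<nu> - 1) * ?c * ?s + y / 4 * ?s\<^sup>2 \<ge> ?c\<^sup>2 + (\<nu> - 1) * ?c * ?s + ((\<nu> - 1)\<^sup>2 / 2 * ?s\<^sup>2 + 1 / 2 * ?s\<^sup>2)"
      by linarith
    moreover have "?c\<^sup>2 + (\<nu> - 1) * ?c * ?s + ((\<nu> - 1)\<^sup>2 / 2 * ?s\<^sup>2 + 1 / 2 * ?s\<^sup>2) = (?c + (\<nu> - 1) * ?s)\<^sup>2 / 2 + (?c\<^sup>2 + ?s\<^sup>2) / 2"
      by (simp add: power2_sum power_mult_distrib add_divide_distrib)
        (use sin_cos_squared_add[of "phase \<nu> y"] in linarith)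
    moreover have "\<dots> \<ge> 1 / 2" by simp
    ultimately have "1 / 2 \<le> ?c\<^sup>2 + (\<nu> - 1) * ?c * ?s + y / 4 * ?s\<^sup>2" by linarith
    then have "1 / 2 / y \<le> bes_wronskian \<nu> y / bes_amp2 \<nu> y"
      unfolding phase_deriv_form[OF \<nu> less_imp_neq[OF y0, symmetric]] using y0
      by (intro divide_right_mono) auto
    moreover have "((\<lambda>y. phase \<nu> y - ln y / 2) has_real_derivative bes_wronskian \<nu> y / bes_amp2 \<nu> y - 1 / 2 / y) (at y)"
      using y0 by (auto intro!: derivative_eq_intros phase_deriv[OF \<nu>])
    ultimately show "\<exists>z. ((\<lambda>y. phase \<nu> y - ln y / 2) has_real_derivative z) (at y) \<and> 0 \<le> z"
      by (intro exI conjI) auto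
  qed
  define x where "x = max X (exp (2 * \<bar>p\<bar> + ln X + 1))"
  have "X \<le> x" by (simp add: x_def)
  have "ln (exp (2 * \<bar>p\<bar> + ln X + 1)) \<le> ln x" unfolding x_def by (intro ln_mono) auto
  then have "2 * \<bar>p\<bar> + ln X + 1 \<le> ln x" by simp
  with low[OF \<open>X \<le> x\<close>] phase_pos[OF \<nu>, of X] show ?thesis by (intro exI[of _ x]) linarith
qed

text \<open>If the phase stayed above p > 0, then sin^2 of the phase would stay above m^2 as x tends to -\<infinity>, where the right-hand side of the Pruefer equation is close to sin^2 / 4. So the phase would fall at least linearly and become negative.\<close>

lemma phase_small:
  assumes \<nu>: "1 \<le> \<nu>" and "0 < p" shows "\<exists>x. phase \<nu> x < p"
proof (rule ccontr)
  assume "\<not> ?thesis"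
  then have ge: "p \<le> phase \<nu> x" for x by (auto simp: not_less)
  have p2: "p \<le> pi / 2" using ge[of 0] phase_0[OF \<nu>] by simp
  define m where "m = sin p"
  have m: "0 < m" using assms(2) p2 pi_gt_zero by (auto simp: m_def intro!: sin_gt_zero)
  \<comment> \<open>To the left of -X the remaining terms, at most \<nu> / |x|, are at most m^2 / 8.\<close>
  define X where "X = 8 * \<nu> / m\<^sup>2"
  have X: "0 < X" using m \<nu> by (simp add: X_def)
  have low: "phase \<nu> x - m\<^sup>2 / 8 * x \<le> phase \<nu> (-X) - m\<^sup>2 / 8 * (-X)" if "x \<le> -X" for x
  proof (rule DERIV_nonneg_imp_nondecreasing[OF that])
    fix y assume y: "y \<le> -X"
    then have y0: "y < 0" using X by linarith
    let ?c = "cos (phase \<nu> y)" and ?s = "sin (phase \<nu> y)"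
    have "phase \<nu> y \<le> pi / 2" using phase_strict_mono[OF \<nu> y0] phase_0[OF \<nu>] by simp
    then have "m \<le> ?s" unfolding m_def using ge[of y] assms(2) by (intro sin_monotone_2pi_le) auto
    then have s: "m\<^sup>2 \<le> ?s\<^sup>2" using m by (simp add: power_mono)
    have cs: "?c\<^sup>2 + (\<nu> - 1) * ?c * ?s \<le> \<nu>"
    proof -
      have "?c\<^sup>2 \<le> 1" by (simp add: abs_square_le_1)
      moreover have "?c * ?s \<le> 1"
        using mult_mono[of "\<bar>?c\<bar>" 1 "\<bar>?s\<bar>" 1] abs_cos_le_one[of "phase \<nu> y"] abs_sin_le_one[of "phase \<nu> y"]
        by (simp add: abs_mult[symmetric])
      then have "(\<nu> - 1) * (?c * ?s) \<le> (\<nu> - 1) * 1" using \<nu> by (intro mult_left_mono) auto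
      ultimately show ?thesis by (simp add: mult.assoc)
    qed
    have "(?c\<^sup>2 + (\<nu> - 1) * ?c * ?s) / y \<ge> \<nu> / y" using cs y0 by (simp add: divide_right_mono_neg)
    moreover have "\<nu> / y \<ge> \<nu> / (- X)"
      using y y0 X \<nu> divide_left_mono_neg[of y "-X" "-\<nu>"] divide_left_mono[of X "-y" \<nu>] mult_neg_pos[OF y0 X]
      by simp
    moreover have "\<nu> / (- X) = - (m\<^sup>2 / 8)" using X m \<nu> by (simp add: X_def field_simps)
    ultimately have "(?c\<^sup>2 + (\<nu> - 1) * ?c * ?s) / y \<ge> - (m\<^sup>2 / 8)" by linarith
    moreover have "bes_wronskian \<nu> y / bes_amp2 \<nu> y = (?c\<^sup>2 + (\<nu> - 1) * ?c * ?s) / y + ?s\<^sup>2 / 4"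
      using phase_deriv_form[OF \<nu>, of y] y0 by (simp add: field_simps)
    ultimately have "m\<^sup>2 / 8 \<le> bes_wronskian \<nu> y / bes_amp2 \<nu> y" using s by linarith
    moreover have "((\<lambda>y. phase \<nu> y - m\<^sup>2 / 8 * y) has_real_derivative bes_wronskian \<nu> y / bes_amp2 \<nu> y - m\<^sup>2 / 8) (at y)"
      by (auto intro!: derivative_eq_intros phase_deriv[OF \<nu>])
    ultimately show "\<exists>z. ((\<lambda>y. phase \<nu> y - m\<^sup>2 / 8 * y) has_real_derivative z) (at y) \<and> 0 \<le> z"
      by (intro exI conjI) auto
  qed
  define x where "x = - X - 8 * phase \<nu> (-X) / m\<^sup>2"
  have pp: "0 < phase \<nu> (-X)" by (rule phase_pos[OF \<nu>])
  then have "x \<le> -X" by (simp add: x_def)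
  moreover have "m\<^sup>2 / 8 * x = m\<^sup>2 / 8 * (- X) - phase \<nu> (-X)" using m by (simp add: x_def right_diff_distrib)
  ultimately have "phase \<nu> x \<le> 0" using low[of x] by linarith
  then show False using phase_pos[OF \<nu>, of x] by simp
qed

lemma phase_surj:
  assumes \<nu>: "1 \<le> \<nu>" and "0 < p" shows "\<exists>x. phase \<nu> x = p"
proof -
  obtain a b where ab: "phase \<nu> a < p" "p < phase \<nu> b"
    using phase_small[OF assms] phase_unbounded[OF \<nu>] by blast
  then have "a < b" using phase_strict_mono[OF \<nu>, of b a] by (cases a b rule: linorder_cases) auto
  then show ?thesis using IVT[of "phase \<nu>" a p b] ab isCont_phase[OF \<nu>] by auto
qed

definition invphase :: "real \<Rightarrow> real \<Rightarrow> real" where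
  "invphase \<nu> p = (THE x. phase \<nu> x = p)"

lemma phase_eq_iff: "1 \<le> \<nu> \<Longrightarrow> phase \<nu> x = phase \<nu> y \<longleftrightarrow> x = y"
  using phase_strict_mono[of \<nu> x y] phase_strict_mono[of \<nu> y x] by (cases x y rule: linorder_cases) auto

lemma invphase_phase [simp]: "1 \<le> \<nu> \<Longrightarrow> invphase \<nu> (phase \<nu> x) = x"
  by (simp add: invphase_def phase_eq_iff)

lemma phase_invphase [simp]: "1 \<le> \<nu> \<Longrightarrow> 0 < p \<Longrightarrow> phase \<nu> (invphase \<nu> p) = p"
  using phase_surj invphase_phase by metis

lemma invphase_less:
  assumes "1 \<le> \<nu>" "0 < p" "p < q" shows "invphase \<nu> p < invphase \<nu> q"
proof (rule ccontr)
  assume "\<not> ?thesis"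
  then have "phase \<nu> (invphase \<nu> q) \<le> phase \<nu> (invphase \<nu> p)"
    using phase_strict_mono[OF assms(1), of "invphase \<nu> q" "invphase \<nu> p"] by (cases "invphase \<nu> q = invphase \<nu> p") auto
  then show False using assms by simp
qed

lemma isCont_invphase:
  assumes \<nu>: "1 \<le> \<nu>" and "0 < p" shows "isCont (invphase \<nu>) p"
proof -
  have "isCont (invphase \<nu>) (phase \<nu> (invphase \<nu> p))"
    by (rule isCont_inverse_function[of 1]) (use isCont_phase[OF \<nu>] \<nu> in auto)
  then show ?thesis using assms by simp
qed

lemma invphase_at_0: "1 \<le> \<nu> \<Longrightarrow> filterlim (invphase \<nu>) at_bot (at_right 0)"
  unfolding filterlim_at_bot
proof
  fix Z assume \<nu>: "1 \<le> \<nu>"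
  have "\<forall>\<^sub>F p in at_right 0. p \<in> {0<..<phase \<nu> Z}"
    by (rule eventually_at_right_real[OF phase_pos[OF \<nu>]])
  then show "\<forall>\<^sub>F p in at_right 0. invphase \<nu> p \<le> Z"
    by eventually_elim (use invphase_less[OF \<nu>, of _ "phase \<nu> Z"] \<nu> in fastforce)
qed

lemma invphase_at_top: "1 \<le> \<nu> \<Longrightarrow> filterlim (invphase \<nu>) at_top at_top"
  unfolding filterlim_at_top
proof
  fix Z assume \<nu>: "1 \<le> \<nu>"
  have "\<forall>\<^sub>F p in at_top. phase \<nu> Z < p" by (rule eventually_gt_at_top)
  then show "\<forall>\<^sub>F p in at_top. Z \<le> invphase \<nu> p"
    by eventually_elim (use invphase_less[OF \<nu> phase_pos[OF \<nu>], of Z] \<nu> in fastforce)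
qed

section \<open>Real analyticity and the branch curves\<close>

text \<open>Analyticity at a point as existence of a holomorphic extension to a complex disc. Closure under composition, primitives and inverse functions then comes from complex analysis; \<open>real_analytic_iff\<close> connects this with power series.\<close>

definition real_analytic_at :: "(real \<Rightarrow> real) \<Rightarrow> real \<Rightarrow> bool" where
  "real_analytic_at f x \<longleftrightarrow> (\<exists>e>0. \<exists>F. F holomorphic_on ball (complex_of_real x) e \<and>
     (\<forall>y. \<bar>y - x\<bar> < e \<longrightarrow> F (of_real y) = of_real (f y)))"

lemma of_real_in_ball: "complex_of_real y \<in> ball (of_real x) e \<longleftrightarrow> \<bar>y - x\<bar> < e"
  by (simp add: dist_norm abs_minus_commute flip: of_real_diff)

lemma real_analytic_atE:
  assumes "real_analytic_at f x" "0 < d"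
  obtains e F where "0 < e" "e \<le> d" "F holomorphic_on ball (complex_of_real x) e"
    "\<And>y. \<bar>y - x\<bar> < e \<Longrightarrow> F (of_real y) = of_real (f y)"
proof -
  obtain e F where e: "0 < e" "F holomorphic_on ball (complex_of_real x) e"
    "\<And>y. \<bar>y - x\<bar> < e \<Longrightarrow> F (of_real y) = of_real (f y)"
    using assms(1) unfolding real_analytic_at_def by blast
  show ?thesis
    by (rule that[of "min e d" F])
      (use e assms(2) holomorphic_on_subset[OF e(2), of "ball (of_real x) (min e d)"] in auto)
qed

lemma real_analytic_at_compose:
  assumes "real_analytic_at f (g x)" "real_analytic_at g x"
  shows "real_analytic_at (\<lambda>x. f (g x)) x"
proof -
  obtain e F where F: "0 < e" "F holomorphic_on ball (complex_of_real (g x)) e"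
    "\<And>y. \<bar>y - g x\<bar> < e \<Longrightarrow> F (of_real y) = of_real (f y)"
    using assms(1) unfolding real_analytic_at_def by blast
  obtain d G where G: "0 < d" "G holomorphic_on ball (complex_of_real x) d"
    "\<And>y. \<bar>y - x\<bar> < d \<Longrightarrow> G (of_real y) = of_real (g y)"
    using assms(2) unfolding real_analytic_at_def by blast
  have "isCont G (of_real x)"
    using G(1,2) holomorphic_on_imp_continuous_on continuous_on_interior by fastforce
  moreover have "G (of_real x) = of_real (g x)" using G by simp
  ultimately obtain c where c: "0 < c" "\<And>z. dist z (of_real x) < c \<Longrightarrow> dist (G z) (of_real (g x)) < e"
    using F(1) unfolding continuous_at_eps_delta by (metis dist_commute)
  define m where "m = min c d"
  have "(\<lambda>z. F (G z)) holomorphic_on ball (of_real x) m"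
  proof (rule holomorphic_on_compose_gen[unfolded o_def, of G _ F "ball (of_real (g x)) e"])
    show "G holomorphic_on ball (of_real x) m"
      by (rule holomorphic_on_subset[OF G(2)]) (auto simp: m_def)
    show "G ` ball (of_real x) m \<subseteq> ball (of_real (g x)) e"
      using c(2) by (auto simp: m_def dist_commute)
  qed (rule F)
  moreover have "F (G (of_real y)) = of_real (f (g y))" if "\<bar>y - x\<bar> < m" for y
  proof -
    have Gy: "G (of_real y) = of_real (g y)" using G(3) that by (simp add: m_def)
    have "dist (G (of_real y)) (of_real (g x)) < e"
      using c(2)[of "of_real y"] that by (simp add: m_def dist_norm flip: of_real_diff)
    then have "\<bar>g y - g x\<bar> < e" unfolding Gy by (simp add: dist_norm flip: of_real_diff)
    then show ?thesis using F(3) Gy by simp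
  qed
  moreover have "0 < m" using c G by (simp add: m_def)
  ultimately show ?thesis unfolding real_analytic_at_def by blast
qed

lemma real_analytic_at_const: "real_analytic_at (\<lambda>x. c) x"
  unfolding real_analytic_at_def by (intro exI[of _ "1::real"] conjI exI[of _ "\<lambda>_. of_real c"]) auto

lemma real_analytic_at_ident: "real_analytic_at (\<lambda>x. x) x"
  unfolding real_analytic_at_def by (intro exI[of _ "1::real"] conjI exI[of _ "\<lambda>z. z"]) auto

lemma real_analytic_at_binop:
  assumes "real_analytic_at f x" "real_analytic_at g x"
    and h: "\<And>S F G. F holomorphic_on S \<Longrightarrow> G holomorphic_on S \<Longrightarrow> (\<lambda>z. h' (F z) (G z)) holomorphic_on S"
    and eq: "\<And>a b. h' (of_real a) (of_real b) = complex_of_real (h a b)"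
  shows "real_analytic_at (\<lambda>x. h (f x) (g x)) x"
proof -
  obtain e F where F: "0 < e" "F holomorphic_on ball (complex_of_real x) e"
    "\<And>y. \<bar>y - x\<bar> < e \<Longrightarrow> F (of_real y) = of_real (f y)"
    using assms(1) unfolding real_analytic_at_def by blast
  obtain d G where G: "0 < d" "d \<le> e" "G holomorphic_on ball (complex_of_real x) d"
    "\<And>y. \<bar>y - x\<bar> < d \<Longrightarrow> G (of_real y) = of_real (g y)"
    using real_analytic_atE[OF assms(2) F(1)] by metis
  have "(\<lambda>z. h' (F z) (G z)) holomorphic_on ball (of_real x) d"
    by (rule h[OF holomorphic_on_subset[OF F(2)] G(3)]) (use G in auto)
  then show ?thesis unfolding real_analytic_at_def
    by (intro exI[of _ d] conjI exI[of _ "\<lambda>z. h' (F z) (G z)"]) (use F G eq in auto)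
qed

lemma real_analytic_at_add:
  "real_analytic_at f x \<Longrightarrow> real_analytic_at g x \<Longrightarrow> real_analytic_at (\<lambda>x. f x + g x) x"
  by (rule real_analytic_at_binop[where h = "\<lambda>a b. a + b" and h' = "\<lambda>a b. a + b"])
    (assumption | rule holomorphic_on_add | simp)+

lemma real_analytic_at_mult:
  "real_analytic_at f x \<Longrightarrow> real_analytic_at g x \<Longrightarrow> real_analytic_at (\<lambda>x. f x * g x) x"
  by (rule real_analytic_at_binop[where h = "\<lambda>a b. a * b" and h' = "\<lambda>a b. a * b"])
    (assumption | rule holomorphic_on_mult | simp)+

lemma real_analytic_at_diff:
  "real_analytic_at f x \<Longrightarrow> real_analytic_at g x \<Longrightarrow> real_analytic_at (\<lambda>x. f x - g x) x"
  by (rule real_analytic_at_binop[where h = "\<lambda>a b. a - b" and h' = "\<lambda>a b. a - b"])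
    (assumption | rule holomorphic_on_diff | simp)+

lemma real_analytic_at_inverse: "c \<noteq> 0 \<Longrightarrow> real_analytic_at inverse c"
  unfolding real_analytic_at_def
  by (intro exI[of _ "\<bar>c\<bar>"] conjI exI[of _ inverse]) (auto intro!: holomorphic_intros simp: dist_norm)

lemma real_analytic_at_divide:
  assumes "real_analytic_at f x" "real_analytic_at g x" "g x \<noteq> 0"
  shows "real_analytic_at (\<lambda>x. f x / g x) x"
  unfolding divide_inverse
  by (intro real_analytic_at_mult assms real_analytic_at_compose[of inverse, OF real_analytic_at_inverse])

text \<open>A holomorphic primitive on the disc, shifted by a constant, extends f, because both have the same derivative on the real diameter.\<close>

lemma real_analytic_at_antiderivative:
  assumes f: "\<And>x. (f has_real_derivative f' x) (at x)" and a: "real_analytic_at f' x"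
  shows "real_analytic_at f x"
proof -
  obtain e F where F: "0 < e" "F holomorphic_on ball (complex_of_real x) e"
    "\<And>y. \<bar>y - x\<bar> < e \<Longrightarrow> F (of_real y) = of_real (f' y)"
    using a unfolding real_analytic_at_def by blast
  obtain G where G: "\<And>z. z \<in> ball (of_real x) e \<Longrightarrow> (G has_field_derivative F z) (at z within ball (of_real x) e)"
    using holomorphic_convex_primitive'[OF convex_ball open_ball F(2)] by metis
  have G': "(G has_field_derivative F z) (at z)" if "z \<in> ball (of_real x) e" for z
    using G[OF that] that by (simp add: at_within_open[of _ "ball (of_real x) e"])
  define H where "H = (\<lambda>z. G z - G (of_real x) + of_real (f x))"
  have "(H has_field_derivative F z) (at z)" if "z \<in> ball (of_real x) e" for z
    unfolding H_def using G'[OF that] by (auto intro!: derivative_eq_intros)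
  then have "H holomorphic_on ball (of_real x) e"
    unfolding holomorphic_on_open[OF open_ball] by blast
  moreover have "H (of_real y) = of_real (f y)" if y: "\<bar>y - x\<bar> < e" for y
  proof -
    have "((\<lambda>y. G (of_real y) - of_real (f y)) has_vector_derivative 0) (at y within ball x e)" if "y \<in> ball x e" for y
    proof -
      have y: "\<bar>y - x\<bar> < e" using that by (simp add: dist_real_def abs_minus_commute)
      have "((\<lambda>y. G (of_real y)) has_vector_derivative F (of_real y)) (at y within ball x e)"
        by (rule has_vector_derivative_real_field) (use G' y of_real_in_ball in blast)
      moreover have "((\<lambda>y. complex_of_real (f y)) has_vector_derivative of_real (f' y)) (at y within ball x e)"
        by (rule has_vector_derivative_of_real) (rule f[THEN has_field_derivative_at_within])
      ultimately have "((\<lambda>y. G (of_real y) - of_real (f y)) has_vector_derivative F (of_real y) - of_real (f' y)) (at y within ball x e)"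
        by (rule has_vector_derivative_diff)
      then show ?thesis using F(3)[OF y] by simp
    qed
    then obtain c where c: "\<And>y. y \<in> ball x e \<Longrightarrow> G (of_real y) - of_real (f y) = c"
      by (rule has_vector_derivative_zero_constant[OF convex_ball]) (assumption, rule that)
    have "x \<in> ball x e" "y \<in> ball x e" using F(1) y by (auto simp: dist_real_def abs_minus_commute)
    then have "G (of_real y) - of_real (f y) = G (of_real x) - of_real (f x)" using c by metis
    then show ?thesis by (simp add: H_def algebra_simps)
  qed
  ultimately show ?thesis using F(1) unfolding real_analytic_at_def by blast
qed

text \<open>The holomorphic extension of f is locally injective, and continuity of g places its values in the region of injectivity, so that the local holomorphic inverse extends g.\<close>

lemma real_analytic_at_inverse_function:
  assumes a: "real_analytic_at f x" and d: "(f has_real_derivative d) (at x)" "d \<noteq> 0"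
    and g: "isCont g (f x)" "g (f x) = x" "\<forall>\<^sub>F y in nhds (f x). f (g y) = y"
  shows "real_analytic_at g (f x)"
proof -
  obtain e F where F: "0 < e" "F holomorphic_on ball (complex_of_real x) e"
    "\<And>y. \<bar>y - x\<bar> < e \<Longrightarrow> F (of_real y) = of_real (f y)"
    using a unfolding real_analytic_at_def by blast
  have xb: "of_real x \<in> ball (complex_of_real x) e" using F(1) by simp
  have dF: "(F has_field_derivative deriv F (of_real x)) (at (of_real x))"
    using holomorphic_derivI[OF F(2) open_ball xb] .
  have "((\<lambda>y. F (of_real y)) has_vector_derivative deriv F (of_real x)) (at x)"
    by (rule has_vector_derivative_real_field[OF dF])
  then have "((\<lambda>y. complex_of_real (f y)) has_vector_derivative deriv F (of_real x)) (at x)"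
    by (rule has_vector_derivative_transform_within_open[where S = "ball x e"])
      (use F in \<open>auto simp: dist_real_def abs_minus_commute\<close>)
  moreover have "((\<lambda>y. complex_of_real (f y)) has_vector_derivative of_real d) (at x)"
    by (rule has_vector_derivative_of_real[OF d(1)])
  ultimately have "deriv F (of_real x) \<noteq> 0"
    using vector_derivative_unique_at d(2) by fastforce
  from has_complex_derivative_locally_invertible[OF F(2) xb open_ball this]
  obtain r where r: "r > 0" "ball (of_real x) r \<subseteq> ball (complex_of_real x) e" "open (F ` ball (of_real x) r)"
    "inj_on F (ball (of_real x) r)" by metis
  have Fr: "F holomorphic_on ball (of_real x) r" using holomorphic_on_subset[OF F(2) r(2)] .
  obtain G where G: "G holomorphic_on F ` ball (of_real x) r" "\<And>z. z \<in> ball (of_real x) r \<Longrightarrow> G (F z) = z"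
    using holomorphic_has_inverse[OF Fr open_ball r(4)] by metis
  have "of_real (f x) \<in> F ` ball (of_real x) r"
    using F(3)[of x] F(1) r(1) by (intro image_eqI[of _ _ "of_real x"]) auto
  then obtain e2 where e2: "0 < e2" "ball (of_real (f x)) e2 \<subseteq> F ` ball (of_real x) r"
    using r(3) open_contains_ball by blast
  obtain e3 where e3: "0 < e3" "\<And>y. \<bar>y - f x\<bar> < e3 \<Longrightarrow> f (g y) = y"
    using g(3) unfolding eventually_nhds_metric by (auto simp: dist_real_def)
  obtain e4 where e4: "0 < e4" "\<And>y. \<bar>y - f x\<bar> < e4 \<Longrightarrow> \<bar>g y - x\<bar> < r"
    using g(1,2) r(1) unfolding continuous_at_eps_delta by (metis dist_real_def)
  define m where "m = min e2 (min e3 e4)"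
  have "G (of_real y) = of_real (g y)" if y: "\<bar>y - f x\<bar> < m" for y
  proof -
    have gy: "\<bar>g y - x\<bar> < r" "f (g y) = y" using e3 e4 y by (auto simp: m_def)
    then have b: "of_real (g y) \<in> ball (complex_of_real x) r" by (simp only: of_real_in_ball)
    then have "\<bar>g y - x\<bar> < e" using r(2) of_real_in_ball by blast
    then have "F (of_real (g y)) = of_real y" using F(3) gy by simp
    then show ?thesis using G(2)[OF b] by simp
  qed
  moreover have "G holomorphic_on ball (of_real (f x)) m"
    by (rule holomorphic_on_subset[OF G(1)]) (use e2 in \<open>auto simp: m_def\<close>)
  moreover have "0 < m" using e2 e3 e4 by (simp add: m_def)
  ultimately show ?thesis unfolding real_analytic_at_def by blast
qed

lemma powser_holomorphic:
  assumes "\<And>x::real. \<bar>x\<bar> < K \<Longrightarrow> summable (\<lambda>n. c n * x ^ n)"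
  shows "(\<lambda>z. \<Sum>n. complex_of_real (c n) * z ^ n) holomorphic_on ball 0 K"
proof -
  have s: "summable (\<lambda>n. complex_of_real (c n) * z ^ n)" if "norm z < K" for z
  proof -
    from dense[OF that] obtain r where r: "norm z < r" "r < K" by blast
    then have r0: "0 < r" using norm_ge_zero[of z] by linarith
    have "summable (\<lambda>n. complex_of_real (c n * r ^ n))"
      using assms[of r] r r0 by (intro summable_of_real) auto
    then have "summable (\<lambda>n. complex_of_real (c n) * of_real r ^ n)" by simp
    then show ?thesis by (rule powser_inside) (use r r0 in simp)
  qed
  show ?thesis
    unfolding holomorphic_on_open[OF open_ball]
  proof
    fix z :: complex assume "z \<in> ball 0 K"
    then have "norm z < K" by simp
    from termdiffs_strong'[of K "\<lambda>n. complex_of_real (c n)", OF s this]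
    show "\<exists>f'. ((\<lambda>z. \<Sum>n. complex_of_real (c n) * z ^ n) has_field_derivative f') (at z)" by blast
  qed
qed

lemma real_analytic_at_psum:
  assumes "entire_coeffs c" shows "real_analytic_at (psum c) x"
  unfolding real_analytic_at_def
proof (intro exI conjI allI impI)
  have "(\<lambda>z. \<Sum>n. complex_of_real (c n) * z ^ n) holomorphic_on ball 0 (\<bar>x\<bar> + 1)"
    by (rule powser_holomorphic) (rule entire_coeffsD[OF assms])
  then show "(\<lambda>z. \<Sum>n. complex_of_real (c n) * z ^ n) holomorphic_on ball (of_real x) 1"
  proof (rule holomorphic_on_subset)
    have "norm z < \<bar>x\<bar> + 1" if "norm (z - of_real x) < 1" for z :: complex
      using norm_triangle_sub[of z "of_real x"] that by simp
    then show "ball (complex_of_real x) 1 \<subseteq> ball 0 (\<bar>x\<bar> + 1)"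
      by (auto simp: dist_norm norm_minus_commute)
  qed
  show "(\<Sum>n. complex_of_real (c n) * of_real y ^ n) = of_real (psum c y)" for y
    using suminf_of_real[OF entire_coeffsD[OF assms, of y], where 'a = complex] by (simp add: psum_def)
qed auto

lemma real_analytic_iff: "real_analytic f \<longleftrightarrow> (\<forall>x. real_analytic_at f x)"
proof
  assume f: "real_analytic f"
  show "\<forall>x. real_analytic_at f x"
  proof
    fix x
    obtain r a where r: "0 < r" "\<And>y. \<bar>y - x\<bar> < r \<Longrightarrow> (\<lambda>n. a n * (y - x) ^ n) sums f y"
      using f unfolding real_analytic_def by blast
    have "(\<lambda>z. \<Sum>n. complex_of_real (a n) * z ^ n) holomorphic_on ball 0 r"
      by (rule powser_holomorphic) (use r(2)[of "x + _"] sums_summable in force)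
    then have "((\<lambda>z. \<Sum>n. complex_of_real (a n) * z ^ n) \<circ> (\<lambda>z. z - of_real x)) holomorphic_on ball (of_real x) r"
      by (intro holomorphic_on_compose_gen[of _ _ _ "ball 0 r"] holomorphic_intros)
        (auto simp: dist_norm norm_minus_commute)
    moreover have "(\<Sum>n. complex_of_real (a n) * (of_real y - of_real x) ^ n) = of_real (f y)" if "\<bar>y - x\<bar> < r" for y
      using suminf_of_real[OF sums_summable[OF r(2)[OF that]], where 'a = complex] sums_unique[OF r(2)[OF that]]
      by simp
    ultimately show "real_analytic_at f x" using r(1) unfolding real_analytic_at_def by (auto simp: o_def)
  qed
next
  assume f: "\<forall>x. real_analytic_at f x"
  show "real_analytic f" unfolding real_analytic_def
  proof
    fix x
    obtain e F where F: "0 < e" "F holomorphic_on ball (complex_of_real x) e"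
      "\<And>y. \<bar>y - x\<bar> < e \<Longrightarrow> F (of_real y) = of_real (f y)"
      using f unfolding real_analytic_at_def by blast
    define c where "c = (\<lambda>n. (deriv ^^ n) F (of_real x) / fact n)"
    have "(\<lambda>n. Re (c n) * (y - x) ^ n) sums f y" if y: "\<bar>y - x\<bar> < e" for y
    proof -
      have "(\<lambda>n. c n * (of_real y - of_real x) ^ n) sums F (of_real y)"
        unfolding c_def by (rule holomorphic_power_series[OF F(2)]) (use y of_real_in_ball in blast)
      then have "(\<lambda>n. Re (c n * (of_real y - of_real x) ^ n)) sums Re (F (of_real y))"
        by (rule sums_Re)
      moreover have "Re (c n * (of_real y - of_real x) ^ n) = Re (c n) * (y - x) ^ n" for n
        by (simp flip: of_real_diff of_real_power)
      ultimately show ?thesis using F(3)[OF y] by simp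
    qed
    then show "\<exists>r>0. \<exists>a. \<forall>y. \<bar>y - x\<bar> < r \<longrightarrow> (\<lambda>n. a n * (y - x) ^ n) sums f y"
      using F(1) by (intro exI[of _ e] conjI exI[of _ "\<lambda>n. Re (c n)"]) auto
  qed
qed

text \<open>An uncountable set of reals has a limit point. The set T of points near which both functions agree is open, contains all limit points of the zeros of the difference, and is therefore closed.\<close>

lemma real_analytic_eqI:
  assumes "real_analytic f" "real_analytic g" and unc: "uncountable {x. f x = g x}"
  shows "f = g"
proof -
  define d where "d = (\<lambda>x. f x - g x)"
  have da: "real_analytic_at d x" for x
    unfolding d_def using assms(1,2) by (intro real_analytic_at_diff) (auto simp: real_analytic_iff)
  define Z where "Z = {x. d x = 0}"
  define T where "T = {x. \<exists>e>0. \<forall>y. \<bar>y - x\<bar> < e \<longrightarrow> d y = 0}"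
  have L: "x \<in> T" if x: "x islimpt Z" for x
  proof -
    obtain e F where F: "0 < e" "F holomorphic_on ball (complex_of_real x) e"
      "\<And>y. \<bar>y - x\<bar> < e \<Longrightarrow> F (of_real y) = of_real (d y)"
      using da[of x] unfolding real_analytic_at_def by blast
    define U where "U = complex_of_real ` {y. \<bar>y - x\<bar> < e \<and> d y = 0}"
    have lim: "complex_of_real x islimpt U"
      unfolding islimpt_approachable
    proof (intro allI impI)
      fix \<delta> :: real assume "0 < \<delta>"
      then obtain y where y: "y \<in> Z" "y \<noteq> x" "dist y x < min \<delta> e"
        using x F(1) unfolding islimpt_approachable by (metis min_less_iff_conj)
      then have "of_real y \<in> U" by (auto simp: U_def Z_def dist_real_def)
      with y show "\<exists>x'\<in>U. x' \<noteq> complex_of_real x \<and> dist x' (of_real x) < \<delta>"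
        by (intro bexI[of _ "of_real y"]) auto
    qed
    have "F w = 0" if "w \<in> ball (of_real x) e" for w
    proof (rule analytic_continuation[OF F(2) open_ball connected_ball _ _ lim _ that])
      show "U \<subseteq> ball (of_real x) e" using of_real_in_ball by (auto simp only: U_def)
      show "of_real x \<in> ball (complex_of_real x) e" using F(1) by simp
      show "F z = 0" if "z \<in> U" for z using that F(3) by (auto simp: U_def)
    qed
    then have "d y = 0" if "\<bar>y - x\<bar> < e" for y
      using F(3)[OF that] that of_real_in_ball by (metis of_real_eq_0_iff)
    then show ?thesis using F(1) by (auto simp: T_def)
  qed
  have TZ: "T \<subseteq> Z" unfolding T_def Z_def by force
  have "open T"
    unfolding open_dist
  proof
    fix x assume "x \<in> T"
    then obtain e where e: "0 < e" "\<And>y. \<bar>y - x\<bar> < e \<Longrightarrow> d y = 0" by (auto simp: T_def)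
    have "y \<in> T" if "dist y x < e / 2" for y
    proof -
      have "d z = 0" if "\<bar>z - y\<bar> < e / 2" for z
        by (rule e(2)) (use that \<open>dist y x < e / 2\<close> in \<open>auto simp: dist_real_def abs_if split: if_splits\<close>)
      then show ?thesis unfolding T_def using e(1) by (auto intro!: exI[of _ "e/2"])
    qed
    then show "\<exists>e>0. \<forall>y. dist y x < e \<longrightarrow> y \<in> T" using e(1) by (intro exI[of _ "e/2"]) auto
  qed
  moreover have "closed T"
    unfolding closed_limpt using L TZ islimpt_subset by blast
  moreover have "T \<noteq> {}"
  proof -
    have "Z = (\<Union>n. Z \<inter> {- real n..real n})"
    proof -
      have "\<exists>n. x \<in> {- real n..real n}" for x :: real
      proof -
        obtain n where "\<bar>x\<bar> \<le> real n" using real_arch_simple by blast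
        then show ?thesis by (intro exI[of _ n]) auto
      qed
      then show ?thesis by blast
    qed
    moreover have "uncountable Z" using unc by (simp add: Z_def d_def)
    moreover have "countable (\<Union>n. Z \<inter> {- real n..real n})" if "\<And>n. countable (Z \<inter> {- real n..real n})"
      using that by (intro countable_UN) auto
    ultimately obtain n where "uncountable (Z \<inter> {- real n..real n})" by auto
    then have "infinite (Z \<inter> {- real n..real n})" using uncountable_infinite by blast
    then obtain x where "x islimpt (Z \<inter> {- real n..real n})"
      using compact_Icc[of "- real n" "real n"] unfolding compact_eq_Bolzano_Weierstrass by (metis inf_le2)
    then have "x islimpt Z" using islimpt_subset by blast
    then show ?thesis using L by blast
  qed
  ultimately have "T = UNIV" using clopen by blast
  then have "d x = 0" for x using TZ by (auto simp: Z_def)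
  then show ?thesis by (auto simp: d_def)
qed

lemma real_analytic_at_phase:
  assumes \<nu>: "1 \<le> \<nu>" shows "real_analytic_at (phase \<nu>) x"
proof -
  have b: "real_analytic_at (bes \<nu>) x" "real_analytic_at (bes' \<nu>) x" for x
    unfolding bes_def bes'_def
    by (intro real_analytic_at_psum entire_coeffs_diffs entire_bessel_coeff1 \<nu>)+
  show ?thesis
  proof (rule real_analytic_at_antiderivative[OF phase_deriv[OF \<nu>]])
    show "real_analytic_at (\<lambda>x. bes_wronskian \<nu> x / bes_amp2 \<nu> x) x"
      unfolding bes_wronskian_def bes_amp2_def power2_eq_square
      using bes_amp2_pos[OF \<nu>, of x]
      by (intro real_analytic_at_divide real_analytic_at_add real_analytic_at_mult
          real_analytic_at_ident real_analytic_at_const b) (auto simp: bes_amp2_def power2_eq_square)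
  qed
qed

lemma invphase_analytic:
  assumes \<nu>: "1 \<le> \<nu>" and p: "0 < p"
  shows "real_analytic_at (invphase \<nu>) p"
    and "\<exists>d>0. (invphase \<nu> has_real_derivative d) (at p)"
proof -
  let ?x = "invphase \<nu> p"
  define d where "d = bes_wronskian \<nu> ?x / bes_amp2 \<nu> ?x"
  have d: "0 < d" unfolding d_def using bes_wronskian_pos[OF \<nu>] bes_amp2_pos[OF \<nu>] by simp
  have D: "(phase \<nu> has_real_derivative d) (at ?x)" unfolding d_def by (rule phase_deriv[OF \<nu>])
  have px: "phase \<nu> ?x = p" using assms by simp
  have "real_analytic_at (invphase \<nu>) (phase \<nu> ?x)"
  proof (rule real_analytic_at_inverse_function[of "phase \<nu>" ?x d, OF real_analytic_at_phase[OF \<nu>] D])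
    show "d \<noteq> 0" using d by simp
    show "isCont (invphase \<nu>) (phase \<nu> ?x)" unfolding px by (rule isCont_invphase[OF assms])
    show "\<forall>\<^sub>F y in nhds (phase \<nu> ?x). phase \<nu> (invphase \<nu> y) = y"
      unfolding px using eventually_nhds_in_open[of "{0<..}" p] p \<nu>
      by (auto elim!: eventually_mono)
  qed (use \<nu> in simp)
  then show "real_analytic_at (invphase \<nu>) p" unfolding px .
  have "(invphase \<nu> has_real_derivative inverse d) (at p)"
    by (rule DERIV_inverse_function[where f = "phase \<nu>" and g = "invphase \<nu>" and x = p and a = 0 and b = "p + 1", OF D])
      (use p \<nu> d isCont_invphase[OF assms] in auto)
  then show "\<exists>d>0. (invphase \<nu> has_real_derivative d) (at p)" using d by (meson positive_imp_inverse_positive)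
qed

text \<open>A branch curve is parametrised by the phase p of the first radial solution at the boundary; the second one has phase p + s. The curves that occur have s = t \<pi> for an integer t.\<close>

definition branch_alpha :: "real \<Rightarrow> real \<Rightarrow> real \<Rightarrow> real \<Rightarrow> real" where
  "branch_alpha \<nu> R s p = invphase \<nu> p / R\<^sup>2 + invphase \<nu> (p + s) / R\<^sup>2"

definition branch_lambda :: "real \<Rightarrow> real \<Rightarrow> real \<Rightarrow> real \<Rightarrow> real" where
  "branch_lambda \<nu> R s p = - (invphase \<nu> p / R\<^sup>2 * (invphase \<nu> (p + s) / R\<^sup>2))"

lemma branch_alpha_less:
  assumes "1 \<le> \<nu>" "0 < R" "0 \<le> s" "0 < p" "p < q"
  shows "branch_alpha \<nu> R s p < branch_alpha \<nu> R s q"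
  unfolding branch_alpha_def using assms invphase_less[of \<nu> p q] invphase_less[of \<nu> "p + s" "q + s"]
  by (intro add_strict_mono divide_strict_right_mono) auto

lemma isCont_branch_alpha:
  assumes "1 \<le> \<nu>" "0 \<le> s" "0 < p" shows "isCont (branch_alpha \<nu> R s) p"
proof -
  have "isCont (\<lambda>p. invphase \<nu> (p + s)) p"
    by (rule isCont_o2[OF _ isCont_invphase]) (use assms in auto)
  then show ?thesis unfolding branch_alpha_def divide_inverse
    using assms by (intro continuous_intros isCont_invphase) auto
qed

text \<open>As p tends to 0 the first summand tends to -\<infinity> while the second one stays bounded; as p tends to \<infinity> both become large.\<close>

lemma branch_alpha_surj:
  assumes \<nu>: "1 \<le> \<nu>" and R: "0 < R" and s: "0 < s"
  shows "\<exists>p>0. branch_alpha \<nu> R s p = \<alpha>"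
proof -
  have R2: "0 < inverse (R\<^sup>2)" using R by simp
  have "filterlim (\<lambda>p. invphase \<nu> (p + s) * inverse (R\<^sup>2) + invphase \<nu> p * inverse (R\<^sup>2)) at_bot (at_right 0)"
  proof (rule filterlim_tendsto_add_at_bot_iff[THEN iffD2])
    have "isCont (\<lambda>p. invphase \<nu> (p + s) * inverse (R\<^sup>2)) 0"
      using isCont_o2[of 0 "\<lambda>p. p + s", OF _ isCont_invphase[OF \<nu>]] s by (intro continuous_intros) auto
    then show "((\<lambda>p. invphase \<nu> (p + s) * inverse (R\<^sup>2)) \<longlongrightarrow> invphase \<nu> (0 + s) * inverse (R\<^sup>2)) (at_right 0)"
      unfolding isCont_def by (rule tendsto_mono[rotated]) (simp add: at_le)
    show "filterlim (\<lambda>p. invphase \<nu> p * inverse (R\<^sup>2)) at_bot (at_right 0)"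
      using filterlim_tendsto_pos_mult_at_bot[OF tendsto_const R2 invphase_at_0[OF \<nu>]] by (simp add: mult.commute)
  qed
  then have "\<forall>\<^sub>F p in at_right 0. branch_alpha \<nu> R s p \<le> \<alpha>"
    unfolding filterlim_at_bot branch_alpha_def by (simp add: divide_inverse add.commute)
  moreover have "\<forall>\<^sub>F p in at_right (0::real). 0 < p" by (rule eventually_at_right_less)
  ultimately obtain p where p: "0 < p" "branch_alpha \<nu> R s p \<le> \<alpha>"
    using eventually_happens[OF eventually_conj] trivial_limit_at_right_real by blast
  have "filterlim (\<lambda>p. inverse (R\<^sup>2) * invphase \<nu> p) at_top at_top"
    by (rule filterlim_tendsto_pos_mult_at_top[OF tendsto_const R2 invphase_at_top[OF \<nu>]])
  then have "\<forall>\<^sub>F q in at_top. \<bar>\<alpha>\<bar> \<le> inverse (R\<^sup>2) * invphase \<nu> q \<and> p < q"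
    unfolding filterlim_at_top by (intro eventually_conj eventually_gt_at_top) auto
  then obtain q where q: "p < q" "\<bar>\<alpha>\<bar> \<le> inverse (R\<^sup>2) * invphase \<nu> q"
    using eventually_happens[of _ at_top] trivial_limit_at_top_linorder by blast
  have "invphase \<nu> q < invphase \<nu> (q + s)" using invphase_less[OF \<nu>, of q "q + s"] p q s by simp
  then have "inverse (R\<^sup>2) * invphase \<nu> q < inverse (R\<^sup>2) * invphase \<nu> (q + s)" using R2 by (rule mult_strict_left_mono)
  then have "\<alpha> \<le> branch_alpha \<nu> R s q"
    unfolding branch_alpha_def using q by (simp add: divide_inverse mult.commute)
  then obtain x where "p \<le> x" "x \<le> q" "branch_alpha \<nu> R s x = \<alpha>"
    using IVT[of "branch_alpha \<nu> R s" p \<alpha> q] p q s isCont_branch_alpha[OF \<nu>] by force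
  then show ?thesis using p by (intro exI[of _ x]) auto
qed

text \<open>The parameter p is an analytic function of \<alpha>, since \<alpha> is an analytic function of p with positive derivative that takes every real value.\<close>

lemma branch_function:
  assumes \<nu>: "1 \<le> \<nu>" and R: "0 < R" and s: "0 < s"
  obtains \<Lambda> where "real_analytic \<Lambda>"
    "{(\<alpha>, \<Lambda> \<alpha>) | \<alpha>. True} = {(branch_alpha \<nu> R s p, branch_lambda \<nu> R s p) | p. 0 < p}"
proof -
  let ?a = "branch_alpha \<nu> R s"
  have inj: "p = q" if "0 < p" "0 < q" "?a p = ?a q" for p q
    using branch_alpha_less[OF \<nu> R, of s p q] branch_alpha_less[OF \<nu> R, of s q p] s that
    by (cases p q rule: linorder_cases) auto
  define g where "g = (\<lambda>\<alpha>. THE p. 0 < p \<and> ?a p = \<alpha>)"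
  have ga: "g (?a p) = p" if "0 < p" for p
    unfolding g_def using inj that by (intro the_equality) auto
  have ag: "0 < g \<alpha> \<and> ?a (g \<alpha>) = \<alpha>" for \<alpha>
    using branch_alpha_surj[OF \<nu> R s, of \<alpha>] ga by auto
  have sh: "real_analytic_at (\<lambda>p. invphase \<nu> (p + s)) p" if "0 < p" for p
    by (rule real_analytic_at_compose[where f = "invphase \<nu>" and g = "\<lambda>p. p + s",
          OF invphase_analytic(1)[OF \<nu>] real_analytic_at_add[OF real_analytic_at_ident real_analytic_at_const]])
      (use that s in simp)
  have an: "real_analytic_at ?a p" if "0 < p" for p
    unfolding branch_alpha_def using that R
    by (intro real_analytic_at_add real_analytic_at_divide sh invphase_analytic[OF \<nu>] real_analytic_at_const) auto
  have gan: "real_analytic_at g \<alpha>" for \<alpha>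
  proof -
    let ?p = "g \<alpha>"
    have p: "0 < ?p" "?a ?p = \<alpha>" using ag by auto
    obtain d1 where d1: "0 < d1" "(invphase \<nu> has_real_derivative d1) (at ?p)"
      using invphase_analytic(2)[OF \<nu> p(1)] by blast
    obtain d2 where d2: "0 < d2" "(invphase \<nu> has_real_derivative d2) (at (?p + s))"
      using invphase_analytic(2)[OF \<nu>, of "?p + s"] p(1) s by auto
    have d2': "((\<lambda>p. invphase \<nu> (p + s)) has_real_derivative d2) (at ?p)"
      using DERIV_shift[of "invphase \<nu>" d2 ?p s] d2(2) by simp
    have D: "(?a has_real_derivative (d1 + d2) / R\<^sup>2) (at ?p)"
      unfolding branch_alpha_def
      unfolding add_divide_distrib
      by (intro DERIV_add DERIV_cdivide d1(2) d2')
    have "isCont g (?a ?p)"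
    proof (rule isCont_inverse_function[where d = "?p / 2" and x = ?p and f = ?a and g = g])
      show "g (?a z) = z" "isCont ?a z" if "\<bar>z - ?p\<bar> \<le> ?p / 2" for z
      proof -
        have "0 < z" using that p(1) by linarith
        then show "g (?a z) = z" "isCont ?a z" using ga isCont_branch_alpha[OF \<nu>] s by auto
      qed
    qed (use p in simp)
    then have "real_analytic_at g (?a ?p)"
      by (intro real_analytic_at_inverse_function[OF an[OF p(1)] D])
        (use d1 d2 R p ag in \<open>auto simp: field_simps\<close>)
    then show ?thesis using p by simp
  qed
  define \<Lambda> where "\<Lambda> = (\<lambda>\<alpha>. branch_lambda \<nu> R s (g \<alpha>))"
  have "real_analytic_at \<Lambda> \<alpha>" for \<alpha>
    unfolding \<Lambda>_def
  proof (rule real_analytic_at_compose[OF _ gan])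
    have "real_analytic_at (\<lambda>p. (-1) * (invphase \<nu> p / R\<^sup>2 * (invphase \<nu> (p + s) / R\<^sup>2))) (g \<alpha>)"
      using ag R by (intro real_analytic_at_mult real_analytic_at_divide sh invphase_analytic[OF \<nu>] real_analytic_at_const) auto
    then show "real_analytic_at (branch_lambda \<nu> R s) (g \<alpha>)" by (simp add: branch_lambda_def[abs_def])
  qed
  then have "real_analytic \<Lambda>" by (simp add: real_analytic_iff)
  moreover have "{(\<alpha>, \<Lambda> \<alpha>) | \<alpha>. True} = {(?a p, branch_lambda \<nu> R s p) | p. 0 < p}"
    unfolding \<Lambda>_def using ag ga by force
  ultimately show ?thesis using that by blast
qed

section \<open>Regularity up to the boundary and normal derivatives\<close>

lemma C1_cball_if_C_on:
  fixes w :: "'a::euclidean_space \<Rightarrow> real"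
  assumes "C_on 1 w UNIV" shows "C1_cball R w"
  unfolding C1_cball_def
proof (intro exI conjI ballI)
  let ?G = "\<lambda>x. \<Sum>b\<in>Basis. partial b w x *\<^sub>R b"
  have w: "C_on (Suc 0) w UNIV" using assms by simp
  have "continuous_on UNIV (partial b w)" if "b \<in> Basis" for b
    using w that by simp
  then show "continuous_on (cball 0 R) ?G"
    by (intro continuous_on_sum continuous_on_scaleR continuous_on_const) (auto intro: continuous_on_subset)
  fix x :: 'a
  have "?G x \<bullet> h = (\<Sum>b\<in>Basis. (h \<bullet> b) * partial b w x)" for h
    by (simp add: inner_sum_left) (rule sum.cong, auto simp: inner_commute)
  moreover have "w differentiable (at x)" using C_on_differentiable_at[OF w] by simp
  ultimately show "(w has_derivative (\<lambda>h. ?G x \<bullet> h)) (at x within cball 0 R)"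
    using has_derivative_at_withinI[OF has_derivative_partials] by simp
qed

lemma C1_cball_cong:
  assumes "\<And>x. x \<in> cball 0 R \<Longrightarrow> u x = v x"
  shows "C1_cball R u \<longleftrightarrow> C1_cball R v"
proof -
  have "(u has_derivative D) (at x within cball 0 R) \<longleftrightarrow> (v has_derivative D) (at x within cball 0 R)"
    if "x \<in> cball 0 R" for x D
    using has_derivative_transform[OF that, of u v D] has_derivative_transform[OF that, of v u D] assms by metis
  then show ?thesis unfolding C1_cball_def by metis
qed

lemma C1_cball_continuous: "C1_cball R u \<Longrightarrow> continuous_on (cball 0 R) u"
  unfolding C1_cball_def continuous_on_eq_continuous_within using has_derivative_continuous by blast

lemma has_normal_derivative_cong:
  fixes u v :: "'a::euclidean_space \<Rightarrow> real"
  assumes R: "0 < R" and x: "norm x = R" and eq: "\<And>y. y \<in> cball 0 R \<Longrightarrow> u y = v y"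
  shows "has_normal_derivative R u x d \<longleftrightarrow> has_normal_derivative R v x d"
  unfolding has_normal_derivative_def
proof (rule has_field_derivative_cong_eventually)
  have "eventually (\<lambda>t. t \<in> {-R<..<0}) (at_left (0::real))"
    by (rule eventually_at_left_real) (use R in simp)
  then show "\<forall>\<^sub>F t in at_left 0. u (x + t *\<^sub>R (x /\<^sub>R R)) = v (x + t *\<^sub>R (x /\<^sub>R R))"
  proof eventually_elim
    case (elim t)
    have "x + t *\<^sub>R (x /\<^sub>R R) = (1 + t / R) *\<^sub>R x" by (simp add: scaleR_left_distrib divide_inverse)
    moreover have "norm ((1 + t / R) *\<^sub>R x) \<le> R"
    proof -
      have "\<bar>1 + t / R\<bar> \<le> 1" using elim R by (auto simp: abs_le_iff field_simps)
      then show ?thesis using x R by (simp add: mult_left_le_one_le)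
    qed
    ultimately show ?case using eq by simp
  qed
qed (use eq x in simp)

lemma has_normal_derivative_unique:
  "has_normal_derivative R u x d \<Longrightarrow> has_normal_derivative R u x d' \<Longrightarrow> d = d'"
  unfolding has_normal_derivative_def has_real_derivative_iff_has_vector_derivative
  by (rule vector_derivative_unique_within) auto

lemma eq_on_cball:
  fixes u v :: "'a::euclidean_space \<Rightarrow> real"
  assumes "0 < R" "continuous_on (cball 0 R) u" "continuous_on (cball 0 R) v"
    "\<And>x. x \<in> ball 0 R \<Longrightarrow> u x = v x" "x \<in> cball 0 R"
  shows "u x = v x"
proof -
  have "(\<lambda>x. u x - v x) x = 0"
    by (rule continuous_constant_on_closure[of "ball 0 R"])
      (use assms in \<open>auto intro!: continuous_intros\<close>)
  then show ?thesis by simp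
qed

lemma plate_eigenfunction_cong:
  fixes u v :: "'a::euclidean_space \<Rightarrow> real"
  assumes R: "0 < R" and eq: "\<And>y. y \<in> cball 0 R \<Longrightarrow> u y = v y" and u: "plate_eigenfunction R \<alpha> \<mu> u"
  shows "plate_eigenfunction R \<alpha> \<mu> v"
proof -
  have b: "u y = v y" if "y \<in> ball 0 R" for y using eq that by auto
  have l: "laplacian u y = laplacian v y" if "y \<in> ball 0 R" for y
    by (rule laplacian_cong_open[OF open_ball that b])
  have ll: "laplacian (laplacian u) y = laplacian (laplacian v) y" if "y \<in> ball 0 R" for y
    by (rule laplacian_cong_open[OF open_ball that l])
  have "C_on 4 v (ball 0 R)"
  proof -
    have "C_on 4 u (ball 0 R)" using u by (auto simp: plate_eigenfunction_def)
    then show ?thesis using C_on_cong[OF open_ball, where u = u and v = v and n = 4] b by blast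
  qed
  moreover have "C1_cball R v" using u C1_cball_cong[of R u v] eq by (auto simp: plate_eigenfunction_def)
  moreover have "has_normal_derivative R v x 0" if "x \<in> sphere 0 R" for x
  proof -
    have "norm x = R" "has_normal_derivative R u x 0" using that u by (auto simp: plate_eigenfunction_def)
    then show ?thesis using has_normal_derivative_cong[OF R, where u = u and v = v and x = x] eq by blast
  qed
  moreover have "v x = 0" if "x \<in> sphere 0 R" for x
    using eq[of x] that u by (auto simp: plate_eigenfunction_def)
  ultimately show ?thesis using u b l ll unfolding plate_eigenfunction_def by metis
qed

section \<open>Harmonic polynomials times radial power series\<close>

context
  fixes P :: "'a::euclidean_space \<Rightarrow> real" and k :: nat and \<nu> :: real
  assumes P: "solid_harmonic k P" and \<nu>: "\<nu> = real k + real DIM('a) / 2"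
begin

lemma C_on_harmonic_series:
  assumes "entire_coeffs c" "open U"
  shows "C_on n (\<lambda>x. P x * psum c (x \<bullet> x)) U"
proof (rule C_on_mult[OF assms(2)])
  show "C_on n P U" using P by (intro C_on_polynomial) (simp add: solid_harmonic_def)
  show "C_on n (\<lambda>x. psum c (x \<bullet> x)) U"
    by (rule C_on_compose[where \<psi> = "psum c" and g = "\<lambda>x. x \<bullet> x", OF assms(2) open_UNIV subset_UNIV
          C_on_psum[OF assms(1)] C_on_polynomial[OF real_polynomial_function_inner_self]])
qed

lemma laplacian_harmonic_series:
  assumes "entire_coeffs c"
  shows "laplacian (\<lambda>x. P x * psum c (x \<bullet> x)) x = P x * psum (radial_op \<nu> c) (x \<bullet> x)"
  using laplacian_harmonic_radial[OF P open_UNIV psum_has_derivative[OF assms]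
      psum_has_derivative[OF entire_coeffs_diffs[OF assms]], of x]
  by (simp add: psum_radial_op[OF assms] \<nu>)

lemma laplacian2_harmonic_series:
  assumes "entire_coeffs c"
  shows "laplacian (laplacian (\<lambda>x. P x * psum c (x \<bullet> x))) x = P x * psum (radial_op \<nu> (radial_op \<nu> c)) (x \<bullet> x)"
  unfolding laplacian_harmonic_series[OF assms, abs_def]
  by (rule laplacian_harmonic_series[OF entire_coeffs_radial_op[OF assms]])

lemma normal_derivative_harmonic_series:
  assumes c: "entire_coeffs c" and R: "0 < R" and x: "norm x = R"
  shows "has_normal_derivative R (\<lambda>x. P x * psum c (x \<bullet> x)) x
     (P x * (real k * psum c (R\<^sup>2) + 2 * R\<^sup>2 * psum (diffs c) (R\<^sup>2)) / R)"
proof -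
  have xx: "x \<bullet> x = R\<^sup>2" using x by (simp add: power2_norm_eq_inner[symmetric])
  have eq: "P (x + t *\<^sub>R (x /\<^sub>R R)) * psum c ((x + t *\<^sub>R (x /\<^sub>R R)) \<bullet> (x + t *\<^sub>R (x /\<^sub>R R)))
     = (1 + t / R) ^ k * P x * psum c ((1 + t / R)\<^sup>2 * R\<^sup>2)" for t
  proof -
    have "x + t *\<^sub>R (x /\<^sub>R R) = (1 + t / R) *\<^sub>R x" by (simp add: scaleR_left_distrib divide_inverse)
    then show ?thesis using P xx by (simp add: solid_harmonic_def power2_eq_square mult.assoc)
  qed
  have "((\<lambda>t. psum c ((1 + t / R)\<^sup>2 * R\<^sup>2)) has_real_derivative psum (diffs c) (R\<^sup>2) * (2 * R)) (at 0)"
    by (rule DERIV_chain2[of "psum c"])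
      (use R psum_has_derivative[OF c, of "R\<^sup>2"] in \<open>auto intro!: derivative_eq_intros simp: power2_eq_square\<close>)
  then have "((\<lambda>t. (1 + t / R) ^ k * P x * psum c ((1 + t / R)\<^sup>2 * R\<^sup>2)) has_real_derivative
     real k / R * P x * psum c (R\<^sup>2) + P x * (psum (diffs c) (R\<^sup>2) * (2 * R))) (at 0)"
    using R by (auto intro!: derivative_eq_intros)
  moreover have "real k / R * P x * psum c (R\<^sup>2) + P x * (psum (diffs c) (R\<^sup>2) * (2 * R)) =
      P x * (real k * psum c (R\<^sup>2) + 2 * R\<^sup>2 * psum (diffs c) (R\<^sup>2)) / R"
    using R by (simp add: field_simps power2_eq_square)
  ultimately have "((\<lambda>t. (1 + t / R) ^ k * P x * psum c ((1 + t / R)\<^sup>2 * R\<^sup>2)) has_real_derivative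
     P x * (real k * psum c (R\<^sup>2) + 2 * R\<^sup>2 * psum (diffs c) (R\<^sup>2)) / R) (at 0)" by (simp only:)
  then show ?thesis
    unfolding has_normal_derivative_def eq by (rule has_field_derivative_at_within)
qed

lemma harmonic_series_nonzero:
  assumes R: "0 < R" and \<theta>: "norm \<theta> = 1" "P \<theta> \<noteq> 0" and c: "entire_coeffs c"
    and nz: "c 0 \<noteq> 0 \<or> c 1 \<noteq> 0"
  shows "\<exists>x\<in>ball 0 R. P x * psum c (x \<bullet> x) \<noteq> 0"
proof (rule ccontr)
  let ?w = "\<lambda>x. P x * psum c (x \<bullet> x)"
  have Pc: "P (c *\<^sub>R x) = c ^ k * P x" for c x using P by (simp add: solid_harmonic_def)
  assume *: "\<not> ?thesis"
  have z: "psum c \<rho> = 0" if \<rho>: "\<rho> \<in> {0<..<R\<^sup>2}" for \<rho>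
  proof -
    have "sqrt \<rho> < R" using \<rho> R by (simp add: real_less_lsqrt)
    then have "sqrt \<rho> *\<^sub>R \<theta> \<in> ball 0 R" using \<rho> \<theta> by simp
    with * have "?w (sqrt \<rho> *\<^sub>R \<theta>) = 0" by blast
    moreover have "(sqrt \<rho> *\<^sub>R \<theta>) \<bullet> (sqrt \<rho> *\<^sub>R \<theta>) = \<rho>" using \<theta> \<rho> by (simp add: norm_eq_1)
    moreover have "P (sqrt \<rho> *\<^sub>R \<theta>) \<noteq> 0" using \<theta> \<rho> by (simp add: Pc)
    ultimately show ?thesis by simp
  qed
  have lim: "f 0 = 0" if "continuous_on UNIV f" "\<And>\<rho>. \<rho> \<in> {0<..<R\<^sup>2} \<Longrightarrow> f \<rho> = 0" for f :: "real \<Rightarrow> real"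
  proof (rule continuous_constant_on_closure[where S = "{0<..<R\<^sup>2}" and f = f and x = 0 and a = 0])
    show "continuous_on (closure {0<..<R\<^sup>2}) f" by (rule continuous_on_subset[OF that(1) subset_UNIV])
    have "(0::real) < R\<^sup>2" using R by simp
    then show "0 \<in> closure {0<..<R\<^sup>2}" by (simp add: closure_greaterThanLessThan)
  qed (rule that(2))
  have "psum (diffs c) \<rho> = 0" if \<rho>: "\<rho> \<in> {0<..<R\<^sup>2}" for \<rho>
  proof -
    have "((\<lambda>_. 0) has_real_derivative psum (diffs c) \<rho>) (at \<rho>)"
      by (rule has_field_derivative_transform_within_open[OF psum_has_derivative[OF c] open_greaterThanLessThan \<rho>])
        (rule z)
    from DERIV_unique[OF this DERIV_const] show ?thesis .
  qed
  from lim[OF continuous_on_psum[OF entire_coeffs_diffs[OF c]] this] lim[OF continuous_on_psum[OF c] z]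
  show False using nz by (simp add: diffs_def)
qed

lemma plate_eigenfunction_harmonic_series:
  assumes R: "0 < R" and \<theta>: "norm \<theta> = 1" "P \<theta> \<noteq> 0" and c: "entire_coeffs c"
    and rec: "\<And>n. radial_op \<nu> (radial_op \<nu> c) n + \<alpha> * radial_op \<nu> c n = \<mu> * c n"
    and nz: "c 0 \<noteq> 0 \<or> c 1 \<noteq> 0"
    and bc: "psum c (R\<^sup>2) = 0" "psum (diffs c) (R\<^sup>2) = 0"
  shows "plate_eigenfunction R \<alpha> \<mu> (\<lambda>x. P x * psum c (x \<bullet> x))"
proof -
  let ?w = "\<lambda>x. P x * psum c (x \<bullet> x)"
  have e1: "entire_coeffs (radial_op \<nu> c)" and e2: "entire_coeffs (radial_op \<nu> (radial_op \<nu> c))"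
    by (simp_all add: c entire_coeffs_radial_op)
  have "laplacian (laplacian ?w) x + \<alpha> * laplacian ?w x = \<mu> * ?w x" for x
  proof -
    have "psum (radial_op \<nu> (radial_op \<nu> c)) (x \<bullet> x) + \<alpha> * psum (radial_op \<nu> c) (x \<bullet> x) = \<mu> * psum c (x \<bullet> x)"
    proof -
      have "(\<lambda>n. 1 * radial_op \<nu> (radial_op \<nu> c) n + \<alpha> * radial_op \<nu> c n) = (\<lambda>n. \<mu> * c n + 0 * c n)"
        using rec by auto
      then show ?thesis using psum_lincomb[OF e2 e1, of 1 \<alpha> "x \<bullet> x"] psum_lincomb[OF c c, of \<mu> 0 "x \<bullet> x"] by simp
    qed
    from arg_cong[OF this, of "\<lambda>z. P x * z"] show ?thesis
      by (simp add: laplacian2_harmonic_series[OF c] laplacian_harmonic_series[OF c] algebra_simps)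
  qed
  moreover have "\<exists>x\<in>ball 0 R. ?w x \<noteq> 0"
    by (rule harmonic_series_nonzero[OF R \<theta> c nz])
  moreover have "?w x = 0 \<and> has_normal_derivative R ?w x 0" if "x \<in> sphere 0 R" for x
  proof -
    have "norm x = R" using that by simp
    then show ?thesis
      using normal_derivative_harmonic_series[OF c R, of x] bc by (simp add: power2_norm_eq_inner[symmetric])
  qed
  ultimately show ?thesis
    unfolding plate_eigenfunction_def
    using C_on_harmonic_series[OF c open_ball, of 4 0 R] C1_cball_if_C_on[OF C_on_harmonic_series[OF c open_UNIV], of R]
    by blast
qed

end

section \<open>Uniqueness of separated solutions\<close>

lemma ray_derivative:
  fixes u :: "'a::euclidean_space \<Rightarrow> real"
  assumes "u differentiable (at (r *\<^sub>R \<theta>))"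
  shows "((\<lambda>r. u (r *\<^sub>R \<theta>)) has_real_derivative (\<Sum>b\<in>Basis. (\<theta> \<bullet> b) * partial b u (r *\<^sub>R \<theta>))) (at r)"
proof -
  have "((\<lambda>r. u (r *\<^sub>R \<theta>)) has_derivative (\<lambda>t. \<Sum>b\<in>Basis. ((t *\<^sub>R \<theta>) \<bullet> b) * partial b u (r *\<^sub>R \<theta>))) (at r)"
    by (rule has_derivative_compose[of "\<lambda>r. r *\<^sub>R \<theta>", OF _ has_derivative_partials[OF assms]])
      (auto intro!: derivative_eq_intros)
  then show ?thesis unfolding has_field_derivative_def
    by (rule has_derivative_eq_rhs) (auto simp: fun_eq_iff sum_distrib_left sum_distrib_right mult_ac)
qed

text \<open>The radial part f of a separated function carries no regularity of its own; everything is deduced from the smoothness of u along the ray through \<theta>. Here m is u on that ray, up to a constant, and m1 is its derivative. Dividing by r^k can make q and q1 singular at the origin, but the numerators m and m1 are continuous there.\<close>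

lemma separated_radial_profile:
  fixes u :: "'a::euclidean_space \<Rightarrow> real"
  assumes R: "0 < R" and P: "solid_harmonic k P" and \<theta>: "norm \<theta> = 1" "P \<theta> \<noteq> 0"
    and u: "C_on 2 u (ball 0 R)" and sep: "\<And>x. x \<in> ball 0 R - {0} \<Longrightarrow> u x = f (norm x) * P (x /\<^sub>R norm x)"
    and \<nu>: "\<nu> = real k + real DIM('a) / 2"
  obtains q q1 q2 m m1 where
    "\<And>\<rho>. \<rho> \<in> {0<..<R\<^sup>2} \<Longrightarrow> (q has_real_derivative q1 \<rho>) (at \<rho>)"
    "\<And>\<rho>. \<rho> \<in> {0<..<R\<^sup>2} \<Longrightarrow> (q1 has_real_derivative q2 \<rho>) (at \<rho>)"
    "\<And>x. x \<in> ball 0 R - {0} \<Longrightarrow> u x = P x * q (x \<bullet> x)"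
    "\<And>x. x \<in> ball 0 R - {0} \<Longrightarrow> laplacian u x = P x * (4 * (x \<bullet> x) * q2 (x \<bullet> x) + 4 * \<nu> * q1 (x \<bullet> x))"
    "isCont m 0" "isCont m1 0"
    "\<And>r. 0 < r \<Longrightarrow> r < R \<Longrightarrow> q (r\<^sup>2) = m r / r ^ k"
    "\<And>r. 0 < r \<Longrightarrow> r < R \<Longrightarrow> q1 (r\<^sup>2) = m1 r / (2 * r ^ (k + 1)) - real k * m r / (2 * r ^ (k + 2))"
proof -
  have Pc: "P (c *\<^sub>R x) = c ^ k * P x" for c x using P by (simp add: solid_harmonic_def)
  have u2: "C_on (Suc (Suc 0)) u (ball 0 R)" using u by (simp add: numeral_2_eq_2)
  define m where "m = (\<lambda>r. u (r *\<^sub>R \<theta>) / P \<theta>)"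
  define m1 where "m1 = (\<lambda>r. (\<Sum>b\<in>Basis. (\<theta> \<bullet> b) * partial b u (r *\<^sub>R \<theta>)) / P \<theta>)"
  have b: "r *\<^sub>R \<theta> \<in> ball 0 R" if "\<bar>r\<bar> < R" for r using that \<theta> by simp
  have dm: "(m has_real_derivative m1 r) (at r)" if "\<bar>r\<bar> < R" for r
    unfolding m_def m1_def
    by (intro DERIV_cdivide ray_derivative C_on_differentiable_at[OF u2 open_ball b[OF that]])
  have dm1: "\<exists>d. (m1 has_real_derivative d) (at r)" if "\<bar>r\<bar> < R" for r
  proof -
    have "(\<lambda>r. partial e u (r *\<^sub>R \<theta>)) field_differentiable at r" if e: "e \<in> Basis" for e
      using ray_derivative[OF C_on_differentiable_at[OF C_on_partial[OF u2 e] open_ball b[OF \<open>\<bar>r\<bar> < R\<close>]]]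
      unfolding field_differentiable_def by blast
    then have "m1 field_differentiable at r"
      unfolding m1_def
      by (intro field_differentiable_divide field_differentiable_sum field_differentiable_mult field_differentiable_const)
        (use \<theta> in auto)
    then show ?thesis by (simp add: field_differentiable_def)
  qed
  define q where "q = (\<lambda>\<rho>. m (sqrt \<rho>) / sqrt \<rho> ^ k)"
  define q1 where "q1 = (\<lambda>\<rho>. m1 (sqrt \<rho>) / (2 * sqrt \<rho> ^ (k + 1)) - real k * m (sqrt \<rho>) / (2 * sqrt \<rho> ^ (k + 2)))"
  define q2 where "q2 = deriv q1"
  have sq: "\<bar>sqrt \<rho>\<bar> < R \<and> 0 < sqrt \<rho> \<and> 0 < \<rho>" if "\<rho> \<in> {0<..<R\<^sup>2}" for \<rho>
    using that R by (auto simp: real_less_lsqrt)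
  have dsq: "(sqrt has_real_derivative 1 / (2 * sqrt \<rho>)) (at \<rho>)" if "\<rho> \<in> {0<..<R\<^sup>2}" for \<rho>
    using that by (auto intro!: derivative_eq_intros simp: field_simps)
  have dms: "((\<lambda>\<rho>. m (sqrt \<rho>)) has_real_derivative m1 (sqrt \<rho>) * (1 / (2 * sqrt \<rho>))) (at \<rho>)" if "\<rho> \<in> {0<..<R\<^sup>2}" for \<rho>
    by (rule DERIV_chain2[OF dm dsq[OF that]]) (use sq[OF that] in blast)
  have dq: "(q has_real_derivative q1 \<rho>) (at \<rho>)" if \<rho>: "\<rho> \<in> {0<..<R\<^sup>2}" for \<rho>
  proof -
    let ?s = "sqrt \<rho>"
    have s: "?s \<noteq> 0" using sq[OF \<rho>] by auto
    have "((\<lambda>\<rho>. sqrt \<rho> ^ k) has_real_derivative real k * (1 / (2 * ?s) * ?s ^ (k - 1))) (at \<rho>)"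
      using DERIV_power[OF dsq[OF \<rho>], of k] by simp
    from DERIV_divide[OF dms[OF \<rho>] this]
    have "(q has_real_derivative (m1 ?s * (1 / (2 * ?s)) * ?s ^ k - m ?s * (real k * (1 / (2 * ?s) * ?s ^ (k - 1)))) / (?s ^ k * ?s ^ k)) (at \<rho>)"
      unfolding q_def using s by auto
    moreover have "(m1 ?s * (1 / (2 * ?s)) * ?s ^ k - m ?s * (real k * (1 / (2 * ?s) * ?s ^ (k - 1)))) / (?s ^ k * ?s ^ k) = q1 \<rho>"
      using s by (cases k) (simp_all add: q1_def field_simps)
    ultimately show ?thesis by metis
  qed
  have dq1: "(q1 has_real_derivative q2 \<rho>) (at \<rho>)" if \<rho>: "\<rho> \<in> {0<..<R\<^sup>2}" for \<rho>
  proof -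
    obtain d where d: "(m1 has_real_derivative d) (at (sqrt \<rho>))" using dm1 sq[OF \<rho>] by blast
    have "sqrt field_differentiable at \<rho>" "(\<lambda>\<rho>. m (sqrt \<rho>)) field_differentiable at \<rho>"
      "(\<lambda>\<rho>. m1 (sqrt \<rho>)) field_differentiable at \<rho>"
      using dsq[OF \<rho>] dms[OF \<rho>] DERIV_chain2[OF d dsq[OF \<rho>]] field_differentiable_def by blast+
    then have "q1 field_differentiable at \<rho>" unfolding q1_def
      by (intro field_differentiable_diff field_differentiable_divide field_differentiable_mult
          field_differentiable_const field_differentiable_power) (use sq[OF \<rho>] in auto)
    then show ?thesis unfolding q2_def using DERIV_deriv_iff_field_differentiable by blast
  qed
  have uq: "u x = P x * q (x \<bullet> x)" if x: "x \<in> ball 0 R - {0}" for x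
  proof -
    have n: "0 < norm x" "norm x < R" using x by auto
    have "u (norm x *\<^sub>R \<theta>) = f (norm x) * P \<theta>"
    proof -
      have "\<theta> \<noteq> 0" using \<theta>(1) by auto
      then show ?thesis using sep[of "norm x *\<^sub>R \<theta>"] n \<theta>(1) by simp
    qed
    then have "f (norm x) = m (norm x)" using \<theta> by (simp add: m_def)
    moreover have "P (x /\<^sub>R norm x) = P x / norm x ^ k" by (simp add: Pc power_inverse divide_inverse)
    moreover have "sqrt (x \<bullet> x) = norm x" by (simp add: norm_eq_sqrt_inner)
    ultimately show ?thesis using sep[OF x] by (simp add: q_def)
  qed
  have lap: "laplacian u x = P x * (4 * (x \<bullet> x) * q2 (x \<bullet> x) + 4 * \<nu> * q1 (x \<bullet> x))"
    if x: "x \<in> ball 0 R - {0}" for x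
  proof -
    have V: "x \<bullet> x \<in> {0<..<R\<^sup>2}"
      using x R by (auto simp: power2_norm_eq_inner[symmetric] intro: power_strict_mono)
    have "laplacian u x = laplacian (\<lambda>x. P x * q (x \<bullet> x)) x"
      by (rule laplacian_cong_open[of "ball 0 R - {0}"]) (use uq x in \<open>auto intro: open_delete\<close>)
    also have "\<dots> = P x * (4 * (x \<bullet> x) * q2 (x \<bullet> x) + 4 * \<nu> * q1 (x \<bullet> x))"
      unfolding \<nu> by (rule laplacian_harmonic_radial[OF P open_greaterThanLessThan dq dq1 V])
    finally show ?thesis .
  qed
  show ?thesis
  proof (rule that[OF dq dq1 uq lap])
    show "isCont m 0" "isCont m1 0" using dm[of 0] dm1[of 0] R DERIV_isCont by (auto simp: DERIV_isCont)
    show "q (r\<^sup>2) = m r / r ^ k" if "0 < r" "r < R" for r using that by (simp add: q_def)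
    show "q1 (r\<^sup>2) = m1 r / (2 * r ^ (k + 1)) - real k * m r / (2 * r ^ (k + 2))" if "0 < r" "r < R" for r
      using that by (simp add: q1_def)
  qed
qed

lemma psum_bessel: "psum (bessel_coeffs \<nu> \<sigma>) \<rho> = bes \<nu> (\<sigma> * \<rho>)"
  by (simp add: psum_def bes_def power_mult_distrib mult.assoc)

lemma psum_diffs_bessel:
  assumes "1 \<le> \<nu>"
  shows "psum (diffs (bessel_coeffs \<nu> \<sigma>)) \<rho> = \<sigma> * bes' \<nu> (\<sigma> * \<rho>)"
proof -
  have "((\<lambda>\<rho>. bes \<nu> (\<sigma> * \<rho>)) has_real_derivative bes' \<nu> (\<sigma> * \<rho>) * \<sigma>) (at \<rho>)"
    by (rule DERIV_chain2[OF bes_deriv[OF assms]]) (auto intro!: derivative_eq_intros)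
  moreover have "((\<lambda>\<rho>. bes \<nu> (\<sigma> * \<rho>)) has_real_derivative psum (diffs (bessel_coeffs \<nu> \<sigma>)) \<rho>) (at \<rho>)"
    using psum_has_derivative[OF entire_bessel_coeff[OF assms], of \<sigma> \<rho>]
    unfolding ext[of "psum (bessel_coeffs \<nu> \<sigma>)", OF psum_bessel] .
  ultimately show ?thesis using DERIV_unique by (metis mult.commute)
qed

lemma psum_radial_op_bessel:
  assumes "1 \<le> \<nu>"
  shows "psum (radial_op \<nu> (bessel_coeffs \<nu> \<sigma>)) \<rho> = - \<sigma> * psum (bessel_coeffs \<nu> \<sigma>) \<rho>"
  using radial_op_bessel[OF assms, of \<sigma>] suminf_mult[OF entire_coeffsD[OF entire_bessel_coeff[OF assms]], of "- \<sigma>" \<sigma> \<rho>]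
  by (simp add: psum_def mult.assoc)

text \<open>A vanishing Wronskian makes (q, q1) a multiple C of (F, F1). Computing C as a projection onto this vector, instead of as the quotient q / F, avoids the zeros of F; the differential equation makes C constant.\<close>

lemma radial_ode_uniqueness:
  assumes \<nu>: "1 \<le> \<nu>" and V: "V = {0<..<(r::real)}"
    and q: "\<And>\<rho>. \<rho> \<in> V \<Longrightarrow> (q has_real_derivative q1 \<rho>) (at \<rho>)"
    and q1: "\<And>\<rho>. \<rho> \<in> V \<Longrightarrow> (q1 has_real_derivative q2 \<rho>) (at \<rho>)"
    and ode: "\<And>\<rho>. \<rho> \<in> V \<Longrightarrow> 4 * \<rho> * q2 \<rho> + 4 * \<nu> * q1 \<rho> = - \<sigma> * q \<rho>"
    and wr: "\<And>\<rho>. \<rho> \<in> V \<Longrightarrow> q \<rho> * (\<sigma> * bes' \<nu> (\<sigma> * \<rho>)) = q1 \<rho> * bes \<nu> (\<sigma> * \<rho>)"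
  shows "\<exists>c. \<forall>\<rho>\<in>V. q \<rho> = c * bes \<nu> (\<sigma> * \<rho>)"
proof -
  define b where "b = bessel_coeffs \<nu> \<sigma>"
  have eb: "entire_coeffs b" unfolding b_def by (rule entire_bessel_coeff[OF \<nu>])
  define F F1 F2 where "F = psum b" and "F1 = psum (diffs b)" and "F2 = psum (diffs (diffs b))"
  have dF: "(F has_real_derivative F1 \<rho>) (at \<rho>)" "(F1 has_real_derivative F2 \<rho>) (at \<rho>)" for \<rho>
    unfolding F_def F1_def F2_def by (intro psum_has_derivative eb entire_coeffs_diffs)+
  have odeF: "4 * \<rho> * F2 \<rho> + 4 * \<nu> * F1 \<rho> = - \<sigma> * F \<rho>" for \<rho>
  proof -
    have "psum (radial_op \<nu> b) \<rho> = - \<sigma> * F \<rho>" unfolding F_def b_def by (rule psum_radial_op_bessel[OF \<nu>])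
    then show ?thesis by (simp add: psum_radial_op[OF eb] F1_def F2_def)
  qed
  have Fb: "F \<rho> = bes \<nu> (\<sigma> * \<rho>)" "F1 \<rho> = \<sigma> * bes' \<nu> (\<sigma> * \<rho>)" for \<rho>
    unfolding F_def F1_def b_def using psum_bessel psum_diffs_bessel[OF \<nu>] by auto
  define s where "s = (\<lambda>\<rho>. (F \<rho>)\<^sup>2 + (F1 \<rho>)\<^sup>2)"
  have s: "s \<rho> > 0" for \<rho>
  proof (rule ccontr)
    assume "\<not> s \<rho> > 0"
    then have z: "F \<rho> = 0" "F1 \<rho> = 0" unfolding s_def by (auto simp: sum_power2_gt_zero_iff)
    then have "\<sigma> \<noteq> 0" by (auto simp: Fb bes_0)
    with z have "bes_amp2 \<nu> (\<sigma> * \<rho>) = 0" by (simp add: Fb bes_amp2_def)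
    then show False using bes_amp2_pos[OF \<nu>, of "\<sigma> * \<rho>"] by simp
  qed
  define C where "C = (\<lambda>\<rho>. (q \<rho> * F \<rho> + q1 \<rho> * F1 \<rho>) / s \<rho>)"
  have qC: "q \<rho> = C \<rho> * F \<rho>" "q1 \<rho> = C \<rho> * F1 \<rho>" if "\<rho> \<in> V" for \<rho>
  proof -
    have w: "q \<rho> * F1 \<rho> = q1 \<rho> * F \<rho>" using wr[OF that] by (simp add: Fb)
    have "C \<rho> * F \<rho> = (q \<rho> * (F \<rho>)\<^sup>2 + (q1 \<rho> * F \<rho>) * F1 \<rho>) / s \<rho>" by (simp add: C_def power2_eq_square algebra_simps)
    also have "\<dots> = q \<rho> * s \<rho> / s \<rho>" unfolding w[symmetric] by (simp add: s_def power2_eq_square algebra_simps)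
    finally show "q \<rho> = C \<rho> * F \<rho>" using s[of \<rho>] by simp
    have "C \<rho> * F1 \<rho> = ((q \<rho> * F1 \<rho>) * F \<rho> + q1 \<rho> * (F1 \<rho>)\<^sup>2) / s \<rho>" by (simp add: C_def power2_eq_square algebra_simps)
    also have "\<dots> = q1 \<rho> * s \<rho> / s \<rho>" unfolding w by (simp add: s_def power2_eq_square algebra_simps)
    finally show "q1 \<rho> = C \<rho> * F1 \<rho>" using s[of \<rho>] by simp
  qed
  have dC: "(C has_real_derivative 0) (at \<rho> within V)" if \<rho>: "\<rho> \<in> V" for \<rho>
  proof -
    have "\<rho> > 0" using \<rho> V by auto
    have "4 * \<rho> * q2 \<rho> = C \<rho> * (4 * \<rho> * F2 \<rho>)"
      using ode[OF \<rho>] odeF[of \<rho>] qC[OF \<rho>] by algebra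
    then have q2: "q2 \<rho> = C \<rho> * F2 \<rho>" using \<open>\<rho> > 0\<close> by simp
    let ?n = "q \<rho> * F \<rho> + q1 \<rho> * F1 \<rho>"
    let ?n' = "q1 \<rho> * F \<rho> + q \<rho> * F1 \<rho> + q2 \<rho> * F1 \<rho> + q1 \<rho> * F2 \<rho>"
    let ?s' = "2 * F \<rho> * F1 \<rho> + 2 * F1 \<rho> * F2 \<rho>"
    have dn: "((\<lambda>\<rho>. q \<rho> * F \<rho> + q1 \<rho> * F1 \<rho>) has_real_derivative ?n') (at \<rho>)"
      by (auto intro!: derivative_eq_intros q[OF \<rho>] q1[OF \<rho>] dF)
    have ds: "(s has_real_derivative ?s') (at \<rho>)"
      unfolding s_def by (auto intro!: derivative_eq_intros dF)
    have "(C has_real_derivative (?n' * s \<rho> - ?n * ?s') / (s \<rho> * s \<rho>)) (at \<rho>)"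
      unfolding C_def using s[of \<rho>] by (intro DERIV_divide dn ds) auto
    moreover have "?n' * s \<rho> - ?n * ?s' = 0"
    proof -
      have "?n = C \<rho> * s \<rho>" using s[of \<rho>] by (simp add: C_def)
      moreover have "?n' = C \<rho> * ?s'" unfolding qC[OF \<rho>] q2 by (simp add: algebra_simps)
      ultimately show ?thesis by simp
    qed
    ultimately show ?thesis by (simp add: has_field_derivative_at_within)
  qed
  have "\<exists>c. \<forall>\<rho>\<in>V. C \<rho> = c"
    using has_field_derivative_zero_constant[of V C] dC V by auto
  then show ?thesis using qC Fb by metis
qed

text \<open>The Wronskian of q and the regular solution, multiplied by r^(2k+N), is constant. Regularity of u at the origin forces the constant to be 0: written in terms of m and m1, the expression is continuous at the origin and vanishes there.\<close>

lemma helmholtz_separated: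
  fixes u :: "'a::euclidean_space \<Rightarrow> real"
  assumes N: "2 \<le> DIM('a)" and R: "0 < R" and P: "solid_harmonic k P" and \<theta>: "norm \<theta> = 1" "P \<theta> \<noteq> 0"
    and u: "C_on 2 u (ball 0 R)" and sep: "\<And>x. x \<in> ball 0 R - {0} \<Longrightarrow> u x = f (norm x) * P (x /\<^sub>R norm x)"
    and eq: "\<And>x. x \<in> ball 0 R \<Longrightarrow> - laplacian u x = \<sigma> * u x"
    and \<nu>: "\<nu> = real k + real DIM('a) / 2"
  shows "\<exists>c. \<forall>x\<in>ball 0 R. u x = c * (P x * psum (bessel_coeffs \<nu> \<sigma>) (x \<bullet> x))"
proof -
  obtain q q1 q2 m m1 where q:
    "\<And>\<rho>. \<rho> \<in> {0<..<R\<^sup>2} \<Longrightarrow> (q has_real_derivative q1 \<rho>) (at \<rho>)"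
    "\<And>\<rho>. \<rho> \<in> {0<..<R\<^sup>2} \<Longrightarrow> (q1 has_real_derivative q2 \<rho>) (at \<rho>)"
    and uq: "\<And>x. x \<in> ball 0 R - {0} \<Longrightarrow> u x = P x * q (x \<bullet> x)"
    and lap: "\<And>x. x \<in> ball 0 R - {0} \<Longrightarrow> laplacian u x = P x * (4 * (x \<bullet> x) * q2 (x \<bullet> x) + 4 * \<nu> * q1 (x \<bullet> x))"
    and m: "isCont m 0" "isCont m1 0"
    and qm: "\<And>r. 0 < r \<Longrightarrow> r < R \<Longrightarrow> q (r\<^sup>2) = m r / r ^ k"
    and q1m: "\<And>r. 0 < r \<Longrightarrow> r < R \<Longrightarrow> q1 (r\<^sup>2) = m1 r / (2 * r ^ (k + 1)) - real k * m r / (2 * r ^ (k + 2))"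
    using separated_radial_profile[OF R P \<theta> u sep \<nu>] by blast
  have \<nu>1: "1 \<le> \<nu>" using N \<nu> by simp
  let ?N = "DIM('a)"
  define b where "b = bessel_coeffs \<nu> \<sigma>"
  have eb: "entire_coeffs b" unfolding b_def by (rule entire_bessel_coeff[OF \<nu>1])
  define F F1 F2 where "F = psum b" and "F1 = psum (diffs b)" and "F2 = psum (diffs (diffs b))"
  have dF: "(F has_real_derivative F1 \<rho>) (at \<rho>)" "(F1 has_real_derivative F2 \<rho>) (at \<rho>)" for \<rho>
    unfolding F_def F1_def F2_def by (intro psum_has_derivative eb entire_coeffs_diffs)+
  have odeF: "4 * \<rho> * F2 \<rho> + 4 * \<nu> * F1 \<rho> = - \<sigma> * F \<rho>" for \<rho>
  proof -
    have "psum (radial_op \<nu> b) \<rho> = - \<sigma> * F \<rho>" unfolding F_def b_def by (rule psum_radial_op_bessel[OF \<nu>1])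
    then show ?thesis by (simp add: psum_radial_op[OF eb] F1_def F2_def)
  qed
  have ode: "4 * \<rho> * q2 \<rho> + 4 * \<nu> * q1 \<rho> = - \<sigma> * q \<rho>" if \<rho>: "\<rho> \<in> {0<..<R\<^sup>2}" for \<rho>
  proof -
    let ?x = "sqrt \<rho> *\<^sub>R \<theta>"
    have xx: "?x \<bullet> ?x = \<rho>" using \<rho> \<theta> by (simp add: norm_eq_1)
    have x: "?x \<in> ball 0 R - {0}" using \<rho> \<theta> R by (auto simp: real_less_lsqrt)
    have "P ?x \<noteq> 0" using P \<theta> \<rho> by (simp add: solid_harmonic_def)
    moreover have "P ?x * (4 * \<rho> * q2 \<rho> + 4 * \<nu> * q1 \<rho>) = P ?x * (- \<sigma> * q \<rho>)"
    proof -
      have "laplacian u ?x = - \<sigma> * u ?x" using eq[of ?x] x by simp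
      then show ?thesis unfolding lap[OF x] uq[OF x] xx by simp
    qed
    ultimately show ?thesis by (metis mult_left_cancel)
  qed
  \<comment> \<open>The exponent is 2 \<nu>, as required for the integrating factor of the Wronskian in the variable r.\<close>
  define W where "W = (\<lambda>r. r ^ (2 * k + ?N) * (q (r\<^sup>2) * F1 (r\<^sup>2) - q1 (r\<^sup>2) * F (r\<^sup>2)))"
  have dW: "(W has_real_derivative 0) (at r within {0<..<R})" if r: "r \<in> {0<..<R}" for r
  proof -
    have r2: "r\<^sup>2 \<in> {0<..<R\<^sup>2}" using r by (auto intro: power_strict_mono)
    have sqd: "((\<lambda>r. r\<^sup>2) has_real_derivative 2 * r) (at r)" by (auto intro!: derivative_eq_intros)
    note ch = DERIV_chain2[OF q(1)[OF r2] sqd] DERIV_chain2[OF q(2)[OF r2] sqd]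
      DERIV_chain2[OF dF(1)[of "r\<^sup>2"] sqd] DERIV_chain2[OF dF(2)[of "r\<^sup>2"] sqd]
    define w where "w = q (r\<^sup>2) * F1 (r\<^sup>2) - q1 (r\<^sup>2) * F (r\<^sup>2)"
    define w' where "w' = q (r\<^sup>2) * F2 (r\<^sup>2) - q2 (r\<^sup>2) * F (r\<^sup>2)"
    obtain n where n: "2 * k + ?N = Suc n" using N by (cases "2 * k + ?N") auto
    have D1: "((\<lambda>r. q (r\<^sup>2) * F1 (r\<^sup>2) - q1 (r\<^sup>2) * F (r\<^sup>2)) has_real_derivative w' * (2 * r)) (at r)"
      unfolding w'_def by (rule derivative_eq_intros ch refl)+ (simp add: algebra_simps)
    have "(W has_real_derivative real (Suc n) * r ^ n * w + r ^ Suc n * (w' * (2 * r))) (at r)"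
      unfolding W_def n w_def by (rule DERIV_cong[OF DERIV_mult[OF DERIV_pow[of "Suc n" r] D1]]) (simp add: mult_ac)
    moreover have "real (Suc n) * r ^ n * w + r ^ Suc n * (w' * (2 * r)) = 0"
    proof -
      have N2: "real (Suc n) = 2 * \<nu>" unfolding n[symmetric] \<nu> by simp
      have "4 * r\<^sup>2 * w' = - 4 * \<nu> * w"
        unfolding w_def w'_def using ode[OF r2] odeF[of "r\<^sup>2"] by algebra
      moreover have "real (Suc n) * r ^ n * w + r ^ Suc n * (w' * (2 * r)) = r ^ n * (2 * \<nu> * w + (4 * r\<^sup>2 * w') / 2)"
        unfolding N2 by (simp add: algebra_simps power2_eq_square)
      ultimately show ?thesis by simp
    qed
    ultimately show ?thesis by (simp add: has_field_derivative_at_within)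
  qed
  obtain w where w: "\<And>r. r \<in> {0<..<R} \<Longrightarrow> W r = w"
    using has_field_derivative_zero_constant[of "{0<..<R}" W] dW by auto
  \<comment> \<open>Y is W with the singular quotients cancelled. For N = 2 and k = 0 the power in the last term of the bracket is r^0, but its coefficient k is then 0, so that Y still vanishes at the origin.\<close>
  define Y where "Y = (\<lambda>r. r ^ (k + ?N) * m r * F1 (r\<^sup>2) - (r ^ (k + ?N - 1) * m1 r / 2 - real k * r ^ (k + ?N - 2) * m r / 2) * F (r\<^sup>2))"
  have WY: "W r = Y r" if r: "r \<in> {0<..<R}" for r
  proof -
    have rr: "0 < r" "r < R" using r by auto
    obtain N' where N': "?N = Suc (Suc N')" using N by (metis add_2_eq_Suc le_Suc_ex)
    define A where "A = r ^ (2 * k + ?N)"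
    have canc: "A * (a / (d * r ^ i)) = r ^ j * a / d" if "i + j = 2 * k + ?N" for a d :: real and i j
    proof -
      have "A = r ^ i * r ^ j" unfolding A_def that[symmetric] by (rule power_add)
      then show ?thesis using rr(1) by (simp add: divide_simps)
    qed
    have e1: "A * (m r / r ^ k) = r ^ (k + ?N) * m r" using canc[of k "k + ?N" "m r" 1] by simp
    have e2: "A * (m1 r / (2 * r ^ (k + 1))) = r ^ (k + ?N - 1) * m1 r / 2"
      by (rule canc) (simp add: N')
    have e3: "A * (real k * m r / (2 * r ^ (k + 2))) = real k * r ^ (k + ?N - 2) * m r / 2"
      using canc[of "k + 2" "k + ?N - 2" "real k * m r" 2] by (simp add: N' mult_ac)
    have "W r = (A * (m r / r ^ k)) * F1 (r\<^sup>2) -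
       (A * (m1 r / (2 * r ^ (k + 1))) - A * (real k * m r / (2 * r ^ (k + 2)))) * F (r\<^sup>2)"
      unfolding W_def qm[OF rr] q1m[OF rr] A_def[symmetric] by (simp only: right_diff_distrib left_diff_distrib mult.assoc)
    then show ?thesis unfolding e1 e2 e3 Y_def .
  qed
  have "isCont Y 0"
  proof -
    have c: "isCont F x" "isCont F1 x" "isCont (\<lambda>r::real. r\<^sup>2) x" for x
      using dF DERIV_isCont by (blast, blast, simp)
    have "isCont (\<lambda>r. F (r\<^sup>2)) 0" "isCont (\<lambda>r. F1 (r\<^sup>2)) 0"
      by (rule isCont_o2[where f = "\<lambda>r. r\<^sup>2" and g = F, OF c(3) c(1)],
          rule isCont_o2[where f = "\<lambda>r. r\<^sup>2" and g = F1, OF c(3) c(2)])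
    then show ?thesis unfolding Y_def by (intro continuous_intros m) auto
  qed
  moreover have "Y 0 = 0"
    unfolding Y_def using N by (cases "k = 0") (auto simp: power_0_left)
  ultimately have "(Y \<longlongrightarrow> 0) (at_right 0)"
    by (metis isCont_def tendsto_within_subset subset_UNIV)
  moreover have "(Y \<longlongrightarrow> w) (at_right 0)"
  proof (rule tendsto_eventually)
    have "\<forall>\<^sub>F r in at_right 0. r \<in> {0<..<R}" by (rule eventually_at_right_real[OF R])
    then show "\<forall>\<^sub>F r in at_right 0. Y r = w" by eventually_elim (use WY w in metis)
  qed
  ultimately have w0: "w = 0" using tendsto_unique trivial_limit_at_right_real by blast
  have Fb: "F \<rho> = bes \<nu> (\<sigma> * \<rho>)" "F1 \<rho> = \<sigma> * bes' \<nu> (\<sigma> * \<rho>)" for \<rho>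
    unfolding F_def F1_def b_def using psum_bessel psum_diffs_bessel[OF \<nu>1] by auto
  have "q \<rho> * (\<sigma> * bes' \<nu> (\<sigma> * \<rho>)) = q1 \<rho> * bes \<nu> (\<sigma> * \<rho>)" if \<rho>: "\<rho> \<in> {0<..<R\<^sup>2}" for \<rho>
  proof -
    have s: "sqrt \<rho> \<in> {0<..<R}" "(sqrt \<rho>)\<^sup>2 = \<rho>" using \<rho> R by (auto simp: real_less_lsqrt)
    have "W (sqrt \<rho>) = 0" using w[OF s(1)] w0 by simp
    then show ?thesis using s(1) unfolding W_def s(2) Fb by auto
  qed
  then obtain c where c: "\<And>\<rho>. \<rho> \<in> {0<..<R\<^sup>2} \<Longrightarrow> q \<rho> = c * bes \<nu> (\<sigma> * \<rho>)"
    using radial_ode_uniqueness[OF \<nu>1 refl q ode] by blast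
  let ?v = "\<lambda>x. c * (P x * psum b (x \<bullet> x))"
  have uv: "u x = ?v x" if x: "x \<in> ball 0 R - {0}" for x
  proof -
    have "x \<bullet> x \<in> {0<..<R\<^sup>2}" using x R by (auto simp: power2_norm_eq_inner[symmetric] intro: power_strict_mono)
    then show ?thesis using uq[OF x] c Fb(1) by (simp add: F_def mult_ac)
  qed
  have "u 0 = ?v 0"
  proof (rule LIM_unique)
    have "isCont u 0" using C_on_continuous[OF u] R by (simp add: continuous_on_eq_continuous_at)
    then show "u \<midarrow>0\<rightarrow> u 0" by (simp add: isCont_def)
    have "continuous_on UNIV (\<lambda>x. P x * psum b (x \<bullet> x))"
      using C_on_continuous[OF C_on_harmonic_series[OF P \<nu> eb open_UNIV]] .
    then have "continuous_on UNIV ?v" by (intro continuous_on_mult_left)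
    from this[unfolded continuous_on_eq_continuous_at[OF open_UNIV]] have "isCont ?v 0"
      by (rule bspec) (rule UNIV_I)
    then have "?v \<midarrow>0\<rightarrow> ?v 0" unfolding isCont_def .
    moreover have "\<forall>\<^sub>F x in at 0. ?v x = u x"
    proof -
      have "?v x = u x" if "x \<noteq> 0" "dist x 0 < R" for x
        by (rule uv[symmetric]) (use that in simp)
      then show ?thesis unfolding eventually_at using R by blast
    qed
    ultimately show "u \<midarrow>0\<rightarrow> ?v 0" by (rule Lim_transform_eventually)
  qed
  then have "u x = ?v x" if "x \<in> ball 0 R" for x
    using uv[of x] that by (cases "x = 0") auto
  then show ?thesis unfolding b_def by blast
qed

section \<open>Robin and Dirichlet spectra through the phase\<close>

lemma spherical_harmonic_iff_solid:
  "spherical_harmonic k S \<longleftrightarrow> (\<exists>P. solid_harmonic k P \<and> (\<forall>\<theta>\<in>sphere 0 1. S \<theta> = P \<theta>))"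
  unfolding spherical_harmonic_def solid_harmonic_def by blast

lemma solid_harmonic_polar:
  assumes "solid_harmonic k P" "x \<noteq> 0"
  shows "P x = norm x ^ k * P (x /\<^sub>R norm x)"
  using assms by (simp add: solid_harmonic_def power_inverse)

lemma separated_solid:
  assumes "separated R f S u" "\<And>\<theta>. norm \<theta> = 1 \<Longrightarrow> S \<theta> = P \<theta>" "x \<in> cball 0 R - {0}"
  shows "u x = f (norm x) * P (x /\<^sub>R norm x)"
  using assms by (simp add: separated_def)

lemma separated_harmonic_series:
  fixes P :: "'a::euclidean_space \<Rightarrow> real"
  assumes "solid_harmonic k P"
  shows "separated R (\<lambda>r. r ^ k * psum c (r\<^sup>2)) P (\<lambda>x. P x * psum c (x \<bullet> x))"
  unfolding separated_def
proof
  fix x :: 'a assume "x \<in> cball 0 R - {0}"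
  then have "P x = norm x ^ k * P (x /\<^sub>R norm x)" by (intro solid_harmonic_polar[OF assms]) simp
  then show "P x * psum c (x \<bullet> x) = norm x ^ k * psum c ((norm x)\<^sup>2) * P (x /\<^sub>R norm x)"
    by (simp add: power2_norm_eq_inner)
qed

lemma continuous_zero_at_origin:
  fixes u :: "'a::euclidean_space \<Rightarrow> real"
  assumes "0 < R" "continuous_on (ball 0 R) u" "\<And>x. x \<in> ball 0 R - {0} \<Longrightarrow> u x = 0"
  shows "u 0 = 0"
proof (rule LIM_unique)
  have "isCont u 0" using assms(1,2) by (simp add: continuous_on_eq_continuous_at)
  then show "u \<midarrow>0\<rightarrow> u 0" by (simp add: isCont_def)
  have "u x = 0" if "x \<noteq> 0" "dist x 0 < R" for x using assms(3)[of x] that by simp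
  then have "\<forall>\<^sub>F x in at 0. u x = 0" unfolding eventually_at using assms(1) by blast
  then show "u \<midarrow>0\<rightarrow> 0" by (rule tendsto_eventually)
qed

lemma harmonic_direction:
  fixes u :: "'a::euclidean_space \<Rightarrow> real"
  assumes R: "0 < R" and c: "continuous_on (ball 0 R) u" and nz: "\<exists>x\<in>ball 0 R. u x \<noteq> 0"
    and sep: "\<And>x. x \<in> ball 0 R - {0} \<Longrightarrow> u x = f (norm x) * P (x /\<^sub>R norm x)"
  shows "\<exists>\<theta>. norm \<theta> = 1 \<and> P \<theta> \<noteq> 0"
proof (rule ccontr)
  assume *: "\<not> ?thesis"
  have z: "u x = 0" if "x \<in> ball 0 R - {0}" for x
  proof -
    have "norm (x /\<^sub>R norm x) = 1" using that by simp
    then show ?thesis using sep[OF that] * by force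
  qed
  with continuous_zero_at_origin[OF R c z] nz show False by (metis Diff_iff singletonD)
qed

context
  fixes P :: "'a::euclidean_space \<Rightarrow> real" and k :: nat and \<nu> R :: real
  assumes N: "2 \<le> DIM('a)" and R: "0 < R" and P: "solid_harmonic k P" and \<nu>: "\<nu> = real k + real DIM('a) / 2"
begin

lemma order_ge_1: "1 \<le> \<nu>" using N \<nu> by simp

lemma separated_eigenfunction_form:
  assumes u: "C_on 2 u (ball 0 R)" "continuous_on (cball 0 R) u" "\<exists>x\<in>ball 0 R. u x \<noteq> 0"
    and eq: "\<And>x. x \<in> ball 0 R \<Longrightarrow> - laplacian u x = \<sigma> * u x"
    and sep: "separated R f S u" and S: "\<And>\<theta>. norm \<theta> = 1 \<Longrightarrow> S \<theta> = P \<theta>"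
  obtains c \<theta> where "norm \<theta> = 1" "P \<theta> \<noteq> 0" "c \<noteq> 0"
    "\<And>x. x \<in> cball 0 R \<Longrightarrow> u x = c * (P x * psum (bessel_coeffs \<nu> \<sigma>) (x \<bullet> x))"
proof -
  have sep': "u x = f (norm x) * P (x /\<^sub>R norm x)" if "x \<in> ball 0 R - {0}" for x
    by (rule separated_solid[OF sep S]) (use that in auto)
  obtain \<theta> where \<theta>: "norm \<theta> = 1" "P \<theta> \<noteq> 0"
    using harmonic_direction[OF R C_on_continuous[OF u(1)] u(3) sep'] by blast
  obtain c where c: "\<And>x. x \<in> ball 0 R \<Longrightarrow> u x = c * (P x * psum (bessel_coeffs \<nu> \<sigma>) (x \<bullet> x))"
    using helmholtz_separated[OF N R P \<theta> u(1) sep' eq \<nu>] by blast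
  have "continuous_on (cball 0 R) (\<lambda>x. P x * psum (bessel_coeffs \<nu> \<sigma>) (x \<bullet> x))"
    using C_on_continuous[OF C_on_harmonic_series[OF P \<nu> entire_bessel_coeff[OF order_ge_1] open_UNIV]]
    by (rule continuous_on_subset) simp
  then have "u x = c * (P x * psum (bessel_coeffs \<nu> \<sigma>) (x \<bullet> x))" if "x \<in> cball 0 R" for x
    by (intro eq_on_cball[OF R u(2) _ c that] continuous_on_mult_left)
  moreover have "c \<noteq> 0" using c u(3) by auto
  ultimately show ?thesis using that \<theta> by blast
qed

text \<open>At the sphere the radial derivative of P(x) q(|x|^2) is P(x) (k q + 2 R^2 q') / R. Evaluated in a direction where P does not vanish, the boundary condition becomes an equation for q(R^2) and q'(R^2).\<close>

lemma robin_condition: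
  assumes v: "robin_eigenfunction R \<beta> \<sigma> v" and sep: "separated R f S v"
    and S: "\<And>\<theta>. norm \<theta> = 1 \<Longrightarrow> S \<theta> = P \<theta>"
  shows "\<exists>c \<theta>. norm \<theta> = 1 \<and> P \<theta> \<noteq> 0 \<and> c \<noteq> 0 \<and>
    (\<forall>x\<in>cball 0 R. v x = c * (P x * psum (bessel_coeffs \<nu> \<sigma>) (x \<bullet> x))) \<and>
    (real k + \<beta> * R) * psum (bessel_coeffs \<nu> \<sigma>) (R\<^sup>2) + 2 * R\<^sup>2 * psum (diffs (bessel_coeffs \<nu> \<sigma>)) (R\<^sup>2) = 0"
proof -
  have v': "C_on 2 v (ball 0 R)" "C1_cball R v" "\<exists>x\<in>ball 0 R. v x \<noteq> 0"
    "\<And>x. x \<in> ball 0 R \<Longrightarrow> - laplacian v x = \<sigma> * v x"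
    and bc: "\<And>x. x \<in> sphere 0 R \<Longrightarrow> \<exists>d. has_normal_derivative R v x d \<and> d + \<beta> * v x = 0"
    using v unfolding robin_eigenfunction_def by blast+
  obtain c \<theta> where \<theta>: "norm \<theta> = 1" "P \<theta> \<noteq> 0" and c: "c \<noteq> 0"
    and vc: "\<And>x. x \<in> cball 0 R \<Longrightarrow> v x = c * (P x * psum (bessel_coeffs \<nu> \<sigma>) (x \<bullet> x))"
    using separated_eigenfunction_form[OF v'(1) C1_cball_continuous[OF v'(2)] v'(3,4) sep S] by blast
  let ?x = "R *\<^sub>R \<theta>" and ?F = "psum (bessel_coeffs \<nu> \<sigma>) (R\<^sup>2)" and ?F1 = "psum (diffs (bessel_coeffs \<nu> \<sigma>)) (R\<^sup>2)"
  have nx: "norm ?x = R" using \<theta> R by simp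
  have xx: "?x \<bullet> ?x = R\<^sup>2" using nx by (simp add: power2_norm_eq_inner[symmetric])
  have Px: "P ?x \<noteq> 0" using P \<theta> R by (simp add: solid_harmonic_def)
  obtain d where d: "has_normal_derivative R v ?x d" "d + \<beta> * v ?x = 0" using bc[of ?x] nx by auto
  have "has_normal_derivative R (\<lambda>x. c * (P x * psum (bessel_coeffs \<nu> \<sigma>) (x \<bullet> x))) ?x d"
    using has_normal_derivative_cong[OF R nx, of v "\<lambda>x. c * (P x * psum (bessel_coeffs \<nu> \<sigma>) (x \<bullet> x))" d] vc d(1) by blast
  moreover have "has_normal_derivative R (\<lambda>x. c * (P x * psum (bessel_coeffs \<nu> \<sigma>) (x \<bullet> x))) ?x
      (c * (P ?x * (real k * ?F + 2 * R\<^sup>2 * ?F1) / R))"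
    using normal_derivative_harmonic_series[OF P \<nu> entire_bessel_coeff[OF order_ge_1] R nx, of \<sigma>]
    unfolding has_normal_derivative_def by (rule DERIV_cmult)
  ultimately have "d = c * (P ?x * (real k * ?F + 2 * R\<^sup>2 * ?F1) / R)" by (rule has_normal_derivative_unique)
  with d(2) vc[of ?x] nx xx have "c * (P ?x * (real k * ?F + 2 * R\<^sup>2 * ?F1) / R) + \<beta> * (c * (P ?x * ?F)) = 0" by simp
  moreover have "R * (c * (P ?x * (real k * ?F + 2 * R\<^sup>2 * ?F1) / R) + \<beta> * (c * (P ?x * ?F))) =
     c * P ?x * ((real k + \<beta> * R) * ?F + 2 * R\<^sup>2 * ?F1)" using R by (simp add: field_simps)
  ultimately have "c * P ?x * ((real k + \<beta> * R) * ?F + 2 * R\<^sup>2 * ?F1) = 0" by simp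
  then have "(real k + \<beta> * R) * ?F + 2 * R\<^sup>2 * ?F1 = 0" using c Px by simp
  then show ?thesis using \<theta> c vc by blast
qed

lemma robin_eigenfunction_series:
  assumes \<theta>: "norm \<theta> = 1" "P \<theta> \<noteq> 0"
    and bc: "(real k + \<beta> * R) * psum (bessel_coeffs \<nu> \<sigma>) (R\<^sup>2) + 2 * R\<^sup>2 * psum (diffs (bessel_coeffs \<nu> \<sigma>)) (R\<^sup>2) = 0"
  shows "robin_eigenfunction R \<beta> \<sigma> (\<lambda>x. P x * psum (bessel_coeffs \<nu> \<sigma>) (x \<bullet> x))"
proof -
  let ?v = "\<lambda>x. P x * psum (bessel_coeffs \<nu> \<sigma>) (x \<bullet> x)"
  note e = entire_bessel_coeff[OF order_ge_1, of \<sigma>]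
  have "bessel_coeffs \<nu> \<sigma> 0 \<noteq> 0" by (simp add: bessel_coeff_def)
  then have nz: "\<exists>x\<in>ball 0 R. ?v x \<noteq> 0" by (intro harmonic_series_nonzero[OF P \<nu> R \<theta> e]) blast
  have lap: "- laplacian ?v x = \<sigma> * ?v x" for x
    unfolding laplacian_harmonic_series[OF P \<nu> e] psum_radial_op_bessel[OF order_ge_1] by simp
  have "\<exists>d. has_normal_derivative R ?v x d \<and> d + \<beta> * ?v x = 0" if "x \<in> sphere 0 R" for x
  proof -
    let ?F = "psum (bessel_coeffs \<nu> \<sigma>) (R\<^sup>2)" and ?F1 = "psum (diffs (bessel_coeffs \<nu> \<sigma>)) (R\<^sup>2)"
    have nx: "norm x = R" using that by simp
    have xx: "x \<bullet> x = R\<^sup>2" using nx by (simp add: power2_norm_eq_inner[symmetric])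
    have "P x * (real k * ?F + 2 * R\<^sup>2 * ?F1) / R + \<beta> * (P x * ?F) = P x * ((real k + \<beta> * R) * ?F + 2 * R\<^sup>2 * ?F1) / R"
      using R by (simp add: field_simps)
    then show ?thesis using normal_derivative_harmonic_series[OF P \<nu> e R nx] bc xx by auto
  qed
  then show ?thesis unfolding robin_eigenfunction_def
    using nz lap C_on_harmonic_series[OF P \<nu> e open_ball, of 2 0 R]
      C1_cball_if_C_on[OF C_on_harmonic_series[OF P \<nu> e open_UNIV], of R] by blast
qed

lemma dirichlet_eigenfunction_series:
  assumes \<theta>: "norm \<theta> = 1" "P \<theta> \<noteq> 0" and bc: "psum (bessel_coeffs \<nu> \<sigma>) (R\<^sup>2) = 0"
  shows "dirichlet_eigenfunction R \<sigma> (\<lambda>x. P x * psum (bessel_coeffs \<nu> \<sigma>) (x \<bullet> x))"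
proof -
  let ?v = "\<lambda>x. P x * psum (bessel_coeffs \<nu> \<sigma>) (x \<bullet> x)"
  note e = entire_bessel_coeff[OF order_ge_1, of \<sigma>]
  have "bessel_coeffs \<nu> \<sigma> 0 \<noteq> 0" by (simp add: bessel_coeff_def)
  then have nz: "\<exists>x\<in>ball 0 R. ?v x \<noteq> 0" by (intro harmonic_series_nonzero[OF P \<nu> R \<theta> e]) blast
  have lap: "- laplacian ?v x = \<sigma> * ?v x" for x
    unfolding laplacian_harmonic_series[OF P \<nu> e] psum_radial_op_bessel[OF order_ge_1] by simp
  have "?v x = 0" if "x \<in> sphere 0 R" for x
    using bc that by (simp add: power2_norm_eq_inner[symmetric])
  moreover have "continuous_on (cball 0 R) ?v"
    using C_on_continuous[OF C_on_harmonic_series[OF P \<nu> e open_UNIV]] by (rule continuous_on_subset) simp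
  ultimately show ?thesis unfolding dirichlet_eigenfunction_def
    using nz lap C_on_harmonic_series[OF P \<nu> e open_ball, of 2 0 R] by blast
qed

end

text \<open>On the solutions for \<sigma>1 and \<sigma>2 the operator M acts as -\<sigma>1 and -\<sigma>2, the roots of X^2 + (\<sigma>1 + \<sigma>2) X + \<sigma>1 \<sigma>2.\<close>

lemma bessel_combination_recurrence:
  fixes a b \<sigma>1 \<sigma>2 :: real
  assumes "1 \<le> \<nu>"
  defines "c \<equiv> \<lambda>n. a * bessel_coeffs \<nu> \<sigma>1 n + b * bessel_coeffs \<nu> \<sigma>2 n"
  shows "radial_op \<nu> (radial_op \<nu> c) n + (\<sigma>1 + \<sigma>2) * radial_op \<nu> c n = - (\<sigma>1 * \<sigma>2) * c n"
proof -
  have r: "radial_op \<nu> (bessel_coeffs \<nu> \<sigma>) = (\<lambda>n. (- \<sigma>) * bessel_coeffs \<nu> \<sigma> n + 0 * bessel_coeffs \<nu> \<sigma> n)" for \<sigma>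
    using radial_op_bessel[OF assms(1)] by auto
  have 1: "radial_op \<nu> (\<lambda>n. a * bessel_coeffs \<nu> \<sigma>1 n + b * bessel_coeffs \<nu> \<sigma>2 n) = (\<lambda>n. (- a * \<sigma>1) * bessel_coeffs \<nu> \<sigma>1 n + (- b * \<sigma>2) * bessel_coeffs \<nu> \<sigma>2 n)" for a b
    unfolding radial_op_lincomb r by (simp add: algebra_simps)
  show ?thesis unfolding c_def 1 by (simp add: algebra_simps)
qed

lemma bessel_combination_nonzero:
  fixes a b \<sigma>1 \<sigma>2 :: real
  assumes "1 \<le> \<nu>" "\<sigma>1 \<noteq> \<sigma>2" "a \<noteq> 0 \<or> b \<noteq> 0"
  defines "c \<equiv> \<lambda>n. a * bessel_coeffs \<nu> \<sigma>1 n + b * bessel_coeffs \<nu> \<sigma>2 n"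
  shows "c 0 \<noteq> 0 \<or> c 1 \<noteq> 0"
proof (rule ccontr)
  assume "\<not> ?thesis"
  moreover have "c 0 = a + b" "c 1 = - (a * \<sigma>1 + b * \<sigma>2) / (4 * \<nu>)"
    using assms(1) by (simp_all add: c_def bessel_coeff_def field_simps)
  ultimately have "a + b = 0" "a * \<sigma>1 + b * \<sigma>2 = 0" using assms(1) by auto
  then have "b = - a" by simp
  with \<open>a * \<sigma>1 + b * \<sigma>2 = 0\<close> have "a * (\<sigma>1 - \<sigma>2) = 0" by (simp add: algebra_simps)
  with \<open>b = - a\<close> show False using assms(2,3) by auto
qed

text \<open>The solution p in (0, \<pi>) of b sin p + 2 cos p = 0.\<close>

definition robin_phase :: "real \<Rightarrow> real" where "robin_phase b = pi / 2 + arctan (b / 2)"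

lemma robin_phase_bounds: "0 < robin_phase b" "robin_phase b < pi"
  using arctan_bounded[of "b / 2"] by (auto simp: robin_phase_def)

lemma robin_phase_solutions:
  assumes "0 < p"
  shows "b * sin p + 2 * cos p = 0 \<longleftrightarrow> (\<exists>i::nat. p = robin_phase b + real i * pi)"
proof -
  define a where "a = arctan (b / 2)"
  define y where "y = p - pi / 2"
  have ca: "0 < cos a" unfolding a_def using arctan_bounded by (intro cos_gt_zero_pi) auto
  have "tan a = b / 2" unfolding a_def using arctan[of "b / 2"] by blast
  then have sa: "sin a = b / 2 * cos a" using ca by (simp add: tan_def field_simps)
  have p: "sin p = cos y" "cos p = - sin y" unfolding y_def by (simp_all add: cos_diff sin_diff)
  have "sin (y - a) = cos a * (sin y - b / 2 * cos y)" unfolding sin_diff sa by (simp add: algebra_simps)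
  then have "b * sin p + 2 * cos p = 0 \<longleftrightarrow> sin (y - a) = 0" using ca unfolding p by auto
  also have "\<dots> \<longleftrightarrow> (\<exists>i::int. y - a = of_int i * pi)" by (simp add: sin_zero_iff_int2)
  also have "\<dots> \<longleftrightarrow> (\<exists>i::nat. p = robin_phase b + real i * pi)"
  proof
    assume "\<exists>i::int. y - a = of_int i * pi"
    then obtain i :: int where i: "p = robin_phase b + of_int i * pi"
      by (auto simp: y_def a_def robin_phase_def algebra_simps)
    have "0 \<le> i"
    proof (rule ccontr)
      assume "\<not> 0 \<le> i"
      then have "of_int i * pi \<le> (-1) * pi" by (intro mult_right_mono) auto
      then show False using i robin_phase_bounds(2)[of b] assms by simp
    qed
    then show "\<exists>i::nat. p = robin_phase b + real i * pi" using i by (intro exI[of _ "nat i"]) simp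
  next
    assume "\<exists>i::nat. p = robin_phase b + real i * pi"
    then obtain i :: nat where "p = robin_phase b + real i * pi" by blast
    then show "\<exists>i::int. y - a = of_int i * pi"
      by (intro exI[of _ "int i"]) (simp add: y_def a_def robin_phase_def algebra_simps)
  qed
  finally show ?thesis .
qed

text \<open>In polar coordinates the left-hand side is E (b sin \<psi> + 2 cos \<psi>), whose zeros are spaced by \<pi>; positivity of the phase selects the shifts by natural multiples of \<pi>.\<close>

lemma robin_condition_phase:
  assumes \<nu>: "1 \<le> \<nu>"
  shows "b * bes \<nu> z + 2 * (z * bes' \<nu> z) = 0 \<longleftrightarrow> (\<exists>i::nat. z = invphase \<nu> (robin_phase b + real i * pi))"
proof -
  obtain E where E: "E \<noteq> 0" "bes \<nu> z = E * sin (phase \<nu> z)" "z * bes' \<nu> z = E * cos (phase \<nu> z)"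
    using bes_polar[OF \<nu>] by blast
  have "b * bes \<nu> z + 2 * (z * bes' \<nu> z) = E * (b * sin (phase \<nu> z) + 2 * cos (phase \<nu> z))"
    unfolding E by (simp add: algebra_simps)
  then have "b * bes \<nu> z + 2 * (z * bes' \<nu> z) = 0 \<longleftrightarrow> (\<exists>i::nat. phase \<nu> z = robin_phase b + real i * pi)"
    using E(1) robin_phase_solutions[OF phase_pos[OF \<nu>], of b z] by simp
  moreover have "phase \<nu> z = robin_phase b + real i * pi \<longleftrightarrow> z = invphase \<nu> (robin_phase b + real i * pi)" for i
  proof -
    have "0 < robin_phase b + real i * pi" using robin_phase_bounds(1)[of b] by (simp add: add_pos_nonneg)
    then show ?thesis using \<nu> by (metis invphase_phase phase_invphase)
  qed
  ultimately show ?thesis by simp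
qed

text \<open>Zeros of \<Phi> are the points where sin of the phase vanishes. The multiple 0 of \<pi> is excluded, because the phase is positive.\<close>

lemma dirichlet_condition_phase:
  assumes \<nu>: "1 \<le> \<nu>"
  shows "bes \<nu> z = 0 \<longleftrightarrow> (\<exists>i\<ge>1. z = invphase \<nu> (real i * pi))"
proof -
  obtain E where E: "E \<noteq> 0" "bes \<nu> z = E * sin (phase \<nu> z)"
    using bes_polar[OF \<nu>] by blast
  have "bes \<nu> z = 0 \<longleftrightarrow> (\<exists>i::int. phase \<nu> z = of_int i * pi)" using E by (simp add: sin_zero_iff_int2)
  also have "\<dots> \<longleftrightarrow> (\<exists>i\<ge>1. phase \<nu> z = real i * pi)"
  proof
    assume "\<exists>i::int. phase \<nu> z = of_int i * pi"
    then obtain i :: int where i: "phase \<nu> z = of_int i * pi" by blast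
    then have "0 < i" using phase_pos[OF \<nu>, of z] by (simp add: zero_less_mult_iff)
    then show "\<exists>i\<ge>1. phase \<nu> z = real i * pi" using i by (intro exI[of _ "nat i"]) auto
  next
    assume "\<exists>i\<ge>1. phase \<nu> z = real i * pi"
    then show "\<exists>i::int. phase \<nu> z = of_int i * pi" by (metis of_int_of_nat_eq)
  qed
  also have "\<dots> \<longleftrightarrow> (\<exists>i\<ge>1. z = invphase \<nu> (real i * pi))"
  proof -
    have "phase \<nu> z = real i * pi \<longleftrightarrow> z = invphase \<nu> (real i * pi)" if "1 \<le> i" for i
      using \<nu> that by (metis invphase_phase phase_invphase mult_pos_pos pi_gt_zero of_nat_0_less_iff less_le_trans zero_less_one)
    then show ?thesis by blast
  qed
  finally show ?thesis .
qed

lemma nth_least_image: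
  assumes s: "\<And>i j. 1 \<le> i \<Longrightarrow> i < j \<Longrightarrow> s i < s j" and j: "1 \<le> j"
  shows "nth_least (s ` {1..}) j = s (j::nat)"
proof -
  have lt: "s i < s l \<longleftrightarrow> i < l" if "1 \<le> i" "1 \<le> l" for i l
    using s[of i l] s[of l i] that by (cases i l rule: linorder_cases) auto
  have below: "{y \<in> s ` {1..}. y < s i} = s ` {1..<i}" if "1 \<le> i" for i using lt that by auto
  have inj: "inj_on s {1..<i}" for i by (rule inj_onI) (metis atLeastLessThan_iff lt less_irrefl linorder_neqE_nat)
  have card: "finite {y \<in> s ` {1..}. y < s i} \<and> Suc (card {y \<in> s ` {1..}. y < s i}) = i" if "1 \<le> i" for i
    unfolding below[OF that] using card_image[OF inj, of i] that by simp
  show ?thesis unfolding nth_least_def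
  proof (rule the_equality)
    show "s j \<in> s ` {1..} \<and> finite {y \<in> s ` {1..}. y < s j} \<and> Suc (card {y \<in> s ` {1..}. y < s j}) = j"
      using card j by auto
    fix x assume x: "x \<in> s ` {1..} \<and> finite {y \<in> s ` {1..}. y < x} \<and> Suc (card {y \<in> s ` {1..}. y < x}) = j"
    then obtain i where i: "1 \<le> i" "x = s i" by auto
    then show "x = s j" using x card[OF i(1)] by simp
  qed
qed

context
  fixes k :: nat and R \<nu> :: real and T :: "'a::euclidean_space itself"
  assumes N: "2 \<le> DIM('a)" and R: "0 < R" and \<nu>: "\<nu> = real k + real DIM('a) / 2"
begin

lemma radial_order_ge_1: "1 \<le> \<nu>" using N \<nu> by simp

lemma robin_spectrum_eq:
  "robin_spectrum TYPE('a) R k \<beta> = (\<lambda>j. invphase \<nu> (robin_phase (real k + \<beta> * R) + real (j - 1) * pi) / R\<^sup>2) ` {1..}"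
proof -
  have cond: "(real k + \<beta> * R) * psum (bessel_coeffs \<nu> \<sigma>) (R\<^sup>2) + 2 * R\<^sup>2 * psum (diffs (bessel_coeffs \<nu> \<sigma>)) (R\<^sup>2) = 0 \<longleftrightarrow>
     (\<exists>i::nat. \<sigma> * R\<^sup>2 = invphase \<nu> (robin_phase (real k + \<beta> * R) + real i * pi))" for \<sigma>
  proof -
    have "2 * R\<^sup>2 * (\<sigma> * bes' \<nu> (\<sigma> * R\<^sup>2)) = 2 * (\<sigma> * R\<^sup>2 * bes' \<nu> (\<sigma> * R\<^sup>2))" by simp
    then show ?thesis
      unfolding psum_bessel psum_diffs_bessel[OF radial_order_ge_1] by (simp only: robin_condition_phase[OF radial_order_ge_1])
  qed
  have "\<sigma> \<in> robin_spectrum TYPE('a) R k \<beta> \<longleftrightarrow>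
     (real k + \<beta> * R) * psum (bessel_coeffs \<nu> \<sigma>) (R\<^sup>2) + 2 * R\<^sup>2 * psum (diffs (bessel_coeffs \<nu> \<sigma>)) (R\<^sup>2) = 0" (is "_ \<longleftrightarrow> ?C") for \<sigma>
  proof
    assume "\<sigma> \<in> robin_spectrum TYPE('a) R k \<beta>"
    then obtain v :: "'a \<Rightarrow> real" and f S where v: "robin_eigenfunction R \<beta> \<sigma> v" "spherical_harmonic k S" "separated R f S v"
      unfolding robin_spectrum_def by blast
    obtain P where P: "solid_harmonic k P" "\<And>\<theta>. norm \<theta> = 1 \<Longrightarrow> S \<theta> = P \<theta>"
      using v(2) unfolding spherical_harmonic_iff_solid by auto
    show ?C using robin_condition[OF N R P(1) \<nu> v(1,3) P(2)] by blast
  next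
    assume C: ?C
    obtain P :: "'a \<Rightarrow> real" and \<theta> where P: "solid_harmonic k P" "norm \<theta> = 1" "P \<theta> \<noteq> 0"
      using solid_harmonic_exists[OF N, of k] by auto
    have sh: "spherical_harmonic k P" unfolding spherical_harmonic_iff_solid using P by blast
    show "\<sigma> \<in> robin_spectrum TYPE('a) R k \<beta>"
      unfolding robin_spectrum_def mem_Collect_eq
      by (intro exI conjI, rule robin_eigenfunction_series[OF N R P(1) \<nu> P(2,3) C], rule sh,
          rule separated_harmonic_series[OF P(1)])
  qed
  then have mem: "\<sigma> \<in> robin_spectrum TYPE('a) R k \<beta> \<longleftrightarrow>
     (\<exists>i::nat. \<sigma> * R\<^sup>2 = invphase \<nu> (robin_phase (real k + \<beta> * R) + real i * pi))" for \<sigma>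
    unfolding cond .
  have d: "\<sigma> * R\<^sup>2 = x \<longleftrightarrow> \<sigma> = x / R\<^sup>2" for \<sigma> x using R by (simp add: nonzero_eq_divide_eq)
  show ?thesis
  proof (rule set_eqI)
    fix \<sigma>
    have *: "(\<exists>i::nat. \<sigma> = g i) \<longleftrightarrow> \<sigma> \<in> (\<lambda>j. g (j - 1)) ` {1..}" for g :: "nat \<Rightarrow> real"
    proof
      assume "\<exists>i. \<sigma> = g i"
      then obtain i where "\<sigma> = g i" by blast
      then show "\<sigma> \<in> (\<lambda>j. g (j - 1)) ` {1..}" by (intro image_eqI[of _ _ "Suc i"]) simp_all
    qed blast
    show "\<sigma> \<in> robin_spectrum TYPE('a) R k \<beta> \<longleftrightarrow> \<sigma> \<in> (\<lambda>j. invphase \<nu> (robin_phase (real k + \<beta> * R) + real (j - 1) * pi) / R\<^sup>2) ` {1..}"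
      using *[of "\<lambda>i. invphase \<nu> (robin_phase (real k + \<beta> * R) + real i * pi) / R\<^sup>2"]
      unfolding mem d .
  qed
qed

lemma dirichlet_spectrum_eq:
  "dirichlet_spectrum TYPE('a) R k = (\<lambda>j. invphase \<nu> (real j * pi) / R\<^sup>2) ` {1..}"
proof -
  have "\<gamma> \<in> dirichlet_spectrum TYPE('a) R k \<longleftrightarrow> psum (bessel_coeffs \<nu> \<gamma>) (R\<^sup>2) = 0" (is "_ \<longleftrightarrow> ?C") for \<gamma>
  proof
    assume "\<gamma> \<in> dirichlet_spectrum TYPE('a) R k"
    then obtain v :: "'a \<Rightarrow> real" and f S where v: "dirichlet_eigenfunction R \<gamma> v" "spherical_harmonic k S" "separated R f S v"
      unfolding dirichlet_spectrum_def by blast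
    obtain P where P: "solid_harmonic k P" "\<And>\<theta>. norm \<theta> = 1 \<Longrightarrow> S \<theta> = P \<theta>"
      using v(2) unfolding spherical_harmonic_iff_solid by auto
    have v': "C_on 2 v (ball 0 R)" "continuous_on (cball 0 R) v" "\<exists>x\<in>ball 0 R. v x \<noteq> 0"
      "\<And>x. x \<in> ball 0 R \<Longrightarrow> - laplacian v x = \<gamma> * v x" "\<And>x. x \<in> sphere 0 R \<Longrightarrow> v x = 0"
      using v(1) unfolding dirichlet_eigenfunction_def by blast+
    obtain c \<theta> where \<theta>: "norm \<theta> = 1" "P \<theta> \<noteq> 0" and c: "c \<noteq> 0"
      and vc: "\<And>x. x \<in> cball 0 R \<Longrightarrow> v x = c * (P x * psum (bessel_coeffs \<nu> \<gamma>) (x \<bullet> x))"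
      using separated_eigenfunction_form[OF N R P(1) \<nu> v'(1-4) v(3) P(2)] by blast
    have nx: "norm (R *\<^sub>R \<theta>) = R" using \<theta> R by simp
    then have xx: "(R *\<^sub>R \<theta>) \<bullet> (R *\<^sub>R \<theta>) = R\<^sup>2" by (simp only: power2_norm_eq_inner[symmetric])
    have "P (R *\<^sub>R \<theta>) \<noteq> 0" using P(1) \<theta> R by (simp add: solid_harmonic_def)
    then show ?C using vc[of "R *\<^sub>R \<theta>"] v'(5)[of "R *\<^sub>R \<theta>"] nx c unfolding xx by simp
  next
    assume C: ?C
    obtain P :: "'a \<Rightarrow> real" and \<theta> where P: "solid_harmonic k P" "norm \<theta> = 1" "P \<theta> \<noteq> 0"
      using solid_harmonic_exists[OF N, of k] by auto
    have sh: "spherical_harmonic k P" unfolding spherical_harmonic_iff_solid using P by blast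
    show "\<gamma> \<in> dirichlet_spectrum TYPE('a) R k"
      unfolding dirichlet_spectrum_def mem_Collect_eq
      by (intro exI conjI, rule dirichlet_eigenfunction_series[OF N R P(1) \<nu> P(2,3) C], rule sh,
          rule separated_harmonic_series[OF P(1)])
  qed
  then have mem: "\<gamma> \<in> dirichlet_spectrum TYPE('a) R k \<longleftrightarrow> (\<exists>i\<ge>1. \<gamma> * R\<^sup>2 = invphase \<nu> (real i * pi))" for \<gamma>
    by (simp only: psum_bessel dirichlet_condition_phase[OF radial_order_ge_1])
  have d: "\<sigma> * R\<^sup>2 = x \<longleftrightarrow> \<sigma> = x / R\<^sup>2" for \<sigma> x using R by (simp add: nonzero_eq_divide_eq)
  show ?thesis unfolding set_eq_iff mem d image_iff by (simp add: Bex_def)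
qed

lemma robin_eigenvalue_eq:
  assumes "1 \<le> j"
  shows "robin_eigenvalue TYPE('a) R k j \<beta> = invphase \<nu> (robin_phase (real k + \<beta> * R) + real (j - 1) * pi) / R\<^sup>2"
  unfolding robin_eigenvalue_def robin_spectrum_eq
proof (rule nth_least_image[OF _ assms])
  fix i j :: nat assume ij: "1 \<le> i" "i < j"
  let ?p = "robin_phase (real k + \<beta> * R)"
  have "?p + real (i - 1) * pi < ?p + real (j - 1) * pi" using ij by simp
  moreover have "0 < ?p + real (i - 1) * pi" using robin_phase_bounds(1) by (rule add_pos_nonneg) simp
  ultimately have "invphase \<nu> (?p + real (i - 1) * pi) < invphase \<nu> (?p + real (j - 1) * pi)"
    by (intro invphase_less[OF radial_order_ge_1])
  then show "invphase \<nu> (?p + real (i - 1) * pi) / R\<^sup>2 < invphase \<nu> (?p + real (j - 1) * pi) / R\<^sup>2"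
    by (rule divide_strict_right_mono) (use R in simp)
qed

lemma dirichlet_eigenvalue_eq:
  assumes "1 \<le> j"
  shows "dirichlet_eigenvalue TYPE('a) R k j = invphase \<nu> (real j * pi) / R\<^sup>2"
  unfolding dirichlet_eigenvalue_def dirichlet_spectrum_eq
proof (rule nth_least_image[OF _ assms])
  fix i j :: nat assume ij: "1 \<le> i" "i < j"
  then show "invphase \<nu> (real i * pi) / R\<^sup>2 < invphase \<nu> (real j * pi) / R\<^sup>2"
    using R by (intro divide_strict_right_mono invphase_less[OF radial_order_ge_1]) auto
qed

text \<open>With \<beta> ranging over the reals, the Robin phase takes every value in (0, \<pi>). Its shifts by (j - 1) \<pi> exhaust the positive reals up to the multiples j \<pi>, and these are the phases of the Dirichlet eigenvalues.\<close>

lemma branch_points_eq: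
  assumes t: "1 \<le> t"
  shows "branch_points TYPE('a) R k t =
    {(branch_alpha \<nu> R (real t * pi) p, branch_lambda \<nu> R (real t * pi) p) | p. 0 < p}"
proof -
  define B where "B = (\<lambda>p. (branch_alpha \<nu> R (real t * pi) p, branch_lambda \<nu> R (real t * pi) p))"
  have r: "(robin_eigenvalue TYPE('a) R k j \<beta> + robin_eigenvalue TYPE('a) R k (j + t) \<beta>,
       - (robin_eigenvalue TYPE('a) R k j \<beta> * robin_eigenvalue TYPE('a) R k (j + t) \<beta>)) =
      B (robin_phase (real k + \<beta> * R) + real (j - 1) * pi)" if "1 \<le> j" for j \<beta>
  proof -
    have "real (j + t - 1) * pi = real (j - 1) * pi + real t * pi"
      using that by (simp add: of_nat_diff algebra_simps)
    then show ?thesis using that by (simp add: robin_eigenvalue_eq B_def branch_alpha_def branch_lambda_def add.assoc)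
  qed
  have d: "(dirichlet_eigenvalue TYPE('a) R k j + dirichlet_eigenvalue TYPE('a) R k (j + t),
       - (dirichlet_eigenvalue TYPE('a) R k j * dirichlet_eigenvalue TYPE('a) R k (j + t))) = B (real j * pi)"
    if "1 \<le> j" for j
    using that by (simp add: dirichlet_eigenvalue_eq B_def branch_alpha_def branch_lambda_def distrib_right)
  have "branch_points TYPE('a) R k t = {B (robin_phase (real k + \<beta> * R) + real (j - 1) * pi) | j \<beta>. 1 \<le> j} \<union> {B (real j * pi) | j. 1 \<le> j}"
    unfolding branch_points_def using r d by (intro arg_cong2[where f = "(\<union>)"] Collect_cong) metis+
  also have "\<dots> = {B p | p. 0 < p}"
  proof (intro equalityI subsetI)
    fix x assume "x \<in> {B (robin_phase (real k + \<beta> * R) + real (j - 1) * pi) | j \<beta>. 1 \<le> j} \<union> {B (real j * pi) | j. 1 \<le> j}"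
    then consider j \<beta> where "x = B (robin_phase (real k + \<beta> * R) + real (j - 1) * pi)" | j where "1 \<le> j" "x = B (real j * pi)" by blast
    then show "x \<in> {B p | p. 0 < p}"
    proof cases
      case 1
      have "0 < robin_phase (real k + \<beta> * R) + real (j - 1) * pi" using robin_phase_bounds(1) by (rule add_pos_nonneg) simp
      then show ?thesis using 1 by blast
    next
      case 2
      then have "0 < real j * pi" by simp
      then show ?thesis using 2 by blast
    qed
  next
    fix x assume "x \<in> {B p | p. 0 < p}"
    then obtain p where p: "0 < p" "x = B p" by blast
    define i where "i = nat \<lfloor>p / pi\<rfloor>"
    define r where "r = p - real i * pi"
    have "real i = of_int \<lfloor>p / pi\<rfloor>" using p(1) by (simp add: i_def)
    then have "real i \<le> p / pi" "p / pi < real i + 1" by linarith+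
    then have r: "0 \<le> r" "r < pi" "p = r + real i * pi" by (auto simp: r_def field_simps)
    show "x \<in> {B (robin_phase (real k + \<beta> * R) + real (j - 1) * pi) | j \<beta>. 1 \<le> j} \<union> {B (real j * pi) | j. 1 \<le> j}"
    proof (cases "r = 0")
      case True
      then have "1 \<le> i" "p = real i * pi" using r p by (cases i; simp)+
      then show ?thesis using p(2) by blast
    next
      case False
      \<comment> \<open>The parameter \<beta> at which the Robin phase equals r.\<close>
      define \<beta> where "\<beta> = (2 * tan (r - pi / 2) - real k) / R"
      have "real k + \<beta> * R = 2 * tan (r - pi / 2)" using R by (simp add: \<beta>_def)
      then have "robin_phase (real k + \<beta> * R) = r"
        using r False by (simp add: robin_phase_def arctan_tan)
      then have "x = B (robin_phase (real k + \<beta> * R) + real (Suc i - 1) * pi)" using p(2) r(3) by simp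
      moreover have "1 \<le> Suc i" by simp
      ultimately show ?thesis by blast
    qed
  qed
  finally show ?thesis by (simp add: B_def)
qed

end

text \<open>When the phases of the two radial solutions at the boundary differ by t \<pi>, the vectors formed by value and derivative are parallel, so that a nontrivial combination satisfies both clamped conditions.\<close>

lemma plate_eigenfunction_on_branch:
  fixes P :: "'a::euclidean_space \<Rightarrow> real"
  assumes N: "2 \<le> DIM('a)" and R: "0 < R" and P: "solid_harmonic k P" and \<nu>: "\<nu> = real k + real DIM('a) / 2"
    and \<theta>: "norm \<theta> = 1" "P \<theta> \<noteq> 0" and p: "0 < p" and t: "1 \<le> t"
  shows "\<exists>c. plate_eigenfunction R (branch_alpha \<nu> R (real t * pi) p) (branch_lambda \<nu> R (real t * pi) p)
     (\<lambda>x. P x * psum c (x \<bullet> x))"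
proof -
  have \<nu>1: "1 \<le> \<nu>" using N \<nu> by simp
  define q where "q = p + real t * pi"
  have q: "p < q" "0 < q" using t p by (auto simp: q_def intro: add_pos_nonneg)
  define \<sigma>1 \<sigma>2 where "\<sigma>1 = invphase \<nu> p / R\<^sup>2" and "\<sigma>2 = invphase \<nu> q / R\<^sup>2"
  have ne: "\<sigma>1 \<noteq> \<sigma>2" using invphase_less[OF \<nu>1 p q(1)] R by (simp add: \<sigma>1_def \<sigma>2_def)
  have z: "\<sigma>1 * R\<^sup>2 = invphase \<nu> p" "\<sigma>2 * R\<^sup>2 = invphase \<nu> q" using R by (auto simp: \<sigma>1_def \<sigma>2_def)
  obtain E1 where E1: "E1 \<noteq> 0" "bes \<nu> (\<sigma>1 * R\<^sup>2) = E1 * sin p" "\<sigma>1 * R\<^sup>2 * bes' \<nu> (\<sigma>1 * R\<^sup>2) = E1 * cos p"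
    using bes_polar[OF \<nu>1, of "\<sigma>1 * R\<^sup>2"] unfolding z(1) phase_invphase[OF \<nu>1 p] by blast
  obtain E2 where E2: "E2 \<noteq> 0" "bes \<nu> (\<sigma>2 * R\<^sup>2) = E2 * sin q" "\<sigma>2 * R\<^sup>2 * bes' \<nu> (\<sigma>2 * R\<^sup>2) = E2 * cos q"
    using bes_polar[OF \<nu>1, of "\<sigma>2 * R\<^sup>2"] unfolding z(2) phase_invphase[OF \<nu>1 q(2)] by blast
  have sq: "sin q = (-1) ^ t * sin p" "cos q = (-1) ^ t * cos p"
    unfolding q_def by (simp_all add: sin_add cos_add sin_npi cos_npi mult.commute)
  \<comment> \<open>The boundary data are E1 (sin p, cos p) and E2 (-1)^t (sin p, cos p).\<close>
  define a b where "a = E2 * (-1) ^ t" and "b = - E1"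
  define c where "c = (\<lambda>n. a * bessel_coeffs \<nu> \<sigma>1 n + b * bessel_coeffs \<nu> \<sigma>2 n)"
  note e = entire_bessel_coeff[OF \<nu>1]
  have ec: "entire_coeffs c" unfolding c_def by (intro entire_coeffs_lincomb e)
  have "psum c (R\<^sup>2) = a * bes \<nu> (\<sigma>1 * R\<^sup>2) + b * bes \<nu> (\<sigma>2 * R\<^sup>2)"
    unfolding c_def psum_lincomb[OF e e] psum_bessel ..
  also have "\<dots> = 0" unfolding E1 E2 sq a_def b_def by simp
  finally have bc1: "psum c (R\<^sup>2) = 0" .
  have "R\<^sup>2 * psum (diffs c) (R\<^sup>2) = a * (\<sigma>1 * R\<^sup>2 * bes' \<nu> (\<sigma>1 * R\<^sup>2)) + b * (\<sigma>2 * R\<^sup>2 * bes' \<nu> (\<sigma>2 * R\<^sup>2))"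
    unfolding c_def diffs_lincomb psum_lincomb[OF entire_coeffs_diffs[OF e] entire_coeffs_diffs[OF e]] psum_diffs_bessel[OF \<nu>1]
    by (simp add: algebra_simps)
  also have "\<dots> = 0" unfolding E1 E2 sq a_def b_def by simp
  finally have bc2: "psum (diffs c) (R\<^sup>2) = 0" using R by simp
  have "plate_eigenfunction R (\<sigma>1 + \<sigma>2) (- (\<sigma>1 * \<sigma>2)) (\<lambda>x. P x * psum c (x \<bullet> x))"
  proof (rule plate_eigenfunction_harmonic_series[OF P \<nu> R \<theta> ec _ _ bc1 bc2])
    show "radial_op \<nu> (radial_op \<nu> c) n + (\<sigma>1 + \<sigma>2) * radial_op \<nu> c n = - (\<sigma>1 * \<sigma>2) * c n" for n
      unfolding c_def by (rule bessel_combination_recurrence[OF \<nu>1])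
    show "c 0 \<noteq> 0 \<or> c 1 \<noteq> 0" unfolding c_def
      by (rule bessel_combination_nonzero[OF \<nu>1 ne]) (use E1 in \<open>simp add: b_def\<close>)
  qed
  then show ?thesis by (auto simp: branch_alpha_def branch_lambda_def \<sigma>1_def \<sigma>2_def q_def)
qed

text \<open>The chosen combination vanishes on the sphere. Both functions satisfy the same Robin condition, so vanishing boundary values imply a vanishing normal derivative. The combination is not zero, because F(\<sigma>1), the radial factor of v1 on the sphere, cannot vanish: by the Robin condition its derivative would vanish as well, and a nonzero radial solution has no double zero on the sphere.\<close>

lemma robin_pair_gives_plate_eigenfunction:
  fixes v1 v2 :: "'a::euclidean_space \<Rightarrow> real"
  assumes N: "2 \<le> DIM('a)" and R: "0 < R"
    and v: "robin_eigenfunction R \<beta> \<sigma>1 v1" "robin_eigenfunction R \<beta> \<sigma>2 v2" and ne: "\<sigma>1 \<noteq> \<sigma>2"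
    and S: "spherical_harmonic k S" and sep: "separated R f1 S v1" "separated R f2 S v2"
  shows "plate_eigenfunction R (\<sigma>1 + \<sigma>2) (- (\<sigma>1 * \<sigma>2)) (\<lambda>x. f1 R * v2 x - f2 R * v1 x)"
proof -
  obtain P where P: "solid_harmonic k P" "\<And>\<theta>. norm \<theta> = 1 \<Longrightarrow> S \<theta> = P \<theta>"
    using S unfolding spherical_harmonic_iff_solid by auto
  define \<nu> where "\<nu> = real k + real DIM('a) / 2"
  have \<nu>1: "1 \<le> \<nu>" using N by (simp add: \<nu>_def)
  define F G where "F = (\<lambda>\<sigma>. psum (bessel_coeffs \<nu> \<sigma>) (R\<^sup>2))" and "G = (\<lambda>\<sigma>. psum (diffs (bessel_coeffs \<nu> \<sigma>)) (R\<^sup>2))"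
  obtain c1 \<theta> where 1: "norm \<theta> = 1" "P \<theta> \<noteq> 0" "c1 \<noteq> 0"
    "\<And>x. x \<in> cball 0 R \<Longrightarrow> v1 x = c1 * (P x * psum (bessel_coeffs \<nu> \<sigma>1) (x \<bullet> x))"
    "(real k + \<beta> * R) * F \<sigma>1 + 2 * R\<^sup>2 * G \<sigma>1 = 0"
    unfolding F_def G_def using robin_condition[OF N R P(1) \<nu>_def v(1) sep(1) P(2)] by blast
  obtain c2 where 2: "c2 \<noteq> 0"
    "\<And>x. x \<in> cball 0 R \<Longrightarrow> v2 x = c2 * (P x * psum (bessel_coeffs \<nu> \<sigma>2) (x \<bullet> x))"
    "(real k + \<beta> * R) * F \<sigma>2 + 2 * R\<^sup>2 * G \<sigma>2 = 0"
    unfolding F_def G_def using robin_condition[OF N R P(1) \<nu>_def v(2) sep(2) P(2)] by blast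
  have nx: "norm (R *\<^sub>R \<theta>) = R" using 1(1) R by simp
  then have xx: "(R *\<^sub>R \<theta>) \<bullet> (R *\<^sub>R \<theta>) = R\<^sup>2" by (simp only: power2_norm_eq_inner[symmetric])
  have PR: "P (R *\<^sub>R \<theta>) = R ^ k * P \<theta>" using P(1) by (simp add: solid_harmonic_def)
  have val: "f R = c * (R ^ k * F \<sigma>)"
    if "separated R f S v" "v (R *\<^sub>R \<theta>) = c * (P (R *\<^sub>R \<theta>) * psum (bessel_coeffs \<nu> \<sigma>) ((R *\<^sub>R \<theta>) \<bullet> (R *\<^sub>R \<theta>)))" for f v c \<sigma>
  proof -
    have "R *\<^sub>R \<theta> \<in> cball 0 R - {0}" using nx R by auto
    from separated_solid[OF that(1) P(2) this] have "v (R *\<^sub>R \<theta>) = f R * P \<theta>" using nx R by simp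
    then show ?thesis using that(2) 1(2) unfolding xx PR by (simp add: F_def)
  qed
  have f: "f1 R = c1 * (R ^ k * F \<sigma>1)" "f2 R = c2 * (R ^ k * F \<sigma>2)"
    using val[OF sep(1) 1(4)] val[OF sep(2) 2(2)] nx by simp_all
  define a b where "a = - (f2 R * c1)" and "b = f1 R * c2"
  define c where "c = (\<lambda>n. a * bessel_coeffs \<nu> \<sigma>1 n + b * bessel_coeffs \<nu> \<sigma>2 n)"
  note e = entire_bessel_coeff[OF \<nu>1]
  have ec: "entire_coeffs c" unfolding c_def by (intro entire_coeffs_lincomb e)
  have bc: "a * F \<sigma>1 + b * F \<sigma>2 = 0" unfolding a_def b_def f by simp
  then have bc1: "psum c (R\<^sup>2) = 0" unfolding c_def psum_lincomb[OF e e] F_def .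
  have "2 * R\<^sup>2 * (a * G \<sigma>1 + b * G \<sigma>2) = a * (2 * R\<^sup>2 * G \<sigma>1) + b * (2 * R\<^sup>2 * G \<sigma>2)" by (simp add: algebra_simps)
  also have "\<dots> = - (real k + \<beta> * R) * (a * F \<sigma>1 + b * F \<sigma>2)"
  proof -
    have "2 * R\<^sup>2 * G \<sigma>1 = - ((real k + \<beta> * R) * F \<sigma>1)" "2 * R\<^sup>2 * G \<sigma>2 = - ((real k + \<beta> * R) * F \<sigma>2)"
      using 1(5) 2(3) by linarith+
    then show ?thesis by (simp only:) (simp add: algebra_simps)
  qed
  finally have bc2: "psum (diffs c) (R\<^sup>2) = 0"
    unfolding c_def diffs_lincomb psum_lincomb[OF entire_coeffs_diffs[OF e] entire_coeffs_diffs[OF e]] using bc R by (simp add: G_def)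
  have F1: "F \<sigma>1 \<noteq> 0"
  proof
    assume z: "F \<sigma>1 = 0"
    then have "R\<^sup>2 * G \<sigma>1 = 0" using 1(5) by simp
    with z have "bes \<nu> (\<sigma>1 * R\<^sup>2) = 0" "\<sigma>1 * R\<^sup>2 * bes' \<nu> (\<sigma>1 * R\<^sup>2) = 0"
      unfolding F_def G_def psum_bessel psum_diffs_bessel[OF \<nu>1] by (auto simp: mult_ac)
    then have "bes_amp2 \<nu> (\<sigma>1 * R\<^sup>2) = 0" by (simp add: bes_amp2_def)
    then show False using bes_amp2_pos[OF \<nu>1, of "\<sigma>1 * R\<^sup>2"] by simp
  qed
  have "plate_eigenfunction R (\<sigma>1 + \<sigma>2) (- (\<sigma>1 * \<sigma>2)) (\<lambda>x. P x * psum c (x \<bullet> x))"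
  proof (rule plate_eigenfunction_harmonic_series[OF P(1) \<nu>_def R 1(1,2) ec _ _ bc1 bc2])
    show "radial_op \<nu> (radial_op \<nu> c) n + (\<sigma>1 + \<sigma>2) * radial_op \<nu> c n = - (\<sigma>1 * \<sigma>2) * c n" for n
      unfolding c_def by (rule bessel_combination_recurrence[OF \<nu>1])
    show "c 0 \<noteq> 0 \<or> c 1 \<noteq> 0" unfolding c_def
      by (rule bessel_combination_nonzero[OF \<nu>1 ne]) (use F1 1(3) 2(1) R in \<open>simp add: b_def f\<close>)
  qed
  then show ?thesis
  proof (rule plate_eigenfunction_cong[OF R, rotated])
    fix x :: 'a assume "x \<in> cball 0 R"
    then show "P x * psum c (x \<bullet> x) = f1 R * v2 x - f2 R * v1 x"
      unfolding 1(4)[OF \<open>x \<in> cball 0 R\<close>] 2(2)[OF \<open>x \<in> cball 0 R\<close>] c_def psum_lincomb[OF e e] a_def b_def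
      by (simp add: algebra_simps)
  qed
qed

text \<open>The function (Laplacian + \<sigma>2) u is separated and solves the Helmholtz equation for \<sigma>1, so it is a multiple of the corresponding solution. Subtracting a suitable multiple of that solution from u leaves a separated solution for \<sigma>2.\<close>

lemma plate_separated_two_terms:
  fixes u :: "'a::euclidean_space \<Rightarrow> real"
  assumes N: "2 \<le> DIM('a)" and R: "0 < R" and P: "solid_harmonic k P" and \<nu>: "\<nu> = real k + real DIM('a) / 2"
    and \<theta>: "norm \<theta> = 1" "P \<theta> \<noteq> 0" and ne: "\<sigma>1 \<noteq> \<sigma>2"
    and u: "C_on 4 u (ball 0 R)" "continuous_on (cball 0 R) u"
    and eq: "\<And>x. x \<in> ball 0 R \<Longrightarrow> laplacian (laplacian u) x + (\<sigma>1 + \<sigma>2) * laplacian u x = - (\<sigma>1 * \<sigma>2) * u x"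
    and sep: "\<And>x. x \<in> ball 0 R - {0} \<Longrightarrow> u x = f (norm x) * P (x /\<^sub>R norm x)"
  shows "\<exists>c1 c2. \<forall>x\<in>cball 0 R. u x = c1 * (P x * psum (bessel_coeffs \<nu> \<sigma>1) (x \<bullet> x)) + c2 * (P x * psum (bessel_coeffs \<nu> \<sigma>2) (x \<bullet> x))"
proof -
  have \<nu>1: "1 \<le> \<nu>" using N \<nu> by simp
  have u2: "C_on 2 u (ball 0 R)" by (rule C_on_mono[OF u(1)]) simp
  have "C_on (Suc (Suc 2)) u (ball 0 R)" using u(1) by (simp add: numeral_eq_Suc)
  from C_on_laplacian[OF open_ball this] have lu: "C_on 2 (laplacian u) (ball 0 R)" .
  define w where "w = (\<lambda>\<sigma> x. P x * psum (bessel_coeffs \<nu> \<sigma>) (x \<bullet> x))"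
  note e = entire_bessel_coeff[OF \<nu>1]
  have wC: "C_on 2 (w \<sigma>) (ball 0 R)" for \<sigma> unfolding w_def by (rule C_on_harmonic_series[OF P \<nu> e open_ball])
  have wl: "laplacian (w \<sigma>) x = - \<sigma> * w \<sigma> x" for \<sigma> x
    unfolding w_def laplacian_harmonic_series[OF P \<nu> e] psum_radial_op_bessel[OF \<nu>1] by simp
  have wpol: "w \<sigma> x = (norm x ^ k * psum (bessel_coeffs \<nu> \<sigma>) ((norm x)\<^sup>2)) * P (x /\<^sub>R norm x)" if "x \<noteq> 0" for \<sigma> x
    unfolding w_def using solid_harmonic_polar[OF P that] by (simp add: power2_norm_eq_inner)
  obtain q q1 q2 m m1 where
    lap: "\<And>x. x \<in> ball 0 R - {0} \<Longrightarrow> laplacian u x = P x * (4 * (x \<bullet> x) * q2 (x \<bullet> x) + 4 * \<nu> * q1 (x \<bullet> x))"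
    using separated_radial_profile[OF R P \<theta> u2 sep \<nu>] by metis
  define g where "g = (\<lambda>x. 1 * laplacian u x + \<sigma>2 * u x)"
  have gC: "C_on 2 g (ball 0 R)"
    unfolding g_def by (intro C_on_add C_on_mult open_ball C_on_const lu u2)
  have gl: "- laplacian g x = \<sigma>1 * g x" if "x \<in> ball 0 R" for x
    unfolding g_def laplacian_lincomb[OF open_ball lu u2 that] using eq[OF that] by (simp add: algebra_simps)
  have gs: "g x = ((\<lambda>r. r ^ k * (4 * r\<^sup>2 * q2 (r\<^sup>2) + 4 * \<nu> * q1 (r\<^sup>2)) + \<sigma>2 * f r) (norm x)) * P (x /\<^sub>R norm x)"
    if x: "x \<in> ball 0 R - {0}" for x
  proof -
    have "x \<noteq> 0" using x by simp
    from solid_harmonic_polar[OF P this] show ?thesis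
      unfolding g_def lap[OF x] sep[OF x] by (simp add: power2_norm_eq_inner algebra_simps)
  qed
  obtain c where c: "\<And>x. x \<in> ball 0 R \<Longrightarrow> g x = c * w \<sigma>1 x"
    using helmholtz_separated[OF N R P \<theta> gC gs gl \<nu>] unfolding w_def by blast
  define d where "d = c / (\<sigma>2 - \<sigma>1)"
  define h where "h = (\<lambda>x. 1 * u x + (- d) * w \<sigma>1 x)"
  have hC: "C_on 2 h (ball 0 R)"
    unfolding h_def by (intro C_on_add C_on_mult open_ball C_on_const wC u2)
  have hl: "- laplacian h x = \<sigma>2 * h x" if x: "x \<in> ball 0 R" for x
  proof -
    have "laplacian h x + \<sigma>2 * h x = g x - d * (\<sigma>2 - \<sigma>1) * w \<sigma>1 x"
      unfolding h_def laplacian_lincomb[OF open_ball u2 wC x] wl g_def by (simp add: algebra_simps)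
    also have "\<dots> = 0" using c[OF x] ne by (simp add: d_def)
    finally show ?thesis by simp
  qed
  have hs: "h x = ((\<lambda>r. f r - d * (r ^ k * psum (bessel_coeffs \<nu> \<sigma>1) (r\<^sup>2))) (norm x)) * P (x /\<^sub>R norm x)"
    if x: "x \<in> ball 0 R - {0}" for x
    unfolding h_def sep[OF x] using x wpol[of x \<sigma>1] by (simp add: algebra_simps)
  obtain c2 where c2: "\<And>x. x \<in> ball 0 R \<Longrightarrow> h x = c2 * w \<sigma>2 x"
    using helmholtz_separated[OF N R P \<theta> hC hs hl \<nu>] unfolding w_def by blast
  have wc: "continuous_on (cball 0 R) (w \<sigma>)" for \<sigma>
    unfolding w_def using C_on_continuous[OF C_on_harmonic_series[OF P \<nu> e open_UNIV]] by (rule continuous_on_subset) simp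
  have "u x = d * w \<sigma>1 x + c2 * w \<sigma>2 x" if "x \<in> cball 0 R" for x
  proof (rule eq_on_cball[OF R u(2) _ _ that])
    show "continuous_on (cball 0 R) (\<lambda>x. d * w \<sigma>1 x + c2 * w \<sigma>2 x)" by (intro continuous_intros wc)
    show "u x = d * w \<sigma>1 x + c2 * w \<sigma>2 x" if "x \<in> ball 0 R" for x using c2[OF that] by (simp add: h_def)
  qed
  then show ?thesis unfolding w_def by blast
qed

section \<open>The radial clamped boundary value problem\<close>

lemma radial_op_Suc: "radial_op \<nu> c n = 4 * (real n + \<nu>) * real (Suc n) * c (Suc n)"
  by (simp add: radial_op_def diffs_def)

lemma fourth_order_coeffs_unique:
  assumes \<nu>: "1 \<le> \<nu>"
    and c: "\<And>n. radial_op \<nu> (radial_op \<nu> c) n + \<alpha> * radial_op \<nu> c n - \<mu> * c n = 0"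
    and d: "\<And>n. radial_op \<nu> (radial_op \<nu> d) n + \<alpha> * radial_op \<nu> d n - \<mu> * d n = 0"
    and i: "c 0 = d 0" "c 1 = d 1"
  shows "c n = d n"
proof -
  have "c n = d n \<and> c (Suc n) = d (Suc n)"
  proof (induction n)
    case 0
    then show ?case using i by simp
  next
    case (Suc n)
    have k: "4 * (real n + \<nu>) * real (Suc n) * (4 * (real (Suc n) + \<nu>) * real (Suc (Suc n))) \<noteq> 0"
      using \<nu> by simp
    have "radial_op \<nu> (radial_op \<nu> c) n = radial_op \<nu> (radial_op \<nu> d) n"
      using c[of n] d[of n] Suc by (simp add: radial_op_Suc[of \<nu> c] radial_op_Suc[of \<nu> d])
    then have "(4 * (real n + \<nu>) * real (Suc n) * (4 * (real (Suc n) + \<nu>) * real (Suc (Suc n)))) * c (Suc (Suc n)) =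
       (4 * (real n + \<nu>) * real (Suc n) * (4 * (real (Suc n) + \<nu>) * real (Suc (Suc n)))) * d (Suc (Suc n))"
      unfolding radial_op_Suc by (simp only: mult.assoc)
    then show ?case using k Suc by (metis mult_left_cancel)
  qed
  then show ?thesis ..
qed

lemma psum_zero_on_interval:
  assumes c: "entire_coeffs c" and r: "0 < r" and z: "\<And>\<rho>. \<rho> \<in> {0<..<r} \<Longrightarrow> psum c \<rho> = 0"
  shows "c 0 = 0"
proof -
  have "psum c 0 = 0"
  proof (rule continuous_constant_on_closure[where S = "{0<..<r}" and f = "psum c" and x = 0 and a = 0])
    show "continuous_on (closure {0<..<r}) (psum c)" by (rule continuous_on_psum[OF c])
    show "0 \<in> closure {0<..<r}" using r by (simp add: closure_greaterThanLessThan)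
  qed (rule z)
  then show ?thesis by simp
qed

lemma bes_cauchy_data_nonzero:
  assumes "1 \<le> \<nu>" "R \<noteq> 0" "psum (bessel_coeffs \<nu> \<sigma>) (R\<^sup>2) = 0" "psum (diffs (bessel_coeffs \<nu> \<sigma>)) (R\<^sup>2) = 0"
  shows False
proof -
  have "bes \<nu> (\<sigma> * R\<^sup>2) = 0" "\<sigma> * R\<^sup>2 * bes' \<nu> (\<sigma> * R\<^sup>2) = 0"
    using assms(3,4) unfolding psum_bessel psum_diffs_bessel[OF assms(1)] by auto
  then have "bes_amp2 \<nu> (\<sigma> * R\<^sup>2) = 0" by (simp add: bes_amp2_def)
  then show False using bes_amp2_pos[OF assms(1), of "\<sigma> * R\<^sup>2"] by simp
qed

text \<open>With g = (M + \<alpha>/2) q the equation reads (M + \<alpha>/2) g = -m q, where m >= 0 if the discriminant is not positive. Then W = \<rho>^\<nu> (q g' - q' g) is decreasing, with derivative -\<rho>^(\<nu>-1) (m q^2 + g^2) / 4. It vanishes at 0 because of the weight and at R^2 because of the clamped conditions. Hence g = 0 and m q^2 = 0. For m > 0 this gives q = 0, and for m = 0 a solution of a second-order equation with vanishing Cauchy data.\<close>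

lemma clamped_series_discriminant_pos:
  assumes \<nu>: "1 \<le> \<nu>" and R: "0 < R" and c: "entire_coeffs c"
    and rec: "\<And>n. radial_op \<nu> (radial_op \<nu> c) n + \<alpha> * radial_op \<nu> c n = \<mu> * c n"
    and nz: "c 0 \<noteq> 0 \<or> c 1 \<noteq> 0"
    and bc: "psum c (R\<^sup>2) = 0" "psum (diffs c) (R\<^sup>2) = 0"
  shows "0 < \<alpha>\<^sup>2 + 4 * \<mu>"
proof (rule ccontr)
  assume neg: "\<not> 0 < \<alpha>\<^sup>2 + 4 * \<mu>"
  define a where "a = \<alpha> / 2"
  define m where "m = - (\<mu> + a\<^sup>2)"
  have m: "0 \<le> m" using neg by (simp add: m_def a_def power_divide)
  define d where "d = (\<lambda>n. 1 * radial_op \<nu> c n + a * c n)"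
  have ec1: "entire_coeffs (radial_op \<nu> c)" by (rule entire_coeffs_radial_op[OF c])
  have d: "entire_coeffs d" unfolding d_def by (intro entire_coeffs_lincomb c ec1)
  have Mc: "radial_op \<nu> c = (\<lambda>n. 1 * d n + (-a) * c n)" by (auto simp: d_def)
  have Md: "radial_op \<nu> d = (\<lambda>n. (-m) * c n + (-a) * d n)"
  proof
    fix n
    have "radial_op \<nu> d n = radial_op \<nu> (radial_op \<nu> c) n + a * radial_op \<nu> c n"
      unfolding d_def radial_op_lincomb by simp
    also have "radial_op \<nu> (radial_op \<nu> c) n = \<mu> * c n - \<alpha> * radial_op \<nu> c n" using rec[of n] by simp
    finally show "radial_op \<nu> d n = (-m) * c n + (-a) * d n"
      by (simp add: d_def m_def a_def algebra_simps power2_eq_square)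
  qed
  define q q1 q2 g g1 g2 where "q = psum c" and "q1 = psum (diffs c)" and "q2 = psum (diffs (diffs c))"
    and "g = psum d" and "g1 = psum (diffs d)" and "g2 = psum (diffs (diffs d))"
  note defs = q_def q1_def q2_def g_def g1_def g2_def
  have odeq: "4 * \<rho> * q2 \<rho> + 4 * \<nu> * q1 \<rho> = g \<rho> - a * q \<rho>" for \<rho>
    using psum_radial_op[OF c, of \<nu> \<rho>] psum_lincomb[OF d c, of 1 "-a" \<rho>] unfolding Mc defs by simp
  have odeg: "4 * \<rho> * g2 \<rho> + 4 * \<nu> * g1 \<rho> = - m * q \<rho> - a * g \<rho>" for \<rho>
    using psum_radial_op[OF d, of \<nu> \<rho>] psum_lincomb[OF c d, of "-m" "-a" \<rho>] unfolding Md defs by simp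
  have D: "(q has_real_derivative q1 \<rho>) (at \<rho>)" "(q1 has_real_derivative q2 \<rho>) (at \<rho>)"
    "(g has_real_derivative g1 \<rho>) (at \<rho>)" "(g1 has_real_derivative g2 \<rho>) (at \<rho>)" for \<rho>
    unfolding defs by (intro psum_has_derivative entire_coeffs_diffs c d)+
  define W where "W = (\<lambda>\<rho>. \<rho> powr \<nu> * (q \<rho> * g1 \<rho> - q1 \<rho> * g \<rho>))"
  have dW: "(W has_real_derivative - (\<rho> powr (\<nu> - 1) / 4 * (m * (q \<rho>)\<^sup>2 + (g \<rho>)\<^sup>2))) (at \<rho>)" if "0 < \<rho>" for \<rho>
  proof -
    have "(W has_real_derivative \<rho> powr (\<nu> - 1) * (\<nu> * (q \<rho> * g1 \<rho> - q1 \<rho> * g \<rho>) + \<rho> * (q \<rho> * g2 \<rho> - q2 \<rho> * g \<rho>))) (at \<rho>)"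
      unfolding W_def using that
      by (auto intro!: derivative_eq_intros D simp: powr_diff field_simps)
    moreover have "\<nu> * (q \<rho> * g1 \<rho> - q1 \<rho> * g \<rho>) + \<rho> * (q \<rho> * g2 \<rho> - q2 \<rho> * g \<rho>) = - ((m * (q \<rho>)\<^sup>2 + (g \<rho>)\<^sup>2) / 4)"
    proof -
      have "4 * (\<nu> * (q \<rho> * g1 \<rho> - q1 \<rho> * g \<rho>) + \<rho> * (q \<rho> * g2 \<rho> - q2 \<rho> * g \<rho>)) =
        q \<rho> * (4 * \<rho> * g2 \<rho> + 4 * \<nu> * g1 \<rho>) - (4 * \<rho> * q2 \<rho> + 4 * \<nu> * q1 \<rho>) * g \<rho>" by (simp add: algebra_simps)
      also have "\<dots> = - (m * (q \<rho>)\<^sup>2 + (g \<rho>)\<^sup>2)"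
        unfolding odeq odeg by (simp add: algebra_simps power2_eq_square)
      finally have *: "4 * (\<nu> * (q \<rho> * g1 \<rho> - q1 \<rho> * g \<rho>) + \<rho> * (q \<rho> * g2 \<rho> - q2 \<rho> * g \<rho>)) =
        - (m * (q \<rho>)\<^sup>2 + (g \<rho>)\<^sup>2)" .
      have "X = - (Y / 4)" if "4 * X = - Y" for X Y :: real using that by simp
      from this[OF *] show ?thesis .
    qed
    ultimately show ?thesis by simp
  qed
  have cW: "continuous_on {0..R\<^sup>2} W"
    unfolding W_def defs using \<nu>
    by (intro continuous_on_mult continuous_on_diff continuous_on_psum continuous_on_powr' continuous_on_id
        continuous_on_const entire_coeffs_diffs c d) auto
  have mono: "W b \<le> W a" if "0 \<le> a" "a \<le> b" "b \<le> R\<^sup>2" for a b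
  proof (rule DERIV_nonpos_imp_decreasing_open[OF that(2)])
    show "continuous_on {a..b} W" by (rule continuous_on_subset[OF cW]) (use that in auto)
    fix x assume "a < x" "x < b"
    then have "0 < x" using that by simp
    moreover have "- (x powr (\<nu> - 1) / 4 * (m * (q x)\<^sup>2 + (g x)\<^sup>2)) \<le> 0" using m by simp
    ultimately show "\<exists>y. (W has_real_derivative y) (at x) \<and> y \<le> 0" using dW by blast
  qed
  have ends: "W 0 = 0" "W (R\<^sup>2) = 0" using bc \<nu> by (auto simp: W_def q_def q1_def)
  have zero: "m * (q \<rho>)\<^sup>2 + (g \<rho>)\<^sup>2 = 0" if \<rho>: "\<rho> \<in> {0<..<R\<^sup>2}" for \<rho>
  proof -
    have W0: "W x = 0" if "x \<in> {0<..<R\<^sup>2}" for x using mono[of 0 x] mono[of x "R\<^sup>2"] ends that by auto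
    have "((\<lambda>_. 0) has_real_derivative - (\<rho> powr (\<nu> - 1) / 4 * (m * (q \<rho>)\<^sup>2 + (g \<rho>)\<^sup>2))) (at \<rho>)"
      by (rule has_field_derivative_transform_within_open[OF dW open_greaterThanLessThan \<rho>]) (use \<rho> W0 in auto)
    from DERIV_unique[OF this DERIV_const] show ?thesis using \<rho> by auto
  qed
  have R2: "0 < R\<^sup>2" using R by simp
  have g0: "g \<rho> = 0" and mq0: "m * (q \<rho>)\<^sup>2 = 0" if "\<rho> \<in> {0<..<R\<^sup>2}" for \<rho>
  proof -
    have "0 \<le> m * (q \<rho>)\<^sup>2" "0 \<le> (g \<rho>)\<^sup>2" using m by auto
    then show "g \<rho> = 0" "m * (q \<rho>)\<^sup>2 = 0" using zero[OF that] by (auto simp: add_nonneg_eq_0_iff)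
  qed
  show False
  proof (cases "m = 0")
    case True
    have d0: "d n = 0" for n
    proof (induction n)
      case 0
      show ?case by (rule psum_zero_on_interval[OF d R2]) (use g0 in \<open>simp add: g_def\<close>)
    next
      case (Suc n)
      have "radial_op \<nu> d n = 0" unfolding Md using Suc True by simp
      then show ?case using \<nu> by (simp add: radial_op_Suc)
    qed
    have cn: "c n = c 0 * bessel_coeffs \<nu> a n" for n
    proof (induction n)
      case 0
      then show ?case by (simp add: bessel_coeff_def)
    next
      case (Suc n)
      have "radial_op \<nu> c n = - a * c n" unfolding Mc by (simp add: d0)
      then have "radial_op \<nu> c n = c 0 * radial_op \<nu> (bessel_coeffs \<nu> a) n" unfolding radial_op_bessel[OF \<nu>] Suc by simp
      then have "(4 * (real n + \<nu>) * real (Suc n)) * c (Suc n) = (4 * (real n + \<nu>) * real (Suc n)) * (c 0 * bessel_coeffs \<nu> a (Suc n))"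
        unfolding radial_op_Suc by (simp only: mult_ac)
      moreover have "4 * (real n + \<nu>) * real (Suc n) \<noteq> 0" using \<nu> by simp
      ultimately show ?case using mult_left_cancel by blast
    qed
    have c00: "c 0 \<noteq> 0"
    proof
      assume z: "c 0 = 0"
      have "c 1 = 0" by (subst cn) (simp only: z mult_zero_left)
      with z nz show False by blast
    qed
    have ce: "c = (\<lambda>n. c 0 * bessel_coeffs \<nu> a n + 0 * bessel_coeffs \<nu> a n)"
    proof
      fix n show "c n = c 0 * bessel_coeffs \<nu> a n + 0 * bessel_coeffs \<nu> a n" using cn[of n] by (simp only: mult_zero_left add_0_right)
    qed
    note e = entire_bessel_coeff[OF \<nu>, of a]
    have "c 0 * psum (bessel_coeffs \<nu> a) (R\<^sup>2) = 0" "c 0 * psum (diffs (bessel_coeffs \<nu> a)) (R\<^sup>2) = 0"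
      using bc psum_lincomb[OF e e, of "c 0" 0 "R\<^sup>2"]
        psum_lincomb[OF entire_coeffs_diffs[OF e] entire_coeffs_diffs[OF e], of "c 0" 0 "R\<^sup>2"]
      unfolding diffs_lincomb[symmetric] ce[symmetric] by simp_all
    then show False using bes_cauchy_data_nonzero[OF \<nu>, of R a] c00 R by simp
  next
    case False
    then have q0: "q \<rho> = 0" if "\<rho> \<in> {0<..<R\<^sup>2}" for \<rho> using mq0[OF that] by simp
    have c0: "c 0 = 0" by (rule psum_zero_on_interval[OF c R2]) (use q0 in \<open>simp add: q_def\<close>)
    have "diffs c 0 = 0"
    proof (rule psum_zero_on_interval[OF entire_coeffs_diffs[OF c] R2])
      fix \<rho> assume \<rho>: "\<rho> \<in> {0<..<R\<^sup>2}"
      have "((\<lambda>_. 0) has_real_derivative q1 \<rho>) (at \<rho>)"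
        by (rule has_field_derivative_transform_within_open[OF D(1) open_greaterThanLessThan \<rho>]) (rule q0)
      from DERIV_unique[OF this DERIV_const] show "psum (diffs c) \<rho> = 0" by (simp add: q1_def)
    qed
    with c0 nz show False by (simp add: diffs_def)
  qed
qed

text \<open>A positive discriminant makes the equation factor with real \<sigma>1 < \<sigma>2, and comparing the first two coefficients shows that every solution is a combination of the two Bessel solutions. The clamped conditions are then a homogeneous linear system whose determinant is, up to nonzero factors, the sine of the difference of the phases.\<close>

lemma clamped_series_on_branch:
  assumes \<nu>: "1 \<le> \<nu>" and R: "0 < R" and c: "entire_coeffs c"
    and rec: "\<And>n. radial_op \<nu> (radial_op \<nu> c) n + \<alpha> * radial_op \<nu> c n = \<mu> * c n"
    and nz: "c 0 \<noteq> 0 \<or> c 1 \<noteq> 0"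
    and bc: "psum c (R\<^sup>2) = 0" "psum (diffs c) (R\<^sup>2) = 0"
  shows "\<exists>t\<ge>1. \<exists>p>0. \<alpha> = branch_alpha \<nu> R (real t * pi) p \<and> \<mu> = branch_lambda \<nu> R (real t * pi) p"
proof -
  define s where "s = sqrt (\<alpha>\<^sup>2 + 4 * \<mu>)"
  have disc: "0 < \<alpha>\<^sup>2 + 4 * \<mu>" by (rule clamped_series_discriminant_pos[OF assms])
  have s: "0 < s" "s * s = \<alpha>\<^sup>2 + 4 * \<mu>" using disc by (auto simp: s_def)
  define \<sigma>1 \<sigma>2 where "\<sigma>1 = (\<alpha> - s) / 2" and "\<sigma>2 = (\<alpha> + s) / 2"
  have sl: "\<sigma>1 < \<sigma>2" using s by (simp add: \<sigma>1_def \<sigma>2_def)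
  have sum: "\<sigma>1 + \<sigma>2 = \<alpha>" by (simp add: \<sigma>1_def \<sigma>2_def field_simps)
  have "4 * (\<sigma>1 * \<sigma>2) = \<alpha>\<^sup>2 - s * s"
  proof -
    have "4 * (\<sigma>1 * \<sigma>2) = (\<alpha> - s) * (\<alpha> + s)" unfolding \<sigma>1_def \<sigma>2_def by simp
    then show ?thesis by (simp add: algebra_simps power2_eq_square)
  qed
  then have prod: "\<mu> = - (\<sigma>1 * \<sigma>2)" using s(2) by simp
  define e where "e = c 1 / bessel_coeff \<nu> 1"
  have b1: "bessel_coeff \<nu> 1 \<noteq> 0" using \<nu> by (simp add: bessel_coeff_def)
  \<comment> \<open>The weights for which the first two coefficients of the combination are those of c.\<close>
  define a b where "a = (c 0 * \<sigma>2 - e) / (\<sigma>2 - \<sigma>1)" and "b = (e - c 0 * \<sigma>1) / (\<sigma>2 - \<sigma>1)"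
  have ab: "a + b = c 0" "a * \<sigma>1 + b * \<sigma>2 = e"
    using sl by (simp_all add: a_def b_def divide_simps) (simp_all add: algebra_simps)
  note en = entire_bessel_coeff[OF \<nu>]
  have ceq: "c = (\<lambda>n. a * bessel_coeffs \<nu> \<sigma>1 n + b * bessel_coeffs \<nu> \<sigma>2 n)"
  proof
    fix n
    show "c n = a * bessel_coeffs \<nu> \<sigma>1 n + b * bessel_coeffs \<nu> \<sigma>2 n"
    proof (rule fourth_order_coeffs_unique[where \<alpha> = \<alpha> and \<mu> = \<mu>, OF \<nu>])
      show "radial_op \<nu> (radial_op \<nu> c) n + \<alpha> * radial_op \<nu> c n - \<mu> * c n = 0" for n using rec[of n] by simp
      show "radial_op \<nu> (radial_op \<nu> (\<lambda>n. a * bessel_coeffs \<nu> \<sigma>1 n + b * bessel_coeffs \<nu> \<sigma>2 n)) n +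
         \<alpha> * radial_op \<nu> (\<lambda>n. a * bessel_coeffs \<nu> \<sigma>1 n + b * bessel_coeffs \<nu> \<sigma>2 n) n - \<mu> * (a * bessel_coeffs \<nu> \<sigma>1 n + b * bessel_coeffs \<nu> \<sigma>2 n) = 0" for n
        using bessel_combination_recurrence[OF \<nu>, of a \<sigma>1 b \<sigma>2 n] unfolding sum prod by simp
      show "c 0 = a * bessel_coeffs \<nu> \<sigma>1 0 + b * bessel_coeffs \<nu> \<sigma>2 0" using ab(1) by (simp add: bessel_coeff_def)
      have "a * bessel_coeffs \<nu> \<sigma>1 1 + b * bessel_coeffs \<nu> \<sigma>2 1 = bessel_coeff \<nu> 1 * (a * \<sigma>1 + b * \<sigma>2)" by (simp add: algebra_simps)
      then show "c 1 = a * bessel_coeffs \<nu> \<sigma>1 1 + b * bessel_coeffs \<nu> \<sigma>2 1" unfolding ab(2) e_def using b1 by simp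
    qed
  qed
  have abnz: "a \<noteq> 0 \<or> b \<noteq> 0" using nz ceq by auto
  define z1 z2 where "z1 = \<sigma>1 * R\<^sup>2" and "z2 = \<sigma>2 * R\<^sup>2"
  have zl: "z1 < z2" using sl R by (simp add: z1_def z2_def)
  define p1 p2 where "p1 = phase \<nu> z1" and "p2 = phase \<nu> z2"
  have pl: "0 < p1" "p1 < p2" using phase_pos[OF \<nu>] phase_strict_mono[OF \<nu> zl] by (auto simp: p1_def p2_def)
  obtain E1 where E1: "E1 \<noteq> 0" "bes \<nu> z1 = E1 * sin p1" "z1 * bes' \<nu> z1 = E1 * cos p1"
    unfolding p1_def using bes_polar[OF \<nu>, of z1] by blast
  obtain E2 where E2: "E2 \<noteq> 0" "bes \<nu> z2 = E2 * sin p2" "z2 * bes' \<nu> z2 = E2 * cos p2"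
    unfolding p2_def using bes_polar[OF \<nu>, of z2] by blast
  have "a * bes \<nu> z1 + b * bes \<nu> z2 = 0"
    using bc(1) unfolding ceq psum_lincomb[OF en en] psum_bessel z1_def z2_def .
  then have eq1: "(a * E1) * sin p1 + (b * E2) * sin p2 = 0" unfolding E1 E2 by (simp add: mult_ac)
  have "a * (\<sigma>1 * bes' \<nu> z1) + b * (\<sigma>2 * bes' \<nu> z2) = 0"
    using bc(2) unfolding ceq diffs_lincomb psum_lincomb[OF entire_coeffs_diffs[OF en] entire_coeffs_diffs[OF en]]
      psum_diffs_bessel[OF \<nu>] z1_def z2_def .
  then have "R\<^sup>2 * (a * (\<sigma>1 * bes' \<nu> z1) + b * (\<sigma>2 * bes' \<nu> z2)) = 0" by simp
  then have "a * (z1 * bes' \<nu> z1) + b * (z2 * bes' \<nu> z2) = 0" by (simp add: z1_def z2_def algebra_simps)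
  then have eq2: "(a * E1) * cos p1 + (b * E2) * cos p2 = 0" unfolding E1 E2 by (simp add: mult_ac)
  \<comment> \<open>Eliminating one unknown of the linear system at a time.\<close>
  have "(a * E1) * sin (p2 - p1) = sin p2 * ((a * E1) * cos p1 + (b * E2) * cos p2) - cos p2 * ((a * E1) * sin p1 + (b * E2) * sin p2)"
    by (simp add: sin_diff algebra_simps)
  then have s1: "(a * E1) * sin (p2 - p1) = 0" unfolding eq1 eq2 by simp
  have "(b * E2) * sin (p2 - p1) =
      cos p1 * ((a * E1) * sin p1 + (b * E2) * sin p2) - sin p1 * ((a * E1) * cos p1 + (b * E2) * cos p2)"
    by (simp add: sin_diff algebra_simps)
  then have s2: "(b * E2) * sin (p2 - p1) = 0" unfolding eq1 eq2 by simp
  have "sin (p2 - p1) = 0" using s1 s2 abnz E1(1) E2(1) by auto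
  then obtain i :: int where i: "p2 - p1 = of_int i * pi" by (auto simp: sin_zero_iff_int2)
  then have "0 < i" using pl by (metis diff_gt_0_iff_gt of_int_0_less_iff pi_gt_zero zero_less_mult_pos2)
  define t where "t = nat i"
  have t: "1 \<le> t" "p2 = p1 + real t * pi" using i \<open>0 < i\<close> by (auto simp: t_def)
  have "invphase \<nu> p1 = \<sigma>1 * R\<^sup>2" "invphase \<nu> (p1 + real t * pi) = \<sigma>2 * R\<^sup>2"
    using \<nu> unfolding t(2)[symmetric] by (simp_all add: p1_def p2_def z1_def z2_def)
  then have "\<alpha> = branch_alpha \<nu> R (real t * pi) p1 \<and> \<mu> = branch_lambda \<nu> R (real t * pi) p1"
    unfolding branch_alpha_def branch_lambda_def sum[symmetric] prod using R by simp
  then show ?thesis using t pl by blast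
qed

text \<open>Solving the fourth-order radial equation with right-hand side g for the next coefficient; a and b are the two free initial coefficients of a solution regular at the origin.\<close>

fun series_solution :: "real \<Rightarrow> real \<Rightarrow> real \<Rightarrow> (nat \<Rightarrow> real) \<Rightarrow> real \<Rightarrow> real \<Rightarrow> nat \<Rightarrow> real" where
  "series_solution \<nu> \<alpha> \<mu> g a b 0 = a"
| "series_solution \<nu> \<alpha> \<mu> g a b (Suc 0) = b"
| "series_solution \<nu> \<alpha> \<mu> g a b (Suc (Suc n)) =
     (g n - \<alpha> * (4 * (real n + \<nu>) * real (Suc n) * series_solution \<nu> \<alpha> \<mu> g a b (Suc n))
          + \<mu> * series_solution \<nu> \<alpha> \<mu> g a b n) /
     (4 * (real n + \<nu>) * real (Suc n) * (4 * (real (Suc n) + \<nu>) * real (Suc (Suc n))))"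

lemma series_solution_rec:
  fixes \<alpha> \<mu> a b :: real and g :: "nat \<Rightarrow> real"
  assumes "1 \<le> \<nu>"
  defines "c \<equiv> series_solution \<nu> \<alpha> \<mu> g a b"
  shows "radial_op \<nu> (radial_op \<nu> c) n + \<alpha> * radial_op \<nu> c n - \<mu> * c n = g n"
proof -
  define K where "K = 4 * (real n + \<nu>) * real (Suc n) * (4 * (real (Suc n) + \<nu>) * real (Suc (Suc n)))"
  have K: "K \<noteq> 0" using assms(1) by (simp add: K_def)
  have "radial_op \<nu> (radial_op \<nu> c) n = K * c (Suc (Suc n))" unfolding radial_op_Suc K_def by (simp only: mult.assoc)
  also have "\<dots> = g n - \<alpha> * radial_op \<nu> c n + \<mu> * c n"
  proof -
    have "c (Suc (Suc n)) = (g n - \<alpha> * radial_op \<nu> c n + \<mu> * c n) / K"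
      unfolding c_def radial_op_Suc K_def by (simp only: series_solution.simps)
    then show ?thesis using K by simp
  qed
  finally show ?thesis by simp
qed

text \<open>The divisor in the recursion eventually exceeds any given multiple of the other factors, so |c_n| K^n is bounded for every K. Taking K = 2 (|x| + 1) leaves a convergent geometric series.\<close>

lemma series_solution_entire:
  assumes \<nu>: "1 \<le> \<nu>" and g: "\<And>n. n0 \<le> n \<Longrightarrow> g n = 0"
  shows "entire_coeffs (series_solution \<nu> \<alpha> \<mu> g a b)"
  unfolding entire_coeffs_def
proof
  fix x :: real
  define c where "c = series_solution \<nu> \<alpha> \<mu> g a b"
  define K where "K = 2 * (\<bar>x\<bar> + 1)"
  have K: "1 \<le> K" "0 < K" by (auto simp: K_def)
  obtain n1 :: nat where n1: "\<bar>\<alpha>\<bar> * K + \<bar>\<mu>\<bar> * K\<^sup>2 \<le> real n1" using real_arch_simple by blast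
  define m where "m = max n0 n1"
  define A where "A = (\<lambda>n. \<bar>c n\<bar> * K ^ n)"
  define C where "C = max (A m) (A (Suc m))"
  have A_step: "A (Suc (Suc n)) \<le> max (A n) (A (Suc n))" if n: "m \<le> n" for n
  proof -
    define k1 k2 where "k1 = 4 * (real n + \<nu>) * real (Suc n)" and "k2 = 4 * (real (Suc n) + \<nu>) * real (Suc (Suc n))"
    have ka: "real (Suc n) \<le> k1"
    proof -
      have "1 * real (Suc n) \<le> (4 * (real n + \<nu>)) * real (Suc n)" using \<nu> by (intro mult_right_mono) auto
      then show ?thesis unfolding k1_def mult_1 .
    qed
    have kb: "real (Suc n) \<le> k2"
    proof -
      have "1 * real (Suc (Suc n)) \<le> (4 * (real (Suc n) + \<nu>)) * real (Suc (Suc n))" using \<nu> by (intro mult_right_mono) auto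
      moreover have "real (Suc n) \<le> real (Suc (Suc n))" by simp
      ultimately show ?thesis unfolding k2_def mult_1 by (rule order_trans[rotated])
    qed
    have k: "1 \<le> k1" "1 \<le> k2" using ka kb by auto
    have "g n = 0" using g n by (simp add: m_def)
    then have "c (Suc (Suc n)) = (- \<alpha> * (k1 * c (Suc n)) + \<mu> * c n) / (k1 * k2)"
      unfolding c_def k1_def k2_def by simp
    then have "\<bar>c (Suc (Suc n))\<bar> = \<bar>- \<alpha> * (k1 * c (Suc n)) + \<mu> * c n\<bar> / (k1 * k2)" using k by (simp add: abs_mult)
    also have "\<dots> \<le> (\<bar>\<alpha>\<bar> * (k1 * \<bar>c (Suc n)\<bar>) + \<bar>\<mu>\<bar> * \<bar>c n\<bar>) / (k1 * k2)"
      using k by (intro divide_right_mono order_trans[OF abs_triangle_ineq]) (auto simp: abs_mult)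
    finally have "A (Suc (Suc n)) \<le> (\<bar>\<alpha>\<bar> * (k1 * \<bar>c (Suc n)\<bar>) + \<bar>\<mu>\<bar> * \<bar>c n\<bar>) / (k1 * k2) * K ^ Suc (Suc n)"
      unfolding A_def using K by (intro mult_right_mono) auto
    also have "\<dots> = \<bar>\<alpha>\<bar> * K / k2 * A (Suc n) + \<bar>\<mu>\<bar> * K\<^sup>2 / (k1 * k2) * A n"
      using k by (simp add: A_def field_simps power2_eq_square)
    also have "\<dots> \<le> \<bar>\<alpha>\<bar> * K / k2 * max (A n) (A (Suc n)) + \<bar>\<mu>\<bar> * K\<^sup>2 / k2 * max (A n) (A (Suc n))"
    proof (intro add_mono mult_mono)
      show "\<bar>\<mu>\<bar> * K\<^sup>2 / (k1 * k2) \<le> \<bar>\<mu>\<bar> * K\<^sup>2 / k2"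
        using k by (intro divide_left_mono) auto
    qed (use k K in \<open>auto simp: A_def\<close>)
    also have "\<dots> = (\<bar>\<alpha>\<bar> * K + \<bar>\<mu>\<bar> * K\<^sup>2) / k2 * max (A n) (A (Suc n))" by (simp only: add_divide_distrib distrib_right)
    also have "\<dots> \<le> 1 * max (A n) (A (Suc n))"
    proof (rule mult_right_mono)
      have "real n1 \<le> real (Suc n)" using n by (simp add: m_def)
      then have "\<bar>\<alpha>\<bar> * K + \<bar>\<mu>\<bar> * K\<^sup>2 \<le> k2" using n1 kb by linarith
      then show "(\<bar>\<alpha>\<bar> * K + \<bar>\<mu>\<bar> * K\<^sup>2) / k2 \<le> 1" using k by simp
      show "0 \<le> max (A n) (A (Suc n))" using K by (auto simp: A_def le_max_iff_disj)
    qed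
    finally show ?thesis by simp
  qed
  have bound: "A n \<le> C \<and> A (Suc n) \<le> C" if "m \<le> n" for n
    using that
  proof (induction n rule: dec_induct)
    case base
    then show ?case by (simp add: C_def)
  next
    case (step n)
    then show ?case using A_step[of n] by auto
  qed
  show "summable (\<lambda>n. series_solution \<nu> \<alpha> \<mu> g a b n * x ^ n)"
  proof (rule summable_comparison_test')
    show "summable (\<lambda>n. C * (1 / 2) ^ n)" by (intro summable_mult summable_geometric) auto
    show "norm (series_solution \<nu> \<alpha> \<mu> g a b n * x ^ n) \<le> C * (1 / 2) ^ n" if "m \<le> n" for n
    proof -
      have "\<bar>x\<bar> ^ n \<le> (K / 2) ^ n" by (intro power_mono) (auto simp: K_def)
      then have "\<bar>c n\<bar> * \<bar>x\<bar> ^ n \<le> \<bar>c n\<bar> * (K / 2) ^ n" by (intro mult_left_mono) auto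
      also have "\<dots> = A n * (1 / 2) ^ n" by (simp add: A_def power_divide)
      also have "\<dots> \<le> C * (1 / 2) ^ n" using bound[OF that] by (intro mult_right_mono) auto
      finally show ?thesis by (simp add: c_def abs_mult power_abs)
    qed
  qed
qed

text \<open>The Fredholm alternative in two dimensions: off the branch curves the two clamped conditions are injective on the two-dimensional space of regular homogeneous solutions, hence they can be corrected to 0 for any particular solution.\<close>

lemma clamped_series_solvable:
  assumes \<nu>: "1 \<le> \<nu>" and R: "0 < R" and g: "\<And>n. n0 \<le> n \<Longrightarrow> g n = 0"
    and nb: "\<And>t p. 1 \<le> t \<Longrightarrow> 0 < p \<Longrightarrow>
      \<not> (\<alpha> = branch_alpha \<nu> R (real t * pi) p \<and> \<mu> = branch_lambda \<nu> R (real t * pi) p)"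
  shows "\<exists>c. entire_coeffs c \<and> psum c (R\<^sup>2) = 0 \<and> psum (diffs c) (R\<^sup>2) = 0 \<and>
     (\<forall>n. radial_op \<nu> (radial_op \<nu> c) n + \<alpha> * radial_op \<nu> c n - \<mu> * c n = g n)"
proof -
  define L where "L = (\<lambda>c n. radial_op \<nu> (radial_op \<nu> c) n + \<alpha> * radial_op \<nu> c n - \<mu> * c n)"
  have Llin: "L (\<lambda>n. a * c n + b * d n) n = a * L c n + b * L d n" for a b c d n
    unfolding L_def radial_op_lincomb by (simp add: algebra_simps)
  define h1 h2 s where "h1 = series_solution \<nu> \<alpha> \<mu> (\<lambda>_. 0) 1 0" and "h2 = series_solution \<nu> \<alpha> \<mu> (\<lambda>_. 0) 0 1"
    and "s = series_solution \<nu> \<alpha> \<mu> g 0 0"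
  have e: "entire_coeffs h1" "entire_coeffs h2" "entire_coeffs s"
    unfolding h1_def h2_def s_def using series_solution_entire[OF \<nu>, of 0 "\<lambda>_. 0"] series_solution_entire[OF \<nu> g] by auto
  have Lh: "L h1 n = 0" "L h2 n = 0" "L s n = g n" for n
    unfolding L_def h1_def h2_def s_def by (rule series_solution_rec[OF \<nu>])+
  define B0 B1 where "B0 = (\<lambda>c. psum c (R\<^sup>2))" and "B1 = (\<lambda>c. psum (diffs c) (R\<^sup>2))"
  have B: "B0 (\<lambda>n. a * c n + b * d n) = a * B0 c + b * B0 d" "B1 (\<lambda>n. a * c n + b * d n) = a * B1 c + b * B1 d"
    if "entire_coeffs c" "entire_coeffs d" for a b c d
    unfolding B0_def B1_def diffs_lincomb using that by (simp_all add: psum_lincomb entire_coeffs_diffs)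
  define D where "D = B0 h1 * B1 h2 - B1 h1 * B0 h2"
  have inj: "a = 0 \<and> b = 0" if "a * B0 h1 + b * B0 h2 = 0" "a * B1 h1 + b * B1 h2 = 0" for a b
  proof (rule ccontr)
    assume n: "\<not> (a = 0 \<and> b = 0)"
    define c where "c = (\<lambda>n. a * h1 n + b * h2 n)"
    have c01: "c 0 = a" "c 1 = b" by (auto simp: c_def h1_def h2_def)
    have "\<exists>t\<ge>1. \<exists>p>0. \<alpha> = branch_alpha \<nu> R (real t * pi) p \<and> \<mu> = branch_lambda \<nu> R (real t * pi) p"
    proof (rule clamped_series_on_branch[OF \<nu> R])
      show "entire_coeffs c" unfolding c_def by (intro entire_coeffs_lincomb e)
      show "radial_op \<nu> (radial_op \<nu> c) n + \<alpha> * radial_op \<nu> c n = \<mu> * c n" for n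
        using Llin[of a h1 b h2 n] Lh unfolding c_def[symmetric] L_def by simp
      show "c 0 \<noteq> 0 \<or> c 1 \<noteq> 0" using c01 n by auto
      show "psum c (R\<^sup>2) = 0" "psum (diffs c) (R\<^sup>2) = 0"
        using B[OF e(1,2), of a b] that unfolding B0_def B1_def c_def by auto
    qed
    then show False using nb by blast
  qed
  have D0: "D \<noteq> 0"
  proof
    assume "D = 0"
    then have "B1 h2 * B0 h1 + (- B1 h1) * B0 h2 = 0" "B1 h2 * B1 h1 + (- B1 h1) * B1 h2 = 0"
      "(- B0 h2) * B0 h1 + B0 h1 * B0 h2 = 0" "(- B0 h2) * B1 h1 + B0 h1 * B1 h2 = 0"
      by (simp_all add: D_def algebra_simps)
    then have "B1 h2 = 0 \<and> - B1 h1 = 0" "- B0 h2 = 0 \<and> B0 h1 = 0"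
      using inj[of "B1 h2" "- B1 h1"] inj[of "- B0 h2" "B0 h1"] by blast+
    then have "(1::real) = 0 \<and> (0::real) = 0" using inj[of 1 0] by simp
    then show False by simp
  qed
  define a b where "a = - (B0 s * B1 h2 - B1 s * B0 h2) / D" and "b = - (B0 h1 * B1 s - B1 h1 * B0 s) / D"
  have sol: "a * B0 h1 + b * B0 h2 = - B0 s" "a * B1 h1 + b * B1 h2 = - B1 s"
    using D0 by (simp_all add: a_def b_def field_simps) (simp_all add: D_def algebra_simps)
  define h where "h = (\<lambda>n. a * h1 n + b * h2 n)"
  have eh: "entire_coeffs h" unfolding h_def by (intro entire_coeffs_lincomb e)
  define c where "c = (\<lambda>n. 1 * h n + 1 * s n)"
  have "entire_coeffs c" unfolding c_def by (intro entire_coeffs_lincomb e eh)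
  moreover have "L c n = g n" for n
    unfolding c_def Llin h_def using Lh by simp
  moreover have "B0 c = 0" "B1 c = 0"
    using sol B[OF eh e(3), of 1 1] B[OF e(1,2), of a b] unfolding c_def[symmetric] h_def[symmetric] by simp_all
  ultimately show ?thesis unfolding L_def B0_def B1_def by blast
qed

section \<open>Green's formula, boundary decay and boundary strips\<close>

lemma laplacian_zero: "laplacian (\<lambda>_. 0) x = 0"
proof -
  have "partial b (\<lambda>_. 0) = (\<lambda>_. 0)" for b :: 'a by (simp add: partial_def fun_eq_iff)
  then show ?thesis by (simp add: laplacian_def)
qed

lemma integrable_compact_support:
  fixes f :: "'a::euclidean_space \<Rightarrow> real"
  assumes "continuous_on UNIV f" "\<And>x. s < norm x \<Longrightarrow> f x = 0"
  shows "integrable lborel f"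
proof -
  have "integrable lborel (\<lambda>x. indicator (cball 0 s) x *\<^sub>R f x)"
    by (rule borel_integrable_compact[OF compact_cball continuous_on_subset[OF assms(1) subset_UNIV]])
  moreover have "(\<lambda>x. indicator (cball 0 s) x *\<^sub>R f x) = f"
    using assms(2) by (auto simp: fun_eq_iff indicator_def not_le)
  ultimately show ?thesis by simp
qed

lemma lborel_integral_translate:
  fixes f :: "'a::euclidean_space \<Rightarrow> real"
  assumes "continuous_on UNIV f"
  shows "(\<integral>x. f (c + x) \<partial>lborel) = (\<integral>x. f x \<partial>lborel)"
proof -
  have "(\<integral>x. f x \<partial>distr lborel borel ((+) c)) = (\<integral>x. f (c + x) \<partial>lborel)"
    by (rule integral_distr) (use borel_measurable_continuous_onI[OF assms] in auto)
  then show ?thesis by (simp add: lborel_distr_plus)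
qed

text \<open>The difference quotients of F have integral zero by translation invariance, and they converge dominatedly to the derivative.\<close>

lemma integral_partial_zero:
  fixes F :: "'a::euclidean_space \<Rightarrow> real"
  assumes F: "\<And>x. F differentiable (at x)" and c: "continuous_on UNIV (partial b F)" and b: "b \<in> Basis"
    and s: "\<And>x. s < norm x \<Longrightarrow> F x = 0"
  shows "(\<integral>x. partial b F x \<partial>lborel) = 0"
proof -
  have Fc: "continuous_on UNIV F"
    using F differentiable_imp_continuous_within continuous_at_imp_continuous_on by blast
  define h where "h = (\<lambda>n. 1 / real (Suc n))"
  have h: "0 < h n" "h n \<le> 1" for n by (auto simp: h_def)
  have hlim: "h \<longlonglongrightarrow> 0" unfolding h_def by real_asymp
  define D where "D = (\<lambda>n x. (F (h n *\<^sub>R b + x) - F x) / h n)"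
  have dir: "((\<lambda>t. F (t *\<^sub>R b + x)) has_real_derivative partial b F (t *\<^sub>R b + x)) (at t)" for t x
  proof -
    have "((\<lambda>t. F (t *\<^sub>R b + x)) has_derivative (\<lambda>d. frechet_derivative F (at (t *\<^sub>R b + x)) (d *\<^sub>R b))) (at t)"
      by (rule has_derivative_compose[of "\<lambda>t. t *\<^sub>R b + x"]) (use F frechet_derivative_works in \<open>auto intro!: derivative_eq_intros\<close>)
    moreover have "linear (frechet_derivative F (at (t *\<^sub>R b + x)))"
      using F linear_frechet_derivative by blast
    ultimately show ?thesis
      unfolding has_field_derivative_def by (simp add: linear_scale partial_def mult.commute[of _ "frechet_derivative F (at (t *\<^sub>R b + x)) b"])
  qed
  have mv: "\<exists>z. 0 < z \<and> z < h n \<and> D n x = partial b F (z *\<^sub>R b + x)" for n x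
  proof -
    obtain z where "0 < z" "z < h n" "F (h n *\<^sub>R b + x) - F (0 *\<^sub>R b + x) = (h n - 0) * partial b F (z *\<^sub>R b + x)"
      using MVT2[of 0 "h n" "\<lambda>t. F (t *\<^sub>R b + x)" "\<lambda>t. partial b F (t *\<^sub>R b + x)"] h(1)[of n] dir by blast
    then show ?thesis using h[of n] by (auto simp: D_def)
  qed
  have int0: "(\<integral>x. D n x \<partial>lborel) = 0" for n
  proof -
    have i: "integrable lborel F" "integrable lborel (\<lambda>x. F (h n *\<^sub>R b + x))"
    proof -
      show "integrable lborel F" by (rule integrable_compact_support[OF Fc s])
      show "integrable lborel (\<lambda>x. F (h n *\<^sub>R b + x))"
      proof (rule integrable_compact_support[of _ "s + 1"])
        show "continuous_on UNIV (\<lambda>x. F (h n *\<^sub>R b + x))"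
          by (rule continuous_on_compose2[OF Fc]) (auto intro!: continuous_intros)
        fix x :: 'a assume "s + 1 < norm x"
        moreover have "norm x \<le> norm (h n *\<^sub>R b + x) + norm (h n *\<^sub>R b)"
          using norm_triangle_ineq4[of "h n *\<^sub>R b + x" "h n *\<^sub>R b"] by simp
        moreover have "norm (h n *\<^sub>R b) \<le> 1" using h[of n] b by simp
        ultimately have "s < norm (h n *\<^sub>R b + x)" by linarith
        then show "F (h n *\<^sub>R b + x) = 0" by (rule s)
      qed
    qed
    show ?thesis unfolding D_def using i lborel_integral_translate[OF Fc, of "h n *\<^sub>R b"] by simp
  qed
  have pz: "partial b F x = 0" if "s < norm x" for x
  proof -
    have "open {x::'a. s < norm x}" by (intro open_Collect_less continuous_intros)
    then have "partial b F x = partial b (\<lambda>_. 0) x"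
      by (rule partial_cong_open) (use that s in auto)
    then show ?thesis by (simp add: partial_def)
  qed
  obtain M where M: "\<And>x. norm x \<le> s + 2 \<Longrightarrow> \<bar>partial b F x\<bar> \<le> M"
  proof -
    have "compact (partial b F ` cball 0 (s + 2))"
      by (intro compact_continuous_image continuous_on_subset[OF c]) auto
    then have "bounded (partial b F ` cball 0 (s + 2))" by (rule compact_imp_bounded)
    then obtain M where "\<forall>y\<in>partial b F ` cball 0 (s + 2). norm y \<le> M" unfolding bounded_iff by blast
    then show ?thesis by (intro that[of M]) auto
  qed
  have bd: "norm (D n x) \<le> M * indicator (cball 0 (s + 1)) x" for n x
  proof -
    obtain z where z: "0 < z" "z < h n" "D n x = partial b F (z *\<^sub>R b + x)" using mv by blast
    have nz: "norm (z *\<^sub>R b) \<le> 1" using z h[of n] b by simp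
    have n1: "norm x \<le> norm (z *\<^sub>R b + x) + norm (z *\<^sub>R b)" "norm (z *\<^sub>R b + x) \<le> norm (z *\<^sub>R b) + norm x"
      using norm_triangle_ineq4[of "z *\<^sub>R b + x" "z *\<^sub>R b"] norm_triangle_ineq[of "z *\<^sub>R b" x] by simp_all
    show ?thesis
    proof (cases "norm x \<le> s + 1")
      case True
      then show ?thesis using M[of "z *\<^sub>R b + x"] n1 nz z by simp
    next
      case False
      then have "s < norm (z *\<^sub>R b + x)" using n1 nz by linarith
      then show ?thesis using pz z False by simp
    qed
  qed
  have "(\<lambda>n. \<integral>x. D n x \<partial>lborel) \<longlonglongrightarrow> (\<integral>x. partial b F x \<partial>lborel)"
  proof (rule integral_dominated_convergence[where w = "\<lambda>x::'a. M * indicator (cball 0 (s + 1)) x"])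
    show "partial b F \<in> borel_measurable lborel" using borel_measurable_continuous_onI[OF c] by simp
    have "continuous_on UNIV (\<lambda>x. F (h n *\<^sub>R b + x))" for n
      by (rule continuous_on_compose2[OF Fc]) (auto intro!: continuous_intros)
    then have "continuous_on UNIV (D n)" for n
      unfolding D_def using h(1)[of n] Fc by (intro continuous_intros) auto
    then show "D n \<in> borel_measurable lborel" for n using borel_measurable_continuous_onI[of "D n"] by simp
    show "integrable lborel (\<lambda>x::'a. M * indicator (cball 0 (s + 1)) x)"
      using emeasure_lborel_cball_finite[of "0::'a" "s + 1"] by (intro integrable_mult_right) (simp add: integrable_indicator_iff)
    show "AE x in lborel. (\<lambda>n. D n x) \<longlonglongrightarrow> partial b F x"
    proof (rule AE_I2)
      fix x :: 'a
      have "(\<lambda>t. (F (t *\<^sub>R b + x) - F (0 *\<^sub>R b + x)) / (t - 0)) \<midarrow>0\<rightarrow> partial b F (0 *\<^sub>R b + x)"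
        using dir[of x 0] unfolding has_field_derivative_iff .
      then have "(\<lambda>t. (F (t *\<^sub>R b + x) - F x) / t) \<midarrow>0\<rightarrow> partial b F x" by simp
      moreover have "filterlim h (at 0) sequentially"
        using hlim h(1) by (intro filterlim_atI) (auto intro!: always_eventually simp: less_imp_neq[symmetric])
      ultimately show "(\<lambda>n. D n x) \<longlonglongrightarrow> partial b F x"
        unfolding D_def by (rule filterlim_compose)
    qed
    show "AE x in lborel. norm (D n x) \<le> M * indicator (cball 0 (s + 1)) x" for n
      using bd by (intro AE_I2)
  qed
  then have "(\<lambda>n. 0::real) \<longlonglongrightarrow> (\<integral>x. partial b F x \<partial>lborel)" unfolding int0 .
  then show ?thesis using LIMSEQ_unique tendsto_const by blast
qed

lemma continuous_on_glue:
  fixes f :: "'a::euclidean_space \<Rightarrow> real"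
  assumes "s < R" "continuous_on (ball 0 R) f" "\<And>x. s < norm x \<Longrightarrow> f x = 0"
  shows "continuous_on UNIV f"
proof -
  have o: "open {x::'a. s < norm x}" by (intro open_Collect_less continuous_intros)
  have "continuous_on {x::'a. s < norm x} f"
    by (rule continuous_on_eq[OF continuous_on_const[of _ 0]]) (use assms(3) in auto)
  then have "continuous_on (ball 0 R \<union> {x. s < norm x}) f"
    by (intro continuous_on_open_Un assms(2) open_ball o)
  moreover have "ball 0 R \<union> {x::'a. s < norm x} = UNIV" using assms(1) by auto
  ultimately show ?thesis by simp
qed

text \<open>Nothing is known about u outside the open ball, but \<psi> vanishes beyond the radius s < R, so that the field \<psi> \<nabla>u - u \<nabla>\<psi> is differentiable on the whole space and has compact support.\<close>

lemma green_compact_support: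
  fixes u \<psi> :: "'a::euclidean_space \<Rightarrow> real"
  assumes sR: "s < R" and u: "C_on 2 u (ball 0 R)" and \<psi>: "C_on 2 \<psi> UNIV" and z: "\<And>x. s < norm x \<Longrightarrow> \<psi> x = 0"
  shows "(\<integral>x. \<psi> x * laplacian u x \<partial>lborel) = (\<integral>x. u x * laplacian \<psi> x \<partial>lborel)"
    and "integrable lborel (\<lambda>x. \<psi> x * laplacian u x)" and "integrable lborel (\<lambda>x. u x * laplacian \<psi> x)"
proof -
  have u2: "C_on (Suc (Suc 0)) u (ball 0 R)" and p2: "C_on (Suc (Suc 0)) \<psi> UNIV" using u \<psi> by (simp_all add: numeral_2_eq_2)
  have p2b: "C_on (Suc (Suc 0)) \<psi> (ball 0 R)" by (rule C_on_subset[OF p2]) simp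
  have o: "open {x::'a. s < norm x}" by (intro open_Collect_less continuous_intros)
  have pz: "partial e \<psi> x = 0" if "s < norm x" for x e
  proof -
    have "partial e \<psi> x = partial e (\<lambda>_. 0) x"
      by (rule partial_cong_open[OF o]) (use that z in auto)
    then show ?thesis by (simp add: partial_def)
  qed
  have lz: "laplacian \<psi> x = 0" if "s < norm x" for x
  proof -
    have "laplacian \<psi> x = laplacian (\<lambda>_. 0) x"
      by (rule laplacian_cong_open[OF o]) (use that z in auto)
    then show ?thesis by (simp add: laplacian_zero)
  qed
  have c0: "C_on 0 (\<lambda>x. \<psi> x * laplacian u x) (ball 0 R)" "C_on 0 (\<lambda>x. u x * laplacian \<psi> x) (ball 0 R)"
    by (intro C_on_mult open_ball C_on_laplacian u2 p2b C_on_mono[OF u2] C_on_mono[OF p2b], simp)+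
  have c: "continuous_on UNIV (\<lambda>x. \<psi> x * laplacian u x)" "continuous_on UNIV (\<lambda>x. u x * laplacian \<psi> x)"
    by (rule continuous_on_glue[OF sR C_on_continuous[OF c0(1)]], simp add: z,
        rule continuous_on_glue[OF sR C_on_continuous[OF c0(2)]], simp add: lz)
  show i1: "integrable lborel (\<lambda>x. \<psi> x * laplacian u x)"
    by (rule integrable_compact_support[OF c(1), of s]) (simp add: z)
  show i2: "integrable lborel (\<lambda>x. u x * laplacian \<psi> x)"
    by (rule integrable_compact_support[OF c(2), of s]) (simp add: lz)
  define F where "F = (\<lambda>e x. \<psi> x * partial e u x - u x * partial e \<psi> x)"
  have Fz: "F e x = 0" if "s < norm x" for e x using that z pz by (simp add: F_def)
  have F1: "C_on 1 (F e) (ball 0 R)" if e: "e \<in> Basis" for e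
    unfolding F_def One_nat_def
    by (intro C_on_diff C_on_mult open_ball C_on_partial[OF _ e] u2 p2b C_on_SucD[OF u2] C_on_SucD[OF p2b])
  have dF: "F e differentiable (at x)" if e: "e \<in> Basis" for e x
  proof (cases "norm x < R")
    case True
    then show ?thesis using C_on_differentiable_at[of 0 "F e" "ball 0 R" x] F1[OF e] by simp
  next
    case False
    then have "s < norm x" using sR by simp
    have "((\<lambda>_. 0) has_derivative (\<lambda>_. 0)) (at x)" by simp
    then have "(F e has_derivative (\<lambda>_. 0)) (at x)"
      by (rule has_derivative_transform_within_open[OF _ o]) (use \<open>s < norm x\<close> Fz in auto)
    then show ?thesis by (auto simp: differentiable_def)
  qed
  have pF: "partial e (F e) x = \<psi> x * partial e (partial e u) x - u x * partial e (partial e \<psi>) x"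
    if e: "e \<in> Basis" and x: "x \<in> ball 0 R" for e x
  proof -
    note d = C_on_differentiable_at[OF u2 open_ball x] C_on_differentiable_at[OF p2b open_ball x]
      C_on_differentiable_at[OF C_on_partial[OF u2 e] open_ball x] C_on_differentiable_at[OF C_on_partial[OF p2b e] open_ball x]
    have dm: "(\<lambda>x. (-1) * (u x * partial e \<psi> x)) differentiable (at x)" "(\<lambda>x. u x * partial e \<psi> x) differentiable (at x)"
      "(\<lambda>x. \<psi> x * partial e u x) differentiable (at x)" "(\<lambda>x::'a. -1::real) differentiable (at x)"
      by (intro differentiable_mult d differentiable_const)+
    have "F e = (\<lambda>x. \<psi> x * partial e u x + (-1) * (u x * partial e \<psi> x))" by (simp add: F_def)
    then have "partial e (F e) x = partial e (\<lambda>x. \<psi> x * partial e u x) x + partial e (\<lambda>x. (-1) * (u x * partial e \<psi> x)) x"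
      using partial_add[OF dm(3,1)] by simp
    also have "partial e (\<lambda>x. (-1) * (u x * partial e \<psi> x)) x = - partial e (\<lambda>x. u x * partial e \<psi> x) x"
      using partial_mult[OF dm(4,2)] by (simp add: partial_def)
    finally show ?thesis using partial_mult[OF d(2,3)] partial_mult[OF d(1,4)] by simp
  qed
  have pFz: "partial e (F e) x = 0" if "s < norm x" for x e
  proof -
    have "partial e (F e) x = partial e (\<lambda>_. 0) x"
      by (rule partial_cong_open[OF o]) (use that Fz in auto)
    then show ?thesis by (simp add: partial_def)
  qed
  have pFc: "continuous_on UNIV (partial e (F e))" if e: "e \<in> Basis" for e
    by (rule continuous_on_glue[OF sR _ pFz]) (use F1[OF e] e in simp_all)
  have sumF: "\<psi> x * laplacian u x - u x * laplacian \<psi> x = (\<Sum>e\<in>Basis. partial e (F e) x)" for x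
  proof (cases "norm x < R")
    case True
    then show ?thesis by (simp add: pF laplacian_def sum_distrib_left sum_subtractf)
  next
    case False
    then have "s < norm x" using sR by simp
    then show ?thesis using z lz pFz by simp
  qed
  have "(\<integral>x. \<psi> x * laplacian u x - u x * laplacian \<psi> x \<partial>lborel) = (\<Sum>e\<in>Basis. \<integral>x. partial e (F e) x \<partial>lborel)"
    unfolding sumF by (rule Bochner_Integration.integral_sum) (rule integrable_compact_support[OF pFc pFz])
  also have "\<dots> = 0"
    by (rule sum.neutral) (use integral_partial_zero[OF dF pFc _ Fz] in blast)
  finally show "(\<integral>x. \<psi> x * laplacian u x \<partial>lborel) = (\<integral>x. u x * laplacian \<psi> x \<partial>lborel)" using i1 i2 by simp
qed

lemma plate_weak_form:
  fixes u \<psi> :: "'a::euclidean_space \<Rightarrow> real"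
  assumes sR: "s < R" and u: "C_on 4 u (ball 0 R)" and \<psi>: "C_on 4 \<psi> UNIV" and z: "\<And>x. s < norm x \<Longrightarrow> \<psi> x = 0"
    and eq: "\<And>x. x \<in> ball 0 R \<Longrightarrow> laplacian (laplacian u) x + \<alpha> * laplacian u x = \<mu> * u x"
  shows "(\<integral>x. u x * (laplacian (laplacian \<psi>) x + \<alpha> * laplacian \<psi> x - \<mu> * \<psi> x) \<partial>lborel) = 0"
proof -
  have u4: "C_on (Suc (Suc 2)) u (ball 0 R)" and p4: "C_on (Suc (Suc 2)) \<psi> UNIV" using u \<psi> by (simp_all add: numeral_eq_Suc)
  have lu: "C_on 2 (laplacian u) (ball 0 R)" by (rule C_on_laplacian[OF open_ball u4])
  have lp: "C_on 2 (laplacian \<psi>) UNIV" by (rule C_on_laplacian[OF open_UNIV p4])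
  have u2: "C_on 2 u (ball 0 R)" by (rule C_on_mono[OF u]) simp
  have p2: "C_on 2 \<psi> UNIV" by (rule C_on_mono[OF \<psi>]) simp
  have o: "open {x::'a. s < norm x}" by (intro open_Collect_less continuous_intros)
  have lz: "laplacian \<psi> x = 0" if "s < norm x" for x
  proof -
    have "laplacian \<psi> x = laplacian (\<lambda>_. 0) x"
      by (rule laplacian_cong_open[OF o]) (use that z in auto)
    then show ?thesis by (simp add: laplacian_zero)
  qed
  note G1 = green_compact_support[OF sR lu p2 z] and G2 = green_compact_support[OF sR u2 lp lz]
    and G3 = green_compact_support[OF sR u2 p2 z]
  have i0: "integrable lborel (\<lambda>x. \<psi> x * u x)"
  proof (rule integrable_compact_support[of _ s])
    have "C_on 0 (\<lambda>x. \<psi> x * u x) (ball 0 R)"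
      by (intro C_on_mult open_ball C_on_mono[OF u] C_on_subset[OF C_on_mono[OF \<psi>]]) auto
    then show "continuous_on UNIV (\<lambda>x. \<psi> x * u x)"
      by (intro continuous_on_glue[OF sR]) (auto simp: z)
  qed (simp add: z)
  have swap: "(\<integral>x. \<psi> x * laplacian (laplacian u) x \<partial>lborel) = (\<integral>x. u x * laplacian (laplacian \<psi>) x \<partial>lborel)"
    using G1(1) G2(1) by (simp add: mult.commute)
  have "(\<integral>x. u x * (laplacian (laplacian \<psi>) x + \<alpha> * laplacian \<psi> x - \<mu> * \<psi> x) \<partial>lborel) =
     (\<integral>x. u x * laplacian (laplacian \<psi>) x + \<alpha> * (u x * laplacian \<psi> x) - \<mu> * (\<psi> x * u x) \<partial>lborel)"
    by (rule arg_cong[where f = "integral\<^sup>L lborel"]) (auto simp: algebra_simps)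
  also have "\<dots> = (\<integral>x. u x * laplacian (laplacian \<psi>) x \<partial>lborel) + \<alpha> * (\<integral>x. u x * laplacian \<psi> x \<partial>lborel) - \<mu> * (\<integral>x. \<psi> x * u x \<partial>lborel)"
    using G2(3) G3(3) i0 by simp
  also have "\<dots> = (\<integral>x. \<psi> x * laplacian (laplacian u) x \<partial>lborel) + \<alpha> * (\<integral>x. \<psi> x * laplacian u x \<partial>lborel) - \<mu> * (\<integral>x. \<psi> x * u x \<partial>lborel)"
    using swap G3(1) by simp
  also have "\<dots> = (\<integral>x. \<psi> x * laplacian (laplacian u) x + \<alpha> * (\<psi> x * laplacian u x) - \<mu> * (\<psi> x * u x) \<partial>lborel)"
    using G1(2) G3(2) i0 by simp
  also have "\<dots> = (\<integral>x. 0 \<partial>(lborel :: 'a measure))"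
  proof (rule arg_cong[where f = "integral\<^sup>L lborel"], rule ext)
    fix x :: 'a
    show "\<psi> x * laplacian (laplacian u) x + \<alpha> * (\<psi> x * laplacian u x) - \<mu> * (\<psi> x * u x) = 0"
    proof (cases "norm x < R")
      case True
      then have "laplacian (laplacian u) x + \<alpha> * laplacian u x - \<mu> * u x = 0" using eq[of x] by simp
      then have "\<psi> x * (laplacian (laplacian u) x + \<alpha> * laplacian u x - \<mu> * u x) = 0" by simp
      then show ?thesis by (simp add: algebra_simps)
    next
      case False
      then show ?thesis using z[of x] sR by simp
    qed
  qed
  finally show ?thesis by simp
qed

text \<open>The gradient of u is uniformly continuous on the closed ball and its radial component vanishes on the sphere. The mean value theorem along a ray therefore makes u small compared with the distance to the sphere, uniformly in the direction.\<close>

lemma clamped_boundary_decay: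
  fixes u :: "'a::euclidean_space \<Rightarrow> real"
  assumes R: "0 < R" and u: "C1_cball R u"
    and bc: "\<And>x. norm x = R \<Longrightarrow> u x = 0 \<and> has_normal_derivative R u x 0" and e: "0 < e"
  shows "\<exists>\<delta>>0. \<forall>x. R - \<delta> < norm x \<longrightarrow> norm x \<le> R \<longrightarrow> \<bar>u x\<bar> \<le> e * (R - norm x)"
proof -
  obtain G where Gc: "continuous_on (cball 0 R) G"
    and G: "\<And>x. x \<in> cball 0 R \<Longrightarrow> (u has_derivative (\<lambda>h. G x \<bullet> h)) (at x within cball 0 R)"
    using u unfolding C1_cball_def by blast
  have "uniformly_continuous_on (cball 0 R) G"
    by (rule compact_uniformly_continuous[OF Gc compact_cball])
  then obtain d where d: "0 < d" "\<And>x y. x \<in> cball 0 R \<Longrightarrow> y \<in> cball 0 R \<Longrightarrow> dist x y < d \<Longrightarrow> dist (G x) (G y) < e"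
    unfolding uniformly_continuous_on_def using e by metis
  define \<delta> where "\<delta> = min d R"
  have "\<bar>u x\<bar> \<le> e * (R - norm x)" if x: "R - \<delta> < norm x" "norm x \<le> R" for x
  proof (cases "norm x = R")
    case True
    then show ?thesis using bc[of x] by simp
  next
    case False
    then have xl: "norm x < R" "0 < norm x" using x by (auto simp: \<delta>_def)
    define \<theta> where "\<theta> = x /\<^sub>R norm x"
    have \<theta>: "norm \<theta> = 1" "x = norm x *\<^sub>R \<theta>" using xl by (auto simp: \<theta>_def)
    have inb: "t *\<^sub>R \<theta> \<in> cball 0 R" if "0 \<le> t" "t \<le> R" for t using that \<theta> by simp
    have zero: "G (R *\<^sub>R \<theta>) \<bullet> \<theta> = 0"
    proof -
      let ?y = "R *\<^sub>R \<theta>"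
      have ny: "norm ?y = R" using \<theta> R by simp
      have nt: "?y /\<^sub>R R = \<theta>" using R by simp
      let ?S = "{- R<..<0::real}"
      have 1: "((\<lambda>t. u (?y + t *\<^sub>R \<theta>)) has_vector_derivative 0) (at 0 within ?S)"
      proof (rule has_vector_derivative_within_subset)
        show "((\<lambda>t. u (?y + t *\<^sub>R \<theta>)) has_vector_derivative 0) (at_left 0)"
          using conjunct2[OF bc[OF ny]]
          unfolding has_normal_derivative_def nt has_real_derivative_iff_has_vector_derivative .
      qed auto
      have A: "((\<lambda>t. ?y + t *\<^sub>R \<theta>) has_derivative (\<lambda>t. t *\<^sub>R \<theta>)) (at 0 within ?S)"
        by (auto intro!: derivative_eq_intros)
      have B: "(\<lambda>t. ?y + t *\<^sub>R \<theta>) ` ?S \<subseteq> cball 0 R"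
      proof
        fix z assume "z \<in> (\<lambda>t. ?y + t *\<^sub>R \<theta>) ` ?S"
        then obtain t where "t \<in> ?S" "z = (R + t) *\<^sub>R \<theta>" by (auto simp: scaleR_left_distrib)
        then show "z \<in> cball 0 R" using inb[of "R + t"] by auto
      qed
      have C: "(u has_derivative (\<lambda>h. G ?y \<bullet> h)) (at (?y + 0 *\<^sub>R \<theta>) within cball 0 R)"
        using G[OF inb[of R]] R by simp
      have "((\<lambda>t. u (?y + t *\<^sub>R \<theta>)) has_derivative (\<lambda>t. G ?y \<bullet> (t *\<^sub>R \<theta>))) (at 0 within ?S)"
        by (rule has_derivative_in_compose[OF A has_derivative_subset[OF C B]])
      then have 2: "((\<lambda>t. u (?y + t *\<^sub>R \<theta>)) has_vector_derivative (G ?y \<bullet> \<theta>)) (at 0 within ?S)"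
        unfolding has_vector_derivative_def by simp
      have "at (0::real) within ?S \<noteq> bot"
        using R by (simp add: trivial_limit_within islimpt_greaterThanLessThan2)
      then show ?thesis using vector_derivative_unique_within[OF _ 2 1] by simp
    qed
    define g where "g = (\<lambda>t. u (t *\<^sub>R \<theta>))"
    have dg: "(g has_real_derivative G (t *\<^sub>R \<theta>) \<bullet> \<theta>) (at t)" if t: "0 < t" "t < R" for t
    proof -
      have "t *\<^sub>R \<theta> \<in> interior (cball 0 R)" using t \<theta> by simp
      then have "(u has_derivative (\<lambda>h. G (t *\<^sub>R \<theta>) \<bullet> h)) (at (t *\<^sub>R \<theta>))"
        using G[OF inb[of t]] t at_within_interior by fastforce
      then have "(g has_derivative (\<lambda>s. G (t *\<^sub>R \<theta>) \<bullet> (s *\<^sub>R \<theta>))) (at t)"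
        unfolding g_def by (rule has_derivative_compose[rotated]) (auto intro!: derivative_eq_intros)
      then show ?thesis unfolding has_field_derivative_def by (rule has_derivative_eq_rhs) (auto simp: mult.commute)
    qed
    have abs_t: "\<bar>t\<bar> = t" if "norm x \<le> t" for t using that norm_ge_zero[of x] by linarith
    have gc: "continuous_on {norm x..R} g"
      unfolding g_def
      by (rule continuous_on_compose2[OF C1_cball_continuous[OF u]]) (use \<theta>(1) in \<open>auto intro!: continuous_intros simp: abs_t\<close>)
    have df: "g differentiable (at t)" if "norm x < t" "t < R" for t
      using dg[of t] that xl(2) unfolding real_differentiable_def by (meson less_trans)
    obtain l z where z: "norm x < z" "z < R" "(g has_real_derivative l) (at z)" "g R - g (norm x) = (R - norm x) * l"
      using MVT[OF xl(1) gc df] by blast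
    have "l = G (z *\<^sub>R \<theta>) \<bullet> \<theta>" using DERIV_unique[OF z(3) dg] z xl by auto
    also have "\<dots> = (G (z *\<^sub>R \<theta>) - G (R *\<^sub>R \<theta>)) \<bullet> \<theta>" using zero by (simp add: inner_diff_left)
    finally have "\<bar>l\<bar> \<le> norm (G (z *\<^sub>R \<theta>) - G (R *\<^sub>R \<theta>))"
      using Cauchy_Schwarz_ineq2[of "G (z *\<^sub>R \<theta>) - G (R *\<^sub>R \<theta>)" \<theta>] \<theta> by simp
    also have "\<dots> < e"
    proof -
      have "dist (z *\<^sub>R \<theta>) (R *\<^sub>R \<theta>) = R - z"
        using z \<theta> by (simp add: dist_norm flip: scaleR_left_diff_distrib)
      moreover have "R - z < d" using x(1) z(1) by (simp add: \<delta>_def)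
      ultimately show ?thesis using d(2)[of "z *\<^sub>R \<theta>" "R *\<^sub>R \<theta>"] inb[of z] inb[of R] z xl by (simp add: dist_norm)
    qed
    finally have l: "\<bar>l\<bar> < e" .
    have "g R = 0" using bc[of "R *\<^sub>R \<theta>"] \<theta> R by (simp add: g_def)
    moreover have "g (norm x) = u x" using \<theta>(2) by (simp add: g_def)
    ultimately have "\<bar>u x\<bar> = (R - norm x) * \<bar>l\<bar>" using z(4) xl by (metis abs_minus_cancel abs_mult abs_of_pos diff_0 diff_gt_0_iff_gt)
    also have "\<dots> \<le> (R - norm x) * e" using l xl by (intro mult_left_mono) auto
    finally show ?thesis by (simp add: mult.commute)
  qed
  moreover have "0 < \<delta>" using d R by (simp add: \<delta>_def)
  ultimately show ?thesis by blast
qed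

text \<open>Bernoulli's inequality bounds R^N - a^N by a multiple of the width of the strip.\<close>

lemma strip_measure_bound:
  assumes R: "0 < R" and a: "0 \<le> a" "a \<le> R"
  shows "measure lborel (cball 0 R - ball (0::'a::euclidean_space) a)
    \<le> unit_ball_vol (real DIM('a)) * R ^ DIM('a) * real DIM('a) / R * (R - a)"
proof -
  let ?N = "DIM('a)"
  have "measure lborel (cball 0 R - ball (0::'a) a) = measure lborel (cball (0::'a) R) - measure lborel (ball (0::'a) a)"
    by (rule measure_Diff) (use a emeasure_lborel_cball_finite[of "0::'a" R] in \<open>auto simp: less_top\<close>)
  also have "\<dots> = unit_ball_vol (real ?N) * (R ^ ?N - a ^ ?N)"
    using a R content_cball[of R "0::'a"] content_ball[of a "0::'a"] by (simp add: right_diff_distrib)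
  also have "\<dots> \<le> unit_ball_vol (real ?N) * (R ^ ?N * (real ?N * (1 - a / R)))"
  proof (rule mult_left_mono)
    have "1 + real ?N * (a / R - 1) \<le> (1 + (a / R - 1)) ^ ?N"
      by (rule Bernoulli_inequality) (use a R in simp)
    then have "R ^ ?N * (1 + real ?N * (a / R - 1)) \<le> R ^ ?N * (a / R) ^ ?N" using R by (intro mult_left_mono) auto
    also have "\<dots> = a ^ ?N" using R by (simp add: power_divide)
    finally show "R ^ ?N - a ^ ?N \<le> R ^ ?N * (real ?N * (1 - a / R))" by (simp add: algebra_simps)
  qed simp
  also have "\<dots> = unit_ball_vol (real ?N) * R ^ ?N * real ?N / R * (R - a)" using R by (simp add: field_simps)
  finally show ?thesis .
qed

section \<open>Cutting a clamped radial solution off near the sphere\<close>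

lemma C_on_real_chain:
  "C_on n f (UNIV::real set) \<Longrightarrow> \<exists>F. F 0 = f \<and> (\<forall>i<n. \<forall>x. (F i has_real_derivative F (Suc i) x) (at x)) \<and> continuous_on UNIV (F n)"
proof (induction n arbitrary: f)
  case 0
  then show ?case by (intro exI[of _ "\<lambda>_. f"]) simp
next
  case (Suc n)
  then have "C_on n (partial 1 f) UNIV" by simp
  then obtain F where F: "F 0 = partial 1 f" "\<And>i x. i < n \<Longrightarrow> (F i has_real_derivative F (Suc i) x) (at x)" "continuous_on UNIV (F n)"
    using Suc.IH by blast
  have "(f has_real_derivative partial 1 f x) (at x)" for x
  proof -
    have d: "f differentiable (at x)" using C_on_differentiable_at[OF Suc.prems] by simp
    then show ?thesis unfolding partial_real[OF d] using DERIV_deriv_iff_real_differentiable by blast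
  qed
  then have "(case_nat f F i has_real_derivative case_nat f F (Suc i) x) (at x)" if "i < Suc n" for i x
    using that F(1,2) by (cases i) auto
  then show ?case using F(3) by (intro exI[of _ "case_nat f F"]) simp
qed

lemma DERIV_max_power:
  "((\<lambda>y. (max 0 y) ^ Suc (Suc m)) has_real_derivative real (Suc (Suc m)) * (max 0 y) ^ Suc m) (at y)"
proof (cases y "0::real" rule: linorder_cases)
  case less
  have "((\<lambda>y. 0) has_real_derivative real (Suc (Suc m)) * (max 0 y) ^ Suc m) (at y)" using less by simp
  then show ?thesis
    by (rule has_field_derivative_transform_within_open[of _ _ _ "{..<0}"]) (use less in auto)
next
  case greater
  have "((\<lambda>y. y ^ Suc (Suc m)) has_real_derivative real (Suc (Suc m)) * (max 0 y) ^ Suc m) (at y)"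
    using greater DERIV_pow[of "Suc (Suc m)" y] by simp
  then show ?thesis
    by (rule has_field_derivative_transform_within_open[of _ _ _ "{0<..}"]) (use greater in auto)
next
  case equal
  have "isCont (\<lambda>h::real. (max 0 h) ^ Suc m) 0" by (intro continuous_intros)
  then have "(\<lambda>h::real. (max 0 h) ^ Suc m) \<midarrow>0\<rightarrow> 0" by (simp add: isCont_def)
  moreover have "\<forall>\<^sub>F h in at (0::real). (max 0 h) ^ Suc m = ((max 0 (h::real)) ^ Suc (Suc m) - (max 0 0) ^ Suc (Suc m)) / (h - 0)"
    unfolding eventually_at by (intro exI[of _ 1]) (auto simp: max_def)
  ultimately have "(\<lambda>h::real. ((max 0 h) ^ Suc (Suc m) - (max 0 0) ^ Suc (Suc m)) / (h - 0)) \<midarrow>0\<rightarrow> 0"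
    by (rule Lim_transform_eventually)
  then show ?thesis unfolding has_field_derivative_iff equal by simp
qed

lemma C_on_max_power: "C_on 4 (\<lambda>y::real. (max 0 y) ^ 5) UNIV"
proof -
  define F where "F = (\<lambda>i (y::real). fact 5 / fact (5 - i) * (max 0 y) ^ (5 - i))"
  have "(F i has_real_derivative F (Suc i) x) (at x)" if "i < 4" for i x
  proof -
    define m where "m = 3 - i"
    have m: "5 - i = Suc (Suc m)" "5 - Suc i = Suc m" using that by (auto simp: m_def)
    have "(F i has_real_derivative fact 5 / fact (Suc (Suc m)) * (real (Suc (Suc m)) * (max 0 x) ^ Suc m)) (at x)"
      unfolding F_def m by (rule DERIV_cmult[OF DERIV_max_power])
    moreover have "fact 5 / fact (Suc (Suc m)) * (real (Suc (Suc m)) * (max 0 x) ^ Suc m) = F (Suc i) x"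
      unfolding F_def m by (simp add: fact_Suc[of "Suc m"] del: fact_Suc of_nat_Suc)
    ultimately show ?thesis by simp
  qed
  moreover have "continuous_on UNIV (F 4)" unfolding F_def by (intro continuous_intros)
  ultimately have "C_on 4 (F 0) UNIV" by (intro C_on_realI) auto
  then show ?thesis by (simp add: F_def)
qed

text \<open>The function h(y) = max(0, y)^5 is four times continuously differentiable, and 1 - h(1 - h(y - 1)) is 0 for y at most 1 and 1 for y at least 2.\<close>

lemma smooth_step_exists:
  "\<exists>F :: nat \<Rightarrow> real \<Rightarrow> real. (\<forall>i<4. \<forall>x. (F i has_real_derivative F (Suc i) x) (at x)) \<and>
     continuous_on UNIV (F 4) \<and> (\<forall>y\<le>1. F 0 y = 0) \<and> (\<forall>y\<ge>2. F 0 y = 1)"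
proof -
  define h where "h = (\<lambda>y::real. (max 0 y) ^ 5)"
  define \<kappa> where "\<kappa> = (\<lambda>y. 1 - h (1 - h (y - 1)))"
  have hC: "C_on 4 h UNIV" unfolding h_def by (rule C_on_max_power)
  have lin: "C_on 4 (\<lambda>y::real. y - 1) UNIV"
    by (intro C_on_diff C_on_const open_UNIV C_on_polynomial real_polynomial_function.intros(1) bounded_linear_ident)
  have "C_on 4 (\<lambda>y. h (y - 1)) UNIV"
    by (rule C_on_compose[where \<psi> = h and g = "\<lambda>y. y - 1", OF open_UNIV open_UNIV _ hC lin]) simp
  then have g: "C_on 4 (\<lambda>y. 1 - h (y - 1)) UNIV" by (intro C_on_diff C_on_const open_UNIV)
  have "C_on 4 (\<lambda>y. h (1 - h (y - 1))) UNIV"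
    by (rule C_on_compose[where \<psi> = h and g = "\<lambda>y. 1 - h (y - 1)", OF open_UNIV open_UNIV _ hC g]) simp
  then have "C_on 4 \<kappa> UNIV" unfolding \<kappa>_def by (intro C_on_diff C_on_const open_UNIV)
  from C_on_real_chain[OF this] obtain F where F: "F 0 = \<kappa>"
    "\<forall>i<4. \<forall>x. (F i has_real_derivative F (Suc i) x) (at x)" "continuous_on UNIV (F 4)" by blast
  have "\<kappa> y = 0" if "y \<le> 1" for y using that by (simp add: \<kappa>_def h_def max_def)
  moreover have "\<kappa> y = 1" if "2 \<le> y" for y
  proof -
    have "1 \<le> (y - 1) ^ 5" using that by (intro one_le_power) simp
    then have "1 \<le> h (y - 1)" using that by (simp add: h_def max_def)
    then show ?thesis by (simp add: \<kappa>_def h_def max_def)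
  qed
  ultimately show ?thesis using F by (intro exI[of _ F]) auto
qed

text \<open>By the clamped conditions q has a double zero at r. On a strip of width of order \<epsilon> its values are therefore of order \<epsilon>^2 and its first derivatives of order \<epsilon>, while each derivative of the cutoff costs a factor 1 / \<epsilon>. By Leibniz' rule, derivatives of the product up to order four are at most of order \<epsilon>^(-2).\<close>

lemma cutoff_series:
  assumes c: "entire_coeffs c" and r: "0 < r" and bc: "psum c r = 0" "psum (diffs c) r = 0"
  shows "\<exists>C\<ge>0. \<forall>\<epsilon>. 0 < \<epsilon> \<longrightarrow> \<epsilon> \<le> 1 \<longrightarrow> 2 * \<epsilon> \<le> r \<longrightarrow>
    (\<exists>d :: nat \<Rightarrow> real \<Rightarrow> real. (\<forall>i<4. \<forall>\<rho>. (d i has_real_derivative d (Suc i) \<rho>) (at \<rho>)) \<and>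
      continuous_on UNIV (d 4) \<and> (\<forall>\<rho>>r - \<epsilon>. d 0 \<rho> = 0) \<and> (\<forall>\<rho><r - 2 * \<epsilon>. d 0 \<rho> = psum c \<rho>) \<and>
      (\<forall>i\<le>4. \<forall>\<rho>. r - 2 * \<epsilon> \<le> \<rho> \<longrightarrow> \<rho> \<le> r \<longrightarrow> \<bar>d i \<rho>\<bar> \<le> C / \<epsilon>\<^sup>2))"
proof -
  obtain F :: "nat \<Rightarrow> real \<Rightarrow> real" where F: "\<And>i x. i < 4 \<Longrightarrow> (F i has_real_derivative F (Suc i) x) (at x)"
     "continuous_on UNIV (F 4)" "\<And>y. y \<le> 1 \<Longrightarrow> F 0 y = 0" "\<And>y. y \<ge> 2 \<Longrightarrow> F 0 y = 1"
    using smooth_step_exists by blast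
  define Q where "Q = (\<lambda>i. psum ((diffs ^^ i) c))"
  have ec: "entire_coeffs ((diffs ^^ i) c)" for i by (induction i) (use c entire_coeffs_diffs in auto)
  have dQ: "(Q i has_real_derivative Q (Suc i) x) (at x)" for i x
    unfolding Q_def using psum_has_derivative[OF ec[of i]] by simp
  have contF: "continuous_on A (F i)" if "i \<le> 4" for i A
  proof (cases "i = 4")
    case True
    then show ?thesis using continuous_on_subset[OF F(2)] by blast
  next
    case False
    then have "\<And>x. isCont (F i) x" using F(1) that DERIV_isCont by (metis le_neq_implies_less)
    then show ?thesis by (simp add: continuous_at_imp_continuous_on)
  qed
  have contQ: "continuous_on A (Q i)" for i A unfolding Q_def by (rule continuous_on_psum[OF ec])
  have bdd: "\<exists>b\<ge>0. \<forall>x\<in>{l..u}. \<bar>f x\<bar> \<le> b" if "continuous_on {l..u} f" for f :: "real \<Rightarrow> real" and l u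
  proof -
    have "bounded (f ` {l..u})" by (intro compact_imp_bounded compact_continuous_image that) simp
    then obtain b where "0 < b" "\<forall>y\<in>f ` {l..u}. norm y \<le> b" using bounded_pos by metis
    then show ?thesis by (intro exI[of _ b]) auto
  qed
  have "\<forall>i. \<exists>b. i \<le> 4 \<longrightarrow> 0 \<le> b \<and> (\<forall>x\<in>{0..2}. \<bar>F i x\<bar> \<le> b)"
    using bdd[OF contF] by blast
  from choice[OF this] obtain bF where bF: "\<And>i. i \<le> 4 \<Longrightarrow> 0 \<le> bF i \<and> (\<forall>x\<in>{0..2}. \<bar>F i x\<bar> \<le> bF i)"
    by blast
  have "\<forall>i. \<exists>b. 0 \<le> b \<and> (\<forall>x\<in>{0..r}. \<bar>Q i x\<bar> \<le> b)"
    using bdd[OF contQ] by blast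
  from choice[OF this] obtain bQ where bQ: "\<And>i. 0 \<le> bQ i \<and> (\<forall>x\<in>{0..r}. \<bar>Q i x\<bar> \<le> bQ i)"
    by blast
  define B where "B = (\<Sum>i\<le>4. bF i) + (\<Sum>i\<le>4. bQ i)"
  have BF: "\<bar>F i x\<bar> \<le> B" if "i \<le> 4" "x \<in> {0..2}" for i x
  proof -
    have "bF i \<le> (\<Sum>i\<le>4. bF i)" by (rule member_le_sum) (use that bF in auto)
    moreover have "0 \<le> (\<Sum>i\<le>4. bQ i)" using bQ by (intro sum_nonneg) auto
    ultimately show ?thesis using bF[OF that(1)] that(2) unfolding B_def by fastforce
  qed
  have BQ: "\<bar>Q i x\<bar> \<le> B" if "i \<le> 4" "x \<in> {0..r}" for i x
  proof -
    have "bQ i \<le> (\<Sum>i\<le>4. bQ i)" by (rule member_le_sum) (use that bQ in auto)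
    moreover have "0 \<le> (\<Sum>i\<le>4. bF i)" using bF by (intro sum_nonneg) auto
    ultimately show ?thesis using bQ[of i] that(2) unfolding B_def by fastforce
  qed
  have B0: "0 \<le> B" using BQ[of 0 0] r by (meson abs_ge_zero order_trans atLeastAtMost_iff less_imp_le order_refl zero_le)
  have bcQ: "Q 0 r = 0" "Q (Suc 0) r = 0" using bc by (simp_all add: Q_def)
  have Q1: "\<bar>Q (Suc 0) \<rho>\<bar> \<le> B * (r - \<rho>)" if "0 \<le> \<rho>" "\<rho> \<le> r" for \<rho>
  proof (cases "\<rho> = r")
    case False
    then have "\<rho> < r" using that by simp
    from MVT2[OF this, of "Q (Suc 0)" "Q (Suc (Suc 0))"] dQ obtain z where
      z: "\<rho> < z" "z < r" "Q (Suc 0) r - Q (Suc 0) \<rho> = (r - \<rho>) * Q (Suc (Suc 0)) z" by blast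
    then have "\<bar>Q (Suc 0) \<rho>\<bar> = (r - \<rho>) * \<bar>Q (Suc (Suc 0)) z\<bar>" using bcQ that
      by (metis abs_minus_cancel abs_mult abs_of_nonneg diff_0 diff_ge_0_iff_ge)
    also have "\<dots> \<le> (r - \<rho>) * B" using BQ[of "Suc (Suc 0)" z] z that by (intro mult_left_mono) auto
    finally show ?thesis by (simp add: mult.commute)
  qed (use bcQ in simp)
  have Q0: "\<bar>Q 0 \<rho>\<bar> \<le> B * (r - \<rho>)\<^sup>2" if "0 \<le> \<rho>" "\<rho> \<le> r" for \<rho>
  proof (cases "\<rho> = r")
    case False
    then have "\<rho> < r" using that by simp
    from MVT2[OF this, of "Q 0" "Q (Suc 0)"] dQ obtain z where
      z: "\<rho> < z" "z < r" "Q 0 r - Q 0 \<rho> = (r - \<rho>) * Q (Suc 0) z" by blast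
    then have "\<bar>Q 0 \<rho>\<bar> = (r - \<rho>) * \<bar>Q (Suc 0) z\<bar>" using bcQ that
      by (metis abs_minus_cancel abs_mult abs_of_nonneg diff_0 diff_ge_0_iff_ge)
    also have "\<dots> \<le> (r - \<rho>) * (B * (r - z))" using Q1[of z] z that by (intro mult_left_mono) auto
    also have "\<dots> \<le> (r - \<rho>) * (B * (r - \<rho>))" using z that B0 by (intro mult_left_mono) auto
    finally show ?thesis by (simp add: power2_eq_square mult_ac)
  qed (use bcQ in simp)
  \<comment> \<open>Leibniz' rule of order four has at most 16 terms, each bounded by 4 B^2 / \<epsilon>^2.\<close>
  show ?thesis
  proof (intro exI[of _ "64 * B\<^sup>2"] conjI allI impI)
    show "0 \<le> 64 * B\<^sup>2" by simp
    fix \<epsilon> :: real assume \<epsilon>: "0 < \<epsilon>" "\<epsilon> \<le> 1" "2 * \<epsilon> \<le> r"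
    define K where "K = (\<lambda>i \<rho>. F i ((r - \<rho>) / \<epsilon>) * (- 1 / \<epsilon>) ^ i)"
    have dK: "(K i has_real_derivative K (Suc i) \<rho>) (at \<rho>)" if "i < 4" for i \<rho>
    proof -
      have "((\<lambda>\<rho>. (r - \<rho>) / \<epsilon>) has_real_derivative - 1 / \<epsilon>) (at \<rho>)"
        using \<epsilon> by (auto intro!: derivative_eq_intros)
      from DERIV_chain2[OF F(1)[OF that] this]
      have "((\<lambda>\<rho>. F i ((r - \<rho>) / \<epsilon>)) has_real_derivative F (Suc i) ((r - \<rho>) / \<epsilon>) * (- 1 / \<epsilon>)) (at \<rho>)" .
      from DERIV_cmult_right[OF this, of "(- 1 / \<epsilon>) ^ i"] show ?thesis
        unfolding K_def by (simp only: power_Suc mult.assoc)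
    qed
    have cK: "continuous_on UNIV (K 4)"
      unfolding K_def by (intro continuous_intros continuous_on_compose2[OF F(2)]) (use \<epsilon> in auto)
    have KB: "\<bar>K i \<rho>\<bar> \<le> B / \<epsilon> ^ i" if "i \<le> 4" "r - 2 * \<epsilon> \<le> \<rho>" "\<rho> \<le> r" for i \<rho>
    proof -
      have "(r - \<rho>) / \<epsilon> \<in> {0..2}" using that \<epsilon> by (auto simp: field_simps)
      then have "\<bar>F i ((r - \<rho>) / \<epsilon>)\<bar> * (1 / \<epsilon> ^ i) \<le> B * (1 / \<epsilon> ^ i)"
        using BF[OF that(1)] \<epsilon> by (intro mult_right_mono) auto
      then show ?thesis using \<epsilon> by (simp add: K_def abs_mult power_abs power_divide)
    qed
    have QB: "\<bar>Q i \<rho>\<bar> \<le> 4 * B * \<epsilon> ^ (2 - i)" if "i \<le> 4" "r - 2 * \<epsilon> \<le> \<rho>" "\<rho> \<le> r" for i \<rho>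
    proof -
      have \<rho>: "0 \<le> \<rho>" "r - \<rho> \<le> 2 * \<epsilon>" "0 \<le> r - \<rho>" using that \<epsilon> by auto
      consider "i = 0" | "i = 1" | "2 \<le> i" by linarith
      then show ?thesis
      proof cases
        case 1
        have "B * (r - \<rho>)\<^sup>2 \<le> B * (2 * \<epsilon>)\<^sup>2" using \<rho> B0 by (intro mult_left_mono power_mono) auto
        then show ?thesis using Q0[of \<rho>] \<rho> that 1 by (simp add: power_mult_distrib)
      next
        case 2
        have "B * (r - \<rho>) \<le> B * (2 * \<epsilon>)" using \<rho> B0 by (intro mult_left_mono) auto
        moreover have "B * (2 * \<epsilon>) \<le> 4 * B * \<epsilon>" using B0 \<epsilon> by (simp add: mult_nonneg_nonneg)
        ultimately show ?thesis using Q1[of \<rho>] \<rho> that 2 by simp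
      next
        case 3
        then show ?thesis using BQ[of i \<rho>] \<rho> that B0 by simp
      qed
    qed
    have QK: "\<bar>Q i \<rho> * K j \<rho>\<bar> \<le> 4 * B\<^sup>2 / \<epsilon>\<^sup>2" if "i + j \<le> 4" "r - 2 * \<epsilon> \<le> \<rho>" "\<rho> \<le> r" for i j \<rho>
    proof -
      have "\<bar>Q i \<rho> * K j \<rho>\<bar> \<le> (4 * B * \<epsilon> ^ (2 - i)) * (B / \<epsilon> ^ j)"
        unfolding abs_mult using that \<epsilon> B0 by (intro mult_mono QB KB) auto
      also have "\<dots> = 4 * B\<^sup>2 * (\<epsilon> ^ (2 - i) / \<epsilon> ^ j)" by (simp add: power2_eq_square)
      also have "\<dots> \<le> 4 * B\<^sup>2 * (1 / \<epsilon>\<^sup>2)"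
      proof (rule mult_left_mono)
        have "\<epsilon> ^ ((2 - i) + 2) \<le> \<epsilon> ^ j" using \<epsilon> that by (intro power_decreasing) auto
        then show "\<epsilon> ^ (2 - i) / \<epsilon> ^ j \<le> 1 / \<epsilon>\<^sup>2" using \<epsilon> by (simp add: power_add divide_simps power2_eq_square mult_ac)
      qed simp
      finally show ?thesis by simp
    qed
    define d0 d1 d2 d3 d4 where "d0 = (\<lambda>\<rho>. Q 0 \<rho> * K 0 \<rho>)" and "d1 = (\<lambda>\<rho>. Q 1 \<rho> * K 0 \<rho> + Q 0 \<rho> * K 1 \<rho>)"
      and "d2 = (\<lambda>\<rho>. Q 2 \<rho> * K 0 \<rho> + 2 * (Q 1 \<rho> * K 1 \<rho>) + Q 0 \<rho> * K 2 \<rho>)"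
      and "d3 = (\<lambda>\<rho>. Q 3 \<rho> * K 0 \<rho> + 3 * (Q 2 \<rho> * K 1 \<rho>) + 3 * (Q 1 \<rho> * K 2 \<rho>) + Q 0 \<rho> * K 3 \<rho>)"
      and "d4 = (\<lambda>\<rho>. Q 4 \<rho> * K 0 \<rho> + 4 * (Q 3 \<rho> * K 1 \<rho>) + 6 * (Q 2 \<rho> * K 2 \<rho>) + 4 * (Q 1 \<rho> * K 3 \<rho>) + Q 0 \<rho> * K 4 \<rho>)"
    note dfs = d0_def d1_def d2_def d3_def d4_def
    have q: "(Q 0 has_real_derivative Q 1 \<rho>) (at \<rho>)" "(Q 1 has_real_derivative Q 2 \<rho>) (at \<rho>)"
      "(Q 2 has_real_derivative Q 3 \<rho>) (at \<rho>)" "(Q 3 has_real_derivative Q 4 \<rho>) (at \<rho>)" for \<rho>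
      using dQ[of 0 \<rho>] dQ[of 1 \<rho>] dQ[of 2 \<rho>] dQ[of 3 \<rho>] by (simp_all add: numeral_eq_Suc)
    have k: "(K 0 has_real_derivative K 1 \<rho>) (at \<rho>)" "(K 1 has_real_derivative K 2 \<rho>) (at \<rho>)"
      "(K 2 has_real_derivative K 3 \<rho>) (at \<rho>)" "(K 3 has_real_derivative K 4 \<rho>) (at \<rho>)" for \<rho>
      using dK[of 0 \<rho>] dK[of 1 \<rho>] dK[of 2 \<rho>] dK[of 3 \<rho>] by (simp_all add: numeral_eq_Suc)
    have D: "(d0 has_real_derivative d1 \<rho>) (at \<rho>)" "(d1 has_real_derivative d2 \<rho>) (at \<rho>)"
      "(d2 has_real_derivative d3 \<rho>) (at \<rho>)" "(d3 has_real_derivative d4 \<rho>) (at \<rho>)" for \<rho>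
      unfolding dfs by ((rule derivative_eq_intros q k refl)+, simp add: algebra_simps)+
    define d where "d = (\<lambda>i::nat. [d0, d1, d2, d3, d4] ! i)"
    have "(d i has_real_derivative d (Suc i) \<rho>) (at \<rho>)" if "i < 4" for i \<rho>
    proof -
      have "i = 0 \<or> i = 1 \<or> i = 2 \<or> i = 3" using that by linarith
      then show ?thesis using D by (auto simp: d_def numeral_eq_Suc)
    qed
    moreover have "continuous_on UNIV (d 4)"
    proof -
      have "continuous_on UNIV (K i)" if "i < 4" for i
        using dK[OF that] DERIV_isCont continuous_at_imp_continuous_on by blast
      then have "continuous_on UNIV d4" unfolding dfs by (intro continuous_intros contQ cK) auto
      then show ?thesis by (simp add: d_def numeral_eq_Suc)
    qed
    moreover have "d 0 \<rho> = 0" if "r - \<epsilon> < \<rho>" for \<rho>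
      using F(3)[of "(r - \<rho>) / \<epsilon>"] that \<epsilon> by (simp add: d_def d0_def K_def field_simps)
    moreover have "d 0 \<rho> = psum c \<rho>" if "\<rho> < r - 2 * \<epsilon>" for \<rho>
      using F(4)[of "(r - \<rho>) / \<epsilon>"] that \<epsilon> by (simp add: d_def d0_def K_def Q_def field_simps)
    moreover have "\<bar>d i \<rho>\<bar> \<le> 64 * B\<^sup>2 / \<epsilon>\<^sup>2" if i: "i \<le> 4" and \<rho>: "r - 2 * \<epsilon> \<le> \<rho>" "\<rho> \<le> r" for i \<rho>
    proof -
      define M where "M = 4 * B\<^sup>2 / \<epsilon>\<^sup>2"
      have M0: "0 \<le> M" by (simp add: M_def)
      have qk: "\<bar>Q i \<rho> * K j \<rho>\<bar> \<le> M" if "i + j \<le> 4" for i j using QK[OF that \<rho>] by (simp add: M_def)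
      have e: "64 * B\<^sup>2 / \<epsilon>\<^sup>2 = 16 * M" by (simp add: M_def)
      have "i = 0 \<or> i = 1 \<or> i = 2 \<or> i = 3 \<or> i = 4" using i by linarith
      then show ?thesis unfolding e
      proof (elim disjE)
        assume "i = 0"
        then show "\<bar>d i \<rho>\<bar> \<le> 16 * M" using qk[of 0 0] M0 by (simp add: d_def d0_def)
      next
        assume "i = 1"
        then show "\<bar>d i \<rho>\<bar> \<le> 16 * M" using qk[of 1 0] qk[of 0 1] M0 by (simp add: d_def d1_def)
      next
        assume "i = 2"
        then have "d i \<rho> = d2 \<rho>" by (simp add: d_def numeral_eq_Suc)
        then show "\<bar>d i \<rho>\<bar> \<le> 16 * M" using qk[of 2 0] qk[of 1 1] qk[of 0 2] M0 unfolding d2_def abs_le_iff by simp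
      next
        assume "i = 3"
        then have "d i \<rho> = d3 \<rho>" by (simp add: d_def numeral_eq_Suc)
        then show "\<bar>d i \<rho>\<bar> \<le> 16 * M" using qk[of 3 0] qk[of 2 1] qk[of 1 2] qk[of 0 3] M0 unfolding d3_def abs_le_iff by simp
      next
        assume "i = 4"
        then have "d i \<rho> = d4 \<rho>" by (simp add: d_def numeral_eq_Suc)
        then show "\<bar>d i \<rho>\<bar> \<le> 16 * M"
          using qk[of 4 0] qk[of 3 1] qk[of 2 2] qk[of 1 3] qk[of 0 4] M0 unfolding d4_def abs_le_iff by simp
      qed
    qed
    ultimately show "\<exists>d :: nat \<Rightarrow> real \<Rightarrow> real. (\<forall>i<4. \<forall>\<rho>. (d i has_real_derivative d (Suc i) \<rho>) (at \<rho>)) \<and>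
      continuous_on UNIV (d 4) \<and> (\<forall>\<rho>>r - \<epsilon>. d 0 \<rho> = 0) \<and> (\<forall>\<rho><r - 2 * \<epsilon>. d 0 \<rho> = psum c \<rho>) \<and>
      (\<forall>i\<le>4. \<forall>\<rho>. r - 2 * \<epsilon> \<le> \<rho> \<longrightarrow> \<rho> \<le> r \<longrightarrow> \<bar>d i \<rho>\<bar> \<le> 64 * B\<^sup>2 / \<epsilon>\<^sup>2)"
      by (intro exI[of _ d]) blast
  qed
qed

text \<open>The integral runs over the closed ball, since the values of u outside it are irrelevant.\<close>

definition ball_pairing :: "real \<Rightarrow> ('a::euclidean_space \<Rightarrow> real) \<Rightarrow> ('a \<Rightarrow> real) \<Rightarrow> real" where
  "ball_pairing R u f = (\<integral>x. indicator (cball 0 R) x * (u x * f x) \<partial>lborel)"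

lemma ball_pairing_integrable:
  fixes u f :: "'a::euclidean_space \<Rightarrow> real"
  assumes "continuous_on (cball 0 R) u" "continuous_on (cball 0 R) f"
  shows "integrable lborel (\<lambda>x. indicator (cball 0 R) x * (u x * f x))"
  using borel_integrable_compact[OF compact_cball continuous_on_mult[OF assms]] by simp

lemma ball_pairing_lincomb:
  fixes u f g :: "'a::euclidean_space \<Rightarrow> real"
  assumes "continuous_on (cball 0 R) u" "continuous_on (cball 0 R) f" "continuous_on (cball 0 R) g"
  shows "ball_pairing R u (\<lambda>x. a * f x + b * g x) = a * ball_pairing R u f + b * ball_pairing R u g"
proof -
  have "ball_pairing R u (\<lambda>x. a * f x + b * g x) = (\<integral>x. a * (indicator (cball 0 R) x * (u x * f x)) + b * (indicator (cball 0 R) x * (u x * g x)) \<partial>lborel)"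
    unfolding ball_pairing_def by (rule arg_cong[where f = "integral\<^sup>L lborel"]) (auto simp: algebra_simps)
  then show ?thesis unfolding ball_pairing_def
    using ball_pairing_integrable[OF assms(1,2)] ball_pairing_integrable[OF assms(1,3)] by simp
qed

lemma ball_pairing_strip_bound:
  fixes u f :: "'a::euclidean_space \<Rightarrow> real"
  assumes R: "0 < R" and a: "0 \<le> a" "a \<le> R" and c: "continuous_on (cball 0 R) u" "continuous_on (cball 0 R) f"
    and z: "\<And>x. norm x < a \<Longrightarrow> f x = 0" and b: "\<And>x. a \<le> norm x \<Longrightarrow> norm x \<le> R \<Longrightarrow> \<bar>u x * f x\<bar> \<le> M" and M: "0 \<le> M"
  shows "\<bar>ball_pairing R u f\<bar> \<le> M * (unit_ball_vol (real DIM('a)) * R ^ DIM('a) * real DIM('a) / R * (R - a))"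
proof -
  let ?S = "cball 0 R - ball (0::'a) a"
  have Sm: "emeasure lborel ?S < \<infinity>"
    using emeasure_mono[of ?S "cball 0 R" lborel] emeasure_lborel_cball_finite[of "0::'a" R]
    by (auto simp: less_top top_unique)
  have "\<bar>ball_pairing R u f\<bar> \<le> (\<integral>x. norm (indicator (cball 0 R) x * (u x * f x)) \<partial>lborel)"
    unfolding ball_pairing_def using integral_norm_bound[of lborel] by (metis real_norm_def)
  also have "\<dots> \<le> (\<integral>x. M * indicator ?S x \<partial>lborel)"
  proof (rule integral_mono)
    show "integrable lborel (\<lambda>x. norm (indicator (cball 0 R) x * (u x * f x)))"
      by (rule integrable_norm[OF ball_pairing_integrable[OF c]])
    show "integrable lborel (\<lambda>x. M * indicator ?S x)"
      using Sm by (intro integrable_mult_right) (simp add: integrable_indicator_iff)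
    show "norm (indicator (cball 0 R) x * (u x * f x)) \<le> M * indicator ?S x" for x
      using z[of x] b[of x] M by (auto simp: indicator_def not_less)
  qed
  also have "\<dots> = M * measure lborel ?S" by simp
  also have "\<dots> \<le> M * (unit_ball_vol (real DIM('a)) * R ^ DIM('a) * real DIM('a) / R * (R - a))"
    by (rule mult_left_mono[OF strip_measure_bound[OF R a] M])
  finally show ?thesis .
qed

text \<open>The plate operator applied to P(x) d(|x|^2), by two applications of the reduction to one dimension.\<close>

lemma plate_operator_cutoff:
  fixes P :: "'a::euclidean_space \<Rightarrow> real"
  assumes P: "solid_harmonic k P" and \<nu>: "\<nu> = real k + real DIM('a) / 2"
    and d: "\<And>i \<rho>. i < 4 \<Longrightarrow> (d i has_real_derivative d (Suc i) \<rho>) (at \<rho>)" and d4: "continuous_on UNIV (d (4::nat))"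
  defines "w \<equiv> \<lambda>x. P x * d 0 (x \<bullet> x)"
  shows "C_on 4 w UNIV"
    and "laplacian (laplacian w) x + \<alpha> * laplacian w x - \<mu> * w x = P x *
      (16 * (x \<bullet> x)\<^sup>2 * d 4 (x \<bullet> x) + 32 * (\<nu> + 1) * (x \<bullet> x) * d 3 (x \<bullet> x) + 16 * \<nu> * (\<nu> + 1) * d 2 (x \<bullet> x)
       + \<alpha> * (4 * (x \<bullet> x) * d 2 (x \<bullet> x) + 4 * \<nu> * d 1 (x \<bullet> x)) - \<mu> * d 0 (x \<bullet> x))"
proof -
  have D: "(d 0 has_real_derivative d 1 \<rho>) (at \<rho>)" "(d 1 has_real_derivative d 2 \<rho>) (at \<rho>)"
      "(d 2 has_real_derivative d 3 \<rho>) (at \<rho>)" "(d 3 has_real_derivative d 4 \<rho>) (at \<rho>)" for \<rho>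
    using d[of 0 \<rho>] d[of 1 \<rho>] d[of 2 \<rho>] d[of 3 \<rho>] by (simp_all add: numeral_eq_Suc)
  have Pp: "real_polynomial_function P" using P by (simp add: solid_harmonic_def)
  have d0C: "C_on 4 (d 0) UNIV" by (rule C_on_realI[where F = d and n = 4, OF open_UNIV _ d4]) (rule d)
  show "C_on 4 w UNIV" unfolding w_def
    by (intro C_on_mult open_UNIV C_on_polynomial[OF Pp] C_on_compose[where \<psi> = "d 0" and g = "\<lambda>x. x \<bullet> x", OF open_UNIV open_UNIV subset_UNIV
          d0C C_on_polynomial[OF real_polynomial_function_inner_self]])
  define m where "m = (\<lambda>\<rho>. 4 * \<rho> * d 2 \<rho> + 4 * \<nu> * d 1 \<rho>)"
  define m1 where "m1 = (\<lambda>\<rho>. 4 * \<rho> * d 3 \<rho> + 4 * (\<nu> + 1) * d 2 \<rho>)"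
  define m2 where "m2 = (\<lambda>\<rho>. 4 * \<rho> * d 4 \<rho> + 4 * (\<nu> + 2) * d 3 \<rho>)"
  have dm: "(m has_real_derivative m1 \<rho>) (at \<rho>)" for \<rho>
    unfolding m_def m1_def by (rule derivative_eq_intros D refl)+ (simp add: algebra_simps)
  have dm1: "(m1 has_real_derivative m2 \<rho>) (at \<rho>)" for \<rho>
    unfolding m1_def m2_def by (rule derivative_eq_intros D refl)+ (simp add: algebra_simps)
  have l1: "laplacian w = (\<lambda>x. P x * m (x \<bullet> x))"
  proof
    fix x
    show "laplacian w x = P x * m (x \<bullet> x)"
      unfolding w_def m_def using laplacian_harmonic_radial[OF P open_UNIV D(1) D(2), of x] by (simp add: \<nu>)
  qed
  have l2: "laplacian (laplacian w) x = P x * (4 * (x \<bullet> x) * m2 (x \<bullet> x) + 4 * \<nu> * m1 (x \<bullet> x))"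
    unfolding l1 using laplacian_harmonic_radial[OF P open_UNIV dm dm1, of x] by (simp add: \<nu>)
  show "laplacian (laplacian w) x + \<alpha> * laplacian w x - \<mu> * w x = P x *
      (16 * (x \<bullet> x)\<^sup>2 * d 4 (x \<bullet> x) + 32 * (\<nu> + 1) * (x \<bullet> x) * d 3 (x \<bullet> x) + 16 * \<nu> * (\<nu> + 1) * d 2 (x \<bullet> x)
       + \<alpha> * (4 * (x \<bullet> x) * d 2 (x \<bullet> x) + 4 * \<nu> * d 1 (x \<bullet> x)) - \<mu> * d 0 (x \<bullet> x))"
  proof -
    have l3: "laplacian w x = P x * m (x \<bullet> x)" by (simp add: l1)
    have l0: "w x = P x * d 0 (x \<bullet> x)" by (simp add: w_def)
    show ?thesis unfolding l2 l3 l0 m_def m1_def m2_def by (simp add: algebra_simps power2_eq_square)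
  qed
qed

section \<open>Orthogonality relations for plate eigenfunctions\<close>

lemma laplacian_zero_on_open:
  assumes "open U" "x \<in> U" "\<And>y. y \<in> U \<Longrightarrow> f y = 0"
  shows "laplacian f x = 0"
  using laplacian_cong_open[OF assms(1,2), of f "\<lambda>_. 0"] assms(3) by (simp add: laplacian_zero)

lemma bounded_on_cball:
  fixes f :: "'a::euclidean_space \<Rightarrow> real"
  assumes "continuous_on UNIV f"
  shows "\<exists>B\<ge>0. \<forall>x. norm x \<le> R \<longrightarrow> \<bar>f x\<bar> \<le> B"
proof -
  have "bounded (f ` cball 0 R)"
    by (intro compact_imp_bounded compact_continuous_image continuous_on_subset[OF assms]) auto
  then obtain b where b: "0 < b" "\<forall>y\<in>f ` cball 0 R. norm y \<le> b" using bounded_pos by metis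
  then show ?thesis by (intro exI[of _ b]) auto
qed

text \<open>Let w = P q(|x|^2) solve the plate equation with right-hand side f0, with clamped conditions, and cut w off in a strip of width of order \<epsilon> along the sphere. Green's formula applies to the truncated function, so that the pairing of u with f0 reduces to an integral over the strip. There the operator applied to the truncated function is of order \<epsilon>^(-2), u is at most e times a multiple of \<epsilon>, and the measure is of order \<epsilon>. So the pairing is at most e K with K independent of e.\<close>

lemma plate_orthogonal:
  fixes u P :: "'a::euclidean_space \<Rightarrow> real"
  assumes R: "0 < R" and u: "plate_eigenfunction R \<alpha> \<mu> u"
    and P: "solid_harmonic k P" and \<nu>: "\<nu> = real k + real DIM('a) / 2"
    and c: "entire_coeffs c" and bc: "psum c (R\<^sup>2) = 0" "psum (diffs c) (R\<^sup>2) = 0"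
    and rec: "\<And>n. radial_op \<nu> (radial_op \<nu> c) n + \<alpha> * radial_op \<nu> c n - \<mu> * c n = g n"
  shows "ball_pairing R u (\<lambda>x. P x * psum g (x \<bullet> x)) = 0"
proof -
  define r where "r = R\<^sup>2"
  have r: "0 < r" using R by (simp add: r_def)
  have u4: "C_on 4 u (ball 0 R)" and u1: "C1_cball R u"
    and ueq: "\<And>x. x \<in> ball 0 R \<Longrightarrow> laplacian (laplacian u) x + \<alpha> * laplacian u x = \<mu> * u x"
    and ubc: "\<And>x. norm x = R \<Longrightarrow> u x = 0 \<and> has_normal_derivative R u x 0"
    using u unfolding plate_eigenfunction_def by auto
  have uc: "continuous_on (cball 0 R) u" by (rule C1_cball_continuous[OF u1])
  have \<nu>0: "0 \<le> \<nu>" by (simp add: \<nu>)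
  note e1 = entire_coeffs_radial_op[OF c, of \<nu>]
  note e2 = entire_coeffs_radial_op[OF e1, of \<nu>]
  have gdef: "g = (\<lambda>n. 1 * (1 * radial_op \<nu> (radial_op \<nu> c) n + \<alpha> * radial_op \<nu> c n) + (-\<mu>) * c n)"
    using rec by (auto simp: fun_eq_iff)
  have eg: "entire_coeffs g" unfolding gdef by (intro entire_coeffs_lincomb e1 e2 c)
  define w where "w = (\<lambda>x. P x * psum c (x \<bullet> x))"
  define f0 where "f0 = (\<lambda>x. P x * psum g (x \<bullet> x))"
  have Lw: "laplacian (laplacian w) x + \<alpha> * laplacian w x - \<mu> * w x = f0 x" for x
  proof -
    have pg: "psum g \<rho> = psum (radial_op \<nu> (radial_op \<nu> c)) \<rho> + \<alpha> * psum (radial_op \<nu> c) \<rho> - \<mu> * psum c \<rho>" for \<rho>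
      unfolding gdef psum_lincomb[OF entire_coeffs_lincomb[OF e2 e1] c] psum_lincomb[OF e2 e1] by simp
    then show ?thesis
      unfolding w_def f0_def laplacian2_harmonic_series[OF P \<nu> c] laplacian_harmonic_series[OF P \<nu> c] pg
      by (simp add: algebra_simps)
  qed
  have f0c: "continuous_on UNIV f0"
    unfolding f0_def by (rule C_on_continuous[OF C_on_harmonic_series[OF P \<nu> eg open_UNIV, of 0]])
  obtain G where G: "0 \<le> G" "\<And>x. norm x \<le> R \<Longrightarrow> \<bar>f0 x\<bar> \<le> G" using bounded_on_cball[OF f0c] by blast
  have "continuous_on UNIV P" using P C_on_continuous[OF C_on_polynomial[of P 0 UNIV]] by (simp add: solid_harmonic_def)
  then obtain PB where PB: "0 \<le> PB" "\<And>x. norm x \<le> R \<Longrightarrow> \<bar>P x\<bar> \<le> PB" using bounded_on_cball by blast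
  obtain C where C: "0 \<le> C" "\<And>\<epsilon>. 0 < \<epsilon> \<Longrightarrow> \<epsilon> \<le> 1 \<Longrightarrow> 2 * \<epsilon> \<le> r \<Longrightarrow>
    \<exists>d :: nat \<Rightarrow> real \<Rightarrow> real. (\<forall>i<4. \<forall>\<rho>. (d i has_real_derivative d (Suc i) \<rho>) (at \<rho>)) \<and>
      continuous_on UNIV (d 4) \<and> (\<forall>\<rho>>r - \<epsilon>. d 0 \<rho> = 0) \<and> (\<forall>\<rho><r - 2 * \<epsilon>. d 0 \<rho> = psum c \<rho>) \<and>
      (\<forall>i\<le>4. \<forall>\<rho>. r - 2 * \<epsilon> \<le> \<rho> \<longrightarrow> \<rho> \<le> r \<longrightarrow> \<bar>d i \<rho>\<bar> \<le> C / \<epsilon>\<^sup>2)"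
    using cutoff_series[OF c r] bc unfolding r_def by blast
  \<comment> \<open>A collects the coefficients of the plate operator in the formula for radial factors.\<close>
  define A where "A = 16 * r\<^sup>2 + 32 * (\<nu> + 1) * r + 16 * \<nu> * (\<nu> + 1) + \<bar>\<alpha>\<bar> * (4 * r + 4 * \<nu>) + \<bar>\<mu>\<bar>"
  have A0: "0 \<le> A" using r \<nu>0 by (simp add: A_def)
  define D where "D = PB * (A * C)"
  have D0: "0 \<le> D" using A0 C PB by (simp add: D_def)
  define V where "V = unit_ball_vol (real DIM('a)) * R ^ DIM('a) * real DIM('a) / R"
  have V0: "0 \<le> V" using R by (simp add: V_def)
  define K where "K = (G + D) * V * 4 / R\<^sup>2"
  have K0: "0 \<le> K" using G D0 V0 by (simp add: K_def)
  have bound: "\<bar>ball_pairing R u f0\<bar> \<le> e * K" if e: "0 < e" for e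
  proof -
    obtain \<delta> where \<delta>: "0 < \<delta>" "\<And>x. R - \<delta> < norm x \<Longrightarrow> norm x \<le> R \<Longrightarrow> \<bar>u x\<bar> \<le> e * (R - norm x)"
      using clamped_boundary_decay[OF R u1 ubc e] by blast
    define \<epsilon> where "\<epsilon> = min 1 (min (r / 2) (R * \<delta> / 4))"
    have \<epsilon>: "0 < \<epsilon>" "\<epsilon> \<le> 1" "2 * \<epsilon> \<le> r" using r R \<delta> by (auto simp: \<epsilon>_def)
    have "\<epsilon> \<le> R * \<delta> / 4" by (simp add: \<epsilon>_def)
    then have "2 * \<epsilon> / R \<le> \<delta> / 2" using R by (simp add: field_simps)
    then have \<epsilon>\<delta>: "2 * \<epsilon> / R < \<delta>" using \<delta>(1) by linarith
    obtain d :: "nat \<Rightarrow> real \<Rightarrow> real" where d: "\<And>i \<rho>. i < 4 \<Longrightarrow> (d i has_real_derivative d (Suc i) \<rho>) (at \<rho>)"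
      "continuous_on UNIV (d 4)" "\<And>\<rho>. r - \<epsilon> < \<rho> \<Longrightarrow> d 0 \<rho> = 0" "\<And>\<rho>. \<rho> < r - 2 * \<epsilon> \<Longrightarrow> d 0 \<rho> = psum c \<rho>"
      "\<And>i \<rho>. i \<le> 4 \<Longrightarrow> r - 2 * \<epsilon> \<le> \<rho> \<Longrightarrow> \<rho> \<le> r \<Longrightarrow> \<bar>d i \<rho>\<bar> \<le> C / \<epsilon>\<^sup>2"
      using C(2)[OF \<epsilon>] by blast
    define v where "v = (\<lambda>x. P x * d 0 (x \<bullet> x))"
    define T where "T = (\<lambda>x. laplacian (laplacian v) x + \<alpha> * laplacian v x - \<mu> * v x)"
    have vC: "C_on 4 v UNIV" unfolding v_def by (rule plate_operator_cutoff(1)[OF P \<nu> d(1,2)])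
    have Tf: "T x = P x *
      (16 * (x \<bullet> x)\<^sup>2 * d 4 (x \<bullet> x) + 32 * (\<nu> + 1) * (x \<bullet> x) * d 3 (x \<bullet> x) + 16 * \<nu> * (\<nu> + 1) * d 2 (x \<bullet> x)
       + \<alpha> * (4 * (x \<bullet> x) * d 2 (x \<bullet> x) + 4 * \<nu> * d 1 (x \<bullet> x)) - \<mu> * d 0 (x \<bullet> x))" for x
      unfolding T_def v_def by (rule plate_operator_cutoff(2)[OF P \<nu> d(1,2)])
    have v4: "C_on (Suc (Suc 2)) v UNIV" using vC by (simp add: numeral_eq_Suc)
    have lv: "C_on (Suc (Suc 0)) (laplacian v) UNIV" using C_on_laplacian[OF open_UNIV v4] by (simp add: numeral_2_eq_2)
    have Tc: "continuous_on UNIV T"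
      unfolding T_def
      by (intro continuous_on_add continuous_on_diff continuous_on_mult_left C_on_continuous[OF vC] C_on_continuous[OF lv]
          C_on_continuous[OF C_on_laplacian[OF open_UNIV lv]])
    define s where "s = sqrt (r - \<epsilon>)"
    have s: "0 \<le> s" "s\<^sup>2 = r - \<epsilon>" using \<epsilon> by (auto simp: s_def)
    have sR: "s < R" unfolding s_def using \<epsilon> R by (intro real_less_lsqrt) (auto simp: r_def)
    have vz: "v x = 0" if "s < norm x" for x
    proof -
      have "s\<^sup>2 < (norm x)\<^sup>2" using that s by (intro power_strict_mono) auto
      then have "r - \<epsilon> < x \<bullet> x" using s by (simp add: power2_norm_eq_inner)
      then show ?thesis using d(3) by (simp add: v_def)
    qed
    have o: "open {x::'a. s < norm x}" by (intro open_Collect_less continuous_intros)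
    have lz: "laplacian v x = 0" if "s < norm x" for x
      by (rule laplacian_zero_on_open[OF o]) (use that vz in auto)
    have llz: "laplacian (laplacian v) x = 0" if "s < norm x" for x
      by (rule laplacian_zero_on_open[OF o]) (use that lz in auto)
    have iT: "(\<integral>x. u x * T x \<partial>lborel) = 0"
      unfolding T_def by (rule plate_weak_form[OF sR u4 vC vz ueq])
    have "indicator (cball 0 R) x * (u x * T x) = u x * T x" for x
      using vz[of x] lz[of x] llz[of x] sR by (auto simp: T_def indicator_def)
    then have eT: "(\<lambda>x. indicator (cball 0 R) x * (u x * T x)) = (\<lambda>x. u x * T x)" by (rule ext)
    have bT: "ball_pairing R u T = 0" unfolding ball_pairing_def eT by (rule iT)
    define f where "f = (\<lambda>x. 1 * f0 x + (-1) * T x)"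
    have fc: "continuous_on (cball 0 R) f"
      unfolding f_def by (intro continuous_on_add continuous_on_mult_left continuous_on_subset[OF f0c] continuous_on_subset[OF Tc]) auto
    have bf: "ball_pairing R u f = ball_pairing R u f0"
      unfolding f_def using ball_pairing_lincomb[OF uc continuous_on_subset[OF f0c] continuous_on_subset[OF Tc], of 1 "-1"] bT by simp
    define a where "a = sqrt (r - 2 * \<epsilon>)"
    have a: "0 \<le> a" "a\<^sup>2 = r - 2 * \<epsilon>" using \<epsilon> by (auto simp: a_def)
    have "a\<^sup>2 \<le> R\<^sup>2" using a \<epsilon> by (simp add: r_def)
    then have aR: "a \<le> R" by (rule power2_le_imp_le) (use R in simp)
    have Ra: "R - a \<le> 2 * \<epsilon> / R"
    proof -
      have "(R - a) * R \<le> (R - a) * (R + a)" using a aR by (intro mult_left_mono) auto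
      also have "\<dots> = 2 * \<epsilon>" using a by (simp add: r_def algebra_simps power2_eq_square)
      finally show ?thesis using R by (simp add: field_simps)
    qed
    have f_in: "f x = 0" if x: "norm x < a" for x
    proof -
      have vw: "v y = w y" if "y \<in> ball 0 a" for y
      proof -
        have "(norm y)\<^sup>2 < a\<^sup>2" using that by (intro power_strict_mono) auto
        then have "y \<bullet> y < r - 2 * \<epsilon>" using a by (simp add: power2_norm_eq_inner)
        then show ?thesis using d(4) by (simp add: v_def w_def)
      qed
      have l: "laplacian v y = laplacian w y" if "y \<in> ball 0 a" for y
        by (rule laplacian_cong_open[OF open_ball that vw])
      have xa: "x \<in> ball 0 a" using x by simp
      have "laplacian (laplacian v) x = laplacian (laplacian w) x"
        by (rule laplacian_cong_open[OF open_ball xa l])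
      then have "T x = f0 x" unfolding Lw[symmetric] T_def l[OF xa] vw[OF xa] by simp
      then show ?thesis by (simp add: f_def)
    qed
    define M where "M = e * (2 * \<epsilon> / R) * ((G + D) / \<epsilon>\<^sup>2)"
    have M0: "0 \<le> M" using e \<epsilon> R G D0 by (simp add: M_def)
    have f_out: "\<bar>u x * f x\<bar> \<le> M" if x: "a \<le> norm x" "norm x \<le> R" for x
    proof -
      define \<rho> where "\<rho> = x \<bullet> x"
      have \<rho>n: "\<rho> = (norm x)\<^sup>2" by (simp add: \<rho>_def power2_norm_eq_inner)
      have \<rho>: "r - 2 * \<epsilon> \<le> \<rho>" "\<rho> \<le> r" "0 \<le> \<rho>"
        using power_mono[OF x(1) a(1), of 2] power_mono[OF x(2) norm_ge_zero, of 2] unfolding a(2) \<rho>n r_def by simp_all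
      define m where "m = C / \<epsilon>\<^sup>2"
      have m0: "0 \<le> m" using C by (simp add: m_def)
      have dm: "\<bar>d i \<rho>\<bar> \<le> m" if "i \<le> 4" for i using d(5)[OF that \<rho>(1,2)] by (simp add: m_def)
      have t: "\<bar>b * d i \<rho>\<bar> \<le> b' * m" if "i \<le> 4" "\<bar>b\<bar> \<le> b'" for b b' i
        unfolding abs_mult using that dm[OF that(1)] m0 by (intro mult_mono) auto
      have "\<bar>16 * \<rho>\<^sup>2 * d 4 \<rho>\<bar> \<le> (16 * r\<^sup>2) * m" using \<rho> by (intro t) (auto intro: power_mono)
      moreover have "\<bar>32 * (\<nu> + 1) * \<rho> * d 3 \<rho>\<bar> \<le> (32 * (\<nu> + 1) * r) * m"
        using \<rho> \<nu>0 by (intro t) (auto simp: abs_mult intro: mult_left_mono)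
      moreover have "\<bar>16 * \<nu> * (\<nu> + 1) * d 2 \<rho>\<bar> \<le> (16 * \<nu> * (\<nu> + 1)) * m"
        using \<nu>0 by (intro t) auto
      moreover have "\<bar>(\<alpha> * (4 * \<rho>)) * d 2 \<rho>\<bar> \<le> (\<bar>\<alpha>\<bar> * (4 * r)) * m"
        using \<rho> by (intro t) (auto simp: abs_mult intro: mult_left_mono mult_right_mono)
      moreover have "\<bar>(\<alpha> * (4 * \<nu>)) * d 1 \<rho>\<bar> \<le> (\<bar>\<alpha>\<bar> * (4 * \<nu>)) * m"
        using \<nu>0 by (intro t) (auto simp: abs_mult)
      moreover have "\<bar>\<mu> * d 0 \<rho>\<bar> \<le> \<bar>\<mu>\<bar> * m" by (intro t) auto
      moreover have "A * m = (16 * r\<^sup>2) * m + (32 * (\<nu> + 1) * r) * m + (16 * \<nu> * (\<nu> + 1)) * m + (\<bar>\<alpha>\<bar> * (4 * r)) * m + (\<bar>\<alpha>\<bar> * (4 * \<nu>)) * m + \<bar>\<mu>\<bar> * m"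
        unfolding A_def by (simp only: distrib_left distrib_right)
      ultimately have "\<bar>16 * \<rho>\<^sup>2 * d 4 \<rho> + 32 * (\<nu> + 1) * \<rho> * d 3 \<rho> + 16 * \<nu> * (\<nu> + 1) * d 2 \<rho>
         + ((\<alpha> * (4 * \<rho>)) * d 2 \<rho> + (\<alpha> * (4 * \<nu>)) * d 1 \<rho>) - \<mu> * d 0 \<rho>\<bar> \<le> A * m" by linarith
      moreover have "\<alpha> * (4 * \<rho> * d 2 \<rho> + 4 * \<nu> * d 1 \<rho>) = (\<alpha> * (4 * \<rho>)) * d 2 \<rho> + (\<alpha> * (4 * \<nu>)) * d 1 \<rho>"
        by (simp add: algebra_simps)
      ultimately have "\<bar>T x\<bar> \<le> PB * (A * m)"
        unfolding Tf \<rho>_def[symmetric] abs_mult using PB x A0 m0 by (intro mult_mono) auto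
      also have "\<dots> = D / \<epsilon>\<^sup>2" by (simp add: D_def m_def)
      finally have T1: "\<bar>T x\<bar> \<le> D / \<epsilon>\<^sup>2" .
      have "\<bar>f0 x\<bar> \<le> G / \<epsilon>\<^sup>2"
      proof -
        have "\<epsilon>\<^sup>2 \<le> 1" using \<epsilon> by (simp add: power_le_one)
        then have "G \<le> G / \<epsilon>\<^sup>2" using G(1) \<epsilon> by (simp add: pos_le_divide_eq mult_left_le)
        then show ?thesis using G(2)[OF x(2)] by linarith
      qed
      then have "\<bar>f x\<bar> \<le> (G + D) / \<epsilon>\<^sup>2" using T1 by (simp add: f_def add_divide_distrib)
      moreover have "\<bar>u x\<bar> \<le> e * (2 * \<epsilon> / R)"
      proof -
        have "R - \<delta> < norm x" using x Ra \<epsilon>\<delta> by linarith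
        then have "\<bar>u x\<bar> \<le> e * (R - norm x)" using \<delta>(2) x by blast
        also have "\<dots> \<le> e * (2 * \<epsilon> / R)" using e x Ra by (intro mult_left_mono) auto
        finally show ?thesis .
      qed
      ultimately show ?thesis unfolding M_def abs_mult using e \<epsilon> R by (intro mult_mono) auto
    qed
    have "\<bar>ball_pairing R u f\<bar> \<le> M * (V * (R - a))"
      unfolding V_def by (rule ball_pairing_strip_bound[OF R a(1) aR uc fc f_in f_out M0])
    also have "\<dots> \<le> M * (V * (2 * \<epsilon> / R))" using M0 V0 Ra by (intro mult_left_mono) auto
    also have "\<dots> = e * K" using \<epsilon> R by (simp add: M_def K_def field_simps power2_eq_square)
    finally show ?thesis unfolding bf .
  qed
  have "ball_pairing R u f0 = 0"
  proof (rule ccontr)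
    assume n: "ball_pairing R u f0 \<noteq> 0"
    \<comment> \<open>With e = b / (2 (K + 1)) the bound contradicts the value of the pairing.\<close>
    define b where "b = \<bar>ball_pairing R u f0\<bar>"
    have b: "0 < b" using n by (simp add: b_def)
    have "b \<le> b / (2 * (K + 1)) * K" unfolding b_def by (rule bound) (use b K0 in \<open>simp add: b_def\<close>)
    also have "\<dots> = b * (K / (2 * (K + 1)))" by simp
    also have "\<dots> < b * 1" using b K0 by (intro mult_strict_left_mono) auto
    finally show False by simp
  qed
  then show ?thesis by (simp add: f0_def)
qed

section \<open>Harmonic polynomials span all polynomials\<close>

definition homogeneous_poly :: "nat \<Rightarrow> ('a::euclidean_space \<Rightarrow> real) \<Rightarrow> bool" where
  "homogeneous_poly n p \<longleftrightarrow> real_polynomial_function p \<and> (\<forall>c x. p (c *\<^sub>R x) = c ^ n * p x)"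

lemma real_polynomial_continuous:
  fixes p :: "'a::euclidean_space \<Rightarrow> real"
  shows "real_polynomial_function p \<Longrightarrow> continuous_on A p"
  by (rule C_on_continuous[where n = 0], rule C_on_polynomial)

text \<open>Differentiating the homogeneity relation gives the claim for c different from 0; the case c = 0 follows by continuity.\<close>

lemma homogeneous_poly_partial:
  fixes p :: "'a::euclidean_space \<Rightarrow> real"
  assumes "homogeneous_poly n p"
  shows "if n = 0 then partial b p = (\<lambda>_. 0) else homogeneous_poly (n - 1) (partial b p)"
proof (cases n)
  case 0
  then have "p = (\<lambda>_. p 0)"
    using assms unfolding homogeneous_poly_def by (metis scaleR_zero_left power_0 mult_1)
  moreover have "partial b (\<lambda>_. p 0) = (\<lambda>_. 0)" by (simp add: partial_def fun_eq_iff)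
  ultimately show ?thesis using 0 by metis
next
  case (Suc m)
  have pp: "real_polynomial_function p" and h: "p (c *\<^sub>R x) = c ^ Suc m * p x" for c x
    using assms Suc by (auto simp: homogeneous_poly_def)
  have pb: "real_polynomial_function (partial b p)" by (rule real_polynomial_function_partial[OF pp])
  have dp: "(p has_derivative frechet_derivative p (at y)) (at y)" for y
    using differentiable_at_real_polynomial_function[OF pp] frechet_derivative_works by blast
  have nz: "partial b p (c *\<^sub>R x) = c ^ m * partial b p x" if "c \<noteq> 0" for c x
  proof -
    have "((\<lambda>y. p (c *\<^sub>R y)) has_derivative (\<lambda>h. frechet_derivative p (at (c *\<^sub>R x)) (c *\<^sub>R h))) (at x)"
      by (rule has_derivative_compose[of "\<lambda>y. c *\<^sub>R y", OF _ dp]) (auto intro!: derivative_eq_intros)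
    moreover have "((\<lambda>y. p (c *\<^sub>R y)) has_derivative (\<lambda>h. c ^ Suc m * frechet_derivative p (at x) h)) (at x)"
      unfolding h by (rule has_derivative_mult_right[OF dp])
    ultimately have "frechet_derivative p (at (c *\<^sub>R x)) (c *\<^sub>R b) = c ^ Suc m * frechet_derivative p (at x) b"
      using has_derivative_unique by metis
    moreover have "linear (frechet_derivative p (at (c *\<^sub>R x)))" using dp has_derivative_linear by blast
    ultimately have "c * partial b p (c *\<^sub>R x) = c * (c ^ m * partial b p x)" by (simp add: linear_scale partial_def)
    then show ?thesis using that by simp
  qed
  have "partial b p (c *\<^sub>R x) = c ^ m * partial b p x" for c x
  proof (cases "c = 0")
    case True
    have "isCont (\<lambda>c. partial b p (c *\<^sub>R x)) 0"
    proof -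
      have "continuous_on UNIV (\<lambda>c. partial b p (c *\<^sub>R x))"
        by (rule continuous_on_compose2[OF real_polynomial_continuous[OF pb, of UNIV]]) (auto intro!: continuous_intros)
      then show ?thesis using continuous_on_eq_continuous_at[OF open_UNIV] by blast
    qed
    then have l1: "(\<lambda>c. partial b p (c *\<^sub>R x)) \<midarrow>0\<rightarrow> partial b p (0 *\<^sub>R x)" by (simp only: isCont_def)
    have "isCont (\<lambda>c::real. c ^ m * partial b p x) 0" by (intro continuous_intros)
    then have "(\<lambda>c::real. c ^ m * partial b p x) \<midarrow>0\<rightarrow> 0 ^ m * partial b p x" by (simp only: isCont_def)
    moreover have "\<forall>\<^sub>F c::real in at 0. c ^ m * partial b p x = partial b p (c *\<^sub>R x)"
      unfolding eventually_at using nz by (intro exI[of _ 1]) auto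
    ultimately have "(\<lambda>c. partial b p (c *\<^sub>R x)) \<midarrow>0\<rightarrow> 0 ^ m * partial b p x" by (rule Lim_transform_eventually)
    from LIM_unique[OF l1 this] show ?thesis using True by simp
  qed (rule nz)
  then show ?thesis using Suc pb by (simp add: homogeneous_poly_def)
qed

lemma real_polynomial_laplacian: "real_polynomial_function p \<Longrightarrow> real_polynomial_function (laplacian p)"
  unfolding laplacian_def[abs_def] by (intro real_polynomial_function_sum real_polynomial_function_partial) auto

lemma homogeneous_poly_laplacian:
  fixes p :: "'a::euclidean_space \<Rightarrow> real"
  assumes p: "homogeneous_poly n p"
  shows "if n < 2 then laplacian p = (\<lambda>_. 0) else homogeneous_poly (n - 2) (laplacian p)"
proof (cases "n < 2")
  case True
  have "partial b (partial b p) = (\<lambda>_. 0)" for b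
  proof (cases "n = 0")
    case True
    then have eq: "partial b p = (\<lambda>_. 0)" using homogeneous_poly_partial[OF p, of b] by simp
    show ?thesis unfolding eq by (simp add: partial_def fun_eq_iff)
  next
    case False
    then have "n = 1" using \<open>n < 2\<close> by simp
    then have "homogeneous_poly 0 (partial b p)" using homogeneous_poly_partial[OF p, of b] by simp
    then show ?thesis using homogeneous_poly_partial[of 0 "partial b p" b] by simp
  qed
  then show ?thesis using True by (simp add: laplacian_def[abs_def])
next
  case False
  have "homogeneous_poly (n - 2) (partial b (partial b p))" for b
  proof -
    have "homogeneous_poly (n - 1) (partial b p)" using homogeneous_poly_partial[OF p, of b] False by simp
    moreover have "n - 1 - 1 = n - 2" "n - 1 \<noteq> 0" using False by auto
    ultimately show ?thesis using homogeneous_poly_partial[of "n - 1" "partial b p" b] by simp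
  qed
  then have "laplacian p (c *\<^sub>R x) = c ^ (n - 2) * laplacian p x" for c x
    by (simp add: laplacian_def homogeneous_poly_def sum_distrib_left)
  then show ?thesis using False real_polynomial_laplacian p by (auto simp: homogeneous_poly_def)
qed

lemma homogeneous_poly_laplacian_iter:
  fixes p :: "'a::euclidean_space \<Rightarrow> real"
  assumes "homogeneous_poly n p"
  shows "if 2 * m \<le> n then homogeneous_poly (n - 2 * m) ((laplacian ^^ m) p) else (laplacian ^^ m) p = (\<lambda>_. 0)"
proof (induction m)
  case 0
  then show ?case using assms by simp
next
  case (Suc m)
  show ?case
  proof (cases "2 * m \<le> n")
    case True
    then have h: "homogeneous_poly (n - 2 * m) ((laplacian ^^ m) p)" using Suc by simp
    have e: "n - 2 * m - 2 = n - Suc (Suc (2 * m))" by simp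
    show ?thesis using homogeneous_poly_laplacian[OF h] unfolding e by (auto simp: not_le)
  next
    case False
    then have "(laplacian ^^ m) p = (\<lambda>_. 0)" using Suc by simp
    then have "(laplacian ^^ Suc m) p = laplacian (\<lambda>_. 0)" by (simp only: funpow.simps o_apply)
    also have "\<dots> = (\<lambda>_. 0)" by (simp add: laplacian_zero fun_eq_iff)
    finally show ?thesis using False by (simp del: funpow.simps)
  qed
qed

lemma laplacian_iter_lincomb:
  fixes p q :: "'a::euclidean_space \<Rightarrow> real"
  assumes "real_polynomial_function p" "real_polynomial_function q"
  shows "(laplacian ^^ m) (\<lambda>x. a * p x + b * q x) = (\<lambda>x. a * (laplacian ^^ m) p x + b * (laplacian ^^ m) q x)"
proof (induction m)
  case (Suc m)
  have poly: "real_polynomial_function ((laplacian ^^ m) f)" if "real_polynomial_function f" for f :: "'a \<Rightarrow> real"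
    by (induction m) (use that real_polynomial_laplacian in auto)
  have "laplacian (\<lambda>x. a * (laplacian ^^ m) p x + b * (laplacian ^^ m) q x) x =
      a * laplacian ((laplacian ^^ m) p) x + b * laplacian ((laplacian ^^ m) q) x" for x
    by (rule laplacian_lincomb[OF open_UNIV]) (auto intro: C_on_polynomial poly assms)
  then show ?case by (simp add: Suc fun_eq_iff)
qed simp

lemma real_polynomial_power_norm: "real_polynomial_function (\<lambda>x::'a::euclidean_space. (x \<bullet> x) ^ m)"
  by (intro real_polynomial_function_power real_polynomial_function_inner_self)

text \<open>Each application of the Laplacian lowers the power of |x|^2 by one and produces a positive factor.\<close>

lemma laplacian_iter_harmonic_times_power:
  fixes h :: "'a::euclidean_space \<Rightarrow> real"
  assumes h: "solid_harmonic k h"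
  shows "\<exists>C>0. (laplacian ^^ m) (\<lambda>x. h x * (x \<bullet> x) ^ m) = (\<lambda>x. C * h x)"
proof (induction m)
  case 0
  then show ?case by (intro exI[of _ 1]) simp
next
  case (Suc m)
  then obtain C where C: "0 < C" "(laplacian ^^ m) (\<lambda>x. h x * (x \<bullet> x) ^ m) = (\<lambda>x. C * h x)" by blast
  define D where "D = 4 * real (Suc m) * (real m + (real k + real DIM('a) / 2))"
  have hp: "real_polynomial_function h" using h by (simp add: solid_harmonic_def)
  have D: "0 < D" unfolding D_def by (intro mult_pos_pos add_nonneg_pos) auto
  have "laplacian (\<lambda>x. h x * (x \<bullet> x) ^ Suc m) = (\<lambda>x. D * (h x * (x \<bullet> x) ^ m) + 0 * (h x * (x \<bullet> x) ^ m))"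
  proof
    fix x :: 'a
    have d1: "((\<lambda>\<rho>::real. \<rho> ^ Suc m) has_real_derivative real (Suc m) * \<rho> ^ m) (at \<rho>)" for \<rho>
      using DERIV_pow[of "Suc m" \<rho>] by simp
    have d2: "((\<lambda>\<rho>::real. real (Suc m) * \<rho> ^ m) has_real_derivative real (Suc m) * (real m * \<rho> ^ (m - 1))) (at \<rho>)" for \<rho>
      using DERIV_cmult[OF DERIV_pow[of m \<rho>], of "real (Suc m)"] by simp
    have e: "x \<bullet> x * (real m * (x \<bullet> x) ^ (m - 1)) = real m * (x \<bullet> x) ^ m" by (cases m) auto
    have "laplacian (\<lambda>x. h x * (x \<bullet> x) ^ Suc m) x = h x * (4 * (x \<bullet> x) * (real (Suc m) * (real m * (x \<bullet> x) ^ (m - 1)))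
        + 4 * (real k + real DIM('a) / 2) * (real (Suc m) * (x \<bullet> x) ^ m))"
      by (rule laplacian_harmonic_radial[OF h open_UNIV d1 d2]) simp
    also have "\<dots> = h x * (4 * real (Suc m) * (x \<bullet> x * (real m * (x \<bullet> x) ^ (m - 1)))
        + 4 * (real k + real DIM('a) / 2) * (real (Suc m) * (x \<bullet> x) ^ m))" by (simp only: mult_ac)
    also have "\<dots> = D * (h x * (x \<bullet> x) ^ m)" unfolding e D_def by (simp add: algebra_simps)
    finally show "laplacian (\<lambda>x. h x * (x \<bullet> x) ^ Suc m) x = D * (h x * (x \<bullet> x) ^ m) + 0 * (h x * (x \<bullet> x) ^ m)" by simp
  qed
  then have "(laplacian ^^ Suc m) (\<lambda>x. h x * (x \<bullet> x) ^ Suc m) = (laplacian ^^ m) (\<lambda>x. D * (h x * (x \<bullet> x) ^ m) + 0 * (h x * (x \<bullet> x) ^ m))"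
    by (simp only: funpow_Suc_right o_def)
  also have "\<dots> = (\<lambda>x. (D * C) * h x)"
  proof -
    have "real_polynomial_function (\<lambda>x. h x * (x \<bullet> x) ^ m)"
      by (intro real_polynomial_function.intros(4) hp real_polynomial_power_norm)
    from laplacian_iter_lincomb[OF this this, of m D 0] show ?thesis unfolding C(2) by (simp add: mult.assoc)
  qed
  finally show ?case using C(1) D by (intro exI[of _ "D * C"]) simp
qed

inductive homogeneous_sum :: "('a::euclidean_space \<Rightarrow> real) \<Rightarrow> bool" where
  base: "homogeneous_poly n p \<Longrightarrow> homogeneous_sum p"
| plus: "homogeneous_sum p \<Longrightarrow> homogeneous_sum q \<Longrightarrow> homogeneous_sum (\<lambda>x. p x + q x)"

lemma homogeneous_sum_mult:
  assumes "homogeneous_sum p" "homogeneous_sum q"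
  shows "homogeneous_sum (\<lambda>x. p x * q x)"
  using assms(1)
proof (induction p rule: homogeneous_sum.induct)
  case (base n p)
  show ?case using assms(2)
  proof (induction q rule: homogeneous_sum.induct)
    case (base m q)
    have "homogeneous_poly (n + m) (\<lambda>x. p x * q x)"
      using base \<open>homogeneous_poly n p\<close> by (auto simp: homogeneous_poly_def power_add intro: real_polynomial_function.intros(4))
    then show ?case by (rule homogeneous_sum.base)
  next
    case (plus q1 q2)
    then show ?case using homogeneous_sum.plus[OF plus.IH] by (simp add: distrib_left)
  qed
next
  case (plus p1 p2)
  then show ?case using homogeneous_sum.plus[OF plus.IH] by (simp add: distrib_right)
qed

lemma homogeneous_sum_polynomial: "real_polynomial_function p \<Longrightarrow> homogeneous_sum p"
proof (induction p rule: real_polynomial_function.induct)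
  case (linear f)
  then have "homogeneous_poly 1 f"
    by (auto simp: homogeneous_poly_def linear_scale[OF bounded_linear.linear] intro: real_polynomial_function.intros(1))
  then show ?case by (rule homogeneous_sum.base)
next
  case (const c)
  have "homogeneous_poly 0 (\<lambda>x. c)" by (auto simp: homogeneous_poly_def intro: real_polynomial_function.intros(2))
  then show ?case by (rule homogeneous_sum.base)
next
  case (add f g)
  then show ?case by (intro homogeneous_sum.plus)
next
  case (mult f g)
  then show ?case by (intro homogeneous_sum_mult)
qed

text \<open>Induction on the number m + 1 of applications of the Laplacian that annihilate a homogeneous polynomial p: the m-th Laplacian of p is harmonic, and subtracting a multiple of |x|^(2m) times this harmonic polynomial from p gives a polynomial that is already annihilated by m applications.\<close>

lemma orthogonal_to_polynomials:
  fixes u :: "'a::euclidean_space \<Rightarrow> real"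
  assumes u: "continuous_on (cball 0 R) u"
    and orth: "\<And>k h j. solid_harmonic k h \<Longrightarrow> ball_pairing R u (\<lambda>x. h x * (x \<bullet> x) ^ j) = 0"
    and p: "real_polynomial_function p"
  shows "ball_pairing R u p = 0"
proof -
  have hom: "ball_pairing R u p = 0" if "homogeneous_poly n p" "(laplacian ^^ m) p = (\<lambda>_. 0)" for m n p
    using that
  proof (induction m arbitrary: p)
    case 0
    then show ?case by (simp add: ball_pairing_def)
  next
    case (Suc m)
    have pp: "real_polynomial_function p" using Suc.prems by (simp add: homogeneous_poly_def)
    show ?case
    proof (cases "2 * m \<le> n")
      case False
      then have "(laplacian ^^ m) p = (\<lambda>_. 0)" using homogeneous_poly_laplacian_iter[OF Suc.prems(1), of m] by simp
      then show ?thesis using Suc by blast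
    next
      case True
      define h where "h = (laplacian ^^ m) p"
      have hh: "homogeneous_poly (n - 2 * m) h"
        using homogeneous_poly_laplacian_iter[OF Suc.prems(1), of m] True by (simp add: h_def)
      have "laplacian h = (\<lambda>_. 0)" using Suc.prems(2) by (simp add: h_def)
      then have sh: "solid_harmonic (n - 2 * m) h" using hh by (simp add: solid_harmonic_def homogeneous_poly_def)
      obtain C where C: "0 < C" "(laplacian ^^ m) (\<lambda>x. h x * (x \<bullet> x) ^ m) = (\<lambda>x. C * h x)"
        using laplacian_iter_harmonic_times_power[OF sh] by blast
      define f where "f = (\<lambda>x. h x * (x \<bullet> x) ^ m)"
      have fp: "real_polynomial_function f" unfolding f_def
        using hh by (intro real_polynomial_function.intros(4) real_polynomial_power_norm) (simp add: homogeneous_poly_def)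
      define p' where "p' = (\<lambda>x. 1 * p x + (- 1 / C) * f x)"
      have "homogeneous_poly n p'"
        unfolding homogeneous_poly_def
      proof (intro conjI allI)
        show "real_polynomial_function p'" unfolding p'_def using pp fp
          by (intro real_polynomial_function.intros(2,3,4))
        fix c :: real and x :: 'a
        have cc: "c ^ (n - 2 * m) * (c\<^sup>2) ^ m = c ^ n"
          unfolding power_mult[symmetric] power_add[symmetric] using True by simp
        have "f (c *\<^sub>R x) = c ^ n * f x"
        proof -
          have "f (c *\<^sub>R x) = c ^ (n - 2 * m) * (c\<^sup>2) ^ m * f x"
            using hh by (simp add: f_def homogeneous_poly_def power2_eq_square power_mult_distrib mult_ac)
          then show ?thesis unfolding cc .
        qed
        then show "p' (c *\<^sub>R x) = c ^ n * p' x"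
          using Suc.prems(1) by (simp add: p'_def homogeneous_poly_def algebra_simps)
      qed
      moreover have "(laplacian ^^ m) p' = (\<lambda>_. 0)"
        unfolding p'_def laplacian_iter_lincomb[OF pp fp] h_def[symmetric] using C by (simp add: f_def)
      ultimately have "ball_pairing R u p' = 0" by (rule Suc.IH)
      moreover have "ball_pairing R u f = 0" unfolding f_def by (rule orth[OF sh])
      moreover have "p = (\<lambda>x. 1 * p' x + (1 / C) * f x)" using C(1) by (simp add: p'_def fun_eq_iff)
      moreover have "real_polynomial_function p'" using \<open>homogeneous_poly n p'\<close> by (simp add: homogeneous_poly_def)
      ultimately show ?thesis
        using ball_pairing_lincomb[OF u real_polynomial_continuous[of p'] real_polynomial_continuous[OF fp], of 1 "1 / C"] by simp
    qed
  qed
  have "real_polynomial_function p \<and> ball_pairing R u p = 0"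
    using homogeneous_sum_polynomial[OF p]
  proof (induction p rule: homogeneous_sum.induct)
    case (base n p)
    have "(laplacian ^^ (n + 1)) p = (\<lambda>_. 0)" using homogeneous_poly_laplacian_iter[OF base, of "n + 1"] by simp
    from hom[OF base this] show ?case using base by (simp add: homogeneous_poly_def)
  next
    case (plus p q)
    then show ?case
      using ball_pairing_lincomb[OF u real_polynomial_continuous[of p] real_polynomial_continuous[of q], of 1 1]
      by (auto intro: real_polynomial_function.intros(3))
  qed
  then show ?thesis ..
qed

text \<open>By the Weierstrass theorem u is the uniform limit of polynomials on the closed ball, so the integral of u^2 vanishes.\<close>

lemma orthogonal_to_polynomials_zero:
  fixes u :: "'a::euclidean_space \<Rightarrow> real"
  assumes u: "continuous_on (cball 0 R) u"
    and orth: "\<And>p. real_polynomial_function p \<Longrightarrow> ball_pairing R u p = 0" and x: "x \<in> ball 0 R"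
  shows "u x = 0"
proof (rule ccontr)
  assume n: "u x \<noteq> 0"
  have ux: "isCont u x"
    using continuous_on_subset[OF u ball_subset_cball] x by (simp add: continuous_on_eq_continuous_at)
  then obtain d where d: "0 < d" "\<And>y. dist y x < d \<Longrightarrow> \<bar>u y - u x\<bar> < \<bar>u x\<bar> / 2"
    using n unfolding continuous_at_eps_delta dist_real_def by (metis half_gt_zero zero_less_abs_iff)
  obtain d' where d': "0 < d'" "ball x d' \<subseteq> ball 0 R" using x open_ball open_contains_ball by blast
  define \<delta> where "\<delta> = min d d'"
  have \<delta>: "0 < \<delta>" "ball x \<delta> \<subseteq> ball 0 R" using d d' by (auto simp: \<delta>_def)
  \<comment> \<open>A positive lower bound for the integral of u^2, coming from a ball on which |u| is at least |u x| / 2.\<close>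
  define s where "s = u x * u x / 4 * measure lborel (ball x \<delta>)"
  have mp: "0 < measure lborel (ball x \<delta>)" using content_ball_pos[OF \<delta>(1)] .
  have "0 < u x * u x" using n by (metis not_real_square_gt_zero)
  then have s: "0 < s" using mp unfolding s_def by (intro mult_pos_pos[OF divide_pos_pos]) simp_all
  have low: "s \<le> ball_pairing R u u"
  proof -
    have "s = (\<integral>y. u x * u x / 4 * indicator (ball x \<delta>) y \<partial>lborel)" by (simp add: s_def)
    also have "\<dots> \<le> ball_pairing R u u"
      unfolding ball_pairing_def
    proof (rule integral_mono)
      show "integrable lborel (\<lambda>y. u x * u x / 4 * indicator (ball x \<delta>) y)"
        using emeasure_lborel_ball_finite[of x \<delta>] by (intro integrable_mult_right) (simp add: integrable_indicator_iff less_top)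
      show "integrable lborel (\<lambda>y. indicator (cball 0 R) y * (u y * u y))" by (rule ball_pairing_integrable[OF u u])
      fix y :: 'a
      show "u x * u x / 4 * indicator (ball x \<delta>) y \<le> indicator (cball 0 R) y * (u y * u y)"
      proof (cases "y \<in> ball x \<delta>")
        case True
        then have "\<bar>u y - u x\<bar> < \<bar>u x\<bar> / 2" using d(2)[of y] by (simp add: \<delta>_def dist_commute)
        then have "\<bar>u x\<bar> / 2 \<le> \<bar>u y\<bar>" by linarith
        then have "(\<bar>u x\<bar> / 2)\<^sup>2 \<le> \<bar>u y\<bar>\<^sup>2" by (intro power_mono) auto
        then have "u x * u x / 4 \<le> u y * u y" by (simp add: power2_eq_square)
        moreover have "y \<in> cball 0 R" using True \<delta>(2) by auto
        ultimately show ?thesis using True by simp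
      qed (simp add: indicator_def)
    qed
    finally show ?thesis .
  qed
  define B where "B = (\<integral>y. \<bar>indicator (cball 0 R) y * (u y * 1)\<bar> \<partial>lborel)"
  have Bi: "integrable lborel (\<lambda>y. indicator (cball 0 R) y * (u y * 1))"
    by (rule ball_pairing_integrable[OF u continuous_on_const])
  have B0: "0 \<le> B" unfolding B_def by (intro integral_nonneg_AE AE_I2) simp
  define e where "e = s / (2 * (B + 1))"
  have e: "0 < e" using s B0 by (simp add: e_def)
  obtain g where g: "real_polynomial_function g" "\<And>y. y \<in> cball 0 R \<Longrightarrow> \<bar>u y - g y\<bar> < e"
    using Stone_Weierstrass_real_polynomial_function[OF compact_cball u e] by blast
  have gc: "continuous_on (cball 0 R) g" by (rule real_polynomial_continuous[OF g(1)])
  have "ball_pairing R u u = ball_pairing R u (\<lambda>y. 1 * u y + (-1) * g y)"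
    using ball_pairing_lincomb[OF u u gc, of 1 "-1"] orth[OF g(1)] by simp
  also have "\<dots> \<le> (\<integral>y. e * \<bar>indicator (cball 0 R) y * (u y * 1)\<bar> \<partial>lborel)"
    unfolding ball_pairing_def
  proof (rule integral_mono)
    show "integrable lborel (\<lambda>y. indicator (cball 0 R) y * (u y * (1 * u y + (-1) * g y)))"
      by (rule ball_pairing_integrable[OF u]) (intro continuous_intros u gc)
    show "integrable lborel (\<lambda>y. e * \<bar>indicator (cball 0 R) y * (u y * 1)\<bar>)"
      by (intro integrable_mult_right integrable_abs Bi)
    fix y :: 'a
    show "indicator (cball 0 R) y * (u y * (1 * u y + (-1) * g y)) \<le> e * \<bar>indicator (cball 0 R) y * (u y * 1)\<bar>"
    proof (cases "y \<in> cball 0 R")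
      case True
      have "u y * (u y - g y) \<le> \<bar>u y\<bar> * \<bar>u y - g y\<bar>" by (metis abs_ge_self abs_mult)
      also have "\<dots> \<le> \<bar>u y\<bar> * e" using g(2)[OF True] by (intro mult_left_mono) auto
      finally show ?thesis using True by (simp add: mult.commute)
    qed simp
  qed
  also have "\<dots> = e * B" by (simp add: B_def)
  also have "\<dots> < s"
  proof -
    have "e * B = s * (B / (2 * (B + 1)))" by (simp add: e_def)
    also have "\<dots> < s * 1" using s B0 by (intro mult_strict_left_mono) auto
    finally show ?thesis by simp
  qed
  finally show False using low by simp
qed

lemma psum_unit_coeff: "psum (\<lambda>n. if n = j then 1 else 0) \<rho> = \<rho> ^ j"
proof -
  have "(\<lambda>n. (if n = j then 1 else 0) * \<rho> ^ n) = (\<lambda>n. if n = j then \<rho> ^ n else 0)" by auto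
  then show ?thesis unfolding psum_def using sums_unique[OF sums_single[of j "\<lambda>n. \<rho> ^ n"]] by simp
qed

section \<open>Every clamped eigenvalue lies on a branch curve\<close>

text \<open>Off all branch curves the radial problem can be solved for every monomial right-hand side, which makes u orthogonal to all products of harmonic polynomials with powers of |x|^2.\<close>

theorem plate_eigenvalue_on_branch:
  fixes u :: "'a::euclidean_space \<Rightarrow> real"
  assumes N: "2 \<le> DIM('a)" and R: "0 < R" and u: "plate_eigenfunction R \<alpha> \<mu> u"
  shows "\<exists>k t p. 1 \<le> t \<and> 0 < p \<and> \<alpha> = branch_alpha (real k + real DIM('a) / 2) R (real t * pi) p \<and>
     \<mu> = branch_lambda (real k + real DIM('a) / 2) R (real t * pi) p"
proof (rule ccontr)
  assume n: "\<not> ?thesis"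
  have uc: "continuous_on (cball 0 R) u" using u C1_cball_continuous by (auto simp: plate_eigenfunction_def)
  have "ball_pairing R u (\<lambda>x. h x * (x \<bullet> x) ^ j) = 0" if h: "solid_harmonic k h" for k j and h :: "'a \<Rightarrow> real"
  proof -
    define \<nu> where "\<nu> = real k + real DIM('a) / 2"
    have \<nu>1: "1 \<le> \<nu>" using N by (simp add: \<nu>_def)
    have nb: "\<not> (\<alpha> = branch_alpha \<nu> R (real t * pi) p \<and> \<mu> = branch_lambda \<nu> R (real t * pi) p)"
      if "1 \<le> t" "0 < p" for t p using n that unfolding \<nu>_def by blast
    obtain c where c: "entire_coeffs c" "psum c (R\<^sup>2) = 0" "psum (diffs c) (R\<^sup>2) = 0"
      "\<And>n. radial_op \<nu> (radial_op \<nu> c) n + \<alpha> * radial_op \<nu> c n - \<mu> * c n = (if n = j then 1 else 0)"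
      using clamped_series_solvable[OF \<nu>1 R _ nb, of "Suc j" "\<lambda>n. if n = j then 1 else 0"] by auto
    from plate_orthogonal[OF R u h \<nu>_def c] show ?thesis unfolding psum_unit_coeff .
  qed
  then have "u x = 0" if "x \<in> ball 0 R" for x
    using orthogonal_to_polynomials_zero[OF uc orthogonal_to_polynomials[OF uc] that] by blast
  then show False using u by (auto simp: plate_eigenfunction_def)
qed

section \<open>Limits, continuation and completeness of the branches\<close>

lemma tendsto_robin_phase:
  assumes "0 < R"
  shows "((\<lambda>\<beta>. robin_phase (b + \<beta> * R)) \<longlongrightarrow> pi) at_top"
    and "((\<lambda>\<beta>. robin_phase (b + \<beta> * R)) \<longlongrightarrow> 0) at_bot"
proof -
  have i: "filterlim (\<lambda>\<beta>. R / 2 * \<beta>) at_top at_top"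
    by (rule filterlim_tendsto_pos_mult_at_top[OF tendsto_const _ filterlim_ident]) (use assms in simp)
  have "filterlim (\<lambda>\<beta>. b / 2 + R / 2 * \<beta>) at_top at_top"
    by (rule filterlim_tendsto_add_at_top[OF tendsto_const i])
  then have "filterlim (\<lambda>\<beta>. (b + \<beta> * R) / 2) at_top at_top" by (simp add: add_divide_distrib mult.commute)
  then have "((\<lambda>\<beta>. pi / 2 + arctan ((b + \<beta> * R) / 2)) \<longlongrightarrow> pi / 2 + pi / 2) at_top"
    by (intro tendsto_add tendsto_const filterlim_compose[OF tendsto_arctan_at_top])
  then show "((\<lambda>\<beta>. robin_phase (b + \<beta> * R)) \<longlongrightarrow> pi) at_top" by (simp add: robin_phase_def)
  have i: "filterlim (\<lambda>\<beta>. R / 2 * \<beta>) at_bot at_bot"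
    by (rule filterlim_tendsto_pos_mult_at_bot[OF tendsto_const _ filterlim_ident]) (use assms in simp)
  have "filterlim (\<lambda>\<beta>. b / 2 + R / 2 * \<beta>) at_bot at_bot"
    using filterlim_tendsto_add_at_bot_iff[OF tendsto_const] i by blast
  then have "filterlim (\<lambda>\<beta>. (b + \<beta> * R) / 2) at_bot at_bot" by (simp add: add_divide_distrib mult.commute)
  then have "((\<lambda>\<beta>. pi / 2 + arctan ((b + \<beta> * R) / 2)) \<longlongrightarrow> pi / 2 + - (pi / 2)) at_bot"
    by (intro tendsto_add tendsto_const filterlim_compose[OF tendsto_arctan_at_bot])
  then show "((\<lambda>\<beta>. robin_phase (b + \<beta> * R)) \<longlongrightarrow> 0) at_bot" by (simp add: robin_phase_def)
qed

context
  fixes k :: nat and R \<nu> :: real and T :: "'a::euclidean_space itself"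
  assumes N: "2 \<le> DIM('a)" and R: "0 < R" and \<nu>: "\<nu> = real k + real DIM('a) / 2"
begin

lemma robin_eigenvalue_at_top:
  assumes "1 \<le> j"
  shows "(robin_eigenvalue TYPE('a) R k j \<longlongrightarrow> dirichlet_eigenvalue TYPE('a) R k j) at_top"
proof -
  have \<nu>1: "1 \<le> \<nu>" using N \<nu> by simp
  have j: "pi + real (j - 1) * pi = real j * pi" using assms by (simp add: of_nat_diff algebra_simps)
  have c: "isCont (invphase \<nu>) (real j * pi)" using isCont_invphase[OF \<nu>1] assms by simp
  have "((\<lambda>\<beta>. robin_phase (real k + \<beta> * R) + real (j - 1) * pi) \<longlongrightarrow> pi + real (j - 1) * pi) at_top"
    by (intro tendsto_add tendsto_const tendsto_robin_phase(1)[OF R])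
  then have "((\<lambda>\<beta>. robin_phase (real k + \<beta> * R) + real (j - 1) * pi) \<longlongrightarrow> real j * pi) at_top" unfolding j .
  from isCont_tendsto_compose[OF c this]
  have "((\<lambda>\<beta>. invphase \<nu> (robin_phase (real k + \<beta> * R) + real (j - 1) * pi) / R\<^sup>2) \<longlongrightarrow> invphase \<nu> (real j * pi) / R\<^sup>2) at_top"
    by (intro tendsto_divide tendsto_const) (use R in auto)
  then show ?thesis
    unfolding dirichlet_eigenvalue_eq[OF N R \<nu> assms] robin_eigenvalue_eq[OF N R \<nu> assms, abs_def] .
qed

text \<open>As \<beta> tends to -\<infinity> the Robin phase tends to 0, so the phase of the eigenvalue with index j + 1 tends to j \<pi>, which belongs to the Dirichlet eigenvalue with index j.\<close>

lemma robin_eigenvalue_at_bot: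
  assumes "1 \<le> j"
  shows "(robin_eigenvalue TYPE('a) R k (j + 1) \<longlongrightarrow> dirichlet_eigenvalue TYPE('a) R k j) at_bot"
proof -
  have \<nu>1: "1 \<le> \<nu>" using N \<nu> by simp
  have c: "isCont (invphase \<nu>) (real j * pi)" using isCont_invphase[OF \<nu>1] assms by simp
  have "((\<lambda>\<beta>. robin_phase (real k + \<beta> * R) + real (j + 1 - 1) * pi) \<longlongrightarrow> 0 + real (j + 1 - 1) * pi) at_bot"
    by (intro tendsto_add tendsto_const tendsto_robin_phase(2)[OF R])
  then have "((\<lambda>\<beta>. robin_phase (real k + \<beta> * R) + real (j + 1 - 1) * pi) \<longlongrightarrow> real j * pi) at_bot" by simp
  from isCont_tendsto_compose[OF c this]
  have l: "((\<lambda>\<beta>. invphase \<nu> (robin_phase (real k + \<beta> * R) + real (j + 1 - 1) * pi) / R\<^sup>2) \<longlongrightarrow> invphase \<nu> (real j * pi) / R\<^sup>2) at_bot"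
    by (intro tendsto_divide tendsto_const) (use R in auto)
  have "1 \<le> j + 1" by simp
  from l show ?thesis
    unfolding dirichlet_eigenvalue_eq[OF N R \<nu> assms] robin_eigenvalue_eq[OF N R \<nu> \<open>1 \<le> j + 1\<close>, abs_def] .
qed

text \<open>For the first index there is no shift, so the phase tends to 0 and the eigenvalue to -\<infinity>.\<close>

lemma first_robin_eigenvalue_at_bot: "filterlim (robin_eigenvalue TYPE('a) R k 1) at_bot at_bot"
proof -
  have \<nu>1: "1 \<le> \<nu>" using N \<nu> by simp
  have "filterlim (\<lambda>\<beta>. robin_phase (real k + \<beta> * R)) (at_right 0) at_bot"
    unfolding filterlim_at using tendsto_robin_phase(2)[OF R] robin_phase_bounds(1) by (simp add: less_imp_neq[symmetric])
  from filterlim_compose[OF invphase_at_0[OF \<nu>1] this]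
  have "filterlim (\<lambda>\<beta>. inverse (R\<^sup>2) * invphase \<nu> (robin_phase (real k + \<beta> * R))) at_bot at_bot"
    by (intro filterlim_tendsto_pos_mult_at_bot[OF tendsto_const]) (use R in simp_all)
  then show ?thesis
    unfolding robin_eigenvalue_eq[OF N R \<nu> le_refl, abs_def] by (simp add: divide_inverse mult.commute)
qed

lemma robin_eigenvalue_indices:
  assumes s: "\<sigma>1 \<in> robin_spectrum TYPE('a) R k \<beta>" "\<sigma>2 \<in> robin_spectrum TYPE('a) R k \<beta>" and l: "\<sigma>1 < \<sigma>2"
  shows "\<exists>j\<ge>1. \<exists>t\<ge>1. \<sigma>1 = robin_eigenvalue TYPE('a) R k j \<beta> \<and> \<sigma>2 = robin_eigenvalue TYPE('a) R k (j + t) \<beta>"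
proof -
  let ?p = "robin_phase (real k + \<beta> * R)"
  have \<nu>1: "1 \<le> \<nu>" using N \<nu> by simp
  obtain i j where ij: "1 \<le> i" "1 \<le> j" and e: "\<sigma>1 = invphase \<nu> (?p + real (i - 1) * pi) / R\<^sup>2" "\<sigma>2 = invphase \<nu> (?p + real (j - 1) * pi) / R\<^sup>2"
    using s unfolding robin_spectrum_eq[OF N R \<nu>] by auto
  have "i < j"
  proof (rule ccontr)
    assume "\<not> i < j"
    then have "?p + real (j - 1) * pi = ?p + real (i - 1) * pi \<or> ?p + real (j - 1) * pi < ?p + real (i - 1) * pi"
      using ij by (cases "i = j") auto
    moreover have "0 < ?p + real (j - 1) * pi" using robin_phase_bounds(1) by (rule add_pos_nonneg) simp
    ultimately have "invphase \<nu> (?p + real (j - 1) * pi) \<le> invphase \<nu> (?p + real (i - 1) * pi)"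
      using invphase_less[OF \<nu>1, of "?p + real (j - 1) * pi" "?p + real (i - 1) * pi"] by auto
    then have "\<sigma>2 \<le> \<sigma>1" unfolding e by (intro divide_right_mono) auto
    then show False using l by simp
  qed
  then show ?thesis using ij e
    by (intro exI[of _ i] conjI exI[of _ "j - i"]) (auto simp: robin_eigenvalue_eq[OF N R \<nu>])
qed

lemma branch_is_analytic_branch:
  assumes t: "1 \<le> t"
  shows "\<exists>\<Lambda>. analytic_branch TYPE('a) R \<Lambda> \<and> {(\<alpha>, \<Lambda> \<alpha>) | \<alpha>. True} = branch_points TYPE('a) R k t"
proof -
  have \<nu>1: "1 \<le> \<nu>" using N \<nu> by simp
  obtain P :: "'a \<Rightarrow> real" and \<theta> where P: "solid_harmonic k P" "norm \<theta> = 1" "P \<theta> \<noteq> 0"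
    using solid_harmonic_exists[OF N, of k] by auto
  have "0 < real t * pi" using t by simp
  then obtain \<Lambda> where \<Lambda>: "real_analytic \<Lambda>"
    "{(\<alpha>, \<Lambda> \<alpha>) | \<alpha>. True} = {(branch_alpha \<nu> R (real t * pi) p, branch_lambda \<nu> R (real t * pi) p) | p. 0 < p}"
    using branch_function[OF \<nu>1 R] by blast
  have "\<exists>u :: 'a \<Rightarrow> real. plate_eigenfunction R \<alpha> (\<Lambda> \<alpha>) u" for \<alpha>
  proof -
    have "(\<alpha>, \<Lambda> \<alpha>) \<in> {(\<alpha>, \<Lambda> \<alpha>) | \<alpha>. True}" by blast
    then obtain p where p: "0 < p" "\<alpha> = branch_alpha \<nu> R (real t * pi) p" "\<Lambda> \<alpha> = branch_lambda \<nu> R (real t * pi) p"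
      unfolding \<Lambda>(2) by blast
    show ?thesis unfolding p(2) p(3)[unfolded p(2)]
      using plate_eigenfunction_on_branch[OF N R P(1) \<nu> P(2,3) p(1) t] by blast
  qed
  then have "analytic_branch TYPE('a) R \<Lambda>" using \<Lambda>(1) by (auto simp: analytic_branch_def)
  moreover have "{(\<alpha>, \<Lambda> \<alpha>) | \<alpha>. True} = branch_points TYPE('a) R k t" unfolding \<Lambda>(2) branch_points_eq[OF N R \<nu> t] ..
  ultimately show ?thesis by blast
qed

lemma dirichlet_eigenvalue_pair:
  assumes "1 \<le> j"
  shows "dirichlet_eigenvalue TYPE('a) R k j + dirichlet_eigenvalue TYPE('a) R k (j + t) = branch_alpha \<nu> R (real t * pi) (real j * pi)"
    and "- (dirichlet_eigenvalue TYPE('a) R k j * dirichlet_eigenvalue TYPE('a) R k (j + t)) = branch_lambda \<nu> R (real t * pi) (real j * pi)"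
proof -
  have j': "1 \<le> j + t" and e: "real (j + t) * pi = real j * pi + real t * pi" using assms by (auto simp: distrib_right)
  note d = dirichlet_eigenvalue_eq[OF N R \<nu> assms] dirichlet_eigenvalue_eq[OF N R \<nu> j', unfolded e]
  show "dirichlet_eigenvalue TYPE('a) R k j + dirichlet_eigenvalue TYPE('a) R k (j + t) = branch_alpha \<nu> R (real t * pi) (real j * pi)"
    unfolding d branch_alpha_def ..
  show "- (dirichlet_eigenvalue TYPE('a) R k j * dirichlet_eigenvalue TYPE('a) R k (j + t)) = branch_lambda \<nu> R (real t * pi) (real j * pi)"
    unfolding d branch_lambda_def ..
qed

lemma dirichlet_pair_plate_eigenfunction_exists:
  assumes "1 \<le> j" "1 \<le> t"
  shows "\<exists>(u :: 'a \<Rightarrow> real) f S.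
     plate_eigenfunction R (dirichlet_eigenvalue TYPE('a) R k j + dirichlet_eigenvalue TYPE('a) R k (j + t))
       (- (dirichlet_eigenvalue TYPE('a) R k j * dirichlet_eigenvalue TYPE('a) R k (j + t))) u \<and>
     spherical_harmonic k S \<and> separated R f S u"
proof -
  obtain P :: "'a \<Rightarrow> real" and \<theta> where P: "solid_harmonic k P" "norm \<theta> = 1" "P \<theta> \<noteq> 0"
    using solid_harmonic_exists[OF N, of k] by auto
  have "0 < real j * pi" using assms(1) by simp
  from plate_eigenfunction_on_branch[OF N R P(1) \<nu> P(2,3) this assms(2)]
  obtain c where "plate_eigenfunction R (branch_alpha \<nu> R (real t * pi) (real j * pi)) (branch_lambda \<nu> R (real t * pi) (real j * pi))
     (\<lambda>x. P x * psum c (x \<bullet> x))" by blast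
  moreover have "spherical_harmonic k P" using P(1) by (auto simp: spherical_harmonic_iff_solid)
  ultimately show ?thesis unfolding dirichlet_eigenvalue_pair[OF assms(1)]
    using separated_harmonic_series[OF P(1), of R c] by blast
qed

lemma dirichlet_pair_plate_eigenfunction_decomposes:
  fixes u :: "'a \<Rightarrow> real"
  assumes j: "1 \<le> j" and t: "1 \<le> t"
    and u: "plate_eigenfunction R (dirichlet_eigenvalue TYPE('a) R k j + dirichlet_eigenvalue TYPE('a) R k (j + t))
       (- (dirichlet_eigenvalue TYPE('a) R k j * dirichlet_eigenvalue TYPE('a) R k (j + t))) u"
    and S: "spherical_harmonic k S" and sep: "separated R f S u"
  shows "\<exists>w1 w2 c1 c2. dirichlet_eigenfunction R (dirichlet_eigenvalue TYPE('a) R k j) w1 \<and>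
     dirichlet_eigenfunction R (dirichlet_eigenvalue TYPE('a) R k (j + t)) w2 \<and>
     (\<forall>x\<in>cball 0 R. u x = c1 * w1 x + c2 * w2 x)"
proof -
  have \<nu>1: "1 \<le> \<nu>" using N \<nu> by simp
  define g where "g = (\<lambda>j. dirichlet_eigenvalue TYPE('a) R k j)"
  have geq: "g i = invphase \<nu> (real i * pi) / R\<^sup>2" if "1 \<le> i" for i
    unfolding g_def by (rule dirichlet_eigenvalue_eq[OF N R \<nu> that])
  have zero: "psum (bessel_coeffs \<nu> (g i)) (R\<^sup>2) = 0" if "1 \<le> i" for i
  proof -
    have "g i * R\<^sup>2 = invphase \<nu> (real i * pi)" unfolding geq[OF that] using R by simp
    then show ?thesis unfolding psum_bessel dirichlet_condition_phase[OF \<nu>1] using that by blast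
  qed
  have jt: "1 \<le> j + t" using j by simp
  have "invphase \<nu> (real j * pi) < invphase \<nu> (real (j + t) * pi)"
    by (rule invphase_less[OF \<nu>1]) (use j t in auto)
  then have ne: "g j \<noteq> g (j + t)" unfolding geq[OF j] geq[OF jt] using R by simp
  obtain P where P: "solid_harmonic k P" "\<And>\<theta>. norm \<theta> = 1 \<Longrightarrow> S \<theta> = P \<theta>"
    using S unfolding spherical_harmonic_iff_solid by auto
  have u': "C_on 4 u (ball 0 R)" "C1_cball R u" "\<exists>x\<in>ball 0 R. u x \<noteq> 0"
    "\<And>x. x \<in> ball 0 R \<Longrightarrow> laplacian (laplacian u) x + (g j + g (j + t)) * laplacian u x = - (g j * g (j + t)) * u x"
    using u unfolding plate_eigenfunction_def g_def by blast+
  have sep': "u x = f (norm x) * P (x /\<^sub>R norm x)" if "x \<in> ball 0 R - {0}" for x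
    by (rule separated_solid[OF sep P(2)]) (use that in auto)
  obtain \<theta> where \<theta>: "norm \<theta> = 1" "P \<theta> \<noteq> 0"
    using harmonic_direction[OF R C_on_continuous[OF u'(1)] u'(3) sep'] by blast
  obtain c1 c2 where c: "\<And>x. x \<in> cball 0 R \<Longrightarrow> u x = c1 * (P x * psum (bessel_coeffs \<nu> (g j)) (x \<bullet> x)) + c2 * (P x * psum (bessel_coeffs \<nu> (g (j + t))) (x \<bullet> x))"
    using plate_separated_two_terms[OF N R P(1) \<nu> \<theta> ne u'(1) C1_cball_continuous[OF u'(2)] u'(4) sep'] by blast
  have w: "dirichlet_eigenfunction R (g i) (\<lambda>x. P x * psum (bessel_coeffs \<nu> (g i)) (x \<bullet> x))" if "1 \<le> i" for i
    by (rule dirichlet_eigenfunction_series[OF N R P(1) \<nu> \<theta> zero[OF that]])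
  show ?thesis
    unfolding g_def[symmetric]
    by (rule exI[of _ "\<lambda>x. P x * psum (bessel_coeffs \<nu> (g j)) (x \<bullet> x)"], rule exI[of _ "\<lambda>x. P x * psum (bessel_coeffs \<nu> (g (j + t))) (x \<bullet> x)"],
        rule exI[of _ c1], rule exI[of _ c2]) (intro conjI w j jt ballI c)
qed

end

text \<open>The graph of \<Lambda> is covered by countably many branch curves, each the graph of an analytic function. As the real line is uncountable, \<Lambda> agrees with one of these functions on an uncountable set, and hence everywhere.\<close>

lemma analytic_branch_is_branch:
  assumes N: "2 \<le> DIM('a::euclidean_space)" and R: "0 < R" and L: "analytic_branch TYPE('a) R \<Lambda>"
  shows "\<exists>k. \<exists>t\<ge>1. {(\<alpha>, \<Lambda> \<alpha>) | \<alpha>. True} = branch_points TYPE('a) R k t"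
proof -
  define \<nu> where "\<nu> k = real k + real DIM('a) / 2" for k :: nat
  have \<nu>1: "1 \<le> \<nu> k" for k using N by (simp add: \<nu>_def)
  define B where "B k t = {(branch_alpha (\<nu> k) R (real t * pi) p, branch_lambda (\<nu> k) R (real t * pi) p) | p. 0 < p}" for k t :: nat
  have ex: "\<exists>M. real_analytic M \<and> {(\<alpha>, M \<alpha>) | \<alpha>. True} = B k t" if "1 \<le> t" for k t :: nat
  proof -
    have "0 < real t * pi" using that by simp
    then obtain L where "real_analytic L" "{(\<alpha>, L \<alpha>) | \<alpha>. True} = B k t"
      unfolding B_def by (rule branch_function[OF \<nu>1[of k] R])
    then show ?thesis by (intro exI[of _ L] conjI)
  qed
  define M where "M k t = (SOME M. real_analytic M \<and> {(\<alpha>, M \<alpha>) | \<alpha>. True} = B k t)" for k t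
  have M: "real_analytic (M k t) \<and> {(\<alpha>, M k t \<alpha>) | \<alpha>. True} = B k t" if "1 \<le> t" for k t
    unfolding M_def by (rule someI_ex[OF ex[OF that]])
  have "\<exists>k t. 1 \<le> t \<and> \<Lambda> \<alpha> = M k t \<alpha>" for \<alpha>
  proof -
    obtain u :: "'a \<Rightarrow> real" where "plate_eigenfunction R \<alpha> (\<Lambda> \<alpha>) u" using L by (auto simp: analytic_branch_def)
    from plate_eigenvalue_on_branch[OF N R this]
    obtain k t p where "1 \<le> t" and p: "0 < p" "\<alpha> = branch_alpha (\<nu> k) R (real t * pi) p" "\<Lambda> \<alpha> = branch_lambda (\<nu> k) R (real t * pi) p"
      unfolding \<nu>_def by blast
    have "(\<alpha>, \<Lambda> \<alpha>) \<in> B k t" unfolding B_def using p by blast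
    then have "(\<alpha>, \<Lambda> \<alpha>) \<in> {(\<alpha>, M k t \<alpha>) | \<alpha>. True}" using M[OF \<open>1 \<le> t\<close>, of k] by simp
    then show ?thesis using \<open>1 \<le> t\<close> by blast
  qed
  note cover = this
  have U: "(UNIV :: real set) = (\<Union>kt\<in>UNIV \<times> {1..}. {\<alpha>. \<Lambda> \<alpha> = M (fst kt) (snd kt) \<alpha>})"
  proof (intro equalityI subsetI UNIV_I)
    fix \<alpha> :: real
    obtain k t where kt: "1 \<le> t" "\<Lambda> \<alpha> = M k t \<alpha>" using cover by blast
    show "\<alpha> \<in> (\<Union>kt\<in>UNIV \<times> {1..}. {\<alpha>. \<Lambda> \<alpha> = M (fst kt) (snd kt) \<alpha>})"
      by (rule UN_I[of "(k, t)"]) (use kt in simp_all)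
  qed
  have "\<exists>kt\<in>UNIV \<times> {1..}. uncountable {\<alpha>. \<Lambda> \<alpha> = M (fst kt) (snd kt) \<alpha>}"
  proof (rule ccontr)
    assume "\<not> ?thesis"
    then have "countable (\<Union>kt\<in>UNIV \<times> {1..}. {\<alpha>. \<Lambda> \<alpha> = M (fst kt) (snd kt) \<alpha>})"
      by (intro countable_UN) auto
    then show False using U uncountable_UNIV_real by simp
  qed
  then obtain k t where t: "1 \<le> t" and unc: "uncountable {\<alpha>. \<Lambda> \<alpha> = M k t \<alpha>}" by auto
  have "\<Lambda> = M k t" using real_analytic_eqI[OF _ _ unc] L M[OF t] by (simp add: analytic_branch_def)
  then have "{(\<alpha>, \<Lambda> \<alpha>) | \<alpha>. True} = branch_points TYPE('a) R k t"
    using M[OF t, of k] branch_points_eq[OF N R \<nu>_def t] by (simp add: B_def)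
  then show ?thesis using t by blast
qed

theorem theorem3p1:
  fixes R :: real
  assumes "2 \<le> DIM('a::euclidean_space)" and "0 < R"
  shows
    "let \<sigma> = robin_eigenvalue TYPE('a) R; \<gamma> = dirichlet_eigenvalue TYPE('a) R in
     (\<forall>\<beta> \<sigma>\<^sub>1 \<sigma>\<^sub>2 k S f\<^sub>1 f\<^sub>2. \<forall>(v\<^sub>1 :: 'a \<Rightarrow> real) v\<^sub>2.
        robin_eigenfunction R \<beta> \<sigma>\<^sub>1 v\<^sub>1 \<and> robin_eigenfunction R \<beta> \<sigma>\<^sub>2 v\<^sub>2 \<and> \<sigma>\<^sub>1 \<noteq> \<sigma>\<^sub>2 \<and>
        spherical_harmonic k S \<and> separated R f\<^sub>1 S v\<^sub>1 \<and> separated R f\<^sub>2 S v\<^sub>2 \<longrightarrow>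
        plate_eigenfunction R (\<sigma>\<^sub>1 + \<sigma>\<^sub>2) (- (\<sigma>\<^sub>1 * \<sigma>\<^sub>2)) (\<lambda>x. f\<^sub>1 R * v\<^sub>2 x - f\<^sub>2 R * v\<^sub>1 x))
   \<and> (\<forall>k \<beta>. \<forall>\<sigma>\<^sub>1\<in>robin_spectrum TYPE('a) R k \<beta>. \<forall>\<sigma>\<^sub>2\<in>robin_spectrum TYPE('a) R k \<beta>.
        \<sigma>\<^sub>1 < \<sigma>\<^sub>2 \<longrightarrow> (\<exists>j\<ge>1. \<exists>t\<ge>1. \<sigma>\<^sub>1 = \<sigma> k j \<beta> \<and> \<sigma>\<^sub>2 = \<sigma> k (j + t) \<beta>))
   \<and> (\<forall>k. \<forall>t\<ge>1. \<exists>\<Lambda>. analytic_branch TYPE('a) R \<Lambda> \<and>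
        {(\<alpha>, \<Lambda> \<alpha>) | \<alpha>. True} = branch_points TYPE('a) R k t)
   \<and> (\<forall>k. \<forall>t\<ge>1.
        filterlim (\<lambda>\<beta>. \<sigma> k 1 \<beta> + \<sigma> k (1 + t) \<beta>) at_bot at_bot \<and>
        (\<forall>j\<ge>1.
          ((\<lambda>\<beta>. \<sigma> k j \<beta> + \<sigma> k (j + t) \<beta>) \<longlongrightarrow> \<gamma> k j + \<gamma> k (j + t)) at_top \<and>
          ((\<lambda>\<beta>. - (\<sigma> k j \<beta> * \<sigma> k (j + t) \<beta>)) \<longlongrightarrow> - (\<gamma> k j * \<gamma> k (j + t))) at_top \<and>
          ((\<lambda>\<beta>. \<sigma> k (j + 1) \<beta> + \<sigma> k (j + 1 + t) \<beta>) \<longlongrightarrow> \<gamma> k j + \<gamma> k (j + t)) at_bot \<and>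
          ((\<lambda>\<beta>. - (\<sigma> k (j + 1) \<beta> * \<sigma> k (j + 1 + t) \<beta>)) \<longlongrightarrow> - (\<gamma> k j * \<gamma> k (j + t))) at_bot \<and>
          (\<exists>(u :: 'a \<Rightarrow> real) f S.
             plate_eigenfunction R (\<gamma> k j + \<gamma> k (j + t)) (- (\<gamma> k j * \<gamma> k (j + t))) u \<and>
             spherical_harmonic k S \<and> separated R f S u) \<and>
          (\<forall>(u :: 'a \<Rightarrow> real) f S.
             plate_eigenfunction R (\<gamma> k j + \<gamma> k (j + t)) (- (\<gamma> k j * \<gamma> k (j + t))) u \<and>
             spherical_harmonic k S \<and> separated R f S u \<longrightarrow>
             (\<exists>w\<^sub>1 w\<^sub>2 c\<^sub>1 c\<^sub>2.
                dirichlet_eigenfunction R (\<gamma> k j) w\<^sub>1 \<and>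
                dirichlet_eigenfunction R (\<gamma> k (j + t)) w\<^sub>2 \<and>
                (\<forall>x\<in>cball 0 R. u x = c\<^sub>1 * w\<^sub>1 x + c\<^sub>2 * w\<^sub>2 x)))))
   \<and> (\<forall>\<Lambda>. analytic_branch TYPE('a) R \<Lambda> \<longrightarrow>
        (\<exists>k. \<exists>t\<ge>1. {(\<alpha>, \<Lambda> \<alpha>) | \<alpha>. True} = branch_points TYPE('a) R k t))"
proof -
  note N = assms(1) and R = assms(2)
  let ?\<nu> = "\<lambda>k. real k + real DIM('a) / 2"
  note nu = refl[of "?\<nu> k" for k]
  have lim0: "filterlim (\<lambda>\<beta>. robin_eigenvalue TYPE('a) R k 1 \<beta> + robin_eigenvalue TYPE('a) R k (1 + t) \<beta>) at_bot at_bot"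
    if "1 \<le> t" for k t
    using filterlim_tendsto_add_at_bot_iff[OF robin_eigenvalue_at_bot[OF N R nu that, of k], of "robin_eigenvalue TYPE('a) R k 1"]
      first_robin_eigenvalue_at_bot[OF N R nu, of k] by (simp add: add.commute)
  have bot: "(robin_eigenvalue TYPE('a) R k (j + 1 + t) \<longlongrightarrow> dirichlet_eigenvalue TYPE('a) R k (j + t)) at_bot"
    if "1 \<le> j" for j k t
    using robin_eigenvalue_at_bot[OF N R nu, of "j + t" k] that by (simp add: add.commute add.left_commute)
  have top: "(robin_eigenvalue TYPE('a) R k (j + t) \<longlongrightarrow> dirichlet_eigenvalue TYPE('a) R k (j + t)) at_top"
    if "1 \<le> j" for j k t
    using robin_eigenvalue_at_top[OF N R nu, of "j + t" k] that by simp
  show ?thesis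
    unfolding Let_def
  proof (intro conjI allI ballI impI, goal_cases)
    case (1 \<beta> \<sigma>\<^sub>1 \<sigma>\<^sub>2 k S f\<^sub>1 f\<^sub>2 v\<^sub>1 v\<^sub>2)
    then show ?case using robin_pair_gives_plate_eigenfunction[OF N R] by blast
  next
    case (2 k \<beta> \<sigma>\<^sub>1 \<sigma>\<^sub>2)
    then show ?case by (intro robin_eigenvalue_indices[OF N R nu])
  next
    case (3 k t)
    then show ?case by (intro branch_is_analytic_branch[OF N R nu])
  next
    case (4 k t)
    then show ?case by (rule lim0)
  next
    case (5 k t j)
    then show ?case by (intro tendsto_add robin_eigenvalue_at_top[OF N R nu] top)
  next
    case (6 k t j)
    then show ?case by (intro tendsto_minus tendsto_mult robin_eigenvalue_at_top[OF N R nu] top)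
  next
    case (7 k t j)
    then show ?case by (intro tendsto_add robin_eigenvalue_at_bot[OF N R nu] bot)
  next
    case (8 k t j)
    then show ?case by (intro tendsto_minus tendsto_mult robin_eigenvalue_at_bot[OF N R nu] bot)
  next
    case (9 k t j)
    then show ?case by (intro dirichlet_pair_plate_eigenfunction_exists[OF N R nu])
  next
    case (10 k t j u f S)
    then show ?case using dirichlet_pair_plate_eigenfunction_decomposes[OF N R nu] by blast
  next
    case (11 \<Lambda>)
    then show ?case by (rule analytic_branch_is_branch[OF N R])
  qed
qed

end
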